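(* Let $x_0\in\Omega$ and $r>0$ be such that $D^2(x_0,2r)\subset\Omega$. There exists a radius $\rho_0\in(r,2r)$ such that $\mathfrak S_\star\cap D^2(x_0,\rho_0)$ is a finite union of path-connected components.
   Context: $\Omega\subset\mathbb R^2$ is a smooth bounded domain. $V:\mathbb R^k\to\mathbb R$ ($k\ge1$) is smooth with $\inf V=0$ and satisfies: (1) the zero set $\Sigma=\{V=0\}$ is finite with at least two elements; (2) $\nabla^2V(\sigma)$ is positive definite at each $\sigma\in\Sigma$; (3) there are $\alpha_\infty,R_\infty>0$ with $y\cdot\nabla V(y)\ge\alpha_\infty|y|^2$ if $|y|>R_\infty$, and $V(y)\to+\infty$ as $|y|\to+\infty$. Set $e_\varepsilon(u)=\varepsilon\frac{|\nabla u|^2}{2}+\frac1\varepsilon V(u)$ and $E_\varepsilon(u)=\int_\Omega e_\varepsilon(u)dx$. $D^2(x,r)$ is the open disk of center $x$ and radius $r$. Let $M_0>0$, $\varepsilon_n\in(0,1]$, $\varepsilon_n\to0$, and let $u_{\varepsilon_n}\in H^1(\Omega,\mathbb R^k)$ be solutions of $-\Delta u_{\varepsilon_n}=-\varepsilon_n^{-2}\nabla_uV(u_{\varepsilon_n})$ in $\Omega$ with $E_{\varepsilon_n}(u_{\varepsilon_n})\le M_0$, such that (after passing to a subsequence) $e_{\varepsilon_n}(u_{\varepsilon_n})dx\rightharpoonup\nu_\star$ weakly as measures on $\Omega$. Let $\eta_1>0$ be a constant depending only on $V$ with the clearing-out property (such a constant exists): for every sequence $\tilde\varepsilon_n\in(0,1]$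 with $\tilde\varepsilon_n\to0$, all solutions $v_n\in H^1(\Omega,\mathbb R^k)$ of $-\Delta v_n=-\tilde\varepsilon_n^{-2}\nabla_uV(v_n)$ in $\Omega$ with $\sup_nE_{\tilde\varepsilon_n}(v_n)<+\infty$, and every measure $\nu$ on $\Omega$ such that $e_{\tilde\varepsilon_n}(v_n)dx\rightharpoonup\nu$ weakly as measures on $\Omega$, if $D^2(x_0,r)\subset\Omega$ and $\nu(\overline{D^2(x_0,r)})<\eta_1r$, then $\nu(\overline{D^2(x_0,r/2)})=0$. The concentration set is $\mathfrak S_\star=\{x\in\Omega:\liminf_{r\to0}\nu_\star(\overline{D^2(x,r)})/r\ge\eta_1\}$. (Closed disks are understood intersected with $\Omega$.) *)

theory Defs
  imports "HOL-Analysis.Analysis"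
begin

section \<open>Smooth functions, gradient and Hessian\<close>

text \<open>\<open>Ck_on n S f\<close> is meant for open \<open>S\<close>: there it says that \<open>f\<close> is \<open>n\<close> times continuously
  differentiable, by requiring that every directional derivative is \<open>n - 1\<close> times
  continuously differentiable.\<close>

primrec Ck_on ::
  "nat \<Rightarrow> 'a::euclidean_space set \<Rightarrow> ('a \<Rightarrow> 'b::real_normed_vector) \<Rightarrow> bool" where
  "Ck_on 0 S f \<longleftrightarrow> continuous_on S f"
| "Ck_on (Suc n) S f \<longleftrightarrow>
     (\<forall>x\<in>S. f differentiable (at x)) \<and>
     (\<forall>v. Ck_on n S (\<lambda>x. frechet_derivative f (at x) v))"

definition smooth_on :: "'a::euclidean_space set \<Rightarrow> ('a \<Rightarrow> 'b::real_normed_vector) \<Rightarrow> bool" where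
  "smooth_on S f \<longleftrightarrow> (\<forall>n. Ck_on n S f)"

definition grad :: "(real^'m \<Rightarrow> real) \<Rightarrow> real^'m \<Rightarrow> real^'m" where
  "grad f x = (\<chi> j. frechet_derivative f (at x) (axis j 1))"

definition hessian :: "(real^'m \<Rightarrow> real) \<Rightarrow> real^'m \<Rightarrow> real^'m^'m" where
  "hessian f x = (\<chi> i. grad (\<lambda>y. grad f y $ i) x)"

definition positive_definite :: "real^'m^'m \<Rightarrow> bool" where
  "positive_definite A \<longleftrightarrow> transpose A = A \<and> (\<forall>v. v \<noteq> 0 \<longrightarrow> v \<bullet> (A *v v) > 0)"

section \<open>The domain and the potential\<close>

text \<open>Smoothness of the boundary: near each boundary point the domain is the negativity set of a
  smooth function without critical points.\<close>

definition smooth_bounded_domain :: "(real^'m) set \<Rightarrow> bool" where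
  "smooth_bounded_domain \<Omega> \<longleftrightarrow>
     open \<Omega> \<and> connected \<Omega> \<and> \<Omega> \<noteq> {} \<and> bounded \<Omega> \<and>
     (\<forall>p\<in>frontier \<Omega>. \<exists>U \<psi>. open U \<and> p \<in> U \<and> smooth_on U (\<psi> :: real^'m \<Rightarrow> real) \<and>
        (\<forall>x\<in>U. grad \<psi> x \<noteq> 0) \<and> \<Omega> \<inter> U = {x\<in>U. \<psi> x < 0})"

definition multiwell_potential :: "(real^'k \<Rightarrow> real) \<Rightarrow> bool" where
  "multiwell_potential V \<longleftrightarrow>
     smooth_on UNIV V \<and>
     bdd_below (range V) \<and> (INF y. V y) = 0 \<and>
     finite {y. V y = 0} \<and> card {y. V y = 0} \<ge> 2 \<and>
     (\<forall>\<sigma>. V \<sigma> = 0 \<longrightarrow> positive_definite (hessian V \<sigma>)) \<and>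
     (\<exists>\<alpha>>0. \<exists>R>0. \<forall>y. norm y > R \<longrightarrow> y \<bullet> grad V y \<ge> \<alpha> * (norm y)\<^sup>2) \<and>
     filterlim V at_top at_infinity"

section \<open>The space $H^1$ and weak gradients\<close>

definition test_function :: "(real^'m) set \<Rightarrow> (real^'m \<Rightarrow> real) \<Rightarrow> bool" where
  "test_function \<Omega> \<phi> \<longleftrightarrow>
     smooth_on UNIV \<phi> \<and> compact (closure {x. \<phi> x \<noteq> 0}) \<and> closure {x. \<phi> x \<noteq> 0} \<subseteq> \<Omega>"

definition locally_integrable ::
  "(real^'m) set \<Rightarrow> (real^'m \<Rightarrow> 'b::euclidean_space) \<Rightarrow> bool" where
  "locally_integrable \<Omega> f \<longleftrightarrow> (\<forall>K. compact K \<and> K \<subseteq> \<Omega> \<longrightarrow> set_integrable lebesgue K f)"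

definition L2_on :: "(real^'m) set \<Rightarrow> (real^'m \<Rightarrow> 'b::euclidean_space) \<Rightarrow> bool" where
  "L2_on \<Omega> f \<longleftrightarrow>
     f \<in> borel_measurable (lebesgue_on \<Omega>) \<and> integrable (lebesgue_on \<Omega>) (\<lambda>x. (norm (f x))\<^sup>2)"

text \<open>Row \<open>i\<close> of \<open>G x\<close> is the gradient of the \<open>i\<close>-th component of \<open>u\<close>. The norm of
  \<open>real^'m^'k\<close> is the Frobenius norm.\<close>

definition has_weak_gradient ::
  "(real^'m) set \<Rightarrow> (real^'m \<Rightarrow> real^'k) \<Rightarrow> (real^'m \<Rightarrow> real^'m^'k) \<Rightarrow> bool" where
  "has_weak_gradient \<Omega> u G \<longleftrightarrow>
     locally_integrable \<Omega> u \<and> locally_integrable \<Omega> G \<and>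
     (\<forall>\<phi>. test_function \<Omega> \<phi> \<longrightarrow> (\<forall>i j.
        (LINT x|lebesgue_on \<Omega>. u x $ i * grad \<phi> x $ j) =
        - (LINT x|lebesgue_on \<Omega>. G x $ i $ j * \<phi> x)))"

text \<open>The choice below is unique up to null sets whenever a weak gradient exists.\<close>

definition weak_grad ::
  "(real^'m) set \<Rightarrow> (real^'m \<Rightarrow> real^'k) \<Rightarrow> real^'m \<Rightarrow> real^'m^'k" where
  "weak_grad \<Omega> u = (SOME G. has_weak_gradient \<Omega> u G)"

definition H1_on :: "(real^'m) set \<Rightarrow> (real^'m \<Rightarrow> real^'k) \<Rightarrow> bool" where
  "H1_on \<Omega> u \<longleftrightarrow> L2_on \<Omega> u \<and> (\<exists>G. has_weak_gradient \<Omega> u G \<and> L2_on \<Omega> G)"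

section \<open>The Allen-Cahn equation and its energy\<close>

text \<open>Weak solutions in $H^1$. Local integrability of \<open>\<nabla>V(u)\<close> makes the right-hand side a
  distribution; without it the Bochner integral could take its default value 0.\<close>

definition allen_cahn_solution ::
  "(real^2) set \<Rightarrow> (real^'k \<Rightarrow> real) \<Rightarrow> real \<Rightarrow> (real^2 \<Rightarrow> real^'k) \<Rightarrow> bool" where
  "allen_cahn_solution \<Omega> V \<epsilon> u \<longleftrightarrow>
     H1_on \<Omega> u \<and> locally_integrable \<Omega> (\<lambda>x. grad V (u x)) \<and>
     (\<forall>\<phi>. test_function \<Omega> \<phi> \<longrightarrow> (\<forall>i.
        (LINT x|lebesgue_on \<Omega>. (weak_grad \<Omega> u x $ i) \<bullet> grad \<phi> x) =
        - (1 / \<epsilon>\<^sup>2) * (LINT x|lebesgue_on \<Omega>. grad V (u x) $ i * \<phi> x)))"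

definition energy_density ::
  "(real^2) set \<Rightarrow> (real^'k \<Rightarrow> real) \<Rightarrow> real \<Rightarrow> (real^2 \<Rightarrow> real^'k) \<Rightarrow> real^2 \<Rightarrow> real" where
  "energy_density \<Omega> V \<epsilon> u x = \<epsilon> * ((norm (weak_grad \<Omega> u x))\<^sup>2 / 2) + (1 / \<epsilon>) * V (u x)"

definition energy ::
  "(real^2) set \<Rightarrow> (real^'k \<Rightarrow> real) \<Rightarrow> real \<Rightarrow> (real^2 \<Rightarrow> real^'k) \<Rightarrow> ennreal" where
  "energy \<Omega> V \<epsilon> u = (\<integral>\<^sup>+x. ennreal (energy_density \<Omega> V \<epsilon> u x) \<partial>lebesgue_on \<Omega>)"

definition energy_measure ::
  "(real^2) set \<Rightarrow> (real^'k \<Rightarrow> real) \<Rightarrow> real \<Rightarrow> (real^2 \<Rightarrow> real^'k) \<Rightarrow> (real^2) measure" where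
  "energy_measure \<Omega> V \<epsilon> u =
     density (lebesgue_on \<Omega>) (\<lambda>x. ennreal (energy_density \<Omega> V \<epsilon> u x))"

section \<open>Limit measures, clearing-out and the concentration set\<close>

definition radon_measure_on :: "(real^'m) set \<Rightarrow> (real^'m) measure \<Rightarrow> bool" where
  "radon_measure_on \<Omega> \<nu> \<longleftrightarrow>
     sets \<nu> = sets (restrict_space borel \<Omega>) \<and>
     (\<forall>K. compact K \<and> K \<subseteq> \<Omega> \<longrightarrow> emeasure \<nu> K < \<infinity>)"

text \<open>Weak convergence of measures on the open set \<open>\<Omega>\<close> is tested against continuous functions with
  compact support in \<open>\<Omega>\<close>, so mass may escape to the boundary.\<close>

definition weakly_converges_on ::
  "(real^'m) set \<Rightarrow> (nat \<Rightarrow> (real^'m) measure) \<Rightarrow> (real^'m) measure \<Rightarrow> bool" where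
  "weakly_converges_on \<Omega> \<mu> \<nu> \<longleftrightarrow>
     (\<forall>\<phi> :: real^'m \<Rightarrow> real.
        continuous_on UNIV \<phi> \<and> compact (closure {x. \<phi> x \<noteq> 0}) \<and> closure {x. \<phi> x \<noteq> 0} \<subseteq> \<Omega> \<longrightarrow>
        (\<lambda>n. LINT x|\<mu> n. \<phi> x) \<longlonglongrightarrow> (LINT x|\<nu>. \<phi> x))"

definition clearing_out :: "(real^2) set \<Rightarrow> (real^'k \<Rightarrow> real) \<Rightarrow> real \<Rightarrow> bool" where
  "clearing_out \<Omega> V \<eta> \<longleftrightarrow>
     (\<forall>(\<epsilon> :: nat \<Rightarrow> real) v \<nu> x0 r.
        (\<forall>n. 0 < \<epsilon> n \<and> \<epsilon> n \<le> 1) \<and> \<epsilon> \<longlonglongrightarrow> 0 \<and>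
        (\<forall>n. allen_cahn_solution \<Omega> V (\<epsilon> n) (v n)) \<and>
        (SUP n. energy \<Omega> V (\<epsilon> n) (v n)) < \<infinity> \<and>
        radon_measure_on \<Omega> \<nu> \<and>
        weakly_converges_on \<Omega> (\<lambda>n. energy_measure \<Omega> V (\<epsilon> n) (v n)) \<nu> \<and>
        r > 0 \<and> ball x0 r \<subseteq> \<Omega> \<and>
        emeasure \<nu> (cball x0 r \<inter> \<Omega>) < ennreal (\<eta> * r)
        \<longrightarrow> emeasure \<nu> (cball x0 (r / 2) \<inter> \<Omega>) = 0)"

definition concentration_set :: "(real^2) set \<Rightarrow> (real^2) measure \<Rightarrow> real \<Rightarrow> (real^2) set" where
  "concentration_set \<Omega> \<nu> \<eta> =
     {x\<in>\<Omega>. Liminf (at_right 0) (\<lambda>r. emeasure \<nu> (cball x r \<inter> \<Omega>) / ennreal r) \<ge> ennreal \<eta>}"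

end

theory Submission
  imports Defs "HOL-Complex_Analysis.Great_Picard"
begin

text \<open>By the clearing-out property the concentration set \<open>S\<close> is the support of \<open>\<nu>\<close> and carries at least
  the mass \<open>\<eta>1 s\<close> in a disk of radius \<open>s\<close> around each of its points. Hence \<open>S\<close> has locally finite length.

  No nonempty compact part \<open>Z\<close> of \<open>S\<close> is isolated from the rest of \<open>S\<close>: for a cutoff \<open>\<theta>\<close> around \<open>Z\<close> whose
  gradient is supported off \<open>S\<close>, the integral of \<open>\<theta>\<^sup>2 e(u)\<close> is bounded by the energy on the support of
  the gradient of \<open>\<theta>\<close>, which tends to 0. This follows from the Pohozaev identity with the vector field
  \<open>\<theta> x\<close>, which controls the potential, combined with the equation tested with \<open>\<theta>\<^sup>2 \<nabla>V(u)\<close>, which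
  controls the gradient since \<open>V\<close> is nondegenerate at its zeros; the remaining quartic gradient term is
  controlled by second derivatives, as solutions are uniformly bounded on compact sets. The
  computation is carried out for mollified solutions.

  Consequently every component of the intersection of \<open>S\<close> with an open disk reaches the boundary
  circle. As the mass of the disk of radius \<open>\<rho>\<close> is monotone in \<open>\<rho>\<close>, at some \<open>\<rho>\<close> it has finite lower left
  derivative; there the number of components is finite. In small disks this makes \<open>S\<close> locally connected, and two
  points of a connected part of \<open>S\<close> are joined by a path in its closure because its length is finite;
  so \<open>S\<close> is locally path-connected and each component is a path component.\<close>

section \<open>Directional derivatives and integration by parts\<close>

text \<open>In dimension two the Dirichlet integral is conformally invariant, so the Pohozaev field
  leaves only the potential term, and a second identity has to supply the gradient term. Testing
  with \<open>\<nabla>V\<close> produces the Hessian of \<open>V\<close>, which is bounded below by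
  \<kappa> only up to an error C V; the resulting product of V and the squared gradient is what
  forces the quartic estimate. All terms scale alike: \<epsilon>^3 times the fourth power of the
  gradient, \<epsilon>^3 times the squared Hessian and V / \<epsilon> are comparable through the
  equation and the sup bound.

  Second derivatives are available only after mollification, and a mollified solution solves the
  equation up to a defect, because \<open>\<nabla>V\<close> does not commute with averaging. For
  fixed \<epsilon> the defect tends to 0 in L2. In the Pohozaev identity it is paired with the
  gradient; a parameter K splits that product. The mollification scale tends to 0 first, then K to
  infinity.

  The geometric part sees the equation only through three facts about the set: relative closedness,
  the linear lower density and the absence of isolated compact parts.\<close>

definition pder :: "'a::euclidean_space \<Rightarrow> ('a \<Rightarrow> 'b::real_normed_vector) \<Rightarrow> ('a \<Rightarrow> 'b) \<Rightarrow> bool" where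
  "pder e f f' \<longleftrightarrow> (\<forall>x. ((\<lambda>t. f (x + t *\<^sub>R e)) has_vector_derivative f' x) (at 0))"

lemma pderD: "pder e f f' \<Longrightarrow> ((\<lambda>t. f (x + t *\<^sub>R e)) has_vector_derivative f' (x + s *\<^sub>R e)) (at s)"
proof -
  assume "pder e f f'"
  then have *: "((\<lambda>t. f ((x + s *\<^sub>R e) + t *\<^sub>R e)) has_vector_derivative f' (x + s *\<^sub>R e)) (at 0)"
    by (auto simp: pder_def)
  have "((\<lambda>t. f ((x + s *\<^sub>R e) + t *\<^sub>R e)) \<circ> (\<lambda>t. t - s) has_vector_derivative
      1 *\<^sub>R f' (x + s *\<^sub>R e)) (at s)"
    by (rule vector_diff_chain_at) (auto intro!: derivative_eq_intros simp: *)
  then show ?thesis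
    by (simp add: o_def algebra_simps)
qed

lemma pder_const: "pder e (\<lambda>x. c) (\<lambda>x. 0)"
  by (simp add: pder_def)

lemma pder_add: "pder e f f' \<Longrightarrow> pder e g g' \<Longrightarrow> pder e (\<lambda>x. f x + g x) (\<lambda>x. f' x + g' x)"
  by (auto simp: pder_def intro!: derivative_intros)

lemma pder_diff: "pder e f f' \<Longrightarrow> pder e g g' \<Longrightarrow> pder e (\<lambda>x. f x - g x) (\<lambda>x. f' x - g' x)"
  by (auto simp: pder_def intro!: derivative_intros)

lemma pder_bilinear:
  assumes "bounded_bilinear pr" "pder e f f'" "pder e g g'"
  shows "pder e (\<lambda>x. pr (f x) (g x)) (\<lambda>x. pr (f' x) (g x) + pr (f x) (g' x))"
  unfolding pder_def
proof
  fix x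
  show "((\<lambda>t. pr (f (x + t *\<^sub>R e)) (g (x + t *\<^sub>R e))) has_vector_derivative
      pr (f' x) (g x) + pr (f x) (g' x)) (at 0)"
    using bounded_bilinear.has_vector_derivative[OF assms(1), of "\<lambda>t. f (x + t *\<^sub>R e)" "f' x" 0 UNIV
        "\<lambda>t. g (x + t *\<^sub>R e)" "g' x"] assms(2,3)
    by (simp add: pder_def add.commute)
qed

lemmas pder_inner = pder_bilinear[OF bounded_bilinear_inner]
lemmas pder_mult = pder_bilinear[OF bounded_bilinear_mult]

lemma pder_chain:
  assumes "\<And>y. (F has_derivative F' y) (at y)" "pder e f f'"
  shows "pder e (\<lambda>x. F (f x)) (\<lambda>x. F' (f x) (f' x))"
  unfolding pder_def
proof
  fix x
  have "((\<lambda>t. f (x + t *\<^sub>R e)) has_vector_derivative f' x) (at 0)"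
    using assms(2) by (auto simp: pder_def)
  then have 1: "((\<lambda>t. f (x + t *\<^sub>R e)) has_derivative (\<lambda>t. t *\<^sub>R f' x)) (at 0)"
    by (simp add: has_vector_derivative_def)
  have "((\<lambda>t. F (f (x + t *\<^sub>R e))) has_derivative (\<lambda>t. F' (f x) (t *\<^sub>R f' x))) (at 0)"
    using has_derivative_compose[OF 1, of F "F' (f x)"] assms(1) by simp
  moreover have "F' (f x) (t *\<^sub>R f' x) = t *\<^sub>R F' (f x) (f' x)" for t
    using assms(1) has_derivative_linear linear_cmul by blast
  ultimately show "((\<lambda>t. F (f (x + t *\<^sub>R e))) has_vector_derivative F' (f x) (f' x)) (at 0)"
    by (simp add: has_vector_derivative_def)
qed

lemma has_derivative_pder:
  assumes "\<And>y. (F has_derivative F' y) (at y)"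
  shows "pder e F (\<lambda>x. F' x e)"
proof -
  have "pder e (\<lambda>x. x) (\<lambda>x. e)"
    by (auto simp: pder_def intro!: derivative_eq_intros)
  from pder_chain[OF assms this] show ?thesis .
qed

lemma integrable_continuous_compact_support:
  fixes f :: "'a::euclidean_space \<Rightarrow> 'b::{banach, second_countable_topology}"
  assumes "continuous_on UNIV f" "compact K" "\<And>x. x \<notin> K \<Longrightarrow> f x = 0"
  shows "integrable lborel f"
proof -
  have "integrable lborel (\<lambda>x. indicator K x *\<^sub>R f x)"
    using assms by (intro borel_integrable_compact) (auto intro: continuous_on_subset)
  moreover have "(\<lambda>x. indicator K x *\<^sub>R f x) = f"
    using assms(3) by (auto simp: indicator_def)
  ultimately show ?thesis by simp
qed

lemma integral_lborel_translation:
  fixes f :: "'a::euclidean_space \<Rightarrow> 'b::{banach, second_countable_topology}"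
  assumes [measurable]: "f \<in> borel_measurable borel"
  shows "(LINT x|lborel. f (x + c)) = (LINT x|lborel. f x)"
proof -
  have "(LINT x|lborel. f x) = (LINT x|distr lborel borel ((+) c). f x)"
    by (simp add: lborel_distr_plus)
  also have "\<dots> = (LINT x|lborel. f (c + x))"
    by (subst integral_distr) auto
  finally show ?thesis by (simp add: add.commute)
qed

text \<open>Difference quotients along \<open>e\<close> have integral 0 by translation invariance of
  Lebesgue measure; by the mean value theorem they are bounded by the supremum of \<open>f'\<close>
  on a compact set, so dominated convergence passes this to the derivative.\<close>

lemma integral_pder_eq_0:
  fixes f :: "'a::euclidean_space \<Rightarrow> real"
  assumes pd: "pder e f f'" and cf: "continuous_on UNIV f" and cf': "continuous_on UNIV f'"
    and K: "compact K" "\<And>x. x \<notin> K \<Longrightarrow> f x = 0"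
  shows "(LINT x|lborel. f' x) = 0"
proof -
  obtain R where R: "R > 0" "K \<subseteq> cball 0 R"
    using compact_imp_bounded[OF K(1)] unfolding bounded_pos by (auto simp: subset_iff)
  \<comment> \<open>Steps are at most 1: a quotient can be nonzero only within \<open>norm e\<close>
    of the ball of radius \<open>R\<close>, and the mean value point moves by at most another
    \<open>norm e\<close>.\<close>
  define B where "B = cball (0::'a) (R + 2 * norm e)"
  have "bounded (f' ` B)"
    by (intro compact_imp_bounded compact_continuous_image) 
       (use cf' in \<open>auto simp: B_def intro: continuous_on_subset\<close>)
  then obtain M where M: "\<And>x. x \<in> B \<Longrightarrow> norm (f' x) \<le> M" and "M > 0"
    unfolding bounded_pos by auto
  define h :: "nat \<Rightarrow> real" where "h n = inverse (real (Suc n))" for n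
  have h: "0 < h n" "h n \<le> 1" for n by (auto simp: h_def field_simps)
  have hlim: "h \<longlonglongrightarrow> 0" unfolding h_def by (rule LIMSEQ_inverse_real_of_nat)
  define q where "q n x = (f (x + h n *\<^sub>R e) - f x) / h n" for n x
  have qz: "(LINT x|lborel. q n x) = 0" for n
  proof -
    have i: "integrable lborel f"
      by (rule integrable_continuous_compact_support[OF cf K])
    have c2: "continuous_on UNIV (\<lambda>x. f (x + h n *\<^sub>R e))"
      by (intro continuous_on_compose2[OF cf]) (auto intro!: continuous_intros)
    have ne: "norm (h n *\<^sub>R e) \<le> norm e"
      using h[of n] mult_right_mono[of "h n" 1 "norm e"] by simp
    have i2: "integrable lborel (\<lambda>x. f (x + h n *\<^sub>R e))"
    proof (rule integrable_continuous_compact_support[OF c2 compact_cball])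
      fix x assume "x \<notin> cball (0::'a) (R + norm e)"
      then have "norm x > R + norm e" by simp
      moreover have "norm x \<le> norm (x + h n *\<^sub>R e) + norm (h n *\<^sub>R e)"
        using norm_triangle_ineq4[of "x + h n *\<^sub>R e" "h n *\<^sub>R e"] by simp
      ultimately have "x + h n *\<^sub>R e \<notin> cball 0 R" using ne by simp
      then show "f (x + h n *\<^sub>R e) = 0" using R K by blast
    qed
    have fm: "f \<in> borel_measurable borel"
      using cf by (rule borel_measurable_continuous_onI)
    show ?thesis
      unfolding q_def using i i2 integral_lborel_translation[OF fm, of "h n *\<^sub>R e"]
      by (simp add: diff_divide_distrib)
  qed
  have "(\<lambda>n. LINT x|lborel. q n x) \<longlonglongrightarrow> (LINT x|lborel. f' x)"
  proof (rule integral_dominated_convergence[where w = "\<lambda>x. indicator B x *\<^sub>R M"])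
    show "f' \<in> borel_measurable lborel"
      using borel_measurable_continuous_onI[OF cf'] by simp
    show "q n \<in> borel_measurable lborel" for n
    proof -
      have "continuous_on UNIV (q n)"
        unfolding q_def using h[of n]
        by (intro continuous_intros continuous_on_compose2[OF cf]) auto
      from borel_measurable_continuous_onI[OF this] show ?thesis by simp
    qed
    show "integrable lborel (\<lambda>x. indicator B x *\<^sub>R M)"
      by (intro borel_integrable_compact) (auto simp: B_def)
    show "AE x in lborel. (\<lambda>n. q n x) \<longlonglongrightarrow> f' x"
    proof (rule AE_I2)
      fix x
      have "((\<lambda>t. f (x + t *\<^sub>R e)) has_real_derivative f' x) (at 0)"
        using pd by (auto simp: pder_def has_real_derivative_iff_has_vector_derivative)
      then have "((\<lambda>t. (f (x + t *\<^sub>R e) - f x) / t) \<longlongrightarrow> f' x) (at 0)"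
        by (simp add: DERIV_def)
      moreover have "filterlim h (at 0) sequentially"
        using hlim h by (simp add: filterlim_at less_imp_neq[symmetric])
      ultimately show "(\<lambda>n. q n x) \<longlonglongrightarrow> f' x"
        unfolding q_def by (rule filterlim_compose)
    qed
    show "AE x in lborel. norm (q n x) \<le> indicator B x *\<^sub>R M" for n
    proof (rule AE_I2)
      fix x
      obtain z where z: "0 < z" "z < h n"
        "f (x + h n *\<^sub>R e) - f (x + 0 *\<^sub>R e) = (h n - 0) * f' (x + z *\<^sub>R e)"
        using MVT2[of 0 "h n" "\<lambda>t. f (x + t *\<^sub>R e)" "\<lambda>t. f' (x + t *\<^sub>R e)"] h[of n] pderD[OF pd]
        by (auto simp: has_real_derivative_iff_has_vector_derivative)
      have qe: "q n x = f' (x + z *\<^sub>R e)"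
        using z h[of n] by (simp add: q_def)
      have nz: "norm (s *\<^sub>R e) \<le> norm e" if "0 \<le> s" "s \<le> 1" for s
        using that mult_right_mono[of s 1 "norm e"] by simp
      show "norm (q n x) \<le> indicator B x *\<^sub>R M"
      proof (cases "norm x \<le> R + norm e")
        case True
        have "norm (x + z *\<^sub>R e) \<le> R + 2 * norm e"
          using norm_triangle_ineq[of x "z *\<^sub>R e"] nz[of z] z h[of n] True by simp
        then have "norm (q n x) \<le> M" using M qe by (auto simp: B_def)
        moreover have "x \<in> B" using True by (auto simp: B_def intro: order_trans)
        ultimately show ?thesis by simp
      next
        case False
        have "norm x \<le> norm (x + h n *\<^sub>R e) + norm (h n *\<^sub>R e)"
          using norm_triangle_ineq4[of "x + h n *\<^sub>R e" "h n *\<^sub>R e"] by simp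
        then have "x + h n *\<^sub>R e \<notin> cball 0 R" using False nz[of "h n"] h[of n] by auto
        moreover have "x \<notin> cball 0 R" using False norm_ge_zero[of e] by (simp del: norm_ge_zero)
        ultimately have "f (x + h n *\<^sub>R e) = 0" "f x = 0" using R K by blast+
        then have "q n x = 0" by (simp add: q_def)
        then show ?thesis using \<open>M > 0\<close> by (auto simp: indicator_def)
      qed
    qed
  qed
  then show ?thesis
    using LIMSEQ_unique[of "\<lambda>n. 0" "LINT x|lborel. f' x" 0] by (simp add: qz)
qed

section \<open>The energy estimate for smooth maps\<close>

lemma quad_am_gm: "\<delta> > 0 \<Longrightarrow> x * y \<le> \<delta> * x\<^sup>2 + y\<^sup>2 / (4 * \<delta>)" for x y \<delta> :: real
proof -
  assume "\<delta> > 0"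
  have "0 \<le> (2 * \<delta> * x - y)\<^sup>2 / (4 * \<delta>)" using \<open>\<delta> > 0\<close> by simp
  also have "\<dots> = \<delta> * x\<^sup>2 + y\<^sup>2 / (4 * \<delta>) - x * y"
    using \<open>\<delta> > 0\<close> by (simp add: field_simps power2_eq_square)
  finally show ?thesis by simp
qed

lemma norm_add_squared_le: "(norm (p::'b::real_inner) + norm q)\<^sup>2 \<le> 2 * (p \<bullet> p + q \<bullet> q)"
proof -
  have "0 \<le> (norm p - norm q)\<^sup>2" by simp
  then show ?thesis by (simp add: power2_eq_square algebra_simps norm_eq_sqrt_inner)
qed

text \<open>In the following four lemmas \<open>p\<close>, \<open>q\<close> are the first and \<open>a\<close>, \<open>b\<close>, \<open>c\<close> the second partial derivatives
  of a map \<open>v\<close> at a point, and \<open>g\<close> is its defect in the Allen-Cahn equation. \<open>D1\<close> to \<open>D4\<close> are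
  divergences of compactly supported fields, hence integrate to 0: \<open>D1\<close> comes from the Pohozaev
  identity, \<open>D2\<close> from the null Lagrangian \<open>b \<bullet> b - a \<bullet> c\<close>, \<open>D3\<close> from the field \<open>\<theta>\<^sup>2 N (v \<bullet> \<nabla>v)\<close> and
  \<open>D4\<close> from the field \<open>\<theta>\<^sup>2 (\<nabla>V(v) \<bullet> \<nabla>v)\<close>.\<close>

lemma pohozaev_pointwise:
  fixes p q g :: "'b::real_inner"
  assumes "0 < \<epsilon>" "\<epsilon> \<le> 1" "0 \<le> \<theta>" "\<bar>x1\<bar> \<le> R" "\<bar>x2\<bar> \<le> R" "1 \<le> K" "0 \<le> V"
    and D1: "D1 = \<epsilon> * (\<theta> * (g \<bullet> (x1 *\<^sub>R p + x2 *\<^sub>R q))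
        + \<theta>1 * ((p \<bullet> p - q \<bullet> q) / 2 * x1 + (p \<bullet> q) * x2)
        + \<theta>2 * ((p \<bullet> q) * x1 + (q \<bullet> q - p \<bullet> p) / 2 * x2))
        - (2 * \<theta> * V + V * (x1 * \<theta>1 + x2 * \<theta>2)) / \<epsilon>"
    and N: "N = p \<bullet> p + q \<bullet> q"
    and z: "z = \<bar>\<theta>1\<bar> + \<bar>\<theta>2\<bar> + \<theta>1\<^sup>2 + \<theta>2\<^sup>2"
  shows "\<theta> * V / \<epsilon> \<le> - D1 + R * (K * (\<theta> * (g \<bullet> g)) + \<theta> * N / K) + 4 * R * (z * (\<epsilon> * N / 2 + V / \<epsilon>))"
proof -
  have R: "0 \<le> R" using assms(4) by linarith
  have N0: "0 \<le> N" by (simp add: N)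
  have s: "\<bar>p \<bullet> q\<bar> \<le> N / 2"
  proof -
    have "\<bar>p \<bullet> q\<bar> \<le> norm p * norm q" by (rule Cauchy_Schwarz_ineq2)
    also have "\<dots> \<le> ((norm p)\<^sup>2 + (norm q)\<^sup>2) / 2"
      using sum_squares_bound[of "norm p" "norm q"] by simp
    finally show ?thesis by (simp add: N power2_norm_eq_inner)
  qed
  have d: "\<bar>(p \<bullet> p - q \<bullet> q) / 2\<bar> \<le> N / 2" "\<bar>(q \<bullet> q - p \<bullet> p) / 2\<bar> \<le> N / 2"
    by (auto simp: N abs_le_iff)
  have m: "\<bar>a * x\<bar> \<le> N / 2 * R" if "\<bar>a\<bar> \<le> N / 2" "\<bar>x\<bar> \<le> R" for a x
    using mult_mono[OF that] N0 by (simp add: abs_mult)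
  have A1: "\<bar>(p \<bullet> p - q \<bullet> q) / 2 * x1 + (p \<bullet> q) * x2\<bar> \<le> N * R"
    using m[OF d(1) assms(4)] m[OF s assms(5)] by linarith
  have A2: "\<bar>(p \<bullet> q) * x1 + (q \<bullet> q - p \<bullet> p) / 2 * x2\<bar> \<le> N * R"
    using m[OF s assms(4)] m[OF d(2) assms(5)] by linarith
  have z': "\<bar>\<theta>1\<bar> + \<bar>\<theta>2\<bar> \<le> z" by (simp add: z)
  have B: "\<bar>\<theta>1 * ((p \<bullet> p - q \<bullet> q) / 2 * x1 + (p \<bullet> q) * x2)
        + \<theta>2 * ((p \<bullet> q) * x1 + (q \<bullet> q - p \<bullet> p) / 2 * x2)\<bar> \<le> z * (N * R)"
  proof -
    have "\<bar>\<theta>1 * ((p \<bullet> p - q \<bullet> q) / 2 * x1 + (p \<bullet> q) * x2)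
        + \<theta>2 * ((p \<bullet> q) * x1 + (q \<bullet> q - p \<bullet> p) / 2 * x2)\<bar> \<le> \<bar>\<theta>1\<bar> * (N * R) + \<bar>\<theta>2\<bar> * (N * R)"
      using mult_left_mono[OF A1 abs_ge_zero[of \<theta>1]] mult_left_mono[OF A2 abs_ge_zero[of \<theta>2]]
      unfolding abs_mult[symmetric] by linarith
    also have "\<dots> \<le> z * (N * R)"
      using mult_right_mono[OF z', of "N * R"] N0 R by (simp add: algebra_simps)
    finally show ?thesis .
  qed
  have C: "\<bar>V * (x1 * \<theta>1 + x2 * \<theta>2)\<bar> \<le> R * (z * V)"
  proof -
    have "\<bar>x1 * \<theta>1 + x2 * \<theta>2\<bar> \<le> R * \<bar>\<theta>1\<bar> + R * \<bar>\<theta>2\<bar>"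
      using mult_right_mono[OF assms(4) abs_ge_zero[of \<theta>1]] mult_right_mono[OF assms(5) abs_ge_zero[of \<theta>2]]
      unfolding abs_mult[symmetric] by linarith
    also have "\<dots> \<le> R * z" using mult_left_mono[OF z' R] by (simp add: algebra_simps)
    finally have "V * \<bar>x1 * \<theta>1 + x2 * \<theta>2\<bar> \<le> V * (R * z)" using \<open>0 \<le> V\<close> by (rule mult_left_mono)
    then show ?thesis using \<open>0 \<le> V\<close> by (simp add: abs_mult mult_ac)
  qed
  \<comment> \<open>Young's inequality with weight \<open>K\<close> puts the large factor on the
    defect, which vanishes under mollification before \<open>K\<close> tends to infinity, and the
    small factor on the gradient.\<close>
  have G: "g \<bullet> (x1 *\<^sub>R p + x2 *\<^sub>R q) \<le> R * (K * (g \<bullet> g) + N / K)"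
  proof -
    have "norm (x1 *\<^sub>R p + x2 *\<^sub>R q) \<le> R * (norm p + norm q)"
      using norm_triangle_ineq[of "x1 *\<^sub>R p" "x2 *\<^sub>R q"]
        mult_right_mono[OF assms(4) norm_ge_zero[of p]] mult_right_mono[OF assms(5) norm_ge_zero[of q]]
      by (simp add: algebra_simps)
    then have "g \<bullet> (x1 *\<^sub>R p + x2 *\<^sub>R q) \<le> norm g * (R * (norm p + norm q))"
      by (meson order_trans norm_cauchy_schwarz mult_left_mono norm_ge_zero)
    also have "\<dots> = R * (norm g * (norm p + norm q))" by simp
    also have "\<dots> \<le> R * (K * (norm g)\<^sup>2 + (norm p + norm q)\<^sup>2 / (4 * K))"
      using quad_am_gm[of K "norm g" "norm p + norm q"] \<open>1 \<le> K\<close> R by (intro mult_left_mono) auto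
    also have "\<dots> \<le> R * (K * (g \<bullet> g) + N / K)"
    proof (intro mult_left_mono add_mono R)
      show "(norm p + norm q)\<^sup>2 / (4 * K) \<le> N / K"
        using order_trans[OF norm_add_squared_le[of p q], of "4 * N"] \<open>1 \<le> K\<close> N0 by (simp add: N field_simps)
    qed (use \<open>1 \<le> K\<close> in \<open>auto simp: power2_norm_eq_inner\<close>)
    finally show ?thesis .
  qed
  \<comment> \<open>The factor 2 is the divergence of the position field. One of the two copies of
    the potential is kept; the other is nonnegative and can be discarded.\<close>
  have "2 * (\<theta> * V / \<epsilon>) = - D1 + \<epsilon> * (\<theta> * (g \<bullet> (x1 *\<^sub>R p + x2 *\<^sub>R q))) 
      + \<epsilon> * (\<theta>1 * ((p \<bullet> p - q \<bullet> q) / 2 * x1 + (p \<bullet> q) * x2)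
        + \<theta>2 * ((p \<bullet> q) * x1 + (q \<bullet> q - p \<bullet> p) / 2 * x2)) - V * (x1 * \<theta>1 + x2 * \<theta>2) / \<epsilon>"
    unfolding D1 by (simp add: algebra_simps add_divide_distrib)
  moreover have "\<epsilon> * (\<theta> * (g \<bullet> (x1 *\<^sub>R p + x2 *\<^sub>R q))) \<le> R * (K * (\<theta> * (g \<bullet> g)) + \<theta> * N / K)"
  proof -
    have "0 \<le> R * (K * (\<theta> * (g \<bullet> g)) + \<theta> * N / K)" using R \<open>1 \<le> K\<close> \<open>0 \<le> \<theta>\<close> N0 by simp
    moreover have "\<theta> * (g \<bullet> (x1 *\<^sub>R p + x2 *\<^sub>R q)) \<le> R * (K * (\<theta> * (g \<bullet> g)) + \<theta> * N / K)"
      using mult_left_mono[OF G \<open>0 \<le> \<theta>\<close>] by (simp add: algebra_simps)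
    ultimately have "\<epsilon> * (\<theta> * (g \<bullet> (x1 *\<^sub>R p + x2 *\<^sub>R q))) \<le> \<epsilon> * (R * (K * (\<theta> * (g \<bullet> g)) + \<theta> * N / K))"
      and "\<epsilon> * (R * (K * (\<theta> * (g \<bullet> g)) + \<theta> * N / K)) \<le> 1 * (R * (K * (\<theta> * (g \<bullet> g)) + \<theta> * N / K))"
      using assms(1,2) by (blast intro: mult_left_mono mult_right_mono less_imp_le)+
    then show ?thesis by linarith
  qed
  moreover have "\<epsilon> * (\<theta>1 * ((p \<bullet> p - q \<bullet> q) / 2 * x1 + (p \<bullet> q) * x2)
        + \<theta>2 * ((p \<bullet> q) * x1 + (q \<bullet> q - p \<bullet> p) / 2 * x2)) \<le> \<epsilon> * (z * (N * R))"
    using B assms(1) by (intro mult_left_mono) auto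
  moreover have "- (V * (x1 * \<theta>1 + x2 * \<theta>2) / \<epsilon>) \<le> R * (z * V) / \<epsilon>"
  proof -
    have "- (V * (x1 * \<theta>1 + x2 * \<theta>2)) \<le> R * (z * V)" using C by linarith
    from divide_right_mono[OF this, of \<epsilon>] assms(1) show ?thesis by simp
  qed
  moreover have "0 \<le> \<theta> * V / \<epsilon>" using assms by simp
  moreover have "0 \<le> \<epsilon> * (z * (N * R))" "0 \<le> R * (z * V) / \<epsilon>"
    using R N0 assms z' by auto
  moreover have "4 * R * (z * (\<epsilon> * N / 2 + V / \<epsilon>)) = 2 * (\<epsilon> * (z * (N * R))) + 4 * (R * (z * V) / \<epsilon>)"
    by (simp add: algebra_simps)
  moreover have "x \<le> - d + a' + t" if "2 * x = - d + a + b - c" "a \<le> a'" "b \<le> b'" "- c \<le> c'"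
      "0 \<le> x" "0 \<le> b'" "0 \<le> c'" "t = 2 * b' + 4 * c'" for x d a b c a' b' c' t :: real
    using that by linarith
  ultimately show ?thesis by blast
qed

lemma hessian_pointwise:
  fixes p a b c l :: "'b::real_inner"
  assumes D2: "D2 = \<theta>\<^sup>2 * (b \<bullet> b - a \<bullet> c) + 2 * \<theta> * \<theta>2 * (p \<bullet> b) - 2 * \<theta> * \<theta>1 * (p \<bullet> c)"
    and l: "l = a + c" and N: "p \<bullet> p \<le> N"
    and z: "\<theta>1\<^sup>2 + \<theta>2\<^sup>2 \<le> z"
  shows "\<theta>\<^sup>2 * (a \<bullet> a + 2 * (b \<bullet> b) + c \<bullet> c) \<le> 2 * (\<theta>\<^sup>2 * (l \<bullet> l)) + 4 * D2 + 16 * (z * N)"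
proof -
  have z0: "0 \<le> z" using z by (meson order_trans sum_power2_ge_zero)
  have 1: "4 * (\<theta> * \<theta>1 * (p \<bullet> c)) \<le> \<theta>\<^sup>2 * (c \<bullet> c) / 2 + 8 * (\<theta>1\<^sup>2 * (p \<bullet> p))"
    using inner_ge_zero[of "\<theta> *\<^sub>R c - (4 * \<theta>1) *\<^sub>R p"]
    by (simp add: inner_diff algebra_simps power2_eq_square inner_commute)
  have 2: "- 4 * (\<theta> * \<theta>2 * (p \<bullet> b)) \<le> \<theta>\<^sup>2 * (b \<bullet> b) + 4 * (\<theta>2\<^sup>2 * (p \<bullet> p))"
    using inner_ge_zero[of "\<theta> *\<^sub>R b + (2 * \<theta>2) *\<^sub>R p"]
    by (simp add: inner_add algebra_simps power2_eq_square inner_commute)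
  have 3: "(\<theta>1\<^sup>2 + \<theta>2\<^sup>2) * (p \<bullet> p) \<le> z * N"
    using z N z0 by (intro mult_mono) auto
  \<comment> \<open>The squared Laplacian and the squared Hessian differ by twice the null
    Lagrangian, whose weighted form is \<open>D2\<close> up to terms with a derivative of the
    cutoff.\<close>
  have 4: "\<theta>\<^sup>2 * (l \<bullet> l) = \<theta>\<^sup>2 * (a \<bullet> a + 2 * (b \<bullet> b) + c \<bullet> c) - 2 * (\<theta>\<^sup>2 * (b \<bullet> b - a \<bullet> c))"
    by (simp add: l inner_add algebra_simps inner_commute)
  have 5: "0 \<le> \<theta>\<^sup>2 * (a \<bullet> a)" "0 \<le> \<theta>2\<^sup>2 * (p \<bullet> p)" by auto
  have "\<theta>\<^sup>2 * (a \<bullet> a + 2 * (b \<bullet> b) + c \<bullet> c) = \<theta>\<^sup>2 * (l \<bullet> l) + 2 * D2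
     - 4 * (\<theta> * \<theta>2 * (p \<bullet> b)) + 4 * (\<theta> * \<theta>1 * (p \<bullet> c))"
    unfolding 4 D2 by (simp add: algebra_simps)
  moreover have "\<theta>\<^sup>2 * (a \<bullet> a + 2 * (b \<bullet> b) + c \<bullet> c) = \<theta>\<^sup>2 * (a \<bullet> a) + 2 * (\<theta>\<^sup>2 * (b \<bullet> b)) + \<theta>\<^sup>2 * (c \<bullet> c)"
    "(\<theta>1\<^sup>2 + \<theta>2\<^sup>2) * (p \<bullet> p) = \<theta>1\<^sup>2 * (p \<bullet> p) + \<theta>2\<^sup>2 * (p \<bullet> p)"
    by (simp_all add: algebra_simps)
  ultimately show ?thesis using 1 2 3 5 by linarith
qed

lemma gradient4_pointwise:
  fixes v p q a b c l :: "'b::real_inner"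
  assumes D3: "D3 = \<theta>\<^sup>2 * N\<^sup>2 + \<theta>\<^sup>2 * N * (v \<bullet> l)
      + \<theta>\<^sup>2 * (2 * (a \<bullet> p + b \<bullet> q) * (v \<bullet> p) + 2 * (b \<bullet> p + c \<bullet> q) * (v \<bullet> q))
      + 2 * \<theta> * N * (\<theta>1 * (v \<bullet> p) + \<theta>2 * (v \<bullet> q))"
    and l: "l = a + c" and N: "N = p \<bullet> p + q \<bullet> q" and L: "norm v \<le> L"
    and z: "\<theta>1\<^sup>2 + \<theta>2\<^sup>2 \<le> z" and H: "H = a \<bullet> a + 2 * (b \<bullet> b) + c \<bullet> c"
  shows "\<theta>\<^sup>2 * N\<^sup>2 \<le> 2 * D3 + 100 * L\<^sup>2 * (\<theta>\<^sup>2 * H) + 16 * L\<^sup>2 * (z * N)"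
proof -
  have z0: "0 \<le> z" using z by (meson order_trans sum_power2_ge_zero)
  have L0: "0 \<le> L" using L norm_ge_zero order_trans by blast
  have N0: "0 \<le> N" by (simp add: N)
  \<comment> \<open>The weights 1, 2, 1 add up to 4, the constant in \<open>s2\<close> by
    Cauchy-Schwarz; they match the double count of \<open>b\<close> in \<open>H\<close>.\<close>
  define s where "s = norm a + 2 * norm b + norm c"
  have s0: "0 \<le> s" by (simp add: s_def)
  have s2: "s\<^sup>2 \<le> 4 * H"
  proof -
    have "0 \<le> (norm a - norm b)\<^sup>2 + (norm a - norm b)\<^sup>2 + (norm a - norm c)\<^sup>2 + (norm b - norm c)\<^sup>2 + (norm b - norm c)\<^sup>2" by simp
    then have "(norm a + 2 * norm b + norm c)\<^sup>2 \<le> 4 * ((norm a)\<^sup>2 + 2 * (norm b)\<^sup>2 + (norm c)\<^sup>2)"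
      by (simp add: power2_eq_square algebra_simps)
    then show ?thesis by (simp add: s_def H power2_norm_eq_inner)
  qed
  have pq: "norm p * norm p \<le> N" "norm q * norm q \<le> N" "norm p * norm q \<le> N"
  proof -
    show "norm p * norm p \<le> N" "norm q * norm q \<le> N"
      by (simp_all add: N norm_eq_sqrt_inner)
    have "norm p * norm q \<le> ((norm p)\<^sup>2 + (norm q)\<^sup>2) / 2"
      using sum_squares_bound[of "norm p" "norm q"] by simp
    also have "\<dots> \<le> N" using N0 unfolding N power2_norm_eq_inner by simp
    finally show "norm p * norm q \<le> N" .
  qed
  have vp: "\<bar>v \<bullet> w\<bar> \<le> L * norm w" for w
    by (meson Cauchy_Schwarz_ineq2 L mult_right_mono norm_ge_zero order_trans)
  have ab: "\<bar>(x \<bullet> w) * (v \<bullet> w')\<bar> \<le> L * (norm x * N)" if "norm w * norm w' \<le> N" for x w w'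
  proof -
    have "\<bar>(x \<bullet> w) * (v \<bullet> w')\<bar> \<le> (norm x * norm w) * (L * norm w')"
      unfolding abs_mult by (intro mult_mono Cauchy_Schwarz_ineq2 vp) auto
    also have "\<dots> = L * (norm x * (norm w * norm w'))" by simp
    also have "\<dots> \<le> L * (norm x * N)" by (intro mult_left_mono that L0 norm_ge_zero)
    finally show ?thesis .
  qed
  have "\<bar>2 * (a \<bullet> p + b \<bullet> q) * (v \<bullet> p) + 2 * (b \<bullet> p + c \<bullet> q) * (v \<bullet> q)\<bar>
      \<le> 2 * (L * (norm a * N)) + 2 * (L * (norm b * N)) + 2 * (L * (norm b * N)) + 2 * (L * (norm c * N))"
    using ab[OF pq(1), of a] ab[of q p b] ab[OF pq(3), of b] ab[OF pq(2), of c] pq(3)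
    by (simp add: algebra_simps)
  also have "\<dots> = N * (2 * L * s)" by (simp add: s_def algebra_simps)
  also have "\<dots> \<le> 1/8 * N\<^sup>2 + (2 * L * s)\<^sup>2 / (4 * (1/8))"
    by (rule quad_am_gm) simp
  also have "\<dots> = N\<^sup>2 / 8 + 8 * L\<^sup>2 * s\<^sup>2" by (simp add: power_mult_distrib)
  also have "8 * L\<^sup>2 * s\<^sup>2 \<le> 8 * L\<^sup>2 * (4 * H)" by (intro mult_left_mono s2) simp
  finally have 1: "\<bar>2 * (a \<bullet> p + b \<bullet> q) * (v \<bullet> p) + 2 * (b \<bullet> p + c \<bullet> q) * (v \<bullet> q)\<bar>
      \<le> N\<^sup>2 / 8 + 32 * L\<^sup>2 * H" by simp
  have "norm l \<le> s" 
    using norm_triangle_ineq[of a c] norm_ge_zero[of b] unfolding l s_def by linarith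
  then have "\<bar>N * (v \<bullet> l)\<bar> \<le> N * (L * s)"
    using vp[of l] L0 N0 unfolding abs_mult 
    by (auto intro!: mult_left_mono intro: order_trans[OF vp])
  also have "\<dots> \<le> 1/8 * N\<^sup>2 + (L * s)\<^sup>2 / (4 * (1/8))"
    by (rule quad_am_gm) simp
  also have "\<dots> = N\<^sup>2 / 8 + 2 * L\<^sup>2 * s\<^sup>2" by (simp add: power_mult_distrib)
  also have "2 * L\<^sup>2 * s\<^sup>2 \<le> 2 * L\<^sup>2 * (4 * H)" by (intro mult_left_mono s2) simp
  finally have 2: "\<bar>N * (v \<bullet> l)\<bar> \<le> N\<^sup>2 / 8 + 8 * L\<^sup>2 * H" by simp
  have 3: "\<bar>2 * \<theta> * N * (\<theta>1 * (v \<bullet> p) + \<theta>2 * (v \<bullet> q))\<bar> \<le> \<theta>\<^sup>2 * N\<^sup>2 / 8 + 8 * L\<^sup>2 * (z * N)"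
  proof -
    define w where "w = \<theta>1 *\<^sub>R p + \<theta>2 *\<^sub>R q"
    have "(norm w)\<^sup>2 \<le> (\<bar>\<theta>1\<bar> * norm p + \<bar>\<theta>2\<bar> * norm q)\<^sup>2"
      unfolding w_def by (intro power_mono) (use norm_triangle_ineq[of "\<theta>1 *\<^sub>R p" "\<theta>2 *\<^sub>R q"] in auto)
    also have "\<dots> \<le> (\<bar>\<theta>1\<bar>\<^sup>2 + \<bar>\<theta>2\<bar>\<^sup>2) * ((norm p)\<^sup>2 + (norm q)\<^sup>2)"
    proof -
      have "(s * x + t * y)\<^sup>2 \<le> (s\<^sup>2 + t\<^sup>2) * (x\<^sup>2 + y\<^sup>2)" for s t x y :: real
        using zero_le_power2[of "s * y - t * x"] by (simp add: power2_eq_square algebra_simps)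
      then show ?thesis by blast
    qed
    also have "\<dots> \<le> z * N"
      using z N0 by (simp add: N power2_norm_eq_inner mult_right_mono)
    finally have w2: "(norm w)\<^sup>2 \<le> z * N" .
    have "2 * \<theta> * N * (\<theta>1 * (v \<bullet> p) + \<theta>2 * (v \<bullet> q)) = (\<theta> * N) * (2 * (v \<bullet> w))"
      by (simp add: w_def inner_add_right algebra_simps)
    moreover have "\<bar>(\<theta> * N) * (2 * (v \<bullet> w))\<bar> \<le> 1/8 * (\<bar>\<theta> * N\<bar>)\<^sup>2 + (\<bar>2 * (v \<bullet> w)\<bar>)\<^sup>2 / (4 * (1/8))"
      unfolding abs_mult[of "\<theta> * N"] by (rule quad_am_gm) simp
    moreover have "(v \<bullet> w)\<^sup>2 \<le> L\<^sup>2 * (z * N)"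
    proof -
      have "(v \<bullet> w)\<^sup>2 \<le> (L * norm w)\<^sup>2" using power_mono[OF vp[of w] abs_ge_zero, of 2] by simp
      also have "\<dots> \<le> L\<^sup>2 * (z * N)" unfolding power_mult_distrib by (intro mult_left_mono w2) simp
      finally show ?thesis .
    qed
    ultimately show ?thesis by (simp only: power_mult_distrib power2_abs) simp
  qed
  have 4: "- (\<theta>\<^sup>2 * (N * (v \<bullet> l))) \<le> \<theta>\<^sup>2 * (N\<^sup>2 / 8 + 8 * L\<^sup>2 * H)"
    using mult_left_mono[OF 2, of "\<theta>\<^sup>2"] by (simp add: abs_mult) (metis abs_le_D2 abs_mult abs_power2 minus_mult_right)
  have 5: "- (\<theta>\<^sup>2 * (2 * (a \<bullet> p + b \<bullet> q) * (v \<bullet> p) + 2 * (b \<bullet> p + c \<bullet> q) * (v \<bullet> q))) \<le> \<theta>\<^sup>2 * (N\<^sup>2 / 8 + 32 * L\<^sup>2 * H)"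
  proof -
    have "- (2 * (a \<bullet> p + b \<bullet> q) * (v \<bullet> p) + 2 * (b \<bullet> p + c \<bullet> q) * (v \<bullet> q)) \<le> N\<^sup>2 / 8 + 32 * L\<^sup>2 * H"
      using 1 by linarith
    from mult_left_mono[OF this, of "\<theta>\<^sup>2"] show ?thesis unfolding mult_minus_right by simp
  qed
  have H0: "0 \<le> H" by (simp add: H)
  \<comment> \<open>The leading square arises where the derivative falls on \<open>v\<close>. Each
    of the three remaining terms costs an eighth of it, together less than half, whence the factor 2
    in front of \<open>D3\<close>.\<close>
  have e: "\<theta>\<^sup>2 * N\<^sup>2 = D3 - \<theta>\<^sup>2 * (N * (v \<bullet> l)) - \<theta>\<^sup>2 * (2 * (a \<bullet> p + b \<bullet> q) * (v \<bullet> p) + 2 * (b \<bullet> p + c \<bullet> q) * (v \<bullet> q))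
     - 2 * \<theta> * N * (\<theta>1 * (v \<bullet> p) + \<theta>2 * (v \<bullet> q))" unfolding D3 by simp
  have r: "\<theta>\<^sup>2 * (N\<^sup>2 / 8 + k * L\<^sup>2 * H) = \<theta>\<^sup>2 * N\<^sup>2 / 8 + k * (L\<^sup>2 * (\<theta>\<^sup>2 * H))" for k
    by (simp add: algebra_simps)
  have "0 \<le> L\<^sup>2 * (\<theta>\<^sup>2 * H)" "0 \<le> L\<^sup>2 * (z * N)" using H0 z0 N0 by auto
  moreover have "0 \<le> \<theta>\<^sup>2 * N\<^sup>2" by simp
  moreover have "x \<le> 2 * d + 100 * L\<^sup>2 * h + 16 * L\<^sup>2 * n"
    if "x = d - a - b - c" "\<bar>c\<bar> \<le> x / 8 + 8 * L\<^sup>2 * n" "- a \<le> x / 8 + 8 * (L\<^sup>2 * h)"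
      "- b \<le> x / 8 + 32 * (L\<^sup>2 * h)" "0 \<le> L\<^sup>2 * h" "0 \<le> L\<^sup>2 * n" "0 \<le> x" for x d a b c h n
    using that unfolding mult.assoc by linarith
  ultimately show ?thesis using e 3 4 5 unfolding r by blast
qed

lemma test_pointwise:
  fixes G p q g l :: "'b::real_inner"
  assumes "0 < \<epsilon>" "\<epsilon> \<le> 1" "0 \<le> \<theta>" "\<theta> \<le> 1" "0 \<le> V" "V \<le> B"
    and D4: "D4 = \<theta>\<^sup>2 * h + \<theta>\<^sup>2 * (G \<bullet> l) + 2 * \<theta> * (\<theta>1 * (G \<bullet> p) + \<theta>2 * (G \<bullet> q))"
    and l: "l = (1 / \<epsilon>\<^sup>2) *\<^sub>R G + g" and N: "N = p \<bullet> p + q \<bullet> q"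
    and G: "G \<bullet> G \<le> C * V" and h: "h \<ge> c * N - C * V * N" and C: "0 \<le> C"
    and z: "z = \<bar>\<theta>1\<bar> + \<bar>\<theta>2\<bar> + \<theta>1\<^sup>2 + \<theta>2\<^sup>2"
  shows "c * (\<epsilon> * (\<theta>\<^sup>2 * N)) \<le> \<epsilon> * D4 + C * (\<epsilon> ^ 3 * (\<theta>\<^sup>2 * N\<^sup>2)) + C * (B + 1) * (\<theta> * V / \<epsilon>)
    + \<theta> * (g \<bullet> g) + (2 * C + 2) * (z * (\<epsilon> * N / 2 + V / \<epsilon>))"
proof -
  have N0: "0 \<le> N" by (simp add: N)
  have z': "\<bar>\<theta>1\<bar> + \<bar>\<theta>2\<bar> \<le> z" by (simp add: z)
  have z0: "0 \<le> z" by (simp add: z)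
  have t2: "\<theta>\<^sup>2 \<le> \<theta>" using assms(3,4) by (simp add: power2_eq_square mult_left_le)
  \<comment> \<open>Young's inequality with weight \<epsilon> splits the product of \<open>V\<close>
    and \<open>N\<close> into the quartic term and V^2 / \<epsilon>; the bound
    \<open>V \<le> B\<close> makes the latter linear in \<open>V\<close>.\<close>
  have 1: "\<epsilon> * (\<theta>\<^sup>2 * (C * V * N)) \<le> C * (\<epsilon> ^ 3 * (\<theta>\<^sup>2 * N\<^sup>2)) + C * B * (\<theta> * V / \<epsilon>)"
  proof -
    have "\<epsilon> * (V * N) = (\<epsilon> * N) * V" by simp
    also have "\<dots> \<le> \<epsilon> * (\<epsilon> * N)\<^sup>2 + V\<^sup>2 / (4 * \<epsilon>)" using assms(1) by (rule quad_am_gm)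
    also have "\<dots> \<le> \<epsilon> ^ 3 * N\<^sup>2 + B * V / \<epsilon>"
    proof (intro add_mono)
      have "V\<^sup>2 / (4 * \<epsilon>) \<le> V\<^sup>2 / \<epsilon>" using assms(1) by (intro divide_left_mono) auto
      also have "\<dots> \<le> B * V / \<epsilon>" using assms(1,5,6) by (intro divide_right_mono) (auto simp: power2_eq_square mult_right_mono)
      finally show "V\<^sup>2 / (4 * \<epsilon>) \<le> B * V / \<epsilon>" .
    qed (simp add: power2_eq_square power3_eq_cube)
    finally have "\<theta>\<^sup>2 * C * (\<epsilon> * (V * N)) \<le> \<theta>\<^sup>2 * C * (\<epsilon> ^ 3 * N\<^sup>2 + B * V / \<epsilon>)"
      using C by (intro mult_left_mono) auto
    moreover have "\<theta>\<^sup>2 * (C * (B * V / \<epsilon>)) \<le> \<theta> * (C * (B * V / \<epsilon>))"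
      using t2 C assms by (intro mult_right_mono) auto
    ultimately show ?thesis by (simp add: algebra_simps)
  qed
  \<comment> \<open>The term \<open>(G \<bullet> G) / \<epsilon>\<^sup>2\<close> has the favourable
    sign and is dropped; only the defect part needs an estimate.\<close>
  have 2: "- (\<epsilon> * (\<theta>\<^sup>2 * (G \<bullet> l))) \<le> C * (\<theta> * V / \<epsilon>) + \<theta> * (g \<bullet> g)"
  proof -
    have "G \<bullet> l = (G \<bullet> G) / \<epsilon>\<^sup>2 + G \<bullet> g" by (simp add: l inner_add_right)
    then have "- (\<epsilon> * (G \<bullet> l)) = - (\<epsilon> * ((G \<bullet> G) / \<epsilon>\<^sup>2)) - \<epsilon> * (G \<bullet> g)"
      by (simp add: algebra_simps)
    also have "\<dots> \<le> - (\<epsilon> * (G \<bullet> g))" using assms(1) by simp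
    also have "\<dots> \<le> \<epsilon> * (norm G * norm g)"
      using Cauchy_Schwarz_ineq2[of G g] mult_left_mono[of "- (G \<bullet> g)" "norm G * norm g" \<epsilon>] assms(1) by simp
    also have "\<dots> \<le> \<epsilon> * (1 / 2 * (norm G)\<^sup>2 + (norm g)\<^sup>2 / (4 * (1 / 2)))"
      using assms(1) by (intro mult_left_mono quad_am_gm) auto
    also have "\<dots> \<le> \<epsilon> * (G \<bullet> G + g \<bullet> g)"
      using assms(1) by (intro mult_left_mono) (auto simp: power2_norm_eq_inner intro!: add_mono)
    also have "\<dots> \<le> C * V / \<epsilon> + g \<bullet> g"
    proof -
      have "\<epsilon> * (G \<bullet> G) \<le> 1 / \<epsilon> * (C * V)"
        using assms(1,2) G by (intro mult_mono) (auto simp: field_simps intro: order_trans[of _ 1] mult_le_one)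
      moreover have "\<epsilon> * (g \<bullet> g) \<le> 1 * (g \<bullet> g)" using assms(2) by (intro mult_right_mono) auto
      ultimately show ?thesis by (simp add: algebra_simps)
    qed
    finally have "\<theta>\<^sup>2 * (- (\<epsilon> * (G \<bullet> l))) \<le> \<theta>\<^sup>2 * (C * V / \<epsilon> + g \<bullet> g)" by (intro mult_left_mono) auto
    also have "\<dots> \<le> \<theta> * (C * V / \<epsilon> + g \<bullet> g)" using t2 C assms by (intro mult_right_mono) auto
    finally show ?thesis by (simp add: algebra_simps)
  qed
  have Gw: "\<epsilon> * \<bar>2 * \<theta> * (G \<bullet> w)\<bar> \<le> (2 * C + 2) * (\<epsilon> * N / 2 + V / \<epsilon>)" if "w \<bullet> w \<le> N" for w
  proof -
    have "\<bar>G \<bullet> w\<bar> \<le> norm G * norm w" by (rule Cauchy_Schwarz_ineq2)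
    also have "\<dots> \<le> 1 / 2 * (norm G)\<^sup>2 + (norm w)\<^sup>2 / (4 * (1 / 2))" by (rule quad_am_gm) simp
    also have "\<dots> \<le> 1/2 * (C * V) + N / 2"
      using G that by (intro add_mono) (auto simp: power2_norm_eq_inner)
    finally have "\<bar>G \<bullet> w\<bar> \<le> 1/2 * (C * V) + N / 2" .
    moreover have "\<bar>2 * \<theta> * (G \<bullet> w)\<bar> \<le> 2 * \<bar>G \<bullet> w\<bar>"
      using assms(3,4) by (auto simp: abs_mult intro!: mult_left_le_one_le)
    ultimately have "\<epsilon> * \<bar>2 * \<theta> * (G \<bullet> w)\<bar> \<le> \<epsilon> * (C * V + N)"
      using assms(1) by (intro mult_left_mono) auto
    also have "\<dots> = C * (\<epsilon> * V) + \<epsilon> * N" by (simp add: algebra_simps)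
    also have "\<epsilon> * V \<le> V / \<epsilon>"
    proof -
      have "\<epsilon> * V \<le> (1 / \<epsilon>) * V"
        using assms(1,2,5) by (intro mult_right_mono) (auto simp: field_simps intro: order_trans[of _ 1] mult_le_one)
      then show ?thesis by simp
    qed
    also have "C * (V / \<epsilon>) + \<epsilon> * N \<le> (2 * C + 2) * (\<epsilon> * N / 2 + V / \<epsilon>)"
    proof -
      have "0 \<le> C * (\<epsilon> * N)" "0 \<le> C * (V / \<epsilon>)" "0 \<le> V / \<epsilon>" "0 \<le> \<epsilon> * N" using C N0 assms by auto
      moreover have "(2 * C + 2) * (\<epsilon> * N / 2 + V / \<epsilon>) = C * (\<epsilon> * N) + \<epsilon> * N + 2 * (C * (V / \<epsilon>)) + 2 * (V / \<epsilon>)"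
        by (simp only: ring_distribs)
      ultimately show ?thesis by linarith
    qed
    finally show ?thesis using C by (simp add: mult_left_mono)
  qed
  have 3: "- (\<epsilon> * (2 * \<theta> * (\<theta>1 * (G \<bullet> p) + \<theta>2 * (G \<bullet> q)))) \<le> (2 * C + 2) * (z * (\<epsilon> * N / 2 + V / \<epsilon>))"
  proof -
    let ?e = "\<epsilon> * N / 2 + V / \<epsilon>"
    have "- (\<epsilon> * (2 * \<theta> * (\<theta>1 * (G \<bullet> p) + \<theta>2 * (G \<bullet> q)))) = 
      - (\<theta>1 * (\<epsilon> * (2 * \<theta> * (G \<bullet> p)))) - (\<theta>2 * (\<epsilon> * (2 * \<theta> * (G \<bullet> q))))" by (simp add: algebra_simps)
    also have "\<dots> \<le> \<bar>\<theta>1\<bar> * (\<epsilon> * \<bar>2 * \<theta> * (G \<bullet> p)\<bar>) + \<bar>\<theta>2\<bar> * (\<epsilon> * \<bar>2 * \<theta> * (G \<bullet> q)\<bar>)"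
    proof -
      have "- (t * (\<epsilon> * y)) \<le> \<bar>t\<bar> * (\<epsilon> * \<bar>y\<bar>)" for t y
        using abs_ge_minus_self[of "t * (\<epsilon> * y)"] assms(1) by (simp add: abs_mult)
      from this[of \<theta>1 "2 * \<theta> * (G \<bullet> p)"] this[of \<theta>2 "2 * \<theta> * (G \<bullet> q)"] show ?thesis by linarith
    qed
    also have "\<dots> \<le> \<bar>\<theta>1\<bar> * ((2 * C + 2) * ?e) + \<bar>\<theta>2\<bar> * ((2 * C + 2) * ?e)"
      by (intro add_mono mult_left_mono Gw) (auto simp: N)
    also have "\<dots> = (\<bar>\<theta>1\<bar> + \<bar>\<theta>2\<bar>) * ((2 * C + 2) * ?e)" by (rule distrib_right[symmetric])
    also have "\<dots> \<le> z * ((2 * C + 2) * ?e)"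
      using z' C N0 assms by (intro mult_right_mono) auto
    finally show ?thesis by (simp add: mult_ac)
  qed
  have "c * (\<epsilon> * (\<theta>\<^sup>2 * N)) = \<epsilon> * \<theta>\<^sup>2 * (c * N - C * V * N) + \<epsilon> * (\<theta>\<^sup>2 * (C * V * N))"
    by (simp add: algebra_simps)
  also have "\<epsilon> * \<theta>\<^sup>2 * (c * N - C * V * N) \<le> \<epsilon> * \<theta>\<^sup>2 * h"
    using h assms(1) by (intro mult_left_mono) auto
  finally have "c * (\<epsilon> * (\<theta>\<^sup>2 * N)) \<le> \<epsilon> * \<theta>\<^sup>2 * h + \<epsilon> * (\<theta>\<^sup>2 * (C * V * N))" by simp
  moreover have "\<epsilon> * \<theta>\<^sup>2 * h = \<epsilon> * D4 - \<epsilon> * (\<theta>\<^sup>2 * (G \<bullet> l)) - \<epsilon> * (2 * \<theta> * (\<theta>1 * (G \<bullet> p) + \<theta>2 * (G \<bullet> q)))"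
    unfolding D4 by (simp add: algebra_simps)
  moreover have "C * (B + 1) * (\<theta> * V / \<epsilon>) = C * B * (\<theta> * V / \<epsilon>) + C * (\<theta> * V / \<epsilon>)" by (simp only: ring_distribs mult_1_right)
  ultimately show ?thesis using 1 2 3 by linarith
qed

section \<open>Integration of the pointwise inequalities against a cutoff\<close>

abbreviation ax :: "2 \<Rightarrow> real^2" where "ax i \<equiv> axis i 1"

lemma pder_coord: "pder (ax i) (\<lambda>x. x $ j) (\<lambda>x. if i = j then 1 else 0)"
proof -
  have "((\<lambda>t. (x + t *\<^sub>R ax i) $ j) has_vector_derivative (if i = j then 1 else 0)) (at 0)" for x
  proof -
    have "(\<lambda>t. (x + t *\<^sub>R ax i) $ j) = (\<lambda>t. x $ j + t * (if i = j then 1 else 0))"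
      by (auto simp: axis_def)
    then show ?thesis by (auto intro!: derivative_eq_intros simp flip: has_real_derivative_iff_has_vector_derivative)
  qed
  then show ?thesis by (simp add: pder_def)
qed

lemma pder_eq: "pder e f f' \<Longrightarrow> (\<And>x. f' x = g' x) \<Longrightarrow> pder e f g'"
  by (metis ext)

text \<open>The factor of \<open>4 * R\<close> is the multiple of the Pohozaev identity used in
  \<open>energy_estimate\<close>; the remaining summands collect the cutoff and defect errors of the
  other three identities. Independence of \<epsilon> is what matters.\<close>

definition energy_const :: "real \<Rightarrow> real \<Rightarrow> real \<Rightarrow> real \<Rightarrow> real \<Rightarrow> real" where
  "energy_const c C L R B = ((400 * C\<^sup>2 * L\<^sup>2 + C * (B + 1) + c) * (4 * R) + 3232 * C * L\<^sup>2 + 400 * C * L\<^sup>2 + 2 * C + 3) / c"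

text \<open>The letters stand for partial derivatives, and sharing \<open>b\<close> encodes equality
  of the mixed second ones. The single third derivative \<open>d\<close> is present because the
  fields behind \<open>D2\<close> are differentiated once more; there it occurs twice with opposite
  signs and cancels.\<close>

locale cutoff_jet =
  fixes v p q a b c d :: "real^2 \<Rightarrow> 'b::euclidean_space" and \<theta> \<theta>1 \<theta>2 :: "real^2 \<Rightarrow> real" and S :: "(real^2) set"
    and V :: "'b \<Rightarrow> real" and G :: "'b \<Rightarrow> 'b" and HV :: "'b \<Rightarrow> 'b \<Rightarrow> 'b"
  assumes pd: "pder (ax 1) v p" "pder (ax 2) v q" "pder (ax 1) p a" "pder (ax 2) p b"
      "pder (ax 1) q b" "pder (ax 2) q c" "pder (ax 2) b d" "pder (ax 1) c d"
    and cont: "continuous_on UNIV v" "continuous_on UNIV p" "continuous_on UNIV q"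
      "continuous_on UNIV a" "continuous_on UNIV b" "continuous_on UNIV c" "continuous_on UNIV d"
    and pd\<theta>: "pder (ax 1) \<theta> \<theta>1" "pder (ax 2) \<theta> \<theta>2"
    and cont\<theta>: "continuous_on UNIV \<theta>" "continuous_on UNIV \<theta>1" "continuous_on UNIV \<theta>2"
    and S: "compact S" "\<And>x. x \<notin> S \<Longrightarrow> \<theta> x = 0 \<and> \<theta>1 x = 0 \<and> \<theta>2 x = 0"
    and V: "\<And>y. (V has_derivative (\<lambda>h. G y \<bullet> h)) (at y)"
    and G: "\<And>y. (G has_derivative HV y) (at y)"
    and HV: "continuous_on UNIV (\<lambda>z. HV (fst z) (snd z))"
begin

lemma cV: "continuous_on UNIV (\<lambda>x. V (v x))" "continuous_on UNIV (\<lambda>x. G (v x))"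
  and cHV: "continuous_on UNIV (\<lambda>x. HV (v x) (p x))" "continuous_on UNIV (\<lambda>x. HV (v x) (q x))"
proof -
  have "continuous_on UNIV V" "continuous_on UNIV G"
    using V G by (auto intro!: continuous_at_imp_continuous_on has_derivative_continuous)
  then show "continuous_on UNIV (\<lambda>x. V (v x))" "continuous_on UNIV (\<lambda>x. G (v x))"
    using cont(1) by (auto intro: continuous_on_compose2)
  show "continuous_on UNIV (\<lambda>x. HV (v x) (p x))"
    using continuous_on_compose2[OF HV, of UNIV "\<lambda>x. (v x, p x)"] cont by (simp add: continuous_on_Pair)
  show "continuous_on UNIV (\<lambda>x. HV (v x) (q x))"
    using continuous_on_compose2[OF HV, of UNIV "\<lambda>x. (v x, q x)"] cont by (simp add: continuous_on_Pair)
qed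

lemma divergence_integral:
  fixes f f' g g' :: "real^2 \<Rightarrow> real"
  assumes "pder (ax 1) f f'" "pder (ax 2) g g'" "continuous_on UNIV f" "continuous_on UNIV f'"
    "continuous_on UNIV g" "continuous_on UNIV g'"
    "\<And>x. x \<notin> S \<Longrightarrow> f x = 0" "\<And>x. x \<notin> S \<Longrightarrow> g x = 0"
    "\<And>x. f' x + g' x = D x" "\<And>x. x \<notin> S \<Longrightarrow> D x = 0"
  shows "integrable lborel D" "(LINT x|lborel. D x) = 0"
proof -
  have D: "D = (\<lambda>x. f' x + g' x)" using assms(9) by auto
  \<comment> \<open>The complement of \<open>S\<close> is open, so vanishing off \<open>S\<close>
    carries over to the derivatives; each of the two is then integrable on its own.\<close>
  have z: "h' x = 0" if "pder e h h'" "\<And>x. x \<notin> S \<Longrightarrow> h x = 0" "x \<notin> S" for e x :: "real^2" and h h' :: "real^2 \<Rightarrow> real"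
  proof -
    have "closed S" using S(1) by (rule compact_imp_closed)
    have o: "open ((\<lambda>t::real. x + t *\<^sub>R e) -` (- S))"
      by (intro open_vimage continuous_intros) (use \<open>closed S\<close> in auto)
    have "((\<lambda>t. h (x + t *\<^sub>R e)) has_vector_derivative h' x) (at 0)" using that(1) by (auto simp: pder_def)
    then have "((\<lambda>t. 0) has_vector_derivative h' x) (at 0)"
      by (rule has_vector_derivative_transform_within_open[OF _ o]) (use that in auto)
    then show "h' x = 0"
      using vector_derivative_unique_at[of "\<lambda>t::real. 0::real" "h' x" 0 0] by simp
  qed
  have i: "integrable lborel f'" "integrable lborel g'"
    using integrable_continuous_compact_support[OF assms(4) S(1)] integrable_continuous_compact_support[OF assms(6) S(1)]
      z[OF assms(1,7)] z[OF assms(2,8)] by auto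
  show "integrable lborel D" unfolding D using i by simp
  show "(LINT x|lborel. D x) = 0" unfolding D
    using i integral_pder_eq_0[OF assms(1,3,4) S(1) assms(7)] integral_pder_eq_0[OF assms(2,5,6) S(1) assms(8)] by simp
qed

lemmas cts = cont cont\<theta> cV cHV

text \<open>The four inequalities are eliminated backwards: \<open>test_pointwise\<close> leaves a
  quartic term, which \<open>gradient4_pointwise\<close> trades for the squared Hessian, which
  \<open>hessian_pointwise\<close> trades for potential and defect, and
  \<open>pohozaev_pointwise\<close> removes the potential. The result holds pointwise up to a
  combination of divergences and is then integrated.\<close>

lemma energy_estimate:
  assumes \<epsilon>: "0 < \<epsilon>" "\<epsilon> \<le> 1" and K: "1 \<le> K" and c0: "0 < \<kappa>" and C0: "0 \<le> C"
    and \<theta>: "\<And>x. 0 \<le> \<theta> x" "\<And>x. \<theta> x \<le> 1"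
    and L: "\<And>x. x \<in> S \<Longrightarrow> norm (v x) \<le> L" and R: "\<And>x. x \<in> S \<Longrightarrow> norm x \<le> R" "0 \<le> R"
    and V0: "\<And>y. 0 \<le> V y" and B: "\<And>y. norm y \<le> L \<Longrightarrow> V y \<le> B" "0 \<le> B"
    and GV: "\<And>y. norm y \<le> L \<Longrightarrow> G y \<bullet> G y \<le> C * V y"
    and HH: "\<And>y w. norm y \<le> L \<Longrightarrow> HV y w \<bullet> w \<ge> \<kappa> * (w \<bullet> w) - C * V y * (w \<bullet> w)"
  defines "N \<equiv> \<lambda>x. p x \<bullet> p x + q x \<bullet> q x"
    and "e \<equiv> \<lambda>x. \<epsilon> * (p x \<bullet> p x + q x \<bullet> q x) / 2 + V (v x) / \<epsilon>"
    and "g \<equiv> \<lambda>x. a x + c x - (1 / \<epsilon>\<^sup>2) *\<^sub>R G (v x)"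
    and "z \<equiv> \<lambda>x. \<bar>\<theta>1 x\<bar> + \<bar>\<theta>2 x\<bar> + (\<theta>1 x)\<^sup>2 + (\<theta>2 x)\<^sup>2"
  shows "(LINT x|lborel. (\<theta> x)\<^sup>2 * e x) \<le> energy_const \<kappa> C L R B *
     ((LINT x|lborel. z x * e x) + K * (LINT x|lborel. \<theta> x * (g x \<bullet> g x)) + (LINT x|lborel. \<theta> x * N x) / K)"
proof -
  define l where "l x = a x + c x" for x
  define D1 where "D1 x = \<epsilon> * (\<theta> x * (g x \<bullet> ((x$1) *\<^sub>R p x + (x$2) *\<^sub>R q x))
        + \<theta>1 x * ((p x \<bullet> p x - q x \<bullet> q x) / 2 * x$1 + (p x \<bullet> q x) * x$2)
        + \<theta>2 x * ((p x \<bullet> q x) * x$1 + (q x \<bullet> q x - p x \<bullet> p x) / 2 * x$2))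
        - (2 * \<theta> x * V (v x) + V (v x) * (x$1 * \<theta>1 x + x$2 * \<theta>2 x)) / \<epsilon>" for x
  define D2 where "D2 x = (\<theta> x)\<^sup>2 * (b x \<bullet> b x - a x \<bullet> c x) + 2 * \<theta> x * \<theta>2 x * (p x \<bullet> b x) - 2 * \<theta> x * \<theta>1 x * (p x \<bullet> c x)" for x
  define D3 where "D3 x = (\<theta> x)\<^sup>2 * (N x)\<^sup>2 + (\<theta> x)\<^sup>2 * N x * (v x \<bullet> l x)
      + (\<theta> x)\<^sup>2 * (2 * (a x \<bullet> p x + b x \<bullet> q x) * (v x \<bullet> p x) + 2 * (b x \<bullet> p x + c x \<bullet> q x) * (v x \<bullet> q x))
      + 2 * \<theta> x * N x * (\<theta>1 x * (v x \<bullet> p x) + \<theta>2 x * (v x \<bullet> q x))" for x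
  define h where "h x = HV (v x) (p x) \<bullet> p x + HV (v x) (q x) \<bullet> q x" for x
  define D4 where "D4 x = (\<theta> x)\<^sup>2 * h x + (\<theta> x)\<^sup>2 * (G (v x) \<bullet> l x) + 2 * \<theta> x * (\<theta>1 x * (G (v x) \<bullet> p x) + \<theta>2 x * (G (v x) \<bullet> q x))" for x
  have lg: "l x = (1 / \<epsilon>\<^sup>2) *\<^sub>R G (v x) + g x" for x by (simp add: l_def g_def)
  note pV = pder_chain[OF V pd(1)] pder_chain[OF V pd(2)]
  note pG = pder_chain[OF G pd(1)] pder_chain[OF G pd(2)]
  note I = pder_mult pder_inner pder_add pder_diff pd pd\<theta> pder_coord pder_const pV pG
  note cI = continuous_intros cts
  have gi: "g x \<bullet> w = a x \<bullet> w + c x \<bullet> w - (1 / \<epsilon>\<^sup>2) * (G (v x) \<bullet> w)" for x w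
      by (simp add: g_def inner_add_left inner_diff_left)
  \<comment> \<open>The divergence of the Pohozaev field, with scalars in place of the inner
    products. The two copies of half \<open>pp - qq\<close> cancel, which is conformal invariance,
    while the two copies of \<open>W\<close> stem from the divergence 2 of the position
    field.\<close>
  have id0: "(t1 * (\<epsilon> * ((pp - qq) * (1/2) * x1 + pq * x2) - (1/\<epsilon>) * (x1 * W))
       + t * (\<epsilon> * ((ap - bq) * x1 + (pp - qq) * (1/2) + (aq + bp) * x2) - (1/\<epsilon>) * (W + x1 * Gp)))
      + (t2 * (\<epsilon> * (pq * x1 + (qq - pp) * (1/2) * x2) - (1/\<epsilon>) * (x2 * W))
       + t * (\<epsilon> * ((cq - bp) * x2 + (qq - pp) * (1/2) + (bq + cp) * x1) - (1/\<epsilon>) * (W + x2 * Gq)))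
      = \<epsilon> * (t * (x1 * (ap + cp - (1 / \<epsilon>\<^sup>2) * Gp) + x2 * (aq + cq - (1 / \<epsilon>\<^sup>2) * Gq))
        + t1 * ((pp - qq) / 2 * x1 + pq * x2) + t2 * (pq * x1 + (qq - pp) / 2 * x2))
        - (2 * t * W + W * (x1 * t1 + x2 * t2)) / \<epsilon>" for t1 t2 t pp qq pq x1 x2 W ap aq bp bq cp cq Gp Gq :: real
      using \<epsilon> by (simp add: power2_eq_square divide_simps) (simp add: algebra_simps)
  have D1: "integrable lborel D1" "(LINT x|lborel. D1 x) = 0"
  proof -
    have 1: "pder (ax 1) (\<lambda>x. \<theta> x * (\<epsilon> * ((p x \<bullet> p x - q x \<bullet> q x) * (1/2) * x$1 + (p x \<bullet> q x) * x$2) - (1/\<epsilon>) * (x$1 * V (v x)))) (\<lambda>x. \<theta>1 x * (\<epsilon> * ((p x \<bullet> p x - q x \<bullet> q x) * (1/2) * x$1 + (p x \<bullet> q x) * x$2) - (1/\<epsilon>) * (x$1 * V (v x))) + \<theta> x * (\<epsilon> * ((a x \<bullet> p x - b x \<bullet> q x) * x$1 + (p x \<bullet> p x - q x \<bullet> q x) * (1/2) + (a x \<bullet> q x + b x \<bullet> p x) * x$2) - (1/\<epsilon>) * (V (v x) + x$1 * (G (v x) \<bullet> p x))))" (is "pder _ ?f ?f'")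
      by (rule pder_eq, (rule I)+) (simp add: inner_commute algebra_simps)
    have 2: "pder (ax 2) (\<lambda>x. \<theta> x * (\<epsilon> * ((p x \<bullet> q x) * x$1 + (q x \<bullet> q x - p x \<bullet> p x) * (1/2) * x$2) - (1/\<epsilon>) * (x$2 * V (v x)))) (\<lambda>x. \<theta>2 x * (\<epsilon> * ((p x \<bullet> q x) * x$1 + (q x \<bullet> q x - p x \<bullet> p x) * (1/2) * x$2) - (1/\<epsilon>) * (x$2 * V (v x))) + \<theta> x * (\<epsilon> * ((c x \<bullet> q x - b x \<bullet> p x) * x$2 + (q x \<bullet> q x - p x \<bullet> p x) * (1/2) + (b x \<bullet> q x + c x \<bullet> p x) * x$1) - (1/\<epsilon>) * (V (v x) + x$2 * (G (v x) \<bullet> q x))))" (is "pder _ ?g ?g'")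
      by (rule pder_eq, (rule I)+) (simp add: inner_commute algebra_simps)
    have c: "continuous_on UNIV ?f" "continuous_on UNIV ?f'" "continuous_on UNIV ?g" "continuous_on UNIV ?g'"
      by (intro cI)+
    have s: "?f x = 0" "?g x = 0" "D1 x = 0" if "x \<notin> S" for x
      using S(2)[OF that] by (simp_all add: D1_def)
    have id: "?f' x + ?g' x = D1 x" for x
      unfolding D1_def inner_add_right inner_scaleR_right gi by (rule id0)
    show "integrable lborel D1" "(LINT x|lborel. D1 x) = 0"
      using divergence_integral[OF 1 2 c s(1,2) id s(3)] by blast+
  qed
  have D2: "integrable lborel D2" "(LINT x|lborel. D2 x) = 0"
  proof -
    have 1: "pder (ax 1) (\<lambda>x. - 1 * (\<theta> x * \<theta> x * (p x \<bullet> c x))) (\<lambda>x. - 2 * \<theta> x * \<theta>1 x * (p x \<bullet> c x) - \<theta> x * \<theta> x * (a x \<bullet> c x + p x \<bullet> d x))" (is "pder _ ?f ?f'")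
      by (rule pder_eq, (rule I)+) (simp add: inner_commute algebra_simps)
    have 2: "pder (ax 2) (\<lambda>x. \<theta> x * \<theta> x * (p x \<bullet> b x)) (\<lambda>x. 2 * \<theta> x * \<theta>2 x * (p x \<bullet> b x) + \<theta> x * \<theta> x * (b x \<bullet> b x + p x \<bullet> d x))" (is "pder _ ?g ?g'")
      by (rule pder_eq, (rule I)+) (simp add: inner_commute algebra_simps)
    have c: "continuous_on UNIV ?f" "continuous_on UNIV ?f'" "continuous_on UNIV ?g" "continuous_on UNIV ?g'"
      by (intro cI)+
    have s: "?f x = 0" "?g x = 0" "D2 x = 0" if "x \<notin> S" for x
      using S(2)[OF that] by (simp_all add: D2_def)
    have id: "?f' x + ?g' x = D2 x" for x
      by (simp add: D2_def algebra_simps power2_eq_square)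
    show "integrable lborel D2" "(LINT x|lborel. D2 x) = 0"
      using divergence_integral[OF 1 2 c s(1,2) id s(3)] by blast+
  qed
  have D3: "integrable lborel D3" "(LINT x|lborel. D3 x) = 0"
  proof -
    have 1: "pder (ax 1) (\<lambda>x. \<theta> x * \<theta> x * (p x \<bullet> p x + q x \<bullet> q x) * (v x \<bullet> p x)) (\<lambda>x. 2 * \<theta> x * \<theta>1 x * (p x \<bullet> p x + q x \<bullet> q x) * (v x \<bullet> p x) + \<theta> x * \<theta> x * (2 * (a x \<bullet> p x + b x \<bullet> q x) * (v x \<bullet> p x) + (p x \<bullet> p x + q x \<bullet> q x) * (p x \<bullet> p x + v x \<bullet> a x)))" (is "pder _ ?f ?f'")
      by (rule pder_eq, (rule I)+) (simp add: inner_commute algebra_simps)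
    have 2: "pder (ax 2) (\<lambda>x. \<theta> x * \<theta> x * (p x \<bullet> p x + q x \<bullet> q x) * (v x \<bullet> q x)) (\<lambda>x. 2 * \<theta> x * \<theta>2 x * (p x \<bullet> p x + q x \<bullet> q x) * (v x \<bullet> q x) + \<theta> x * \<theta> x * (2 * (b x \<bullet> p x + c x \<bullet> q x) * (v x \<bullet> q x) + (p x \<bullet> p x + q x \<bullet> q x) * (q x \<bullet> q x + v x \<bullet> c x)))" (is "pder _ ?g ?g'")
      by (rule pder_eq, (rule I)+) (simp add: inner_commute algebra_simps)
    have c: "continuous_on UNIV ?f" "continuous_on UNIV ?f'" "continuous_on UNIV ?g" "continuous_on UNIV ?g'"
      by (intro cI)+
    have s: "?f x = 0" "?g x = 0" "D3 x = 0" if "x \<notin> S" for x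
      using S(2)[OF that] by (simp_all add: D3_def)
    have id: "?f' x + ?g' x = D3 x" for x
      unfolding D3_def N_def l_def inner_add_right by (simp add: algebra_simps power2_eq_square)
    show "integrable lborel D3" "(LINT x|lborel. D3 x) = 0"
      using divergence_integral[OF 1 2 c s(1,2) id s(3)] by blast+
  qed
  have D4: "integrable lborel D4" "(LINT x|lborel. D4 x) = 0"
  proof -
    have 1: "pder (ax 1) (\<lambda>x. \<theta> x * \<theta> x * (G (v x) \<bullet> p x)) (\<lambda>x. 2 * \<theta> x * \<theta>1 x * (G (v x) \<bullet> p x) + \<theta> x * \<theta> x * (HV (v x) (p x) \<bullet> p x + G (v x) \<bullet> a x))" (is "pder _ ?f ?f'")
      by (rule pder_eq, (rule I)+) (simp add: inner_commute algebra_simps)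
    have 2: "pder (ax 2) (\<lambda>x. \<theta> x * \<theta> x * (G (v x) \<bullet> q x)) (\<lambda>x. 2 * \<theta> x * \<theta>2 x * (G (v x) \<bullet> q x) + \<theta> x * \<theta> x * (HV (v x) (q x) \<bullet> q x + G (v x) \<bullet> c x))" (is "pder _ ?g ?g'")
      by (rule pder_eq, (rule I)+) (simp add: inner_commute algebra_simps)
    have c: "continuous_on UNIV ?f" "continuous_on UNIV ?f'" "continuous_on UNIV ?g" "continuous_on UNIV ?g'"
      by (intro cI)+
    have s: "?f x = 0" "?g x = 0" "D4 x = 0" if "x \<notin> S" for x
      using S(2)[OF that] by (simp_all add: D4_def)
    have id: "?f' x + ?g' x = D4 x" for x
      unfolding D4_def h_def l_def inner_add_right by (simp add: algebra_simps power2_eq_square)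
    show "integrable lborel D4" "(LINT x|lborel. D4 x) = 0"
      using divergence_integral[OF 1 2 c s(1,2) id s(3)] by blast+
  qed
  \<comment> \<open>Total coefficient of the potential after the other three eliminations: 100 times
    4 from the quartic and the Hessian inequality, \<open>C * (B + 1)\<close> from testing, and
    \<kappa> from the potential part of the energy itself.\<close>
  define A where "A = 400 * C\<^sup>2 * L\<^sup>2 + C * (B + 1) + \<kappa>"
  have A0: "0 \<le> A" using C0 B(2) c0 by (simp add: A_def)
  have N0: "0 \<le> N x" for x by (simp add: N_def)
  have e0: "0 \<le> e x" for x using \<epsilon> V0 by (simp add: e_def)
  have z0: "0 \<le> z x" for x by (simp add: z_def)
  define k where "k = energy_const \<kappa> C L R B"
  have k: "\<kappa> * k = 4 * A * R + 3232 * C * L\<^sup>2 + 400 * C * L\<^sup>2 + 2 * C + 3"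
    using c0 by (simp add: k_def energy_const_def A_def)
  \<comment> \<open>The weights record the elimination: 400 is the 4 of the Hessian inequality times
    the 100 of the quartic one, 2 is the factor of \<open>D3\<close> in the latter, and
    \<open>D1\<close> enters its inequality with a minus sign.\<close>
  define D where "D x = - A * D1 x + 400 * C * L\<^sup>2 * \<epsilon> ^ 3 * D2 x + 2 * C * \<epsilon> ^ 3 * D3 x + \<epsilon> * D4 x" for x
  have D: "integrable lborel D" "(LINT x|lborel. D x) = 0"
    unfolding D_def using D1 D2 D3 D4 by simp_all
  have pw: "\<kappa> * ((\<theta> x)\<^sup>2 * e x) \<le> D x + \<kappa> * k * (z x * e x + K * (\<theta> x * (g x \<bullet> g x)) + \<theta> x * N x / K)" for x
  proof (cases "x \<in> S")
    case False
    then have "\<theta> x = 0" "\<theta>1 x = 0" "\<theta>2 x = 0" using S(2) by auto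
    then have "D x = 0" "z x = 0" by (simp_all add: D_def D1_def D2_def D3_def D4_def z_def)
    then show ?thesis using \<open>\<theta> x = 0\<close> by simp
  next
    case True
    note vL = L[OF True]
    have L0: "0 \<le> L" using vL norm_ge_zero order_trans by blast
    have xR: "\<bar>x $ 1\<bar> \<le> R" "\<bar>x $ 2\<bar> \<le> R" using R(1)[OF True] component_le_norm_cart order_trans by blast+
    define X1 where "X1 = \<theta> x * V (v x) / \<epsilon>"
    define H where "H = a x \<bullet> a x + 2 * (b x \<bullet> b x) + c x \<bullet> c x"
    define ze where "ze = z x * e x"
    define gk where "gk = \<theta> x * (g x \<bullet> g x)"
    define nk where "nk = \<theta> x * N x / K"
    have e': "e x = \<epsilon> * N x / 2 + V (v x) / \<epsilon>" by (simp add: e_def N_def)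
    have nn: "0 \<le> X1" "0 \<le> ze" "0 \<le> gk" "0 \<le> nk" "0 \<le> H"
      using \<theta>(1) V0 \<epsilon> z0 e0 K N0 by (auto simp: X1_def ze_def gk_def nk_def H_def)
    have t2: "(\<theta> x)\<^sup>2 \<le> \<theta> x" using \<theta>[of x] by (simp add: power2_eq_square mult_left_le)
    have zN: "\<epsilon> ^ 3 * (z x * N x) \<le> 2 * ze"
    proof -
      have "\<epsilon> ^ 3 \<le> \<epsilon> ^ 1" using \<epsilon> by (intro power_decreasing) auto
      then have "\<epsilon> ^ 3 * (z x * N x) \<le> \<epsilon> * (z x * N x)" using z0 N0 by (intro mult_right_mono) auto
      also have "\<dots> = 2 * (z x * (\<epsilon> * N x / 2))" by simp
      also have "\<dots> \<le> 2 * ze" unfolding ze_def e' using V0 \<epsilon> z0 by (intro mult_left_mono) auto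
      finally show ?thesis .
    qed
    have 1: "X1 \<le> - D1 x + R * (K * gk + nk) + 4 * R * ze"
      using pohozaev_pointwise[of \<epsilon> "\<theta> x" "x$1" R "x$2" K "V (v x)" "D1 x" "g x" "p x" "q x" "\<theta>1 x" "\<theta>2 x" "N x" "z x"]
        \<epsilon> \<theta>(1) xR K V0 unfolding X1_def gk_def nk_def ze_def e' by (simp add: D1_def N_def z_def)
    have z12: "(\<theta>1 x)\<^sup>2 + (\<theta>2 x)\<^sup>2 \<le> z x" by (simp add: z_def)
    have 2: "\<epsilon> ^ 3 * ((\<theta> x)\<^sup>2 * H) \<le> 4 * C * X1 + 4 * gk + 4 * (\<epsilon> ^ 3 * D2 x) + 32 * ze"
    proof -
      have "(\<theta> x)\<^sup>2 * H \<le> 2 * ((\<theta> x)\<^sup>2 * (l x \<bullet> l x)) + 4 * D2 x + 16 * (z x * N x)"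
        unfolding H_def by (rule hessian_pointwise[OF D2_def l_def _ z12]) (simp add: N_def)
      then have "\<epsilon> ^ 3 * ((\<theta> x)\<^sup>2 * H) \<le> \<epsilon> ^ 3 * (2 * ((\<theta> x)\<^sup>2 * (l x \<bullet> l x)) + 4 * D2 x + 16 * (z x * N x))"
        using \<epsilon> by (intro mult_left_mono) auto
      also have "\<dots> = 2 * (\<epsilon> ^ 3 * ((\<theta> x)\<^sup>2 * (l x \<bullet> l x))) + 4 * (\<epsilon> ^ 3 * D2 x) + 16 * (\<epsilon> ^ 3 * (z x * N x))"
        by (simp add: algebra_simps)
      finally have A: "\<epsilon> ^ 3 * ((\<theta> x)\<^sup>2 * H) \<le> \<dots>" .
      have "l x \<bullet> l x \<le> 2 * (1 / \<epsilon>\<^sup>2)\<^sup>2 * (G (v x) \<bullet> G (v x)) + 2 * (g x \<bullet> g x)"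
        using inner_ge_zero[of "(1 / \<epsilon>\<^sup>2) *\<^sub>R G (v x) - g x"] unfolding lg
        by (simp add: inner_add inner_diff inner_commute power2_eq_square)
      also have "\<dots> \<le> 2 * (1 / \<epsilon>\<^sup>2)\<^sup>2 * (C * V (v x)) + 2 * (g x \<bullet> g x)"
        by (intro add_mono mult_left_mono GV vL) auto
      finally have "\<epsilon> ^ 3 * ((\<theta> x)\<^sup>2 * (l x \<bullet> l x)) \<le> \<epsilon> ^ 3 * ((\<theta> x)\<^sup>2 * (2 * (1 / \<epsilon>\<^sup>2)\<^sup>2 * (C * V (v x)) + 2 * (g x \<bullet> g x)))"
        using \<epsilon> by (intro mult_left_mono) auto
      also have "\<dots> = (\<theta> x)\<^sup>2 * (2 * C * V (v x) / \<epsilon> + 2 * (\<epsilon> ^ 3 * (g x \<bullet> g x)))"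
        using \<epsilon> by (simp add: field_simps power2_eq_square power3_eq_cube)
      also have "\<dots> \<le> \<theta> x * (2 * C * V (v x) / \<epsilon> + 2 * (1 * (g x \<bullet> g x)))"
        using \<epsilon> C0 V0 t2 \<theta>(1) by (intro mult_mono add_mono mult_left_mono mult_right_mono) (auto simp: power_le_one)
      also have "\<dots> = 2 * C * X1 + 2 * gk" by (simp add: X1_def gk_def algebra_simps)
      finally show ?thesis using A zN by linarith
    qed
    have 3: "\<epsilon> ^ 3 * ((\<theta> x)\<^sup>2 * (N x)\<^sup>2) \<le> 2 * (\<epsilon> ^ 3 * D3 x) + 100 * L\<^sup>2 * (\<epsilon> ^ 3 * ((\<theta> x)\<^sup>2 * H)) + 16 * L\<^sup>2 * (2 * ze)"
    proof -
      have "(\<theta> x)\<^sup>2 * (N x)\<^sup>2 \<le> 2 * D3 x + 100 * L\<^sup>2 * ((\<theta> x)\<^sup>2 * H) + 16 * L\<^sup>2 * (z x * N x)"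
        by (rule gradient4_pointwise[OF D3_def l_def _ vL z12 H_def]) (simp add: N_def)
      then have "\<epsilon> ^ 3 * ((\<theta> x)\<^sup>2 * (N x)\<^sup>2) \<le> \<epsilon> ^ 3 * (2 * D3 x + 100 * L\<^sup>2 * ((\<theta> x)\<^sup>2 * H) + 16 * L\<^sup>2 * (z x * N x))"
        using \<epsilon> by (intro mult_left_mono) auto
      also have "\<dots> = 2 * (\<epsilon> ^ 3 * D3 x) + 100 * L\<^sup>2 * (\<epsilon> ^ 3 * ((\<theta> x)\<^sup>2 * H)) + 16 * L\<^sup>2 * (\<epsilon> ^ 3 * (z x * N x))"
        by (simp add: algebra_simps)
      also have "\<dots> \<le> 2 * (\<epsilon> ^ 3 * D3 x) + 100 * L\<^sup>2 * (\<epsilon> ^ 3 * ((\<theta> x)\<^sup>2 * H)) + 16 * L\<^sup>2 * (2 * ze)"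
        by (intro add_left_mono mult_left_mono zN) simp
      finally show ?thesis .
    qed
    have 4: "\<kappa> * (\<epsilon> * ((\<theta> x)\<^sup>2 * N x)) \<le> \<epsilon> * D4 x + C * (\<epsilon> ^ 3 * ((\<theta> x)\<^sup>2 * (N x)\<^sup>2)) + C * (B + 1) * X1 + gk + (2 * C + 2) * ze"
      unfolding X1_def gk_def ze_def e'
    proof (rule test_pointwise[OF \<epsilon> \<theta> V0 B(1)[OF vL] D4_def lg _ GV[OF vL] _ C0])
      show "N x = p x \<bullet> p x + q x \<bullet> q x" by (simp add: N_def)
      show "\<kappa> * N x - C * V (v x) * N x \<le> h x"
        using HH[OF vL, of "p x"] HH[OF vL, of "q x"] by (simp add: N_def h_def algebra_simps)
    qed (simp add: z_def)
    have E: "\<kappa> * ((\<theta> x)\<^sup>2 * e x) \<le> \<kappa> * (\<epsilon> * ((\<theta> x)\<^sup>2 * N x)) + \<kappa> * X1"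
    proof -
      have "(\<theta> x)\<^sup>2 * e x = (\<epsilon> * ((\<theta> x)\<^sup>2 * N x)) / 2 + (\<theta> x)\<^sup>2 * (V (v x) / \<epsilon>)"
        by (simp add: e' distrib_left)
      moreover have "(\<theta> x)\<^sup>2 * (V (v x) / \<epsilon>) \<le> \<theta> x * (V (v x) / \<epsilon>)"
        using t2 V0 \<epsilon> by (intro mult_right_mono) auto
      moreover have "0 \<le> \<epsilon> * ((\<theta> x)\<^sup>2 * N x)" using \<epsilon> N0 by simp
      ultimately have "(\<theta> x)\<^sup>2 * e x \<le> \<epsilon> * ((\<theta> x)\<^sup>2 * N x) + X1" by (simp add: X1_def)
      from mult_left_mono[OF this, of \<kappa>] c0 show ?thesis by (simp add: distrib_left)
    qed
    have gK: "gk \<le> K * gk" using nn K by (simp add: mult_le_cancel_right1)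
    have "\<kappa> * ((\<theta> x)\<^sup>2 * e x) \<le> \<epsilon> * D4 x + C * (2 * (\<epsilon> ^ 3 * D3 x) + 100 * L\<^sup>2 * (4 * C * X1 + 4 * gk + 4 * (\<epsilon> ^ 3 * D2 x) + 32 * ze) + 16 * L\<^sup>2 * (2 * ze)) + C * (B + 1) * X1 + gk + (2 * C + 2) * ze + \<kappa> * X1"
    proof -
      have "C * (\<epsilon> ^ 3 * ((\<theta> x)\<^sup>2 * (N x)\<^sup>2)) \<le> C * (2 * (\<epsilon> ^ 3 * D3 x) + 100 * L\<^sup>2 * (\<epsilon> ^ 3 * ((\<theta> x)\<^sup>2 * H)) + 16 * L\<^sup>2 * (2 * ze))"
        by (rule mult_left_mono[OF 3 C0])
      also have "\<dots> \<le> C * (2 * (\<epsilon> ^ 3 * D3 x) + 100 * L\<^sup>2 * (4 * C * X1 + 4 * gk + 4 * (\<epsilon> ^ 3 * D2 x) + 32 * ze) + 16 * L\<^sup>2 * (2 * ze))"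
        using C0 by (intro mult_left_mono add_right_mono add_left_mono 2) auto
      finally show ?thesis using E 4 by linarith
    qed
    also have "\<dots> = A * X1 + (D x + A * D1 x) + (400 * C * L\<^sup>2 + 1) * gk + (3232 * C * L\<^sup>2 + 2 * C + 2) * ze"
      by (simp add: A_def D_def algebra_simps power2_eq_square)
    also have "A * X1 \<le> A * (- D1 x + R * (K * gk + nk) + 4 * R * ze)" by (rule mult_left_mono[OF 1 A0])
    also have "(400 * C * L\<^sup>2 + 1) * gk \<le> (400 * C * L\<^sup>2 + 1) * (K * gk)" using C0 gK by (intro mult_left_mono) auto
    finally have "\<kappa> * ((\<theta> x)\<^sup>2 * e x) \<le> D x + (A * R + 400 * C * L\<^sup>2 + 1) * (K * gk) + A * R * nk + (4 * A * R + 3232 * C * L\<^sup>2 + 2 * C + 2) * ze"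
      by (simp add: algebra_simps)
    also have "\<dots> \<le> D x + \<kappa> * k * (K * gk) + \<kappa> * k * nk + \<kappa> * k * ze"
    proof -
      have "0 \<le> A * R" "0 \<le> C * L\<^sup>2" using A0 R(2) C0 by auto
      then have "A * R + 400 * C * L\<^sup>2 + 1 \<le> \<kappa> * k" "A * R \<le> \<kappa> * k" "4 * A * R + 3232 * C * L\<^sup>2 + 2 * C + 2 \<le> \<kappa> * k"
        unfolding k mult.assoc using C0 by linarith+
      then show ?thesis using nn K by (intro add_mono mult_right_mono) auto
    qed
    finally show ?thesis unfolding gk_def nk_def ze_def by (simp add: algebra_simps)
  qed
  have cN: "continuous_on UNIV N" unfolding N_def by (intro cI)
  have ce: "continuous_on UNIV e" unfolding e_def using \<epsilon> by (intro cI) auto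
  have cg: "continuous_on UNIV g" unfolding g_def by (intro cI)
  have cz: "continuous_on UNIV z" unfolding z_def by (intro cI)
  note int = integrable_continuous_compact_support[OF _ S(1)]
  have i: "integrable lborel (\<lambda>x. (\<theta> x)\<^sup>2 * e x)" "integrable lborel (\<lambda>x. z x * e x)"
    "integrable lborel (\<lambda>x. \<theta> x * (g x \<bullet> g x))" "integrable lborel (\<lambda>x. \<theta> x * N x)"
    by (rule int; use S(2) in \<open>(intro cI cN ce cg cz)?; simp add: z_def\<close>)+
  have "\<kappa> * (LINT x|lborel. (\<theta> x)\<^sup>2 * e x) = (LINT x|lborel. \<kappa> * ((\<theta> x)\<^sup>2 * e x))" by simp
  also have "\<dots> \<le> (LINT x|lborel. D x + \<kappa> * k * (z x * e x + K * (\<theta> x * (g x \<bullet> g x)) + \<theta> x * N x / K))"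
    using i D pw by (intro integral_mono) auto
  also have "\<dots> = \<kappa> * (k * ((LINT x|lborel. z x * e x) + K * (LINT x|lborel. \<theta> x * (g x \<bullet> g x)) + (LINT x|lborel. \<theta> x * N x) / K))"
    using i D by simp
  finally show ?thesis using c0 by (simp add: k_def)
qed

end

section \<open>Multi-well potentials\<close>

lemma smooth_on_differentiable: "smooth_on UNIV f \<Longrightarrow> f differentiable (at x)"
  unfolding smooth_on_def by (metis Ck_on.simps(2) UNIV_I)

lemma smooth_on_has_derivative: "smooth_on UNIV f \<Longrightarrow> (f has_derivative frechet_derivative f (at x)) (at x)"
  using smooth_on_differentiable frechet_derivative_works by blast

lemma smooth_on_continuous: "smooth_on UNIV f \<Longrightarrow> continuous_on UNIV f"
  unfolding smooth_on_def by (metis Ck_on.simps(1))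

lemma smooth_on_directional: "smooth_on UNIV f \<Longrightarrow> smooth_on UNIV (\<lambda>x. frechet_derivative f (at x) v)"
  unfolding smooth_on_def by (metis Ck_on.simps(2))

lemma frechet_derivative_eq_grad:
  fixes f :: "real^'m \<Rightarrow> real"
  assumes "f differentiable (at x)"
  shows "frechet_derivative f (at x) h = grad f x \<bullet> h"
proof -
  have lin: "linear (frechet_derivative f (at x))"
    using assms by (rule linear_frechet_derivative)
  have h: "h = (\<Sum>j\<in>UNIV. h $ j *\<^sub>R axis j 1)"
    by (simp add: vec_eq_iff axis_def if_distrib cong: if_cong)
  have "frechet_derivative f (at x) h = (\<Sum>j\<in>UNIV. h $ j * frechet_derivative f (at x) (axis j 1))"
    by (subst h) (simp add: linear_sum[OF lin] linear_cmul[OF lin])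
  then show ?thesis by (simp add: grad_def inner_vec_def mult.commute)
qed

lemma smooth_on_grad_component:
  fixes f :: "real^'m \<Rightarrow> real"
  shows "smooth_on UNIV f \<Longrightarrow> smooth_on UNIV (\<lambda>y. grad f y $ i)"
  by (simp add: grad_def smooth_on_directional)

lemma has_derivative_grad:
  fixes f :: "real^'m \<Rightarrow> real"
  assumes "smooth_on UNIV f"
  shows "(f has_derivative (\<lambda>h. grad f y \<bullet> h)) (at y)"
proof -
  have "frechet_derivative f (at y) = (\<lambda>h. grad f y \<bullet> h)"
    by (rule ext) (rule frechet_derivative_eq_grad[OF smooth_on_differentiable[OF assms]])
  then show ?thesis using smooth_on_has_derivative[OF assms, of y] by simp
qed

lemma has_derivative_hessian:
  fixes f :: "real^'m \<Rightarrow> real"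
  assumes "smooth_on UNIV f"
  shows "(grad f has_derivative (\<lambda>h. hessian f y *v h)) (at y)"
proof -
  have "((\<lambda>y. grad f y $ i) has_derivative (\<lambda>h. (hessian f y *v h) $ i)) (at y)" for i
  proof -
    have "(hessian f y *v h) $ i = grad (\<lambda>y. grad f y $ i) y \<bullet> h" for h
      by (simp add: hessian_def matrix_vector_mult_def inner_vec_def)
    then show ?thesis using has_derivative_grad[OF smooth_on_grad_component[OF assms, of i], of y] by simp
  qed
  then show ?thesis
    by (subst has_derivative_componentwise_within) (auto simp: Basis_vec_def inner_axis)
qed

lemma continuous_hessian:
  fixes f :: "real^'m \<Rightarrow> real"
  assumes "smooth_on UNIV f"
  shows "continuous_on UNIV (\<lambda>z. hessian f (fst z) *v snd z)"
proof -
  have "continuous_on UNIV (\<lambda>y. hessian f y $ i $ j)" for i j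
    unfolding hessian_def
    using smooth_on_continuous[OF smooth_on_grad_component[OF smooth_on_grad_component[OF assms, of i], of j]] by simp
  then have 1: "continuous_on UNIV (\<lambda>z::(real^'m)\<times>(real^'m). hessian f (fst z) $ i $ j)" for i j
    by (rule continuous_on_compose2) (auto intro: continuous_intros)
  show ?thesis
    unfolding matrix_vector_mult_def
    by (intro continuous_on_vec_lambda continuous_on_sum continuous_on_mult 1 continuous_on_component continuous_on_snd continuous_on_id)
qed

lemma multiwell_nonneg: "multiwell_potential V \<Longrightarrow> 0 \<le> V y"
  unfolding multiwell_potential_def by (metis cINF_lower UNIV_I)

text \<open>A nonnegative function with bounded Hessian dominates its squared gradient up to a
  constant: one step of gradient descent would otherwise make it negative.\<close>

lemma multiwell_gradient_bound:
  fixes V :: "real^'k \<Rightarrow> real"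
  assumes sm: "smooth_on UNIV V" and nn: "\<And>y. 0 \<le> V y"
  obtains C where "0 \<le> C" "\<And>y. norm y \<le> L \<Longrightarrow> grad V y \<bullet> grad V y \<le> C * V y"
proof -
  have cg: "continuous_on UNIV (grad V)"
    using has_derivative_hessian[OF sm] by (auto intro!: continuous_at_imp_continuous_on has_derivative_continuous)
  have "bounded (grad V ` cball 0 L)"
    using cg by (intro compact_imp_bounded compact_continuous_image) (auto intro: continuous_on_subset)
  then obtain M where M: "M > 0" "\<And>y. norm y \<le> L \<Longrightarrow> norm (grad V y) \<le> M"
    unfolding bounded_pos by auto
  \<comment> \<open>Contains every point reached from the ball of radius \<open>L\<close> by a
    descent step of length at most \<open>M\<close>.\<close>
  define S where "S = cball (0::real^'k) (L + M)"
  have "compact ((\<lambda>z. hessian V (fst z) *v snd z) ` (S \<times> sphere 0 1))"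
    using continuous_hessian[OF sm] by (intro compact_continuous_image compact_Times) (auto simp: S_def intro: continuous_on_subset)
  then have "bounded ((\<lambda>z. hessian V (fst z) *v snd z) ` (S \<times> sphere 0 1))" by (rule compact_imp_bounded)
  then obtain \<Lambda> where \<Lambda>: "\<Lambda> > 0" "\<And>y w. y \<in> S \<Longrightarrow> norm w = 1 \<Longrightarrow> norm (hessian V y *v w) \<le> \<Lambda>"
    unfolding bounded_pos by force
  have on: "onorm (\<lambda>h. hessian V y *v h) \<le> \<Lambda>" if "y \<in> S" for y
  proof (rule onorm_le)
    fix h :: "real^'k"
    show "norm (hessian V y *v h) \<le> \<Lambda> * norm h"
    proof (cases "h = 0")
      case False
      have "hessian V y *v h = norm h *\<^sub>R (hessian V y *v ((1 / norm h) *\<^sub>R h))"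
        using False by (simp add: matrix_vector_mult_scaleR)
      then have "norm (hessian V y *v h) = norm h * norm (hessian V y *v ((1 / norm h) *\<^sub>R h))" by (metis abs_norm_cancel norm_scaleR)
      also have "\<dots> \<le> norm h * \<Lambda>" using False by (intro mult_left_mono \<Lambda>(2)[OF that]) auto
      finally show ?thesis by (simp add: mult.commute)
    qed simp
  qed
  have lip: "norm (grad V x - grad V y) \<le> \<Lambda> * norm (x - y)" if "x \<in> S" "y \<in> S" for x y
    by (rule differentiable_bound[of S "grad V" "\<lambda>y h. hessian V y *v h"])
      (use that on has_derivative_hessian[OF sm] in \<open>auto simp: S_def intro: has_derivative_at_withinI\<close>)
  \<comment> \<open>A step factor of at most 1 stays in \<open>S\<close>; at most 1 / (2 \<Lambda>),
    it changes the gradient by no more than half of its norm.\<close>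
  define s where "s = min 1 (1 / (2 * \<Lambda>))"
  have s: "0 < s" "s \<le> 1" "s * \<Lambda> \<le> 1 / 2" using \<Lambda>(1) by (auto simp: s_def min_def field_simps)
  have "grad V y \<bullet> grad V y \<le> (2 / s) * V y" if y: "norm y \<le> L" for y
  proof -
    let ?g = "grad V y"
    define \<phi> where "\<phi> t = V (y - t *\<^sub>R ?g)" for t
    have d: "(\<phi> has_real_derivative - (grad V (y - t *\<^sub>R ?g) \<bullet> ?g)) (at t)" for t
    proof -
      have 1: "((\<lambda>t. y - t *\<^sub>R ?g) has_derivative (\<lambda>h. - h *\<^sub>R ?g)) (at t)"
        by (auto intro!: derivative_eq_intros)
      have "(\<phi> has_derivative (\<lambda>h. grad V (y - t *\<^sub>R ?g) \<bullet> (- h *\<^sub>R ?g))) (at t)"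
        unfolding \<phi>_def using has_derivative_compose[OF 1 has_derivative_grad[OF sm, of "y - t *\<^sub>R ?g"]] by simp
      moreover have "(\<lambda>h. grad V (y - t *\<^sub>R ?g) \<bullet> (- h *\<^sub>R ?g)) = (*) (- (grad V (y - t *\<^sub>R ?g) \<bullet> ?g))"
        by (auto simp: fun_eq_iff)
      ultimately show ?thesis by (simp add: has_field_derivative_def)
    qed
    obtain t where t: "0 < t" "t < s" "\<phi> s - \<phi> 0 = (s - 0) * (- (grad V (y - t *\<^sub>R ?g) \<bullet> ?g))"
      using MVT2[of 0 s \<phi> "\<lambda>t. - (grad V (y - t *\<^sub>R ?g) \<bullet> ?g)"] d s by auto
    have inS: "y \<in> S" "y - t *\<^sub>R ?g \<in> S"
    proof -
      have "norm (t *\<^sub>R ?g) \<le> 1 * M" unfolding norm_scaleR using t s M(2)[OF y] by (intro mult_mono) auto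
      then show "y \<in> S" "y - t *\<^sub>R ?g \<in> S"
        using y M(1) norm_triangle_ineq4[of y "t *\<^sub>R ?g"] by (auto simp: S_def)
    qed
    have "\<bar>(grad V (y - t *\<^sub>R ?g) - ?g) \<bullet> ?g\<bar> \<le> norm (grad V (y - t *\<^sub>R ?g) - ?g) * norm ?g"
      by (rule Cauchy_Schwarz_ineq2)
    also have "\<dots> \<le> (\<Lambda> * norm (t *\<^sub>R ?g)) * norm ?g"
      using lip[OF inS(2,1)] by (intro mult_right_mono) auto
    also have "\<dots> = (t * \<Lambda>) * (?g \<bullet> ?g)" using t by (simp add: power2_norm_eq_inner[symmetric] power2_eq_square)
    also have "\<dots> \<le> 1 / 2 * (?g \<bullet> ?g)"
    proof (rule mult_right_mono)
      have "t * \<Lambda> \<le> s * \<Lambda>" using t \<Lambda>(1) by (intro mult_right_mono) auto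
      then show "t * \<Lambda> \<le> 1 / 2" using s by linarith
    qed simp
    finally have "grad V (y - t *\<^sub>R ?g) \<bullet> ?g \<ge> (?g \<bullet> ?g) / 2" unfolding inner_diff_left by linarith
    then have "s * ((?g \<bullet> ?g) / 2) \<le> s * (grad V (y - t *\<^sub>R ?g) \<bullet> ?g)" using s by (intro mult_left_mono) auto
    also have "\<dots> = \<phi> 0 - \<phi> s" using t(3) by (simp add: algebra_simps)
    also have "\<dots> \<le> V y" using nn by (simp add: \<phi>_def)
    finally show ?thesis using s by (simp add: field_simps)
  qed
  then show ?thesis using that[of "2 / s"] s by simp
qed

text \<open>Compactness: if the bound failed for \<kappa> = 1 / (n + 1) and C = n for every n, a
  limit of counterexamples in the ball times the unit sphere would be a zero of \<open>V\<close>
  with a direction of nonpositive curvature, against positive definiteness. The error term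
  \<open>C * V y\<close> spares a case distinction between points near the wells and away from
  them.\<close>

lemma multiwell_hessian_bound:
  fixes V :: "real^'k \<Rightarrow> real"
  assumes sm: "smooth_on UNIV V" and nn: "\<And>y. 0 \<le> V y"
    and pos: "\<And>\<sigma>. V \<sigma> = 0 \<Longrightarrow> positive_definite (hessian V \<sigma>)"
  obtains \<kappa> C where "0 < \<kappa>" "0 \<le> C"
    "\<And>y w. norm y \<le> L \<Longrightarrow> (hessian V y *v w) \<bullet> w \<ge> \<kappa> * (w \<bullet> w) - C * V y * (w \<bullet> w)"
proof -
  define Q where "Q z = (hessian V (fst z) *v snd z) \<bullet> snd z" for z :: "(real^'k) \<times> (real^'k)"
  have cQ: "continuous_on UNIV Q" unfolding Q_def by (intro continuous_intros continuous_hessian sm)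
  have cV: "continuous_on UNIV (\<lambda>z::(real^'k) \<times> (real^'k). V (fst z))"
    by (rule continuous_on_compose2[OF smooth_on_continuous[OF sm]]) (auto intro: continuous_intros)
  define P where "P = cball (0::real^'k) L \<times> sphere (0::real^'k) 1"
  have P: "compact P" unfolding P_def by (intro compact_Times) auto
  have "\<exists>n::nat. \<forall>z\<in>P. Q z \<ge> 1 / real (Suc n) - real n * V (fst z)"
  proof (rule ccontr)
    assume "\<not> ?thesis"
    then have "\<forall>n. \<exists>z\<in>P. Q z < 1 / real (Suc n) - real n * V (fst z)" by (auto simp: not_le)
    then obtain z where z: "\<And>n::nat. z n \<in> P" "\<And>n. Q (z n) < 1 / real (Suc n) - real n * V (fst (z n))" by metis
    obtain l r where l: "l \<in> P" "strict_mono r" "(z \<circ> r) \<longlonglongrightarrow> l"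
      using P z(1) unfolding compact_def by blast
    have lim: "(\<lambda>n. f (z (r n))) \<longlonglongrightarrow> f l" if "continuous_on UNIV f" for f :: "_ \<Rightarrow> real"
      using isCont_tendsto_compose[of l f "\<lambda>n. z (r n)" sequentially] that l(3) unfolding o_def
      by (cases l) (simp add: continuous_on_eq_continuous_at)
    have Ql: "(\<lambda>n. Q (z (r n))) \<longlonglongrightarrow> Q l" and Vl: "(\<lambda>n. V (fst (z (r n)))) \<longlonglongrightarrow> V (fst l)"
      using lim cQ cV by blast+
    have i0: "(\<lambda>n. 1 / real (Suc (r n))) \<longlonglongrightarrow> 0"
      using LIMSEQ_subseq_LIMSEQ[OF LIMSEQ_inverse_real_of_nat l(2)] by (simp add: o_def inverse_eq_divide)
    have "Q l \<le> 0"
    proof (rule LIMSEQ_le[OF Ql i0])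
      have "Q (z (r n)) \<le> 1 / real (Suc (r n))" for n
        proof -
        have "0 \<le> real (r n) * V (fst (z (r n)))" using nn by simp
        then show ?thesis using z(2)[of "r n"] by linarith
      qed
      then show "\<exists>N. \<forall>n\<ge>N. Q (z (r n)) \<le> 1 / real (Suc (r n))" by blast
    qed
    moreover have "V (fst l) = 0"
    proof -
      \<comment> \<open>Dividing the failed inequality by n + 1 shows that the potential at the
        counterexamples tends to 0, since the quadratic form converges along the
        subsequence.\<close>
      have "(\<lambda>n. inverse (real (Suc (r n))) * (2 - Q (z (r n)) + V (fst (z (r n))))) \<longlonglongrightarrow> 0 * (2 - Q l + V (fst l))"
        by (intro tendsto_intros Ql Vl LIMSEQ_subseq_LIMSEQ[OF LIMSEQ_inverse_real_of_nat l(2), unfolded o_def])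
      moreover have "V (fst (z (r n))) \<le> inverse (real (Suc (r n))) * (2 - Q (z (r n)) + V (fst (z (r n))))" for n
      proof -
        have "real (Suc (r n)) * V (fst (z (r n))) = real (r n) * V (fst (z (r n))) + V (fst (z (r n)))" by (simp add: algebra_simps)
        also have "\<dots> \<le> 1 / real (Suc (r n)) - Q (z (r n)) + V (fst (z (r n)))" using z(2)[of "r n"] by linarith
        also have "\<dots> \<le> 2 - Q (z (r n)) + V (fst (z (r n)))" by (simp add: field_simps)
        finally show ?thesis by (simp add: field_simps)
      qed
      ultimately have "V (fst l) \<le> 0 * (2 - Q l + V (fst l))"
        using LIMSEQ_le[OF Vl] by blast
      then show ?thesis using nn[of "fst l"] by simp
    qed
    moreover have "snd l \<noteq> 0" using l(1) by (auto simp: P_def)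
    ultimately show False using pos[of "fst l"] by (auto simp: positive_definite_def Q_def inner_commute)
  qed
  then obtain n :: nat where n: "\<And>z. z \<in> P \<Longrightarrow> Q z \<ge> 1 / real (Suc n) - real n * V (fst z)" by blast
  show ?thesis
  proof (rule that[of "1 / real (Suc n)" "real n"])
    fix y w :: "real^'k" assume y: "norm y \<le> L"
    show "1 / real (Suc n) * (w \<bullet> w) - real n * V y * (w \<bullet> w) \<le> (hessian V y *v w) \<bullet> w"
    proof (cases "w = 0")
      case False
      define w' where "w' = (1 / norm w) *\<^sub>R w"
      have w: "w = norm w *\<^sub>R w'" "norm w' = 1" using False by (auto simp: w'_def)
      have "Q (y, w') \<ge> 1 / real (Suc n) - real n * V y" using n[of "(y, w')"] y w by (simp add: P_def)
      then have "(1 / real (Suc n) - real n * V y) * (norm w)\<^sup>2 \<le> Q (y, w') * (norm w)\<^sup>2" by (intro mult_right_mono) auto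
      also have "Q (y, w') * (norm w)\<^sup>2 = (hessian V y *v (norm w *\<^sub>R w')) \<bullet> (norm w *\<^sub>R w')"
        by (simp add: Q_def matrix_vector_mult_scaleR power2_eq_square)
      finally show ?thesis using w(1) by (simp add: power2_norm_eq_inner algebra_simps)
    qed simp
  qed auto
qed

text \<open>Integrating the radial derivative outside the ball of radius \<open>R\<close> gives
  linear growth of \<open>V\<close>. The sign condition makes the excess of a solution subharmonic;
  the growth condition bounds its integral by the energy.\<close>

lemma multiwell_coercive:
  fixes V :: "real^'k \<Rightarrow> real"
  assumes "multiwell_potential V"
  obtains R C where "0 < R" "0 < C" "\<And>y. norm y > R \<Longrightarrow> 0 \<le> y \<bullet> grad V y" "\<And>y. norm y \<le> R + C * V y"
proof -
  have sm: "smooth_on UNIV V" using assms by (simp add: multiwell_potential_def)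
  obtain \<alpha> R where aR: "\<alpha> > 0" "R > 0" "\<And>y. norm y > R \<Longrightarrow> y \<bullet> grad V y \<ge> \<alpha> * (norm y)\<^sup>2"
    using assms unfolding multiwell_potential_def by blast
  show ?thesis
  proof (rule that[of R "1 / (\<alpha> * R)"])
    fix y :: "real^'k"
    show "norm y > R \<Longrightarrow> 0 \<le> y \<bullet> grad V y"
      using aR(1) aR(3)[of y] by (meson less_imp_le mult_nonneg_nonneg order_trans zero_le_power2)
    show "norm y \<le> R + 1 / (\<alpha> * R) * V y"
    proof (cases "norm y > R")
      case True
      define w where "w = (1 / norm y) *\<^sub>R y"
      have w: "norm w = 1" "norm y *\<^sub>R w = y" using True aR(2) by (auto simp: w_def)
      have d: "((\<lambda>t. V (t *\<^sub>R w)) has_real_derivative grad V (t *\<^sub>R w) \<bullet> w) (at t)" for t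
      proof -
        have 1: "((\<lambda>t. t *\<^sub>R w) has_derivative (\<lambda>h. h *\<^sub>R w)) (at t)"
          by (auto intro!: derivative_eq_intros)
        show ?thesis
          using has_derivative_compose[OF 1 has_derivative_grad[OF sm, of "t *\<^sub>R w"]]
          by (simp add: has_field_derivative_def mult_commute_abs)
      qed
      obtain t where t: "R < t" "t < norm y" "V (norm y *\<^sub>R w) - V (R *\<^sub>R w) = (norm y - R) * (grad V (t *\<^sub>R w) \<bullet> w)"
        using MVT2[of R "norm y" "\<lambda>t. V (t *\<^sub>R w)" "\<lambda>t. grad V (t *\<^sub>R w) \<bullet> w"] d True by auto
      have t0: "t > 0" using t aR by linarith
      have "\<alpha> * t\<^sup>2 \<le> t * (w \<bullet> grad V (t *\<^sub>R w))"
        using aR(3)[of "t *\<^sub>R w"] t t0 w by simp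
      then have "\<alpha> * t \<le> w \<bullet> grad V (t *\<^sub>R w)" using t0 by (simp add: power2_eq_square)
      moreover have "\<alpha> * R \<le> \<alpha> * t" using t aR by simp
      ultimately have "\<alpha> * R \<le> grad V (t *\<^sub>R w) \<bullet> w" by (simp add: inner_commute)
      then have "(norm y - R) * (\<alpha> * R) \<le> V (norm y *\<^sub>R w) - V (R *\<^sub>R w)"
        unfolding t(3) using True by (intro mult_left_mono) auto
      also have "\<dots> \<le> V y" using multiwell_nonneg[OF assms] w by simp
      finally show ?thesis using aR by (simp add: field_simps)
    next
      case False
      then show ?thesis using aR multiwell_nonneg[OF assms, of y] by (simp add: add_increasing2)
    qed
  qed (use aR in auto)
qed

section \<open>Sets carrying a measure with linear lower density\<close>

text \<open>Otherwise \<open>\<phi>\<close> decreases along every short step to the left of any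
  point, so the set where it is at most \<open>\<phi> b\<close> extends down to \<open>a\<close>;
  the increase of \<open>m\<close> over the interval would then be at least
  \<open>C * (b - a)\<close>.\<close>

lemma exists_finite_left_difference_quotient:
  fixes m :: "real \<Rightarrow> real"
  assumes ab: "a < b" and mono: "\<And>s t. a \<le> s \<Longrightarrow> s \<le> t \<Longrightarrow> t \<le> b \<Longrightarrow> m s \<le> m t"
  obtains \<rho> C where "a < \<rho>" "\<rho> \<le> b" "\<And>h0. 0 < h0 \<Longrightarrow> \<exists>h. 0 < h \<and> h < h0 \<and> m \<rho> - m (\<rho> - h) \<le> C * h"
proof -
  \<comment> \<open>The summand 1 makes \<open>C\<close> exceed the mean slope strictly.\<close>
  define C where "C = (m b - m a + 1) / (b - a)"
  define \<phi> where "\<phi> t = m t - C * t" for t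
  have "\<exists>\<rho>. a < \<rho> \<and> \<rho> \<le> b \<and> (\<forall>h0>0. \<exists>h. 0 < h \<and> h < h0 \<and> m \<rho> - m (\<rho> - h) \<le> C * h)"
  proof (rule ccontr)
    assume "\<not> ?thesis"
    then have neg: "\<exists>h0>0. \<forall>h. 0 < h \<longrightarrow> h < h0 \<longrightarrow> m \<rho> - m (\<rho> - h) > C * h" if "a < \<rho>" "\<rho> \<le> b" for \<rho>
      using that by (metis not_le)
    define T where "T = {t. a \<le> t \<and> t \<le> b \<and> \<phi> t \<le> \<phi> b}"
    have bT: "b \<in> T" using ab by (simp add: T_def)
    have bdd: "bdd_below T" by (auto simp: T_def bdd_below_def)
    define s where "s = Inf T"
    have s: "a \<le> s" "s \<le> b" 
      unfolding s_def by (rule cInf_greatest, use bT in blast, simp add: T_def) (rule cInf_lower[OF bT bdd])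
    have C0: "C > 0" using ab mono[of a b] by (simp add: C_def)
    \<comment> \<open>The infimum belongs to \<open>T\<close>: as \<open>m\<close> is nondecreasing,
      \<open>\<phi>\<close> exceeds its value at a later point by at most \<open>C\<close> times the
      distance.\<close>
    have "\<phi> s \<le> \<phi> b"
    proof (rule field_le_epsilon)
      fix e :: real assume "e > 0"
      then have "s < s + e / C" using C0 by simp
      then obtain t where t: "t \<in> T" "t < s + e / C"
        using cInf_lessD[of T "s + e / C"] bT by (auto simp: s_def)
      have "s \<le> t" using t bdd by (simp add: s_def cInf_lower)
      then have "m s \<le> m t" using s t by (intro mono) (auto simp: T_def)
      then have "\<phi> s \<le> \<phi> t + C * (t - s)" by (simp add: \<phi>_def algebra_simps)
      also have "C * (t - s) \<le> e" using t(2) C0 by (simp add: field_simps)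
      finally show "\<phi> s \<le> \<phi> b + e" using t by (simp add: T_def)
    qed
    have "s = a"
    proof (rule ccontr)
      assume "s \<noteq> a"
      then have "a < s" using s by simp
      then obtain h0 where h0: "h0 > 0" "\<And>h. 0 < h \<Longrightarrow> h < h0 \<Longrightarrow> m s - m (s - h) > C * h"
        using neg s by meson
      define h where "h = min (h0 / 2) (s - a)"
      have h: "0 < h" "h < h0" "h \<le> s - a" using h0 \<open>a < s\<close> by (auto simp: h_def)
      have "\<phi> (s - h) < \<phi> s" using h0(2)[OF h(1,2)] by (simp add: \<phi>_def algebra_simps)
      then have "s - h \<in> T" using h s \<open>\<phi> s \<le> \<phi> b\<close> by (auto simp: T_def)
      then show False using bdd cInf_lower[of "s - h" T] h by (simp add: s_def)
    qed
    then have "C * (b - a) \<le> m b - m a" using \<open>\<phi> s \<le> \<phi> b\<close> by (simp add: \<phi>_def algebra_simps)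
    then show False using ab by (simp add: C_def)
  qed
  then show ?thesis using that by blast
qed

lemma finite_disjoint_compact_separated:
  fixes F :: "'a::heine_borel set set"
  assumes "finite F" "\<And>A. A \<in> F \<Longrightarrow> compact A" "\<And>A B. A \<in> F \<Longrightarrow> B \<in> F \<Longrightarrow> A \<noteq> B \<Longrightarrow> A \<inter> B = {}"
  obtains d where "0 < d" "\<And>A B x y. A \<in> F \<Longrightarrow> B \<in> F \<Longrightarrow> A \<noteq> B \<Longrightarrow> x \<in> A \<Longrightarrow> y \<in> B \<Longrightarrow> d \<le> dist x y"
proof -
  have "\<exists>d>0. \<forall>x\<in>A. \<forall>y\<in>B. d \<le> dist x y" if "A \<in> F" "B \<in> F" "A \<noteq> B" for A B
    using separate_compact_closed[of A B] assms that by (meson compact_imp_closed)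
  then have sep: "\<And>A B. A \<in> F \<Longrightarrow> B \<in> F \<Longrightarrow> A \<noteq> B \<Longrightarrow> \<exists>d>0. \<forall>x\<in>A. \<forall>y\<in>B. d \<le> dist x y" .
  define I where "I = {P \<in> F \<times> F. fst P \<noteq> snd P}"
  have "\<exists>d>0. \<forall>x\<in>fst P. \<forall>y\<in>snd P. d \<le> dist x y" if "P \<in> I" for P
    by (rule sep) (use that in \<open>auto simp: I_def\<close>)
  then obtain d where d: "\<And>P. P \<in> I \<Longrightarrow> 0 < d P" "\<And>P x y. P \<in> I \<Longrightarrow> x \<in> fst P \<Longrightarrow> y \<in> snd P \<Longrightarrow> d P \<le> dist x y"
    by metis
  have fin: "finite I" unfolding I_def using assms(1) by simp
  show ?thesis
  proof (rule that[of "Min (insert 1 (d ` I))"])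
    show "0 < Min (insert 1 (d ` I))" using fin d(1) by (subst Min_gr_iff) simp_all
    fix A B x y assume *: "A \<in> F" "B \<in> F" "A \<noteq> B" "x \<in> A" "y \<in> B"
    then have AB: "(A, B) \<in> I" by (simp add: I_def)
    then have "Min (insert 1 (d ` I)) \<le> d (A, B)" using fin by (intro Min_le) simp_all
    also have "\<dots> \<le> dist x y" using d(2)[OF AB] * by simp
    finally show "Min (insert 1 (d ` I)) \<le> dist x y" .
  qed
qed

text \<open>A chain with the least number of steps admits no shortcut, so points that are not
  neighbours in it are at distance at least \<open>e\<close>. This separation turns the length of
  the chain into a number of disjoint balls.\<close>

lemma connected_chain:
  fixes C :: "'a::metric_space set"
  assumes "connected C" "x \<in> C" "y \<in> C" "0 < e"
  obtains m z where "z 0 = x" "z m = y" "\<And>i. i \<le> m \<Longrightarrow> z i \<in> C"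
    "\<And>i. i < m \<Longrightarrow> dist (z i) (z (Suc i)) < e"
    "\<And>i j. i + 2 \<le> j \<Longrightarrow> j \<le> m \<Longrightarrow> e \<le> dist (z i) (z j)"
proof -
  define R where "R = {(a, b). a \<in> C \<and> b \<in> C \<and> dist a b < e}"
  have "(x, y) \<in> R\<^sup>*"
  proof (rule connected_equivalence_relation[OF assms(1,2,3), of "\<lambda>a b. (a, b) \<in> R\<^sup>*"])
    have "sym R" by (auto simp: R_def sym_def dist_commute)
    then show "(b, a) \<in> R\<^sup>*" if "(a, b) \<in> R\<^sup>*" for a b using that by (metis sym_rtrancl symD)
    show "(a, c) \<in> R\<^sup>*" if "(a, b) \<in> R\<^sup>*" "(b, c) \<in> R\<^sup>*" for a b c using that by (rule rtrancl_trans)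
    show "\<exists>T. openin (top_of_set C) T \<and> a \<in> T \<and> (\<forall>x\<in>T. (a, x) \<in> R\<^sup>*)" if "a \<in> C" for a
    proof (intro exI conjI ballI)
      show "openin (top_of_set C) (C \<inter> ball a e)" by (intro openin_open_Int open_ball)
      show "a \<in> C \<inter> ball a e" using that assms by simp
      show "(a, w) \<in> R\<^sup>*" if "w \<in> C \<inter> ball a e" for w
        using that \<open>a \<in> C\<close> by (intro r_into_rtrancl) (simp add: R_def)
    qed
  qed
  then have ex: "\<exists>n. (x, y) \<in> R ^^ n" by (simp add: rtrancl_power)
  define m where "m = (LEAST n. (x, y) \<in> R ^^ n)"
  have "(x, y) \<in> R ^^ m" unfolding m_def using ex by (rule LeastI_ex)
  then obtain z where z: "z 0 = x" "z m = y" "\<And>i. i < m \<Longrightarrow> (z i, z (Suc i)) \<in> R"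
    by (auto simp: relpow_fun_conv)
  have zC: "z i \<in> C" if "i \<le> m" for i
  proof (cases i)
    case 0 then show ?thesis using z assms by simp
  next
    case (Suc k) then show ?thesis using z(3)[of k] that by (simp add: R_def)
  qed
  have seg: "(z i, z (i + k)) \<in> R ^^ k" if "i + k \<le> m" for i k
    unfolding relpow_fun_conv using that z(3) by (intro exI[of _ "\<lambda>l. z (i + l)"]) simp
  show ?thesis
  proof (rule that[of z m])
    show "dist (z i) (z (Suc i)) < e" if "i < m" for i using z(3)[OF that] by (simp add: R_def)
    fix i j assume ij: "i + 2 \<le> j" "j \<le> m"
    show "e \<le> dist (z i) (z j)"
    proof (rule ccontr)
      assume "\<not> ?thesis"
      then have "(z i, z j) \<in> R" using ij zC by (simp add: R_def)
      moreover have "(x, z i) \<in> R ^^ i" using seg[of 0 i] ij z by simp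
      ultimately have "(x, z j) \<in> R ^^ Suc i" by auto
      moreover have "(z j, y) \<in> R ^^ (m - j)" using seg[of j "m - j"] ij z by simp
      ultimately have "(x, y) \<in> R ^^ (Suc i + (m - j))" by (subst relpow_add) (rule relcompI)
      then have "m \<le> Suc i + (m - j)" unfolding m_def by (rule Least_le)
      then show False using ij by simp
    qed
  qed (use z zC in auto)
qed

section \<open>Polygons through finite chains\<close>

definition clamp01 :: "real \<Rightarrow> real" where "clamp01 s = max 0 (min 1 s)"

lemma sum_clamp01: "0 \<le> a \<Longrightarrow> (\<Sum>i<m. clamp01 (a - real i)) = min a (real m)"
  by (induction m) (auto simp: clamp01_def min_def max_def)

text \<open>Summand \<open>i\<close> is the progress along edge \<open>i\<close>, which grows from 0
  to 1 while the parameter passes from \<open>i\<close> to \<open>i + 1\<close>. The closed sum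
  avoids gluing pieces: up to \<open>m\<close>, the progress of all edges adds up to the parameter
  (\<open>sum_clamp01\<close>), which gives the Lipschitz bound at once.\<close>

definition polygon :: "(nat \<Rightarrow> 'a::real_normed_vector) \<Rightarrow> nat \<Rightarrow> real \<Rightarrow> 'a" where
  "polygon z m a = z 0 + (\<Sum>i<m. clamp01 (a - real i) *\<^sub>R (z (Suc i) - z i))"

lemma polygon_0: "polygon z m 0 = z 0"
  by (simp add: polygon_def clamp01_def)

lemma polygon_end: "real m \<le> a \<Longrightarrow> polygon z m a = z m"
proof -
  assume a: "real m \<le> a"
  have "polygon z m a = z 0 + (\<Sum>i<m. z (Suc i) - z i)"
    unfolding polygon_def using a by (intro arg_cong2[of _ _ _ _ "(+)"] sum.cong) (auto simp: clamp01_def)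
  then show ?thesis by (simp add: sum_lessThan_telescope)
qed

lemma polygon_near:
  assumes "\<And>i. i < m \<Longrightarrow> dist (z i) (z (Suc i)) \<le> e" "0 \<le> e" "0 \<le> a"
  shows "\<exists>k\<le>m. dist (polygon z m a) (z k) \<le> e"
  using assms(1)
proof (induction m)
  case 0
  then show ?case using assms by (auto simp: polygon_def)
next
  case (Suc m)
  have step: "polygon z (Suc m) a = polygon z m a + clamp01 (a - real m) *\<^sub>R (z (Suc m) - z m)"
    by (simp add: polygon_def)
  show ?case
  proof (cases "a \<le> real m")
    case True
    then have "polygon z (Suc m) a = polygon z m a" unfolding step by (simp add: clamp01_def)
    then show ?thesis using Suc by (metis le_SucI less_SucI)
  next
    case False
    then have "polygon z (Suc m) a = z m + clamp01 (a - real m) *\<^sub>R (z (Suc m) - z m)"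
      unfolding step by (simp add: polygon_end)
    then have "dist (polygon z (Suc m) a) (z m) = clamp01 (a - real m) * dist (z m) (z (Suc m))"
      by (simp add: dist_norm norm_minus_commute clamp01_def)
    also have "\<dots> \<le> 1 * e" using Suc.prems[of m] by (intro mult_mono) (auto simp: clamp01_def)
    finally show ?thesis by (intro exI[of _ m]) simp
  qed
qed

lemma polygon_lipschitz:
  assumes e: "\<And>i. i < m \<Longrightarrow> dist (z i) (z (Suc i)) \<le> e" "0 \<le> e" and ab: "0 \<le> a" "a \<le> b" "b \<le> real m"
  shows "dist (polygon z m a) (polygon z m b) \<le> e * (b - a)"
proof -
  have mono: "clamp01 (a - real i) \<le> clamp01 (b - real i)" for i using ab by (auto simp: clamp01_def)
  have "polygon z m b - polygon z m a = (\<Sum>i<m. (clamp01 (b - real i) - clamp01 (a - real i)) *\<^sub>R (z (Suc i) - z i))"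
    by (simp add: polygon_def sum_subtractf scaleR_diff_left)
  then have "dist (polygon z m a) (polygon z m b) = norm (\<Sum>i<m. (clamp01 (b - real i) - clamp01 (a - real i)) *\<^sub>R (z (Suc i) - z i))"
    by (simp add: dist_norm norm_minus_commute[of "polygon z m a"])
  also have "\<dots> \<le> (\<Sum>i<m. (clamp01 (b - real i) - clamp01 (a - real i)) * e)"
  proof (rule sum_norm_le)
    fix i assume "i \<in> {..<m}"
    then have "norm (z (Suc i) - z i) \<le> e" using e(1)[of i] by (simp add: dist_norm norm_minus_commute)
    then show "norm ((clamp01 (b - real i) - clamp01 (a - real i)) *\<^sub>R (z (Suc i) - z i)) \<le> (clamp01 (b - real i) - clamp01 (a - real i)) * e"
      using mono[of i] by (simp add: mult_left_mono)
  qed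
  also have "\<dots> = ((\<Sum>i<m. clamp01 (b - real i)) - (\<Sum>i<m. clamp01 (a - real i))) * e"
    by (simp add: sum_distrib_right[symmetric] sum_subtractf)
  also have "\<dots> = e * (b - a)" using ab by (simp add: sum_clamp01 min_def)
  finally show ?thesis .
qed

text \<open>All that the geometric part uses about the concentration set. The density bound is
  one-sided; the opposite control comes from finiteness of \<open>M\<close>. In the application
  \<open>D\<close> is a disk with closure inside the domain, which is what makes the measure
  finite.\<close>

locale ahlfors_set =
  fixes M :: "'a::euclidean_space measure" and S D :: "'a set" and \<eta> :: real
  assumes finM: "finite_measure M" and setsM: "sets M = sets borel" and \<eta>: "0 < \<eta>" and D: "open D"
    and lower: "\<And>x s. x \<in> S \<Longrightarrow> 0 < s \<Longrightarrow> ball x s \<subseteq> D \<Longrightarrow> \<eta> * s \<le> measure M (ball x s)"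
    and closedS: "closedin (top_of_set D) S"
    and isolated: "\<And>Z. compact Z \<Longrightarrow> openin (top_of_set S) Z \<Longrightarrow> Z = {}"
begin

lemma compact_S_Int: "compact T \<Longrightarrow> T \<subseteq> D \<Longrightarrow> compact (S \<inter> T)"
proof -
  assume T: "compact T" "T \<subseteq> D"
  obtain C where "closed C" "S = D \<inter> C" using closedS by (metis closedin_closed)
  then have "S \<inter> T = C \<inter> T" using T by auto
  then show ?thesis using T \<open>closed C\<close> by (simp add: closed_Int_compact)
qed

text \<open>The packing bound through which mass controls both the number of components and the
  length of chains.\<close>

lemma disjoint_balls_le:
  assumes "finite I" "\<And>i. i \<in> I \<Longrightarrow> z i \<in> S" "0 < s" "\<And>i. i \<in> I \<Longrightarrow> ball (z i) s \<subseteq> D"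
    "\<And>i j. i \<in> I \<Longrightarrow> j \<in> I \<Longrightarrow> i \<noteq> j \<Longrightarrow> 2 * s \<le> dist (z i) (z j)"
    "\<And>i. i \<in> I \<Longrightarrow> ball (z i) s \<subseteq> A" "A \<in> sets borel"
  shows "real (card I) * (\<eta> * s) \<le> measure M A"
proof -
  interpret finite_measure M by (rule finM)
  have "real (card I) * (\<eta> * s) = (\<Sum>i\<in>I. \<eta> * s)" by simp
  also have "\<dots> \<le> (\<Sum>i\<in>I. measure M (ball (z i) s))" using assms by (intro sum_mono lower) auto
  also have "\<dots> = measure M (\<Union>i\<in>I. ball (z i) s)"
  proof (rule finite_measure_finite_Union[symmetric, OF \<open>finite I\<close>])
    show "(\<lambda>i. ball (z i) s) ` I \<subseteq> sets M" by (auto simp: setsM)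
    show "disjoint_family_on (\<lambda>i. ball (z i) s) I"
      unfolding disjoint_family_on_def
    proof (intro ballI impI)
      fix i j assume "i \<in> I" "j \<in> I" "i \<noteq> j"
      then have "2 * s \<le> dist (z i) (z j)" using assms by blast
      then show "ball (z i) s \<inter> ball (z j) s = {}"
        using disjoint_ballI[of "s" s "z i" "z j"] by simp
    qed
  qed
  also have "\<dots> \<le> measure M A" using assms(6,7) by (intro finite_measure_mono UN_least) (auto simp: setsM)
  finally show ?thesis .
qed

text \<open>A component staying inside a smaller closed ball is compact. By the Sura-Bura theorem it
  has a compact neighbourhood that is open in the locally compact set
  \<open>S \<inter> ball c \<rho>\<close>, hence open in \<open>S\<close>: a nonempty isolated
  compact part, which \<open>isolated\<close> excludes.\<close>

lemma component_reaches_boundary: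
  assumes "cball c \<rho> \<subseteq> D" "C \<in> components (S \<inter> ball c \<rho>)" "t < \<rho>"
  shows "\<exists>x\<in>C. t < dist c x"
proof (rule ccontr)
  assume "\<not> ?thesis"
  then have Ct: "C \<subseteq> cball c t" by (auto simp: not_less)
  let ?K = "S \<inter> ball c \<rho>"
  have CK: "C \<subseteq> ?K" using assms(2) in_components_subset by blast
  have K: "?K = S \<inter> cball c \<rho> \<inter> ball c \<rho>" by auto
  have lc: "locally compact ?K"
    unfolding K
    by (rule locally_compact_Int[OF closed_imp_locally_compact[OF compact_imp_closed[OF compact_S_Int[OF compact_cball assms(1)]]]
          open_imp_locally_compact[OF open_ball]])
  have "compact C"
  proof -
    have "closedin (top_of_set ?K) C" using assms(2) by (rule closedin_component)
    then obtain E where "closed E" "C = ?K \<inter> E" by (metis closedin_closed)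
    then have "C = S \<inter> cball c t \<inter> E" using Ct assms(3) by auto
    moreover have "compact (S \<inter> cball c t)" using assms by (intro compact_S_Int) auto
    ultimately show ?thesis using \<open>closed E\<close> by (simp add: compact_Int_closed)
  qed
  moreover have "C \<subseteq> ball c \<rho>" using CK by simp
  ultimately obtain Z where Z: "openin (top_of_set ?K) Z" "compact Z" "C \<subseteq> Z"
    by (rule Sura_Bura_clopen_subset[OF lc assms(2) _ open_ball])
  have "openin (top_of_set S) Z"
    using openin_trans[OF Z(1)] openin_open_Int[OF open_ball] by blast
  then have "Z = {}" using Z isolated by blast
  then show False using Z assms(2) in_components_nonempty by blast
qed

text \<open>Every component reaches the sphere of radius \<open>\<rho>\<close>, so it crosses the annulus of width \<open>h\<close> below it and
  costs at least a fixed multiple of \<open>\<eta> h\<close> of the mass of the annulus. This bounds the number of components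
  when the mass of the annulus is \<open>O(h)\<close> along some \<open>h \<rightarrow> 0\<close>, which holds for some radius because the mass of
  the ball is monotone in the radius.\<close>

lemma finite_components_ball:
  assumes "a < b" "0 \<le> a" "cball c b \<subseteq> D"
  obtains \<rho> where "a < \<rho>" "\<rho> \<le> b" "finite (components (S \<inter> ball c \<rho>))"
proof -
  interpret finite_measure M by (rule finM)
  have mono: "measure M (ball c s) \<le> measure M (ball c t)" if "s \<le> t" for s t
    using that by (intro finite_measure_mono subset_ball) (auto simp: setsM)
  obtain \<rho> C where \<rho>: "a < \<rho>" "\<rho> \<le> b" and C: "\<And>h0. 0 < h0 \<Longrightarrow> \<exists>h. 0 < h \<and> h < h0 \<and> measure M (ball c \<rho>) - measure M (ball c (\<rho> - h)) \<le> C * h"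
    by (rule exists_finite_left_difference_quotient[OF assms(1), of "\<lambda>t. measure M (ball c t)"]) (use mono in blast)+
  have cD: "cball c \<rho> \<subseteq> D" using \<rho> assms by auto
  let ?K = "S \<inter> ball c \<rho>"
  \<comment> \<open>The width \<open>h\<close> depends on the finite family \<open>F\<close>, but
    the resulting bound does not, so the set of all components is finite.\<close>
  have bound: "real (card F) \<le> 4 * C / \<eta>" if F: "F \<subseteq> components ?K" "finite F" "F \<noteq> {}" for F
  proof -
    have "\<forall>A\<in>F. \<exists>x. x \<in> A" using F in_components_nonempty by fastforce
    then obtain pt where pt: "\<And>A. A \<in> F \<Longrightarrow> pt A \<in> A" by metis
    define h0 where "h0 = Min ((\<lambda>A. \<rho> - dist c (pt A)) ` F)"
    have ptK: "pt A \<in> ?K" if "A \<in> F" for A using that F pt[OF that] in_components_subset by blast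
    have "0 < h0" unfolding h0_def
      using F ptK by (subst Min_gr_iff) auto
    then obtain h where h: "0 < h" "h < h0" "h < \<rho>" "measure M (ball c \<rho>) - measure M (ball c (\<rho> - h)) \<le> C * h"
      using C[of "min h0 \<rho>"] \<rho> assms by auto
    have hA: "dist c (pt A) < \<rho> - h" if "A \<in> F" for A
    proof -
      have "h0 \<le> \<rho> - dist c (pt A)" unfolding h0_def using that F by (intro Min_le) auto
      then show ?thesis using h by simp
    qed
    \<comment> \<open>A component has a point below the annulus and points arbitrarily close to the
      outer sphere, so by connectedness it meets every sphere in between.\<close>
    have cross: "\<exists>x\<in>A. dist c x = t" if tt: "A \<in> F" "\<rho> - h \<le> t" "t < \<rho>" for A t
    proof -
      obtain y where y: "y \<in> A" "t < dist c y" using component_reaches_boundary[OF cD _ tt(3)] tt F by blast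
      have "connected ((\<lambda>x. dist c x) ` A)"
        using tt F in_components_connected by (intro connected_continuous_image continuous_intros) auto
      then show ?thesis
        using connectedD_interval[of "(\<lambda>x. dist c x) ` A" "dist c (pt A)" "dist c y" t, OF _ imageI imageI] y pt[OF tt(1)] hA[OF tt(1)] tt
        by auto
    qed
    \<comment> \<open>Only the inner half of the annulus is used: components need not be closed at
      the outer sphere, but their parts in \<open>An\<close> are compact and hence at positive
      distance from each other.\<close>
    define An where "An = {x. \<rho> - h \<le> dist c x \<and> dist c x \<le> \<rho> - h / 2}"
    have cAn: "closed An" unfolding An_def by (intro closed_Collect_conj closed_Collect_le continuous_intros)
    obtain d where d: "0 < d" "\<And>A B x y. A \<in> (\<lambda>A. A \<inter> An) ` F \<Longrightarrow> B \<in> (\<lambda>A. A \<inter> An) ` F \<Longrightarrow> A \<noteq> B \<Longrightarrow> x \<in> A \<Longrightarrow> y \<in> B \<Longrightarrow> d \<le> dist x y"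
    proof (rule finite_disjoint_compact_separated[of "(\<lambda>A. A \<inter> An) ` F"])
      show "finite ((\<lambda>A. A \<inter> An) ` F)" using F by simp
      show "compact A" if "A \<in> (\<lambda>A. A \<inter> An) ` F" for A
      proof -
        obtain B where B: "B \<in> F" "A = B \<inter> An" using \<open>A \<in> _\<close> by auto
        then have "closedin (top_of_set ?K) B" using F closedin_component by blast
        then obtain E where "closed E" "B = ?K \<inter> E" by (metis closedin_closed)
        then have "A = (S \<inter> cball c \<rho>) \<inter> (E \<inter> An)" using B h by (auto simp: An_def)
        then show ?thesis using compact_S_Int[OF compact_cball cD] \<open>closed E\<close> cAn by (simp add: compact_Int_closed closed_Int)
      qed
      show "A \<inter> B = {}" if "A \<in> (\<lambda>A. A \<inter> An) ` F" "B \<in> (\<lambda>A. A \<inter> An) ` F" "A \<noteq> B" for A B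
        using that F components_nonoverlap by blast
    qed blast
    obtain n :: nat where n: "h / (2 * d) < real n" using reals_Archimedean2 by blast
    have n0: "0 < n" using n h d by (cases n) (auto simp: field_simps not_less)
    \<comment> \<open>With this \<open>s\<close>, \<open>n\<close> shells of width
      \<open>2 * s\<close> fill the inner half, so each component contributes mass of at least
      \<eta> h / 4; the inequality 2 s \<le> d keeps balls on different components apart.\<close>
    define s where "s = h / (4 * real n)"
    have s: "0 < s" "2 * s \<le> d" "real n * s = h / 4"
      using n n0 h d by (auto simp: s_def field_simps)
    define t where "t j = \<rho> - h + (2 * real j + 1) * s" for j :: nat
    have t: "\<rho> - h + s \<le> t j" "t j + s \<le> \<rho> - h / 2" if "j < n" for j
    proof -
      show "\<rho> - h + s \<le> t j" using s by (simp add: t_def algebra_simps)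
      have "(2 * real j + 2) * s \<le> (2 * real n) * s" using that s by (intro mult_right_mono) auto
      then show "t j + s \<le> \<rho> - h / 2" using s by (simp add: t_def algebra_simps)
    qed
    have "\<exists>x\<in>A. dist c x = t j" if "A \<in> F" "j < n" for A j
      using t[OF that(2)] s h by (intro cross that) auto
    then have "\<exists>x\<in>fst P. dist c x = t (snd P)" if "P \<in> F \<times> {..<n}" for P
      using that by auto
    then obtain z where z': "\<And>P. P \<in> F \<times> {..<n} \<Longrightarrow> z P \<in> fst P \<and> dist c (z P) = t (snd P)"
      by metis
    have z: "z (A, j) \<in> A \<and> dist c (z (A, j)) = t j" if "A \<in> F" "j < n" for A j
      using z'[of "(A, j)"] that by simp
    have "real (card (F \<times> {..<n})) * (\<eta> * s) \<le> measure M (ball c \<rho> - ball c (\<rho> - h))"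
    proof (rule disjoint_balls_le[of _ z])
      show "finite (F \<times> {..<n})" using F by simp
      show "0 < s" by (rule s)
      fix P assume P: "P \<in> F \<times> {..<n}"
      then obtain A j where Aj: "P = (A, j)" "A \<in> F" "j < n" by auto
      then have zP: "z P \<in> A" "dist c (z P) = t j" using z by auto
      show "z P \<in> S" using zP Aj F in_components_subset by blast
      show sub: "ball (z P) s \<subseteq> ball c \<rho> - ball c (\<rho> - h)"
      proof
        fix y assume "y \<in> ball (z P) s"
        then have "dist (z P) y < s" by simp
        then have "\<bar>dist c y - t j\<bar> < s"
          using dist_triangle[of c y "z P"] dist_triangle[of c "z P" y] zP(2) by (simp add: dist_commute abs_less_iff)
        then show "y \<in> ball c \<rho> - ball c (\<rho> - h)" using t[OF Aj(3)] h by auto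
      qed
      then show "ball (z P) s \<subseteq> D" using cD ball_subset_cball by blast
      fix Q assume Q: "Q \<in> F \<times> {..<n}" "P \<noteq> Q"
      then obtain B k where Bk: "Q = (B, k)" "B \<in> F" "k < n" by auto
      then have zQ: "z Q \<in> B" "dist c (z Q) = t k" using z by auto
      show "2 * s \<le> dist (z P) (z Q)"
      proof (cases "j = k")
        case True
        then have "A \<noteq> B" using Q Aj Bk by auto
        have inAn: "z P \<in> A \<inter> An" "z Q \<in> B \<inter> An" using zP zQ t[OF Aj(3)] t[OF Bk(3)] s by (auto simp: An_def)
        moreover have "A \<inter> B = {}" using \<open>A \<noteq> B\<close> Aj Bk F components_nonoverlap by blast
        ultimately have "A \<inter> An \<noteq> B \<inter> An" by auto
        then have "d \<le> dist (z P) (z Q)" using d(2)[of "A \<inter> An" "B \<inter> An"] inAn Aj Bk by blast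
        then show ?thesis using s by simp
      next
        case False
        then have "1 \<le> \<bar>real j - real k\<bar>" by linarith
        then have "2 * s * 1 \<le> 2 * s * \<bar>real j - real k\<bar>" using s by (intro mult_left_mono) auto
        also have "\<dots> = \<bar>2 * s * (real j - real k)\<bar>" using s by (simp add: abs_mult)
        also have "2 * s * (real j - real k) = t j - t k" by (simp add: t_def algebra_simps)
        also have "\<bar>t j - t k\<bar> \<le> dist (z P) (z Q)"
          using dist_triangle[of c "z P" "z Q"] dist_triangle[of c "z Q" "z P"] zP(2) zQ(2) by (simp add: dist_commute abs_le_iff)
        finally show ?thesis by simp
      qed
    qed simp
    also have "\<dots> = measure M (ball c \<rho>) - measure M (ball c (\<rho> - h))"
      using h by (intro finite_measure_Diff) (auto simp: setsM)
    also have "\<dots> \<le> C * h" by (rule h)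
    finally have "real (card F) * \<eta> * (real n * s) \<le> C * h" by (simp add: card_cartesian_product algebra_simps)
    then have "(real (card F) * \<eta> / 4) * h \<le> C * h" unfolding s by simp
    then show ?thesis using h \<eta> by (simp add: field_simps)
  qed
  have "finite (components ?K) \<and> card (components ?K) \<le> nat \<lceil>4 * C / \<eta>\<rceil>"
  proof (rule finite_if_finite_subsets_card_bdd)
    show "card F \<le> nat \<lceil>4 * C / \<eta>\<rceil>" if "F \<subseteq> components ?K" "finite F" for F
      using bound[OF that] by (cases "F = {}") (simp, linarith)
  qed
  then show ?thesis using that \<rho> by blast
qed

text \<open>Since \<open>S\<close> has locally finite length, the polygons through chains of mesh \<open>e n\<close> are uniformly
  Lipschitz; the Arzela-Ascoli theorem yields a limit path.\<close>

lemma connected_imp_path_component_closure: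
  assumes "connected C" "C \<subseteq> S" "bounded C" "0 < s0" "\<And>z. z \<in> C \<Longrightarrow> ball z s0 \<subseteq> D" "x \<in> C" "y \<in> C"
  shows "path_component (closure C) x y"
proof -
  interpret finite_measure M by (rule finM)
  \<comment> \<open>Packing about half of the chain points with balls of radius
    \<open>e n / 2\<close> bounds their number times \<open>e n\<close> by twice the total mass over
    \<eta>; doubling gives this bound for the length \<open>m * e n\<close>, uniformly in the
    mesh.\<close>
  define \<Lambda> where "\<Lambda> = 4 * measure M UNIV / \<eta>"
  define e where "e n = 2 * s0 / real (Suc n)" for n
  have e: "0 < e n" "e n / 2 \<le> s0" for n using assms(4) by (auto simp: e_def field_simps)
  have elim: "e \<longlonglongrightarrow> 0"
    unfolding e_def by (rule LIMSEQ_Suc[OF lim_const_over_n])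
  have "\<exists>\<gamma>. \<gamma> 0 = x \<and> \<gamma> 1 = y \<and> (\<forall>t\<in>{0..1}. \<exists>w\<in>C. dist (\<gamma> t) w \<le> e n) \<and>
      (\<forall>s\<in>{0..1}. \<forall>t\<in>{0..1}. dist (\<gamma> s) (\<gamma> t) \<le> \<Lambda> * \<bar>s - t\<bar>)" for n
  proof -
    obtain m z where z: "z 0 = x" "z m = y" "\<And>i. i \<le> m \<Longrightarrow> z i \<in> C"
        "\<And>i. i < m \<Longrightarrow> dist (z i) (z (Suc i)) < e n"
        "\<And>i j. i + 2 \<le> j \<Longrightarrow> j \<le> m \<Longrightarrow> e n \<le> dist (z i) (z j)"
      using connected_chain[OF assms(1,6,7) e(1)] by metis
    \<comment> \<open>Every second point of the chain is kept, because only nonadjacent points are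
      known to be \<open>e n\<close> apart.\<close>
    have "real (card {..m div 2}) * (\<eta> * (e n / 2)) \<le> measure M UNIV"
    proof (rule disjoint_balls_le[of _ "\<lambda>i. z (2 * i)"])
      show "z (2 * i) \<in> S" if "i \<in> {..m div 2}" for i using that z(3) assms(2) by auto
      show "ball (z (2 * i)) (e n / 2) \<subseteq> D" if "i \<in> {..m div 2}" for i
      proof -
        have "ball (z (2 * i)) (e n / 2) \<subseteq> ball (z (2 * i)) s0" using e(2) by (rule subset_ball)
        also have "\<dots> \<subseteq> D" using that z(3) by (intro assms(5)) auto
        finally show ?thesis .
      qed
      show "2 * (e n / 2) \<le> dist (z (2 * i)) (z (2 * j))" if "i \<in> {..m div 2}" "j \<in> {..m div 2}" "i \<noteq> j" for i j
      proof (cases "i < j")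
        case True then show ?thesis using z(5)[of "2 * i" "2 * j"] that by simp
      next
        case False then show ?thesis using z(5)[of "2 * j" "2 * i"] that by (simp add: dist_commute)
      qed
    qed (use e in auto)
    then have a1: "(real (m div 2) + 1) * e n \<le> 2 * measure M UNIV / \<eta>" using \<eta> by (simp add: field_simps)
    have "m \<le> 2 * (m div 2 + 1)" by presburger
    then have "real m \<le> real (2 * (m div 2 + 1))" by (rule of_nat_mono)
    then have "real m \<le> 2 * (real (m div 2) + 1)" by simp
    then have "real m * e n \<le> 2 * (real (m div 2) + 1) * e n" using e(1)[of n] by (intro mult_right_mono) auto
    then have len: "real m * e n \<le> \<Lambda>"
      proof -
      have "\<Lambda> = 2 * (2 * measure M UNIV / \<eta>)" by (simp add: \<Lambda>_def)
      then show ?thesis using a1 \<open>real m * e n \<le> _\<close> unfolding mult.assoc by linarith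
    qed
    define \<gamma> where "\<gamma> t = polygon z m (real m * t)" for t
    have le: "\<And>i. i < m \<Longrightarrow> dist (z i) (z (Suc i)) \<le> e n" "0 \<le> e n" using z(4) e(1)[of n] by (auto intro: less_imp_le)
    have lip: "dist (\<gamma> s) (\<gamma> t) \<le> \<Lambda> * (t - s)" if "0 \<le> s" "s \<le> t" "t \<le> 1" for s t
    proof -
      have "dist (\<gamma> s) (\<gamma> t) \<le> e n * (real m * t - real m * s)"
        unfolding \<gamma>_def by (rule polygon_lipschitz[where e = "e n"]) (use that le in \<open>auto intro: mult_left_mono mult_left_le\<close>)
      also have "\<dots> = (real m * e n) * (t - s)" by (simp add: algebra_simps)
      also have "\<dots> \<le> \<Lambda> * (t - s)" using len that by (intro mult_right_mono) auto
      finally show ?thesis .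
    qed
    have "dist (\<gamma> s) (\<gamma> t) \<le> \<Lambda> * \<bar>s - t\<bar>" if "s \<in> {0..1}" "t \<in> {0..1}" for s t
      using lip[of s t] lip[of t s] that by (cases "s \<le> t") (auto simp: dist_commute)
    moreover have "\<exists>w\<in>C. dist (\<gamma> t) w \<le> e n" if "t \<in> {0..1}" for t
      using polygon_near[of m z "e n" "real m * t"] le that z(3) unfolding \<gamma>_def by auto
    moreover have "\<gamma> 0 = x" "\<gamma> 1 = y" using z by (simp_all add: \<gamma>_def polygon_0 polygon_end)
    ultimately show ?thesis by blast
  qed
  then obtain \<gamma> where \<gamma>: "\<And>n. \<gamma> n 0 = x" "\<And>n. \<gamma> n 1 = y" "\<And>n t. t \<in> {0..1} \<Longrightarrow> \<exists>w\<in>C. dist (\<gamma> n t) w \<le> e n"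
      "\<And>n s t. s \<in> {0..1} \<Longrightarrow> t \<in> {0..1} \<Longrightarrow> dist (\<gamma> n s) (\<gamma> n t) \<le> \<Lambda> * \<bar>s - t\<bar>"
    by metis
  obtain B where B: "\<And>w. w \<in> C \<Longrightarrow> norm w \<le> B" using assms(3) unfolding bounded_iff by blast
  have \<Lambda>0: "0 \<le> \<Lambda>" using \<eta> by (simp add: \<Lambda>_def)
  obtain g k where gk: "continuous_on {0..1} g" "strict_mono (k :: nat \<Rightarrow> nat)"
      "\<And>e. 0 < e \<Longrightarrow> \<exists>N. \<forall>n t. n \<ge> N \<and> t \<in> {0..1} \<longrightarrow> norm (\<gamma> (k n) t - g t) < e"
  proof (rule Arzela_Ascoli[of "{0..1::real}" \<gamma> "B + 2 * s0"])
    show "norm (\<gamma> n t) \<le> B + 2 * s0" if "t \<in> {0..1}" for n t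
    proof -
      obtain w where w: "w \<in> C" "dist (\<gamma> n t) w \<le> e n" using \<gamma>(3) \<open>t \<in> {0..1}\<close> by blast
      have "norm (\<gamma> n t) \<le> norm w + dist (\<gamma> n t) w" unfolding dist_norm using norm_triangle_ineq[of w "\<gamma> n t - w"] by simp
      then show ?thesis using B[OF w(1)] w(2) e(2)[of n] by simp
    qed
    show "\<exists>d>0. \<forall>n y. y \<in> {0..1} \<and> norm (t - y) < d \<longrightarrow> norm (\<gamma> n t - \<gamma> n y) < r" if "t \<in> {0..1}" "0 < r" for t r
    proof (intro exI[of _ "r / (\<Lambda> + 1)"] conjI allI impI)
      show "0 < r / (\<Lambda> + 1)" using that \<Lambda>0 by simp
      fix n y assume y: "y \<in> {0..1} \<and> norm (t - y) < r / (\<Lambda> + 1)"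
      have "norm (\<gamma> n t - \<gamma> n y) \<le> \<Lambda> * \<bar>t - y\<bar>" using \<gamma>(4)[of t y n] that y by (simp add: dist_norm)
      also have "\<dots> \<le> \<Lambda> * (r / (\<Lambda> + 1))" using y \<Lambda>0 by (intro mult_left_mono) auto
      also have "\<dots> < r" using \<Lambda>0 that by (simp add: field_simps)
      finally show "norm (\<gamma> n t - \<gamma> n y) < r" .
    qed
  qed auto
  have lim: "(\<lambda>n. \<gamma> (k n) t) \<longlonglongrightarrow> g t" if "t \<in> {0..1}" for t
    unfolding LIMSEQ_iff using gk(3) that by meson
  have g01: "g 0 = x" "g 1 = y"
    using LIMSEQ_unique[OF lim[of 0], of x] LIMSEQ_unique[OF lim[of 1], of y] \<gamma> by auto
  \<comment> \<open>The polygons stay within \<open>e n\<close> of \<open>C\<close> but need not lie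
    in it, so the limit path is located only in the closure.\<close>
  have "g t \<in> closure C" if t: "t \<in> {0..1}" for t
  proof -
    have "\<exists>w. w \<in> C \<and> dist (\<gamma> (k n) t) w \<le> e (k n)" for n using \<gamma>(3)[OF t] by blast
    then obtain w where w: "\<And>n. w n \<in> C" "\<And>n. dist (\<gamma> (k n) t) (w n) \<le> e (k n)" by metis
    have "(\<lambda>n. e (k n)) \<longlonglongrightarrow> 0" using LIMSEQ_subseq_LIMSEQ[OF elim gk(2)] by (simp add: o_def)
    then have "(\<lambda>n. dist (\<gamma> (k n) t) (w n)) \<longlonglongrightarrow> 0"
      by (rule Lim_null_comparison[rotated]) (use w in simp)
    then have "(\<lambda>n. \<gamma> (k n) t - (\<gamma> (k n) t - w n)) \<longlonglongrightarrow> g t - 0"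
      by (intro tendsto_diff lim t) (simp add: dist_norm tendsto_norm_zero_iff)
    then have "w \<longlonglongrightarrow> g t" by simp
    then show ?thesis using w(1) closure_sequential by blast
  qed
  then show ?thesis
    unfolding path_component_def using gk(1) g01
    by (intro exI[of _ g]) (auto simp: path_def path_image_def pathstart_def pathfinish_def)
qed

text \<open>Finiteness of components for some radius about each point gives more: a small ball about
  \<open>x\<close> meets \<open>S\<close> in finitely many components, each open there, so the
  component of \<open>x\<close> is a neighbourhood of \<open>x\<close> all of whose points are
  joined to \<open>x\<close> by paths. Hence path components and components coincide, and the choice
  of \<rho> makes them finitely many.\<close>

lemma finite_path_components_ball:
  assumes "a < b" "0 \<le> a" "cball c b \<subseteq> D"
  obtains \<rho> where "a < \<rho>" "\<rho> \<le> b" "finite (path_components_of (top_of_set (S \<inter> ball c \<rho>)))"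
proof -
  obtain \<rho> where \<rho>: "a < \<rho>" "\<rho> \<le> b" "finite (components (S \<inter> ball c \<rho>))"
    using finite_components_ball[OF assms] by metis
  let ?K = "S \<inter> ball c \<rho>"
  have nbhd: "\<exists>T. openin (top_of_set ?K) T \<and> x \<in> T \<and> (\<forall>y\<in>T. path_component ?K x y)" if x: "x \<in> ?K" for x
  proof -
    obtain q where q: "0 < q" "cball x q \<subseteq> ball c \<rho>"
      using x open_contains_cball_eq[OF open_ball] by blast
    have "ball c \<rho> \<subseteq> D" using assms(3) \<rho> by (meson ball_subset_cball order_trans subset_cball)
    with q have qD: "cball x q \<subseteq> D" by blast
    \<comment> \<open>A radius of at most \<open>q / 2\<close> leaves room twice: the closure of the
      component stays inside \<open>ball c \<rho>\<close>, and the balls of radius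
      \<open>q / 2\<close> about its points stay inside \<open>D\<close>.\<close>
    obtain \<sigma> where \<sigma>: "q / 4 < \<sigma>" "\<sigma> \<le> q / 2" "finite (components (S \<inter> ball x \<sigma>))"
    proof (rule finite_components_ball[of "q / 4" "q / 2" x])
      have "cball x (q / 2) \<subseteq> cball x q" using q by (intro subset_cball) simp
      then show "cball x (q / 2) \<subseteq> D" using qD by blast
    qed (use q in auto)
    define C where "C = connected_component_set (S \<inter> ball x \<sigma>) x"
    have xC: "x \<in> C" and Cc: "C \<in> components (S \<inter> ball x \<sigma>)"
      using x q \<sigma> by (auto simp: C_def components_def)
    have CS: "C \<subseteq> S \<inter> ball x \<sigma>" unfolding C_def by (rule connected_component_subset)
    \<comment> \<open>The other components are finitely many relatively closed sets, so their union
      is relatively closed.\<close>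
    have "openin (top_of_set (S \<inter> ball x \<sigma>)) C"
    proof -
      let ?F = "components (S \<inter> ball x \<sigma>) - {C}"
      have "closedin (top_of_set (S \<inter> ball x \<sigma>)) (\<Union>?F)"
        using \<sigma>(3) closedin_component by (intro closedin_Union) auto
      moreover have "C = (S \<inter> ball x \<sigma>) - \<Union>?F"
      proof -
        have "C \<inter> \<Union>?F = {}" using Cc components_nonoverlap by blast
        moreover have "C \<union> \<Union>?F = S \<inter> ball x \<sigma>" using Cc by (subst Union_components[symmetric, of "S \<inter> ball x \<sigma>"]) blast
        ultimately show ?thesis by blast
      qed
      ultimately show ?thesis by (metis openin_diff openin_subtopology_self)
    qed
    then have oS: "openin (top_of_set S) C" using openin_trans openin_open_Int[OF open_ball] by blast
    have xs: "cball x \<sigma> \<subseteq> cball x q" using \<sigma> q by (intro subset_cball) auto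
    have CK: "C \<subseteq> ?K" using CS q xs ball_subset_cball[of x \<sigma>] by blast
    have "openin (top_of_set ?K) C" using oS CK by (rule openin_subset_trans) auto
    moreover have "path_component ?K x y" if "y \<in> C" for y
    proof -
      have "path_component (closure C) x y"
      proof (rule connected_imp_path_component_closure[OF _ _ _ _ _ xC that])
        show "connected C" unfolding C_def by (rule connected_connected_component)
        show "bounded C" using CS bounded_subset[OF bounded_ball] by blast
        show "0 < q / 2" using q by simp
        show "ball z (q / 2) \<subseteq> D" if "z \<in> C" for z
        proof -
          have "ball z (q / 2) \<subseteq> ball x q"
          proof
            fix w assume "w \<in> ball z (q / 2)"
            moreover have "dist x z < q / 2" using that CS \<sigma>(2) by auto
            ultimately show "w \<in> ball x q" using dist_triangle[of x w z] by (auto simp: dist_commute)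
          qed
          then show ?thesis using qD ball_subset_cball by blast
        qed
      qed (use CS in auto)
      moreover have "closure C \<subseteq> ?K"
      proof -
        have "closed (S \<inter> cball x \<sigma>)" using xs qD by (intro compact_imp_closed compact_S_Int) auto
        then have "closure C \<subseteq> S \<inter> cball x \<sigma>" using CS ball_subset_cball by (intro closure_minimal) auto
        then show ?thesis using xs q by blast
      qed
      ultimately show ?thesis using path_component_of_subset by blast
    qed
    ultimately show ?thesis using xC by blast
  qed
  \<comment> \<open>Being joined by a path in the set is an equivalence relation whose classes are
    open by \<open>nbhd\<close>, so it has a single class on a connected set.\<close>
  have eq: "path_component_set ?K x = connected_component_set ?K x" if "x \<in> ?K" for x
  proof
    show "path_component_set ?K x \<subseteq> connected_component_set ?K x" by (rule path_component_subset_connected_component)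
    show "connected_component_set ?K x \<subseteq> path_component_set ?K x"
    proof
      fix y assume y: "y \<in> connected_component_set ?K x"
      have x: "x \<in> connected_component_set ?K x" using that by simp
      have "path_component ?K x y"
      proof (rule connected_equivalence_relation[OF connected_connected_component x y])
        fix a assume a: "a \<in> connected_component_set ?K x"
        then have "a \<in> ?K" using connected_component_subset by blast
        then obtain T where T: "openin (top_of_set ?K) T" "a \<in> T" "\<forall>y\<in>T. path_component ?K a y" using nbhd by blast
        obtain W where W: "open W" "T = ?K \<inter> W" using T(1) by (auto simp: openin_open)
        have "T \<inter> connected_component_set ?K x = connected_component_set ?K x \<inter> W"
          using W(2) connected_component_subset[of ?K x] by blast
        then have "openin (top_of_set (connected_component_set ?K x)) (T \<inter> connected_component_set ?K x)"
          using openin_open_Int[OF W(1)] by simp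
        then show "\<exists>T. openin (top_of_set (connected_component_set ?K x)) T \<and> a \<in> T \<and> (\<forall>y\<in>T. path_component ?K a y)"
          using T a by blast
      qed (auto intro: path_component_sym path_component_trans)
      then show "y \<in> path_component_set ?K x" by simp
    qed
  qed
  have "path_components_of (top_of_set ?K) = components ?K"
    unfolding path_components_of_def components_def 
  proof (rule image_cong)
    fix x assume "x \<in> ?K"
    moreover have "path_component_of (top_of_set ?K) x = path_component ?K x" by (rule ext) simp
    ultimately show "path_component_of_set (top_of_set ?K) x = connected_component_set ?K x" using eq by simp
  qed simp
  then show ?thesis using that \<rho> by simp
qed

end

section \<open>Mollification\<close>

text \<open>For \<open>k = 0\<close> this is the classical smooth function that is flat at 0. The
  powers in the denominator make the family closed under differentiation up to linear
  combinations.\<close>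

definition flat_exp :: "nat \<Rightarrow> real \<Rightarrow> real" where
  "flat_exp k t = (if 0 < t then exp (- 1 / t) / t ^ k else 0)"

lemma flat_exp_nonneg: "0 \<le> flat_exp k t"
  by (simp add: flat_exp_def)

lemma flat_exp_has_derivative:
  "(flat_exp k has_real_derivative flat_exp (k + 2) t - real k * flat_exp (k + 1) t) (at t)"
proof -
  consider "0 < t" | "t < 0" | "t = 0" by linarith
  then show ?thesis
  proof cases
    case 1
    have p: "real k * t ^ (k - Suc 0) = real k * t ^ k / t" using 1 by (cases k) auto
    have "((\<lambda>t. exp (- 1 / t) / t ^ k) has_real_derivative
        (exp (- 1 / t) * (1 / (t * t)) * t ^ k - exp (- 1 / t) * (real k * t ^ (k - Suc 0))) / (t ^ k * t ^ k)) (at t)"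
      using 1 by (auto intro!: derivative_eq_intros)
    moreover have "(exp (- 1 / t) * (1 / (t * t)) * t ^ k - exp (- 1 / t) * (real k * t ^ (k - Suc 0))) / (t ^ k * t ^ k)
        = flat_exp (k + 2) t - real k * flat_exp (k + 1) t"
      unfolding p using 1 by (simp add: flat_exp_def field_simps power2_eq_square)
    ultimately have "((\<lambda>t. exp (- 1 / t) / t ^ k) has_real_derivative flat_exp (k + 2) t - real k * flat_exp (k + 1) t) (at t)"
      by simp
    then show ?thesis
      by (rule has_field_derivative_transform_within_open[of _ _ _ "{0<..}"]) (use 1 in \<open>auto simp: flat_exp_def\<close>)
  next
    case 2
    have "((\<lambda>t. 0) has_real_derivative flat_exp (k + 2) t - real k * flat_exp (k + 1) t) (at t)"
      using 2 by (auto simp: flat_exp_def)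
    then show ?thesis
      by (rule has_field_derivative_transform_within_open[of _ _ _ "{..<0}"]) (use 2 in \<open>auto simp: flat_exp_def\<close>)
  next
    case 3
    \<comment> \<open>At 0 the left quotient vanishes, and the right one is a power of 1 / h divided
      by exp (1 / h).\<close>
    have "((\<lambda>h. (flat_exp k (0 + h) - flat_exp k 0) / h) \<longlongrightarrow> 0) (at 0)"
    proof (rule filterlim_split_at_real)
      show "((\<lambda>h. (flat_exp k (0 + h) - flat_exp k 0) / h) \<longlongrightarrow> 0) (at_left 0)"
        by (rule tendsto_eventually, rule eventually_at_leftI[of "-1"]) (auto simp: flat_exp_def)
      have "((\<lambda>h. (inverse h) ^ (k + 1) / exp (inverse h)) \<longlongrightarrow> 0) (at_right (0::real))"
        by (rule filterlim_compose[OF tendsto_power_div_exp_0 filterlim_inverse_at_top_right])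
      moreover have "(inverse h) ^ (k + 1) / exp (inverse h) = (flat_exp k (0 + h) - flat_exp k 0) / h" if "0 < h" for h :: real
      proof -
        have "exp (- 1 / h) = 1 / exp (inverse h)" by (simp add: exp_minus divide_inverse)
        then have "(flat_exp k (0 + h) - flat_exp k 0) / h = 1 / exp (inverse h) / h ^ k / h" using that by (simp add: flat_exp_def)
        also have "\<dots> = (inverse h) ^ (k + 1) / exp (inverse h)" by (simp add: divide_inverse power_inverse mult_ac)
        finally show ?thesis by simp
      qed
      then have "\<forall>\<^sub>F h in at_right 0. (inverse h) ^ (k + 1) / exp (inverse h) = (flat_exp k (0 + h) - flat_exp k 0) / h"
        by (intro eventually_at_rightI[of 0 1]) auto
      ultimately show "((\<lambda>h. (flat_exp k (0 + h) - flat_exp k 0) / h) \<longlongrightarrow> 0) (at_right 0)"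
        by (rule Lim_transform_eventually)
    qed
    then show ?thesis using 3 by (simp add: DERIV_def flat_exp_def)
  qed
qed

text \<open>A class of smooth functions with support in a closed ball that contains the standard mollifiers
  and, unlike these, is closed under directional derivatives.\<close>

inductive bumps :: "'a::euclidean_space \<Rightarrow> real \<Rightarrow> ('a \<Rightarrow> real) \<Rightarrow> bool" for a r where
  base: "bumps a r (\<lambda>x. flat_exp k (r - (x - a) \<bullet> (x - a)))"
| lin: "bumps a r f \<Longrightarrow> bumps a r (\<lambda>x. (x \<bullet> w) * f x)"
| add: "bumps a r f \<Longrightarrow> bumps a r g \<Longrightarrow> bumps a r (\<lambda>x. f x + g x)"
| scale: "bumps a r f \<Longrightarrow> bumps a r (\<lambda>x. c * f x)"

lemma bumps_diff: "bumps a r f \<Longrightarrow> bumps a r g \<Longrightarrow> bumps a r (\<lambda>x. f x - g x)"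
  using bumps.add[OF _ bumps.scale[of a r g "-1"], of f] by simp

lemma bumps_support: "bumps a r f \<Longrightarrow> r \<le> (x - a) \<bullet> (x - a) \<Longrightarrow> f x = 0"
  by (induction rule: bumps.induct) (auto simp: flat_exp_def)

text \<open>The induction produces explicit second derivatives together with their symmetry. The
  symmetry is what later allows a common mixed derivative \<open>b\<close> and a common third
  derivative \<open>d\<close> in \<open>cutoff_jet\<close>.\<close>

lemma bumps_derivs:
  assumes "bumps a r f"
  shows "\<exists>f' f''. (\<forall>x. (f has_derivative f' x) (at x)) \<and> (\<forall>v. bumps a r (\<lambda>x. f' x v)) \<and>
    (\<forall>v x. ((\<lambda>x. f' x v) has_derivative f'' x v) (at x)) \<and> (\<forall>x v w. f'' x v w = f'' x w v)"
  using assms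
proof induction
  case (base k)
  define h1 where "h1 t = flat_exp (k + 2) t - real k * flat_exp (k + 1) t" for t
  define h2 where "h2 t = flat_exp (k + 4) t - real (k + 2) * flat_exp (k + 3) t - real k * (flat_exp (k + 3) t - real (k + 1) * flat_exp (k + 2) t)" for t
  define \<rho> where "\<rho> x = r - (x - a) \<bullet> (x - a)" for x
  have d\<rho>: "(\<rho> has_derivative (\<lambda>h. - 2 * ((x - a) \<bullet> h))) (at x)" for x
    unfolding \<rho>_def by (auto intro!: derivative_eq_intros simp: inner_commute)
  have dh: "(flat_exp k has_real_derivative h1 t) (at t)" for t unfolding h1_def by (rule flat_exp_has_derivative)
  have dh1: "(h1 has_real_derivative h2 t) (at t)" for t
    unfolding h1_def h2_def
    using DERIV_diff[OF flat_exp_has_derivative[of "k + 2" t] DERIV_cmult[OF flat_exp_has_derivative[of "k + 1" t], of "real k"]]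
    by (simp add: numeral_eq_Suc)
  have d1: "((\<lambda>x. flat_exp k (\<rho> x)) has_derivative (\<lambda>h. h1 (\<rho> x) * (- 2 * ((x - a) \<bullet> h)))) (at x)" for x
    using has_derivative_compose[OF d\<rho> dh[unfolded has_field_derivative_def]] .
  have d1': "((\<lambda>x. h1 (\<rho> x)) has_derivative (\<lambda>h. h2 (\<rho> x) * (- 2 * ((x - a) \<bullet> h)))) (at x)" for x
    using has_derivative_compose[OF d\<rho> dh1[unfolded has_field_derivative_def]] .
  have b1: "bumps a r (\<lambda>x. h1 (\<rho> x))" unfolding h1_def \<rho>_def by (intro bumps_diff bumps.base bumps.scale)
  show ?case
  proof (intro exI[of _ "\<lambda>x h. h1 (\<rho> x) * (- 2 * ((x - a) \<bullet> h))"]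
      exI[of _ "\<lambda>x v w. h1 (\<rho> x) * (- 2 * (w \<bullet> v)) + h2 (\<rho> x) * (- 2 * ((x - a) \<bullet> w)) * (- 2 * ((x - a) \<bullet> v))"] conjI allI)
    show "((\<lambda>x. flat_exp k (r - (x - a) \<bullet> (x - a))) has_derivative (\<lambda>h. h1 (\<rho> x) * (- 2 * ((x - a) \<bullet> h)))) (at x)" for x
      using d1 by (simp add: \<rho>_def)
    show "bumps a r (\<lambda>x. h1 (\<rho> x) * (- 2 * ((x - a) \<bullet> v)))" for v
    proof -
      have "bumps a r (\<lambda>x. - 2 * ((x \<bullet> v) * h1 (\<rho> x)) + (2 * (a \<bullet> v)) * h1 (\<rho> x))"
        by (intro bumps.add bumps.scale bumps.lin b1)
      then show ?thesis by (simp add: algebra_simps inner_diff_left)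
    qed
    show "((\<lambda>x. h1 (\<rho> x) * (- 2 * ((x - a) \<bullet> v))) has_derivative
      (\<lambda>w. h1 (\<rho> x) * (- 2 * (w \<bullet> v)) + h2 (\<rho> x) * (- 2 * ((x - a) \<bullet> w)) * (- 2 * ((x - a) \<bullet> v)))) (at x)" for v x
      by (rule has_derivative_mult[OF d1', THEN has_derivative_eq_rhs]) (auto intro!: derivative_eq_intros)
  qed (simp add: inner_commute)
next
  case (lin f w)
  then obtain f' f'' where f: "\<And>x. (f has_derivative f' x) (at x)" "\<And>v. bumps a r (\<lambda>x. f' x v)"
    "\<And>v x. ((\<lambda>x. f' x v) has_derivative f'' x v) (at x)" "\<And>x v w. f'' x v w = f'' x w v" by blast
  show ?case
  proof (intro exI[of _ "\<lambda>x h. (x \<bullet> w) * f' x h + (h \<bullet> w) * f x"]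
      exI[of _ "\<lambda>x v h. (x \<bullet> w) * f'' x v h + (h \<bullet> w) * f' x v + (v \<bullet> w) * f' x h"] conjI allI)
    show "((\<lambda>x. (x \<bullet> w) * f x) has_derivative (\<lambda>h. (x \<bullet> w) * f' x h + (h \<bullet> w) * f x)) (at x)" for x
      by (auto intro!: derivative_eq_intros f)
    show "bumps a r (\<lambda>x. (x \<bullet> w) * f' x v + (v \<bullet> w) * f x)" for v
      by (intro bumps.add bumps.lin bumps.scale f lin)
    show "((\<lambda>x. (x \<bullet> w) * f' x v + (v \<bullet> w) * f x) has_derivative
      (\<lambda>h. (x \<bullet> w) * f'' x v h + (h \<bullet> w) * f' x v + (v \<bullet> w) * f' x h)) (at x)" for v x
      by (auto intro!: derivative_eq_intros f)
  qed (simp add: f(4))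
next
  case (add f g)
  then obtain f' f'' g' g'' where f: "\<And>x. (f has_derivative f' x) (at x)" "\<And>v. bumps a r (\<lambda>x. f' x v)"
    "\<And>v x. ((\<lambda>x. f' x v) has_derivative f'' x v) (at x)" "\<And>x v w. f'' x v w = f'' x w v"
   and g: "\<And>x. (g has_derivative g' x) (at x)" "\<And>v. bumps a r (\<lambda>x. g' x v)"
    "\<And>v x. ((\<lambda>x. g' x v) has_derivative g'' x v) (at x)" "\<And>x v w. g'' x v w = g'' x w v" by blast
  show ?case
  proof (intro exI[of _ "\<lambda>x h. f' x h + g' x h"] exI[of _ "\<lambda>x v h. f'' x v h + g'' x v h"] conjI allI)
  qed (auto intro!: has_derivative_add bumps.add f g simp: f(4) g(4))
next
  case (scale f c)
  then obtain f' f'' where f: "\<And>x. (f has_derivative f' x) (at x)" "\<And>v. bumps a r (\<lambda>x. f' x v)"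
    "\<And>v x. ((\<lambda>x. f' x v) has_derivative f'' x v) (at x)" "\<And>x v w. f'' x v w = f'' x w v" by blast
  show ?case
  proof (intro exI[of _ "\<lambda>x h. c * f' x h"] exI[of _ "\<lambda>x v h. c * f'' x v h"] conjI allI)
  qed (auto intro!: has_derivative_mult_right bumps.scale f simp: f(4))
qed

section \<open>Bump functions as convolution kernels\<close>

abbreviation ddir :: "'a::euclidean_space \<Rightarrow> ('a \<Rightarrow> real) \<Rightarrow> 'a \<Rightarrow> real" where
  "ddir v f \<equiv> (\<lambda>x. frechet_derivative f (at x) v)"

lemma bumps_has_derivative: "bumps a r f \<Longrightarrow> (f has_derivative frechet_derivative f (at x)) (at x)"
  using bumps_derivs[of a r f] frechet_derivative_works differentiable_def by blast

lemma bumps_ddir: assumes "bumps a r f" shows "bumps a r (ddir v f)"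
proof -
  obtain f' where f: "\<And>x. (f has_derivative f' x) (at x)" "\<And>v. bumps a r (\<lambda>x. f' x v)"
    using bumps_derivs[OF assms] by blast
  have "frechet_derivative f (at x) = f' x" for x using f(1) by (metis frechet_derivative_at)
  then show ?thesis using f(2) by simp
qed

lemma bumps_symmetric: assumes "bumps a r f" shows "ddir v (ddir w f) = ddir w (ddir v f)"
proof -
  obtain f' f'' where f: "\<And>x. (f has_derivative f' x) (at x)" 
    "\<And>v x. ((\<lambda>x. f' x v) has_derivative f'' x v) (at x)" "\<And>x v w. f'' x v w = f'' x w v"
    using bumps_derivs[OF assms] by blast
  have 1: "frechet_derivative f (at x) = f' x" for x using f(1) by (metis frechet_derivative_at)
  have 2: "frechet_derivative (\<lambda>x. f' x v) (at x) = f'' x v" for x v using f(2) by (metis frechet_derivative_at)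
  show ?thesis using f(3) by (simp add: 1 2)
qed

lemma bumps_continuous: "bumps a r f \<Longrightarrow> continuous_on UNIV f"
  using bumps_has_derivative by (auto intro!: continuous_at_imp_continuous_on has_derivative_continuous)

lemma bumps_pder: "bumps a r f \<Longrightarrow> pder v f (ddir v f)"
  using has_derivative_pder[of f "\<lambda>x. frechet_derivative f (at x)"] bumps_has_derivative by blast

lemma bumps_smooth: "bumps a r f \<Longrightarrow> smooth_on UNIV f"
proof -
  have "bumps a r f \<Longrightarrow> Ck_on n UNIV f" for n
  proof (induction n arbitrary: f)
    case 0 then show ?case by (simp add: bumps_continuous)
  next
    case (Suc n)
    have "f differentiable (at x)" for x using bumps_has_derivative[OF Suc.prems] differentiable_def by blast
    moreover have "Ck_on n UNIV (ddir v f)" for v by (intro Suc.IH bumps_ddir Suc.prems)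
    ultimately show ?case by simp
  qed
  then show "bumps a r f \<Longrightarrow> smooth_on UNIV f" by (simp add: smooth_on_def)
qed

text \<open>The second argument of \<open>bumps\<close> is a squared radius, so kernels of radius
  \<delta> carry \<open>\<delta>\<^sup>2\<close>.\<close>

lemma bumps_outside: assumes "bumps a (\<delta>\<^sup>2) f" "0 \<le> \<delta>" "x \<notin> cball a \<delta>" shows "f x = 0"
proof (rule bumps_support[OF assms(1)])
  have "\<delta> \<le> norm (x - a)" using assms(3) by (simp add: dist_norm norm_minus_commute)
  then have "\<delta>\<^sup>2 \<le> (norm (x - a))\<^sup>2" using assms(2) by (rule power_mono)
  then show "\<delta>\<^sup>2 \<le> (x - a) \<bullet> (x - a)" by (simp add: power2_norm_eq_inner)
qed

lemma bumps_bounded: assumes "bumps a (\<delta>\<^sup>2) f" "0 \<le> \<delta>" obtains B where "0 < B" "\<And>x. \<bar>f x\<bar> \<le> B"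
proof -
  have "bounded (f ` cball a \<delta>)"
    using bumps_continuous[OF assms(1)] by (intro compact_imp_bounded compact_continuous_image) (auto intro: continuous_on_subset)
  then obtain B where "0 < B" "\<And>x. x \<in> cball a \<delta> \<Longrightarrow> \<bar>f x\<bar> \<le> B" unfolding bounded_pos by auto
  moreover have "\<bar>f x\<bar> \<le> B" if "x \<notin> cball a \<delta>" for x using bumps_outside[OF assms that] \<open>0 < B\<close> by simp
  ultimately show ?thesis using that by blast
qed

definition moll :: "real \<Rightarrow> 'a::euclidean_space \<Rightarrow> real" where
  "moll \<delta> x = flat_exp 0 (\<delta>\<^sup>2 - x \<bullet> x) / (LINT y|lebesgue. flat_exp 0 (\<delta>\<^sup>2 - y \<bullet> (y::'a)))"

lemma moll_bumps: "bumps (0::'a::euclidean_space) (\<delta>\<^sup>2) (moll \<delta>)"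
proof -
  have "moll \<delta> = (\<lambda>x::'a. (1 / (LINT y|lebesgue. flat_exp 0 (\<delta>\<^sup>2 - y \<bullet> (y::'a)))) * flat_exp 0 (\<delta>\<^sup>2 - (x - 0) \<bullet> (x - 0)))"
    by (auto simp: moll_def)
  then show ?thesis by (simp only:) (intro bumps.scale bumps.base)
qed

lemma moll_translate_bumps: "bumps (x::'a::euclidean_space) (\<delta>\<^sup>2) (\<lambda>y. moll \<delta> (x - y))"
proof -
  have "(\<lambda>y. moll \<delta> (x - y)) = (\<lambda>y. (1 / (LINT y|lebesgue. flat_exp 0 (\<delta>\<^sup>2 - y \<bullet> (y::'a)))) * flat_exp 0 (\<delta>\<^sup>2 - (y - x) \<bullet> (y - x)))"
    by (auto simp: moll_def inner_diff inner_commute algebra_simps)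
  then show ?thesis by (simp only:) (intro bumps.scale bumps.base)
qed

lemma moll_minus: "moll \<delta> (- x) = moll \<delta> x"
  by (simp add: moll_def)

lemma integrable_bumps: "bumps a (\<delta>\<^sup>2) f \<Longrightarrow> 0 \<le> \<delta> \<Longrightarrow> integrable lborel f"
  using integrable_continuous_compact_support[OF bumps_continuous compact_cball] bumps_outside by metis

lemma lebesgue_integral_borel:
  fixes f :: "'a::euclidean_space \<Rightarrow> 'b::{banach, second_countable_topology}"
  shows "f \<in> borel_measurable borel \<Longrightarrow> (LINT x|lebesgue. f x) = (LINT x|lborel. f x)"
    and "f \<in> borel_measurable borel \<Longrightarrow> integrable lebesgue f \<longleftrightarrow> integrable lborel f"
  by (simp_all add: integral_completion integrable_completion)

lemma moll_integral_pos:
  assumes "0 < \<delta>" shows "0 < (LINT y|lebesgue. flat_exp 0 (\<delta>\<^sup>2 - y \<bullet> (y::'a::euclidean_space)))"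
proof -
  let ?f = "\<lambda>y::'a. flat_exp 0 (\<delta>\<^sup>2 - y \<bullet> y)"
  have b: "bumps 0 (\<delta>\<^sup>2) ?f" using bumps.base[of 0 "\<delta>\<^sup>2" 0] by simp
  have m: "?f \<in> borel_measurable borel" by (rule borel_measurable_continuous_onI[OF bumps_continuous[OF b]])
  \<comment> \<open>A lower bound on the half ball, where
    \<open>\<delta>\<^sup>2 - y \<bullet> y\<close> is at least three quarters of
    \<open>\<delta>\<^sup>2\<close>.\<close>
  define c where "c = exp (- 1 / (\<delta>\<^sup>2 * 3 / 4))"
  have i: "integrable lborel ?f" using integrable_bumps[OF b] assms by simp
  have "c * measure lborel (ball (0::'a) (\<delta> / 2)) = (LINT y|lborel. c * indicator (ball 0 (\<delta> / 2)) (y::'a))" by simp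
  also have "\<dots> \<le> (LINT y|lborel. ?f y)"
  proof (rule integral_mono)
    show "integrable lborel (\<lambda>y::'a. c * indicator (ball 0 (\<delta> / 2)) y)"
      using emeasure_lborel_ball_finite[of "0::'a" "\<delta> / 2"] by (intro integrable_mult_right) (auto simp: integrable_indicator_iff)
    fix y :: 'a
    show "c * indicator (ball 0 (\<delta> / 2)) y \<le> ?f y"
    proof (cases "y \<in> ball 0 (\<delta> / 2)")
      case True
      then have "(norm y)\<^sup>2 \<le> (\<delta> / 2)\<^sup>2" by (intro power_mono) auto
      then have st: "\<delta>\<^sup>2 * 3 / 4 \<le> \<delta>\<^sup>2 - y \<bullet> y" by (simp add: power2_norm_eq_inner power_divide)
      have p: "0 < \<delta>\<^sup>2 * 3 / 4" using assms by simp
      have q: "0 < \<delta>\<^sup>2 - y \<bullet> y" using st p by linarith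
      have "1 / (\<delta>\<^sup>2 - y \<bullet> y) \<le> 1 / (\<delta>\<^sup>2 * 3 / 4)" using st p q by (intro divide_left_mono mult_pos_pos) simp_all
      then have "c \<le> exp (- 1 / (\<delta>\<^sup>2 - y \<bullet> y))" unfolding c_def by simp
      then show ?thesis using True q by (simp add: flat_exp_def)
    qed (simp add: flat_exp_nonneg)
  qed (rule i)
  finally have "c * measure lborel (ball (0::'a) (\<delta> / 2)) \<le> (LINT y|lborel. ?f y)" .
  moreover have "0 < c * measure lborel (ball (0::'a) (\<delta> / 2))"
    using content_ball_pos[of "\<delta> / 2" "0::'a"] assms by (simp add: c_def)
  ultimately show ?thesis using lebesgue_integral_borel(1)[OF m] by simp
qed

lemma moll_integral: "0 < \<delta> \<Longrightarrow> (LINT x|lborel. moll \<delta> (x::'a::euclidean_space)) = 1"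
proof -
  assume d: "0 < \<delta>"
  let ?f = "\<lambda>y::'a. flat_exp 0 (\<delta>\<^sup>2 - y \<bullet> y)"
  have b: "bumps 0 (\<delta>\<^sup>2) ?f" using bumps.base[of 0 "\<delta>\<^sup>2" 0] by simp
  have m: "?f \<in> borel_measurable borel" by (rule borel_measurable_continuous_onI[OF bumps_continuous[OF b]])
  show ?thesis using moll_integral_pos[OF d, where 'a='a] lebesgue_integral_borel(1)[OF m]
    by (simp add: moll_def[abs_def])
qed

lemma moll_nonneg: "0 < \<delta> \<Longrightarrow> 0 \<le> moll \<delta> x"
  using moll_integral_pos[of \<delta>] by (simp add: moll_def flat_exp_nonneg less_imp_le)

definition conv :: "('a::euclidean_space \<Rightarrow> real) \<Rightarrow> ('a \<Rightarrow> 'b::euclidean_space) \<Rightarrow> 'a \<Rightarrow> 'b" where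
  "conv k F x = (LINT y|lebesgue. k (x - y) *\<^sub>R F y)"

lemma conv_kernel_measurable:
  assumes "continuous_on UNIV k"
  shows "(\<lambda>y. k (x - y)) \<in> borel_measurable lebesgue"
proof -
  have "continuous_on UNIV (\<lambda>y. k (x - y))"
    by (rule continuous_on_compose2[OF assms]) (auto intro: continuous_intros)
  from borel_measurable_continuous_onI[OF this] show ?thesis by (intro measurable_completion) simp
qed

lemma conv_integrable:
  fixes F :: "'a::euclidean_space \<Rightarrow> 'b::euclidean_space"
  assumes "continuous_on UNIV k" "\<And>x. \<bar>k x\<bar> \<le> B" "integrable lebesgue F"
  shows "integrable lebesgue (\<lambda>y. k (x - y) *\<^sub>R F y)"
proof (rule Bochner_Integration.integrable_bound)
  show "integrable lebesgue (\<lambda>y. B *\<^sub>R F y)" using assms(3) by simp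
  show "(\<lambda>y. k (x - y) *\<^sub>R F y) \<in> borel_measurable lebesgue"
    using conv_kernel_measurable[OF assms(1)] assms(3) by (intro borel_measurable_scaleR) auto
  show "AE y in lebesgue. norm (k (x - y) *\<^sub>R F y) \<le> norm (B *\<^sub>R F y)"
    using assms(2) by (intro AE_I2) (auto intro!: mult_right_mono order_trans[OF assms(2) abs_ge_self])
qed

lemma conv_continuous:
  fixes F :: "'a::euclidean_space \<Rightarrow> 'b::euclidean_space"
  assumes k: "continuous_on UNIV k" "\<And>x. \<bar>k x\<bar> \<le> B" and F: "integrable lebesgue F"
  shows "continuous_on UNIV (conv k F)"
  unfolding continuous_on_sequentially
proof (intro allI ballI impI)
  fix X :: "nat \<Rightarrow> 'a" and x assume X: "(\<forall>n. X n \<in> UNIV) \<and> X \<longlonglongrightarrow> x"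
  show "(conv k F \<circ> X) \<longlonglongrightarrow> conv k F x"
    unfolding conv_def o_def
  proof (rule integral_dominated_convergence[where w = "\<lambda>y. norm (B *\<^sub>R F y)"])
    show "AE y in lebesgue. (\<lambda>n. k (X n - y) *\<^sub>R F y) \<longlonglongrightarrow> k (x - y) *\<^sub>R F y"
    proof (intro AE_I2 tendsto_scaleR tendsto_const)
      fix y
      have "(\<lambda>n. X n - y) \<longlonglongrightarrow> x - y" using X by (intro tendsto_intros) auto
      moreover have "isCont k (x - y)" using k(1) by (simp add: continuous_on_eq_continuous_at)
      ultimately show "(\<lambda>n. k (X n - y)) \<longlonglongrightarrow> k (x - y)" by (rule isCont_tendsto_compose[rotated])
    qed
    show "AE y in lebesgue. norm (k (X n - y) *\<^sub>R F y) \<le> norm (B *\<^sub>R F y)" for n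
      using k(2) by (intro AE_I2) (auto intro!: mult_right_mono order_trans[OF k(2) abs_ge_self])
    show "integrable lebesgue (\<lambda>y. norm (B *\<^sub>R F y))" using F by simp
    show "(\<lambda>y. k (X n - y) *\<^sub>R F y) \<in> borel_measurable lebesgue" for n
      using conv_integrable[OF k F] by (intro borel_measurable_integrable)
    show "(\<lambda>y. k (x - y) *\<^sub>R F y) \<in> borel_measurable lebesgue"
      using conv_integrable[OF k F] by (intro borel_measurable_integrable)
  qed
qed

text \<open>Along \<open>e\<close> the kernel has a quadratic Taylor remainder with a constant
  uniform in the point, so differentiation under the integral follows from integrability of
  \<open>F\<close> alone.\<close>

lemma conv_pder:
  fixes F :: "'a::euclidean_space \<Rightarrow> 'b::euclidean_space"
  assumes k: "bumps 0 (\<delta>\<^sup>2) k" "0 \<le> \<delta>" and F: "integrable lebesgue F"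
  shows "pder e (conv k F) (conv (ddir e k) F)"
  unfolding pder_def
proof
  fix x
  let ?k1 = "ddir e k" and ?k2 = "ddir e (ddir e k)"
  have b1: "bumps 0 (\<delta>\<^sup>2) ?k1" using bumps_ddir[OF k(1)] .
  have b2: "bumps 0 (\<delta>\<^sup>2) ?k2" using bumps_ddir[OF b1] .
  obtain B0 where B0: "\<And>x. \<bar>k x\<bar> \<le> B0" using bumps_bounded[OF k] by metis
  obtain B1 where B1: "\<And>x. \<bar>?k1 x\<bar> \<le> B1" using bumps_bounded[OF b1 k(2)] by metis
  obtain B where B: "0 < B" "\<And>x. \<bar>?k2 x\<bar> \<le> B" using bumps_bounded[OF b2 k(2)] by metis
  have mvt: "\<exists>s. 0 \<le> s \<and> s \<le> \<bar>t\<bar> \<and> (\<exists>s'. \<bar>s'\<bar> = s \<and> f (z + t *\<^sub>R e) - f z = t * g (z + s' *\<^sub>R e))"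
    if pd: "pder e f g" for f g :: "'a \<Rightarrow> real" and z t
  proof (cases "0 \<le> t")
    case True
    show ?thesis
    proof (cases "t = 0")
      case False
      with True have t: "0 < t" by simp
      obtain s where "0 < s" "s < t" "f (z + t *\<^sub>R e) - f (z + 0 *\<^sub>R e) = (t - 0) * g (z + s *\<^sub>R e)"
        using MVT2[OF t, of "\<lambda>t. f (z + t *\<^sub>R e)" "\<lambda>t. g (z + t *\<^sub>R e)"] pderD[OF pd]
        by (auto simp: has_real_derivative_iff_has_vector_derivative)
      then show ?thesis by (intro exI[of _ s] conjI exI[of _ s]) auto
    qed auto
  next
    case False
    then have t: "t < 0" by simp
    obtain s where "t < s" "s < 0" "f (z + 0 *\<^sub>R e) - f (z + t *\<^sub>R e) = (0 - t) * g (z + s *\<^sub>R e)"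
      using MVT2[OF t, of "\<lambda>t. f (z + t *\<^sub>R e)" "\<lambda>t. g (z + t *\<^sub>R e)"] pderD[OF pd]
      by (auto simp: has_real_derivative_iff_has_vector_derivative)
    then show ?thesis by (intro exI[of _ "- s"] conjI exI[of _ s]) auto
  qed
  have quad: "\<bar>k (z + t *\<^sub>R e) - k z - t * ?k1 z\<bar> \<le> t\<^sup>2 * B" for z t
  proof -
    obtain s' where s': "\<bar>s'\<bar> \<le> \<bar>t\<bar>" "k (z + t *\<^sub>R e) - k z = t * ?k1 (z + s' *\<^sub>R e)"
      using mvt[OF bumps_pder[OF k(1)]] by metis
    obtain s'' where s'': "?k1 (z + s' *\<^sub>R e) - ?k1 z = s' * ?k2 (z + s'' *\<^sub>R e)"
      using mvt[OF bumps_pder[OF b1]] by metis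
    have "k (z + t *\<^sub>R e) - k z - t * ?k1 z = t * (s' * ?k2 (z + s'' *\<^sub>R e))"
      unfolding s'(2) s''[symmetric] by (simp add: algebra_simps)
    also have "\<bar>\<dots>\<bar> = \<bar>t\<bar> * (\<bar>s'\<bar> * \<bar>?k2 (z + s'' *\<^sub>R e)\<bar>)" by (simp add: abs_mult)
    also have "\<dots> \<le> \<bar>t\<bar> * (\<bar>t\<bar> * B)" using s'(1) B by (intro mult_left_mono mult_mono) auto
    finally show ?thesis by (simp add: power2_eq_square)
  qed
  define I where "I = (LINT y|lebesgue. norm (F y))"
  have est: "norm (conv k F (x + t *\<^sub>R e) - conv k F x - t *\<^sub>R conv ?k1 F x) \<le> t\<^sup>2 * (B * I)" for t
  proof -
    note i0 = conv_integrable[OF bumps_continuous[OF k(1)] B0 F]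
    note i1 = conv_integrable[OF bumps_continuous[OF b1] B1 F]
    have "conv k F (x + t *\<^sub>R e) - conv k F x - t *\<^sub>R conv ?k1 F x
      = (LINT y|lebesgue. k (x + t *\<^sub>R e - y) *\<^sub>R F y - k (x - y) *\<^sub>R F y - t *\<^sub>R (?k1 (x - y) *\<^sub>R F y))"
      unfolding conv_def using i0 i1 by (simp del: scaleR_scaleR)
    also have "norm \<dots> \<le> (LINT y|lebesgue. t\<^sup>2 * B * norm (F y))"
    proof (rule Bochner_Integration.integral_norm_bound_integral)
      show "integrable lebesgue (\<lambda>y. k (x + t *\<^sub>R e - y) *\<^sub>R F y - k (x - y) *\<^sub>R F y - t *\<^sub>R (?k1 (x - y) *\<^sub>R F y))"
        using i0 i1 by (simp del: scaleR_scaleR)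
      show "integrable lebesgue (\<lambda>y. t\<^sup>2 * B * norm (F y))" using F by simp
      fix y
      have "k (x + t *\<^sub>R e - y) *\<^sub>R F y - k (x - y) *\<^sub>R F y - t *\<^sub>R (?k1 (x - y) *\<^sub>R F y) =
        (k ((x - y) + t *\<^sub>R e) - k (x - y) - t * ?k1 (x - y)) *\<^sub>R F y" by (simp add: algebra_simps)
      also have "norm \<dots> \<le> t\<^sup>2 * B * norm (F y)"
        unfolding norm_scaleR using quad[of "x - y" t] by (intro mult_right_mono) auto
      finally show "norm (k (x + t *\<^sub>R e - y) *\<^sub>R F y - k (x - y) *\<^sub>R F y - t *\<^sub>R (?k1 (x - y) *\<^sub>R F y)) \<le> t\<^sup>2 * B * norm (F y)" .
    qed
    finally show ?thesis by (simp add: I_def mult.assoc)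
  qed
  show "((\<lambda>t. conv k F (x + t *\<^sub>R e)) has_vector_derivative conv ?k1 F x) (at 0)"
    unfolding has_vector_derivative_def
  proof (rule has_derivativeI_sandwich[where e = 1 and H = "\<lambda>t. \<bar>t\<bar> * (B * I)"])
    show "bounded_linear (\<lambda>t. t *\<^sub>R conv ?k1 F x)" by (rule bounded_linear_scaleR_left)
    show "((\<lambda>t. \<bar>t\<bar> * (B * I)) \<longlongrightarrow> 0) (at 0)" by (auto intro!: tendsto_eq_intros)
    fix t :: real assume "t \<noteq> 0"
    have "norm (conv k F (x + t *\<^sub>R e) - conv k F (x + 0 *\<^sub>R e) - (t - 0) *\<^sub>R conv ?k1 F x) / norm (t - 0) \<le> t\<^sup>2 * (B * I) / \<bar>t\<bar>"
      using divide_right_mono[OF est[of t], of "\<bar>t\<bar>"] by simp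
    also have "\<dots> = \<bar>t\<bar> * (B * I)" using \<open>t \<noteq> 0\<close> by (simp add: power2_eq_square field_simps abs_mult_self_eq)
    finally show "norm (conv k F (x + t *\<^sub>R e) - conv k F (x + 0 *\<^sub>R e) - (t - 0) *\<^sub>R conv ?k1 F x) / norm (t - 0) \<le> \<bar>t\<bar> * (B * I)" .
  qed simp
qed

lemma
  fixes x :: "'a::euclidean_space"
  assumes d: "0 < \<delta>"
  shows moll_total: "(LINT y|lebesgue. moll \<delta> (x - y)) = 1"
    and moll_total_integrable: "integrable lebesgue (\<lambda>y. moll \<delta> (x - y))"
proof -
  have m: "moll \<delta> \<in> borel_measurable (borel :: 'a measure)" by (rule borel_measurable_continuous_onI[OF bumps_continuous[OF moll_bumps]])
  have m2: "(\<lambda>y. moll \<delta> (x - y)) \<in> borel_measurable borel"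
    by (rule borel_measurable_continuous_onI[OF bumps_continuous[OF moll_translate_bumps]])
  have eq: "(\<lambda>y. moll \<delta> (x - y)) = (\<lambda>y. moll \<delta> (y + (- x)))"
    using moll_minus[of \<delta> "x - _"] by (auto simp: fun_eq_iff)
  show "(LINT y|lebesgue. moll \<delta> (x - y)) = 1"
    unfolding lebesgue_integral_borel(1)[OF m2] unfolding eq
    using integral_lborel_translation[OF m, of "- x"] moll_integral[OF d, where 'a='a] by simp
  show "integrable lebesgue (\<lambda>y. moll \<delta> (x - y))"
    unfolding lebesgue_integral_borel(2)[OF m2] by (rule integrable_bumps[OF moll_translate_bumps]) (use d in simp)
qed

lemma moll_outside: "0 < \<delta> \<Longrightarrow> \<delta> \<le> norm z \<Longrightarrow> moll \<delta> z = 0"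
proof (rule bumps_support[OF moll_bumps])
  assume "0 < \<delta>" "\<delta> \<le> norm z"
  then have "\<delta>\<^sup>2 \<le> (norm z)\<^sup>2" by (intro power_mono) auto
  then show "\<delta>\<^sup>2 \<le> (z - 0) \<bullet> (z - 0)" by (simp add: power2_norm_eq_inner)
qed

text \<open>Convolution with \<open>moll\<close> is a weighted mean over the ball of radius
  \<delta>. This form serves for sup bounds (\<open>c = 0\<close>), for uniform convergence
  (\<open>c = g x\<close>) and, with \<open>B = 0\<close>, for the plateaus of the cutoff.\<close>

lemma conv_moll_dist_le:
  fixes F :: "'a::euclidean_space \<Rightarrow> 'b::euclidean_space"
  assumes d: "0 < \<delta>" and F: "integrable lebesgue F" and b: "AE y in lebesgue. y \<in> ball x \<delta> \<longrightarrow> norm (F y - c) \<le> B"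
  shows "norm (conv (moll \<delta>) F x - c) \<le> B"
proof -
  obtain M where M: "\<And>x::'a. \<bar>moll \<delta> x\<bar> \<le> M" using bumps_bounded[OF moll_bumps] d by (metis less_imp_le)
  have i: "integrable lebesgue (\<lambda>y. moll \<delta> (x - y) *\<^sub>R F y)"
    by (rule conv_integrable[OF bumps_continuous[OF moll_bumps] M F])
  have j: "integrable lebesgue (\<lambda>y. moll \<delta> (x - y))" "(LINT y|lebesgue. moll \<delta> (x - y)) = 1"
    using moll_total_integrable[OF d, of x] moll_total[OF d, of x] .
  have "conv (moll \<delta>) F x - c = (LINT y|lebesgue. moll \<delta> (x - y) *\<^sub>R F y) - (LINT y|lebesgue. moll \<delta> (x - y) *\<^sub>R c)"
    using j by (simp add: conv_def)
  also have "\<dots> = (LINT y|lebesgue. moll \<delta> (x - y) *\<^sub>R (F y - c))"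
    using i j by (simp add: scaleR_diff_right)
  also have "norm \<dots> \<le> (LINT y|lebesgue. moll \<delta> (x - y) * B)"
  proof (rule order_trans[OF integral_norm_bound], rule integral_mono_AE)
    show "integrable lebesgue (\<lambda>y. norm (moll \<delta> (x - y) *\<^sub>R (F y - c)))"
      using i j by (intro integrable_norm) (simp add: scaleR_diff_right)
    show "integrable lebesgue (\<lambda>y. moll \<delta> (x - y) * B)" using j by simp
    show "AE y in lebesgue. norm (moll \<delta> (x - y) *\<^sub>R (F y - c)) \<le> moll \<delta> (x - y) * B"
      using b
    proof eventually_elim
      case (elim y)
      then show ?case
        using moll_nonneg[OF d, of "x - y"] moll_outside[OF d, of "x - y"]
        by (cases "y \<in> ball x \<delta>") (auto simp: dist_norm mult_left_mono)
    qed
  qed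
  also have "\<dots> = B" using j by simp
  finally show ?thesis .
qed

lemma conv_diff:
  fixes F G :: "'a::euclidean_space \<Rightarrow> 'b::euclidean_space"
  assumes "0 < \<delta>" "integrable lebesgue F" "integrable lebesgue G"
  shows "conv (moll \<delta>) (\<lambda>x. F x - G x) x = conv (moll \<delta>) F x - conv (moll \<delta>) G x"
proof -
  obtain M where M: "\<And>x::'a. \<bar>moll \<delta> x\<bar> \<le> M" using bumps_bounded[OF moll_bumps] assms(1) by (metis less_imp_le)
  show ?thesis
    unfolding conv_def scaleR_diff_right
    by (intro Bochner_Integration.integral_diff conv_integrable[OF bumps_continuous[OF moll_bumps] M] assms)
qed

text \<open>Tonelli's theorem, with the kernel integrating to 1 in its first variable.\<close>

lemma conv_moll_L1:
  fixes F :: "'a::euclidean_space \<Rightarrow> 'b::euclidean_space"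
  assumes d: "0 < \<delta>" and F: "integrable lebesgue F"
  shows "integrable lebesgue (conv (moll \<delta>) F)"
    "(LINT x|lebesgue. norm (conv (moll \<delta>) F x)) \<le> (LINT x|lebesgue. norm (F x))"
proof -
  obtain M where M: "\<And>x::'a. \<bar>moll \<delta> x\<bar> \<le> M" using bumps_bounded[OF moll_bumps] d by (metis less_imp_le)
  note i = conv_integrable[OF bumps_continuous[OF moll_bumps] M F]
  have cm: "conv (moll \<delta>) F \<in> borel_measurable borel"
    by (rule borel_measurable_continuous_onI[OF conv_continuous[OF bumps_continuous[OF moll_bumps] M F]])
  have Fm: "F \<in> borel_measurable lebesgue" using F by auto
  \<comment> \<open>\<open>F\<close> is only Lebesgue measurable; a Borel representative of its norm
    makes the integrand measurable on the product space.\<close>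
  have "(\<lambda>x. ennreal (norm (F x))) \<in> borel_measurable (completion lborel)" using Fm by simp
  then obtain f where f: "f \<in> borel_measurable lborel" "AE x in lborel. ennreal (norm (F x)) = f x"
    using completion_ex_borel_measurable by blast
  have mm [measurable]: "moll \<delta> \<in> borel_measurable (borel :: 'a measure)"
    by (rule borel_measurable_continuous_onI[OF bumps_continuous[OF moll_bumps]])
  have [measurable]: "f \<in> borel_measurable borel" using f(1) by simp
  have pt: "ennreal (norm (conv (moll \<delta>) F x)) \<le> (\<integral>\<^sup>+y. ennreal (moll \<delta> (x - y)) * f y \<partial>lborel)" for x
  proof -
    have "ennreal (norm (conv (moll \<delta>) F x)) \<le> (\<integral>\<^sup>+y. norm (moll \<delta> (x - y) *\<^sub>R F y) \<partial>lebesgue)"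
      unfolding conv_def by (rule integral_norm_bound_ennreal[OF i])
    also have "\<dots> = (\<integral>\<^sup>+y. ennreal (moll \<delta> (x - y)) * ennreal (norm (F y)) \<partial>lebesgue)"
      by (intro nn_integral_cong) (simp add: ennreal_mult moll_nonneg[OF d])
    also have "\<dots> = (\<integral>\<^sup>+y. ennreal (moll \<delta> (x - y)) * f y \<partial>lebesgue)"
      using AE_completion[OF f(2)] by (intro nn_integral_cong_AE) auto
    also have "\<dots> = (\<integral>\<^sup>+y. ennreal (moll \<delta> (x - y)) * f y \<partial>lborel)"
      by (rule nn_integral_completion)
    finally show ?thesis .
  qed
  have "(\<integral>\<^sup>+x. ennreal (norm (conv (moll \<delta>) F x)) \<partial>lebesgue) = (\<integral>\<^sup>+x. ennreal (norm (conv (moll \<delta>) F x)) \<partial>lborel)"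
    by (rule nn_integral_completion)
  also have "\<dots> \<le> (\<integral>\<^sup>+x. \<integral>\<^sup>+y. ennreal (moll \<delta> (x - y)) * f y \<partial>lborel \<partial>lborel)"
    by (intro nn_integral_mono pt)
  also have "\<dots> = (\<integral>\<^sup>+y. \<integral>\<^sup>+x. ennreal (moll \<delta> (x - y)) * f y \<partial>lborel \<partial>lborel)"
    by (rule lborel_pair.Fubini') measurable
  also have "\<dots> = (\<integral>\<^sup>+y. (\<integral>\<^sup>+x. ennreal (moll \<delta> (x - y)) \<partial>lborel) * f y \<partial>lborel)"
    by (intro nn_integral_cong nn_integral_multc) measurable
  also have "\<dots> = (\<integral>\<^sup>+y. f y \<partial>lborel)"
  proof (intro nn_integral_cong)
    fix y :: 'a
    have b: "bumps y (\<delta>\<^sup>2) (\<lambda>x. moll \<delta> (y - x))" by (rule moll_translate_bumps)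
    have eq: "(\<lambda>x. moll \<delta> (x - y)) = (\<lambda>x. moll \<delta> (y - x))" using moll_minus[of \<delta> "y - _"] by (auto simp: fun_eq_iff)
    have int: "integrable lborel (\<lambda>x. moll \<delta> (x - y))"
      unfolding eq by (rule integrable_bumps[OF b]) (use d in simp)
    have "(\<integral>\<^sup>+x. ennreal (moll \<delta> (x - y)) \<partial>lborel) = ennreal (LINT x|lborel. moll \<delta> (x - y))"
      by (rule nn_integral_eq_integral[OF int]) (simp add: moll_nonneg[OF d])
    also have "(LINT x|lborel. moll \<delta> (x - y)) = 1"
      using integral_lborel_translation[OF mm, of "- y"] moll_integral[OF d, where 'a='a] by simp
    finally show "(\<integral>\<^sup>+x. ennreal (moll \<delta> (x - y)) \<partial>lborel) * f y = f y" by simp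
  qed
  also have "\<dots> = (\<integral>\<^sup>+y. f y \<partial>lebesgue)" by (rule nn_integral_completion[symmetric])
  also have "\<dots> = (\<integral>\<^sup>+y. ennreal (norm (F y)) \<partial>lebesgue)"
    using AE_completion[OF f(2)] by (intro nn_integral_cong_AE) auto
  also have "\<dots> = ennreal (LINT x|lebesgue. norm (F x))"
    using F by (intro nn_integral_eq_integral) auto
  finally have nn: "(\<integral>\<^sup>+x. ennreal (norm (conv (moll \<delta>) F x)) \<partial>lebesgue) \<le> ennreal (LINT x|lebesgue. norm (F x))" .
  show int: "integrable lebesgue (conv (moll \<delta>) F)"
  proof (rule integrableI_bounded)
    show "conv (moll \<delta>) F \<in> borel_measurable lebesgue" using cm by (intro measurable_completion) simp
    show "(\<integral>\<^sup>+x. ennreal (norm (conv (moll \<delta>) F x)) \<partial>lebesgue) < \<infinity>"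
      using nn ennreal_less_top le_less_trans by (metis infinity_ennreal_def)
  qed
  have "ennreal (LINT x|lebesgue. norm (conv (moll \<delta>) F x)) = (\<integral>\<^sup>+x. ennreal (norm (conv (moll \<delta>) F x)) \<partial>lebesgue)"
    using int by (intro nn_integral_eq_integral[symmetric]) auto
  with nn show "(LINT x|lebesgue. norm (conv (moll \<delta>) F x)) \<le> (LINT x|lebesgue. norm (F x))"
    using ennreal_le_iff[of "LINT x|lebesgue. norm (F x)" "LINT x|lebesgue. norm (conv (moll \<delta>) F x)"] by simp
qed

text \<open>Truncation in value and in space approximates \<open>F\<close> by dominated convergence.
  A Lebesgue measurable map is an almost everywhere limit of continuous ones, and applying the same
  truncation to these yields a common dominating function.\<close>

lemma integrable_dense_continuous:
  fixes F :: "'a::euclidean_space \<Rightarrow> 'b::euclidean_space"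
  assumes F: "integrable lebesgue F" and e: "0 < e"
  obtains g R where "continuous_on UNIV g" "0 < R" "\<And>x. x \<notin> cball 0 R \<Longrightarrow> g x = 0" "integrable lebesgue g"
    "(LINT x|lebesgue. norm (F x - g x)) < e"
proof -
  \<comment> \<open>Radial retraction onto the ball of radius \<open>m\<close>; unlike replacing
    large values by 0, it preserves continuity.\<close>
  define clip where "clip m y = (1 / max 1 (norm y / m)) *\<^sub>R y" for m :: real and y :: 'b
  define \<psi> where "\<psi> m x = max 0 (min 1 (m + 1 - norm x))" for m :: real and x :: 'a
  have clip_le: "norm (clip m y) \<le> norm y" for m y
  proof -
    have "1 * norm y \<le> max 1 (norm y / m) * norm y" by (intro mult_right_mono) auto
    then show ?thesis by (simp add: clip_def divide_le_eq mult.commute)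
  qed
  have clip_m: "norm (clip m y) \<le> m" if "0 < m" for m y
  proof -
    have "norm y = (norm y / m) * m" using that by simp
    also have "\<dots> \<le> max 1 (norm y / m) * m" using that by (intro mult_right_mono) auto
    finally show ?thesis by (simp add: clip_def divide_le_eq mult.commute)
  qed
  have cclip: "continuous_on UNIV (clip m)" if "0 < m" for m
    unfolding clip_def using that by (intro continuous_intros) auto
  have c\<psi>: "continuous_on UNIV (\<psi> m)" for m unfolding \<psi>_def by (intro continuous_intros)
  have \<psi>01: "0 \<le> \<psi> m x" "\<psi> m x \<le> 1" for m x by (auto simp: \<psi>_def)
  define T where "T m f x = \<psi> m x *\<^sub>R clip m (f x)" for m and f :: "'a \<Rightarrow> 'b" and x
  have T_le: "norm (T m f x) \<le> norm (f x)" for m f x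
    unfolding T_def norm_scaleR using mult_mono[of "\<bar>\<psi> m x\<bar>" 1 "norm (clip m (f x))" "norm (f x)"] \<psi>01 clip_le by auto
  have Fm [measurable]: "F \<in> borel_measurable lebesgue" using F by auto
  have clipm: "clip m \<in> borel_measurable borel" if "0 < m" for m
    by (rule borel_measurable_continuous_onI[OF cclip[OF that]])
  have \<psi>m: "\<psi> m \<in> borel_measurable lebesgue" for m
    using borel_measurable_continuous_onI[OF c\<psi>] by (intro measurable_completion) simp
  have TF: "T m F \<in> borel_measurable lebesgue" if "0 < m" for m
    unfolding T_def by (intro borel_measurable_scaleR \<psi>m measurable_compose[OF Fm clipm[OF that]])
  have "(\<lambda>n. LINT x|lebesgue. norm (F x - T (real (Suc n)) F x)) \<longlonglongrightarrow> (LINT x|(lebesgue :: 'a measure). norm (0::'b))"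
  proof (rule integral_dominated_convergence[where w = "\<lambda>x. 2 * norm (F x)"])
    show "AE x in lebesgue. (\<lambda>n. norm (F x - T (real (Suc n)) F x)) \<longlonglongrightarrow> norm (0::'b)"
    proof (rule AE_I2)
      fix x
      obtain N :: nat where N: "norm x + norm (F x) < real N" using reals_Archimedean2 by blast
      have "T (real (Suc n)) F x = F x" if "n \<ge> N" for n
      proof -
        have nx: "norm x < real n" "norm (F x) < real n" using N that norm_ge_zero[of x] norm_ge_zero[of "F x"] by linarith+
        have "\<psi> (real (Suc n)) x = 1" using nx by (simp add: \<psi>_def)
        moreover have "norm (F x) / real (Suc n) \<le> 1" using nx by (simp add: divide_le_eq)
        then have "clip (real (Suc n)) (F x) = F x" by (simp add: clip_def max_absorb1)
        ultimately show ?thesis by (simp add: T_def)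
      qed
      then have "\<forall>\<^sub>F n in sequentially. norm (F x - T (real (Suc n)) F x) = norm (0::'b)"
        unfolding eventually_sequentially by (intro exI[of _ N] allI impI) simp
      then show "(\<lambda>n. norm (F x - T (real (Suc n)) F x)) \<longlonglongrightarrow> norm (0::'b)" by (rule tendsto_eventually)
    qed
    show "AE x in lebesgue. norm (norm (F x - T (real (Suc n)) F x)) \<le> 2 * norm (F x)" for n
      using norm_triangle_ineq4[of "F _" "T (real (Suc n)) F _"] T_le[of "real (Suc n)" F] by (intro AE_I2) (smt (verit) norm_ge_zero real_norm_def)
    show "integrable lebesgue (\<lambda>x. 2 * norm (F x))" using F by simp
    show "(\<lambda>x. norm (F x - T (real (Suc n)) F x)) \<in> borel_measurable lebesgue" for n
      using borel_measurable_diff[OF Fm TF[of "real (Suc n)"]] by simp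
  qed simp
  then have "\<forall>\<^sub>F n in sequentially. (LINT x|lebesgue. norm (F x - T (real (Suc n)) F x)) < e / 2"
    using e by (intro order_tendstoD(2)) auto
  then obtain n where n: "(LINT x|lebesgue. norm (F x - T (real (Suc n)) F x)) < e / 2"
    unfolding eventually_sequentially by blast
  define m where "m = real (Suc n)"
  have m: "0 < m" "(LINT x|lebesgue. norm (F x - T m F x)) < e / 2" using n by (auto simp: m_def)
  obtain N g where N: "negligible N" "\<And>n. continuous_on UNIV (g n)" "\<And>x. x \<notin> N \<Longrightarrow> (\<lambda>n. g n x) \<longlonglongrightarrow> F x"
    using lebesgue_measurable_imp_measurable_on[OF Fm, of UNIV] unfolding measurable_on_def by auto
  have cT: "continuous_on UNIV (T m (g n))" for n
    unfolding T_def using c\<psi> continuous_on_compose2[OF cclip[OF m(1)] N(2)] by (intro continuous_on_scaleR) auto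
  have Tz: "T m f x = 0" if "x \<notin> cball 0 (m + 1)" for f x using that by (simp add: T_def \<psi>_def)
  have Tb: "norm (T m f x) \<le> m * indicator (cball 0 (m + 1)) x" for f x
  proof (cases "x \<in> cball 0 (m + 1)")
    case True
    have "norm (T m f x) \<le> 1 * m" unfolding T_def norm_scaleR using \<psi>01 clip_m[OF m(1)] by (intro mult_mono) auto
    then show ?thesis using True by simp
  qed (simp add: Tz)
  have ind: "integrable lebesgue (\<lambda>x. m * indicator (cball 0 (m + 1)) (x::'a))"
    using emeasure_lborel_cball_finite[of "0::'a" "m + 1"] by (intro integrable_mult_right) (auto simp: integrable_indicator_iff)
  have Tm: "T m (g n) \<in> borel_measurable lebesgue" for n
    using borel_measurable_continuous_onI[OF cT] by (intro measurable_completion) simp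
  have iT: "integrable lebesgue (T m f)" if "T m f \<in> borel_measurable lebesgue" for f
    by (rule Bochner_Integration.integrable_bound[OF ind that]) (intro AE_I2 order_trans[OF Tb], simp)
  have "(\<lambda>n. LINT x|lebesgue. norm (T m F x - T m (g n) x)) \<longlonglongrightarrow> (LINT x|(lebesgue :: 'a measure). norm (0::'b))"
  proof (rule integral_dominated_convergence[where w = "\<lambda>x. 2 * (m * indicator (cball 0 (m + 1)) x)"])
    show "AE x in lebesgue. (\<lambda>n. norm (T m F x - T m (g n) x)) \<longlonglongrightarrow> norm (0::'b)"
    proof (rule AE_I[of _ _ N])
      show "N \<in> sets lebesgue" "emeasure lebesgue N = 0" using N(1) by (auto simp: negligible_iff_null_sets)
      show "{x \<in> space lebesgue. \<not> (\<lambda>n. norm (T m F x - T m (g n) x)) \<longlonglongrightarrow> norm (0::'b)} \<subseteq> N"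
      proof
        fix x assume "x \<in> {x \<in> space lebesgue. \<not> (\<lambda>n. norm (T m F x - T m (g n) x)) \<longlonglongrightarrow> norm (0::'b)}"
        moreover have "(\<lambda>n. norm (T m F x - T m (g n) x)) \<longlonglongrightarrow> norm (T m F x - T m F x)" if "x \<notin> N"
        proof -
          have "isCont (clip m) (F x)" using cclip[OF m(1)] by (simp add: continuous_on_eq_continuous_at)
          from isCont_tendsto_compose[OF this N(3)[OF that]] show ?thesis
            unfolding T_def by (intro tendsto_intros)
        qed
        ultimately show "x \<in> N" by auto
      qed
    qed
    show "AE x in lebesgue. norm (norm (T m F x - T m (g n) x)) \<le> 2 * (m * indicator (cball 0 (m + 1)) x)" for n
    proof (rule AE_I2)
      fix x
      show "norm (norm (T m F x - T m (g n) x)) \<le> 2 * (m * indicator (cball 0 (m + 1)) x)"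
        using norm_triangle_ineq4[of "T m F x" "T m (g n) x"] Tb[of F x] Tb[of "g n" x] by simp
    qed
    show "integrable lebesgue (\<lambda>x. 2 * (m * indicator (cball 0 (m + 1)) (x::'a)))" using ind by simp
    show "(\<lambda>x. norm (T m F x - T m (g n) x)) \<in> borel_measurable lebesgue" for n
      using borel_measurable_diff[OF TF[OF m(1)] Tm[of n]] by simp
  qed simp
  then have "\<forall>\<^sub>F n in sequentially. (LINT x|lebesgue. norm (T m F x - T m (g n) x)) < e / 2"
    using e by (intro order_tendstoD(2)) auto
  then obtain n where n: "(LINT x|lebesgue. norm (T m F x - T m (g n) x)) < e / 2"
    unfolding eventually_sequentially by blast
  have ii: "integrable lebesgue (T m (g n))" "integrable lebesgue (T m F)" by (intro iT Tm TF m)+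
  show ?thesis
  proof (rule that[of "T m (g n)" "m + 1"])
    have "(LINT x|lebesgue. norm (F x - T m (g n) x)) \<le> (LINT x|lebesgue. norm (F x - T m F x) + norm (T m F x - T m (g n) x))"
    proof (rule integral_mono)
      fix x show "norm (F x - T m (g n) x) \<le> norm (F x - T m F x) + norm (T m F x - T m (g n) x)"
        using norm_triangle_ineq[of "F x - T m F x" "T m F x - T m (g n) x"] by simp
    qed (use F ii in auto)
    also have "\<dots> = (LINT x|lebesgue. norm (F x - T m F x)) + (LINT x|lebesgue. norm (T m F x - T m (g n) x))"
      using F ii by (intro Bochner_Integration.integral_add) auto
    also have "\<dots> < e" using m n by simp
    finally show "(LINT x|lebesgue. norm (F x - T m (g n) x)) < e" .
  qed (use cT Tz ii m in auto)
qed

lemma conv_moll_uniform: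
  fixes g :: "'a::euclidean_space \<Rightarrow> 'b::euclidean_space"
  assumes g: "continuous_on UNIV g" "integrable lebesgue g" "\<And>x. x \<notin> cball 0 R \<Longrightarrow> g x = 0" and e: "0 < e"
  obtains d where "0 < d" "d \<le> 1" "\<And>\<delta> x. 0 < \<delta> \<Longrightarrow> \<delta> \<le> d \<Longrightarrow> norm (conv (moll \<delta>) g x - g x) \<le> e * indicator (cball 0 (R + 1)) x"
proof -
  have "uniformly_continuous_on (cball 0 (R + 2)) g"
    using g(1) by (intro compact_uniformly_continuous) (auto intro: continuous_on_subset)
  then obtain d where d: "0 < d" "\<And>x y. x \<in> cball 0 (R + 2) \<Longrightarrow> y \<in> cball 0 (R + 2) \<Longrightarrow> dist y x < d \<Longrightarrow> dist (g y) (g x) < e"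
    using e unfolding uniformly_continuous_on_def by metis
  show ?thesis
  proof (rule that[of "min d 1"])
    fix \<delta> x assume \<delta>: "0 < \<delta>" "\<delta> \<le> min d 1"
    show "norm (conv (moll \<delta>) g x - g x) \<le> e * indicator (cball 0 (R + 1)) x"
    proof (rule conv_moll_dist_le[OF \<delta>(1) g(2)], rule AE_I2, intro impI)
      fix y assume y: "y \<in> ball x \<delta>"
      then have xy: "norm (x - y) < d" "norm (x - y) < 1" using \<delta> by (auto simp: dist_norm)
      have tr: "norm y \<le> norm x + norm (x - y)" "norm x \<le> norm y + norm (x - y)"
        using norm_triangle_ineq4[of x "x - y"] norm_triangle_ineq[of y "x - y"] by simp_all
      show "norm (g y - g x) \<le> e * indicator (cball 0 (R + 1)) x"
      proof (cases "x \<in> cball 0 (R + 1)")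
        case True
        then show ?thesis using d(2)[of x y] xy tr by (simp add: dist_norm norm_minus_commute)
      next
        case False
        then have "g x = 0" "g y = 0" using xy tr by (auto intro!: g(3))
        then show ?thesis using False by simp
      qed
    qed
  qed (use d in auto)
qed

text \<open>For continuous maps of compact support the convergence is uniform; the L1 contraction
  \<open>conv_moll_L1\<close> handles the remainder.\<close>

lemma conv_moll_tendsto_L1:
  fixes F :: "'a::euclidean_space \<Rightarrow> 'b::euclidean_space"
  assumes F: "integrable lebesgue F" and \<delta>: "\<And>n. 0 < \<delta> n" "\<delta> \<longlonglongrightarrow> 0"
  shows "(\<lambda>n. LINT x|lebesgue. norm (conv (moll (\<delta> n)) F x - F x)) \<longlonglongrightarrow> 0"
proof (rule LIMSEQ_I)
  fix e :: real assume e: "0 < e"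
  obtain g R where g: "continuous_on UNIV g" "0 < R" "\<And>x. x \<notin> cball 0 R \<Longrightarrow> g x = 0" "integrable lebesgue g"
      "(LINT x|lebesgue. norm (F x - g x)) < e / 3"
    using integrable_dense_continuous[OF F, of "e / 3"] e by auto
  define v where "v = measure lebesgue (cball (0::'a) (R + 1))"
  define e' where "e' = e / (3 * (v + 1))"
  have v: "0 \<le> v" by (simp add: v_def)
  have e': "0 < e'" "e' * v < e / 3"
    using e v by (auto simp: e'_def field_simps)
  obtain d where d: "0 < d" "\<And>\<delta> x. 0 < \<delta> \<Longrightarrow> \<delta> \<le> d \<Longrightarrow> norm (conv (moll \<delta>) g x - g x) \<le> e' * indicator (cball 0 (R + 1)) x"
    using conv_moll_uniform[OF g(1,4,3) e'(1)] by metis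
  obtain N where N: "\<And>n. n \<ge> N \<Longrightarrow> \<delta> n < d"
    using order_tendstoD(2)[OF \<delta>(2) d(1)] unfolding eventually_sequentially by blast
  have ind: "integrable lebesgue (\<lambda>x. e' * indicator (cball 0 (R + 1)) (x::'a))"
    using emeasure_lborel_cball_finite[of "0::'a" "R + 1"] by (intro integrable_mult_right) (auto simp: integrable_indicator_iff)
  show "\<exists>N. \<forall>n\<ge>N. norm ((LINT x|lebesgue. norm (conv (moll (\<delta> n)) F x - F x)) - 0) < e"
  proof (intro exI[of _ N] allI impI)
    fix n assume n: "N \<le> n"
    let ?k = "moll (\<delta> n) :: 'a \<Rightarrow> real"
    have Fg: "integrable lebesgue (\<lambda>x. F x - g x)" using F g by simp
    note cF = conv_moll_L1(1)[OF \<delta>(1)[of n] F] and cg = conv_moll_L1(1)[OF \<delta>(1)[of n] g(4)] and cFg = conv_moll_L1[OF \<delta>(1)[of n] Fg]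
    have "(LINT x|lebesgue. norm (conv ?k F x - F x)) \<le>
      (LINT x|lebesgue. norm (conv ?k (\<lambda>x. F x - g x) x) + norm (conv ?k g x - g x) + norm (F x - g x))"
    proof (rule integral_mono)
      fix x
      have "conv ?k F x - F x = conv ?k (\<lambda>x. F x - g x) x + (conv ?k g x - g x) - (F x - g x)"
        using conv_diff[OF \<delta>(1)[of n] F g(4), of x] by simp
      then show "norm (conv ?k F x - F x) \<le> norm (conv ?k (\<lambda>x. F x - g x) x) + norm (conv ?k g x - g x) + norm (F x - g x)"
        using norm_triangle_ineq4[of "conv ?k (\<lambda>x. F x - g x) x + (conv ?k g x - g x)" "F x - g x"]
          norm_triangle_ineq[of "conv ?k (\<lambda>x. F x - g x) x" "conv ?k g x - g x"] by simp
    qed (use cF cg cFg F g in auto)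
    also have "\<dots> = (LINT x|lebesgue. norm (conv ?k (\<lambda>x. F x - g x) x)) + (LINT x|lebesgue. norm (conv ?k g x - g x)) + (LINT x|lebesgue. norm (F x - g x))"
      using cF cg cFg F g by simp
    also have "(LINT x|lebesgue. norm (conv ?k g x - g x)) \<le> (LINT x|lebesgue. e' * indicator (cball 0 (R + 1)) (x::'a))"
      using cg g ind d(2)[OF \<delta>(1)] N[OF n] by (intro integral_mono) (auto intro: less_imp_le)
    also have "(LINT x|lebesgue. e' * indicator (cball 0 (R + 1)) (x::'a)) = e' * v" by (simp add: v_def)
    finally have "(LINT x|lebesgue. norm (conv ?k F x - F x)) < e"
      using cFg(2) g(5) e'(2) by linarith
    then show "norm ((LINT x|lebesgue. norm (conv ?k F x - F x)) - 0) < e" by simp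
  qed
qed

corollary conv_moll_AE_subseq:
  fixes F :: "'a::euclidean_space \<Rightarrow> 'b::euclidean_space"
  assumes F: "integrable lebesgue F" and \<delta>: "\<And>n. 0 < \<delta> n" "\<delta> \<longlonglongrightarrow> 0"
  obtains s :: "nat \<Rightarrow> nat" where "strict_mono s" "AE x in lebesgue. (\<lambda>n. conv (moll (\<delta> (s n))) F x) \<longlonglongrightarrow> F x"
proof -
  have "\<exists>s::nat\<Rightarrow>nat. strict_mono s \<and> (AE x in lebesgue. (\<lambda>n. conv (moll (\<delta> (s n))) F x - F x) \<longlonglongrightarrow> 0)"
    using conv_moll_L1(1)[OF \<delta>(1) F] F conv_moll_tendsto_L1[OF F \<delta>] by (intro tendsto_L1_AE_subseq) auto
  then obtain s :: "nat \<Rightarrow> nat" where "strict_mono s" "AE x in lebesgue. (\<lambda>n. conv (moll (\<delta> (s n))) F x - F x) \<longlonglongrightarrow> 0" by blast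
  then show ?thesis using that by (simp add: LIM_zero_iff)
qed

section \<open>Mollified weak solutions\<close>

text \<open>Extension by zero off \<open>K\<close>. It turns local integrability on the domain into
  integrability on the whole space, over which \<open>conv\<close> integrates.\<close>

abbreviation rs :: "'a set \<Rightarrow> ('a \<Rightarrow> 'b::real_vector) \<Rightarrow> 'a \<Rightarrow> 'b" where
  "rs K F \<equiv> (\<lambda>y. indicat_real K y *\<^sub>R F y)"

lemma bumps_reflect: "bumps 0 r \<kappa> \<Longrightarrow> bumps x r (\<lambda>y. \<kappa> (x - y))"
proof (induction rule: bumps.induct)
  case (base k)
  have "(\<lambda>y. flat_exp k (r - (x - y - 0) \<bullet> (x - y - 0))) = (\<lambda>y. flat_exp k (r - (y - x) \<bullet> (y - x)))"
    by (auto simp: inner_diff inner_commute algebra_simps)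
  then show ?case by (simp only:) (rule bumps.base)
next
  case (lin f w)
  have "bumps x r (\<lambda>y. (x \<bullet> w) * f (x - y) - (y \<bullet> w) * f (x - y))"
    by (intro bumps_diff bumps.scale bumps.lin lin)
  then show ?case by (simp add: algebra_simps inner_diff_left)
qed (auto intro: bumps.add bumps.scale)

lemma ddir_reflect:
  assumes "bumps 0 r \<kappa>"
  shows "ddir v (\<lambda>y. \<kappa> (x - y)) y = - ddir v \<kappa> (x - y)"
proof -
  have 1: "((\<lambda>y. x - y) has_derivative (\<lambda>h. - h)) (at y)" by (auto intro!: derivative_eq_intros)
  have "((\<lambda>y. \<kappa> (x - y)) has_derivative (\<lambda>h. frechet_derivative \<kappa> (at (x - y)) (- h))) (at y)"
    using has_derivative_compose[OF 1 bumps_has_derivative[OF assms]] .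
  then have "frechet_derivative (\<lambda>y. \<kappa> (x - y)) (at y) = (\<lambda>h. frechet_derivative \<kappa> (at (x - y)) (- h))"
    by (rule frechet_derivative_at[symmetric])
  moreover have "linear (frechet_derivative \<kappa> (at (x - y)))"
    using bumps_has_derivative[OF assms] has_derivative_linear by blast
  ultimately show ?thesis by (simp add: linear_neg)
qed

lemma bumps_test_function:
  fixes \<kappa> :: "real^'m \<Rightarrow> real"
  assumes "bumps 0 (\<delta>\<^sup>2) \<kappa>" "0 \<le> \<delta>" "cball x \<delta> \<subseteq> \<Omega>"
  shows "test_function \<Omega> (\<lambda>y. \<kappa> (x - y))"
proof -
  have b: "bumps x (\<delta>\<^sup>2) (\<lambda>y. \<kappa> (x - y))" by (rule bumps_reflect[OF assms(1)])
  have "{y. \<kappa> (x - y) \<noteq> 0} \<subseteq> cball x \<delta>" using bumps_outside[OF b assms(2)] by blast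
  then have "closure {y. \<kappa> (x - y) \<noteq> 0} \<subseteq> cball x \<delta>" by (rule closure_minimal) simp
  moreover from this have "compact (closure {y. \<kappa> (x - y) \<noteq> 0})"
    using bounded_subset[OF bounded_cball] by (simp add: compact_eq_bounded_closed)
  ultimately show ?thesis using bumps_smooth[OF b] assms(3) by (auto simp: test_function_def)
qed

text \<open>The kernel about \<open>x\<close> vanishes off \<open>cball x \<delta>\<close>, so
  neither the restriction to the domain nor the cutoff at \<open>K\<close> is seen.\<close>

lemma integral_on_eq_conv:
  fixes F :: "real^'m \<Rightarrow> real"
  assumes "bumps 0 (\<delta>\<^sup>2) \<kappa>" "0 \<le> \<delta>" "cball x \<delta> \<subseteq> K" "K \<subseteq> \<Omega>" "open \<Omega>"
  shows "(LINT y|lebesgue_on \<Omega>. F y * \<kappa> (x - y)) = conv \<kappa> (rs K F) x"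
proof -
  have "(LINT y|lebesgue_on \<Omega>. F y * \<kappa> (x - y)) = (LINT y|lebesgue. indicator \<Omega> y *\<^sub>R (F y * \<kappa> (x - y)))"
    using assms(5) by (intro integral_restrict_space) (auto intro: lmeasurable_open)
  also have "\<dots> = conv \<kappa> (rs K F) x"
    unfolding conv_def
  proof (rule Bochner_Integration.integral_cong)
    fix y
    show "indicator \<Omega> y *\<^sub>R (F y * \<kappa> (x - y)) = \<kappa> (x - y) *\<^sub>R (indicat_real K y *\<^sub>R F y)"
      using bumps_outside[OF bumps_reflect[OF assms(1)] assms(2), of y x] assms(3,4)
      by (cases "y \<in> cball x \<delta>") (auto simp: indicator_def)
  qed simp
  finally show ?thesis .
qed

lemma integrable_rs: "locally_integrable \<Omega> F \<Longrightarrow> compact K \<Longrightarrow> K \<subseteq> \<Omega> \<Longrightarrow> integrable lebesgue (rs K F)"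
  by (simp add: locally_integrable_def set_integrable_def)

lemma conv_component:
  fixes F :: "'a::euclidean_space \<Rightarrow> real^'k"
  assumes "continuous_on UNIV k" "\<And>x. \<bar>k x\<bar> \<le> B" "integrable lebesgue F"
  shows "conv k F x $ i = conv k (\<lambda>y. F y $ i) x"
  using integral_bounded_linear[OF bounded_linear_vec_nth conv_integrable[OF assms, of x], of i]
  by (simp add: conv_def)

lemma integrable_vec_nth: "integrable M (F :: _ \<Rightarrow> 'b::euclidean_space^'k) \<Longrightarrow> integrable M (\<lambda>y. F y $ i)"
  by (rule integrable_bounded_linear[OF bounded_linear_vec_nth])

lemma bounded_linear_column: "bounded_linear (\<lambda>A :: real^'m^'k. column j A)"
proof -
  have "linear (\<lambda>A :: real^'m^'k. column j A)"
    by (rule linearI) (simp_all add: column_def vec_eq_iff)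
  then show ?thesis by (simp add: linear_conv_bounded_linear)
qed

text \<open>The reflected kernel is an admissible test function; reflection changes the sign of its
  derivative, which cancels the sign in the definition of the weak gradient.\<close>

lemma weak_gradient_conv:
  fixes u :: "real^'m \<Rightarrow> real^'k"
  assumes wg: "has_weak_gradient \<Omega> u G" and \<kappa>: "bumps 0 (\<delta>\<^sup>2) \<kappa>" "0 \<le> \<delta>"
    and K: "cball x \<delta> \<subseteq> K" "K \<subseteq> \<Omega>" "compact K" "open \<Omega>"
  shows "conv (ddir (axis j 1) \<kappa>) (rs K u) x = conv \<kappa> (rs K (\<lambda>y. column j (G y))) x"
proof -
  have iu: "integrable lebesgue (rs K u)" and iG: "integrable lebesgue (rs K G)"
    using wg K by (auto simp: has_weak_gradient_def intro!: integrable_rs)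
  have iGj: "integrable lebesgue (rs K (\<lambda>y. column j (G y)))"
  proof -
    have "integrable lebesgue (\<lambda>y. column j (indicat_real K y *\<^sub>R G y))"
      by (rule integrable_bounded_linear[OF bounded_linear_column iG])
    moreover have "column j (c *\<^sub>R A) = c *\<^sub>R column j A" for c and A :: "real^'m^'k"
      by (simp add: column_def vec_eq_iff)
    ultimately show ?thesis by simp
  qed
  have b: "bumps 0 (\<delta>\<^sup>2) (ddir (axis j 1) \<kappa>)" by (rule bumps_ddir[OF \<kappa>(1)])
  obtain B where B: "\<And>z. \<bar>\<kappa> z\<bar> \<le> B" using bumps_bounded[OF \<kappa>] by metis
  obtain B' where B': "\<And>z. \<bar>ddir (axis j 1) \<kappa> z\<bar> \<le> B'" using bumps_bounded[OF b \<kappa>(2)] by metis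
  have "conv (ddir (axis j 1) \<kappa>) (rs K u) x $ i = conv \<kappa> (rs K (\<lambda>y. column j (G y))) x $ i" for i
  proof -
    have tf: "test_function \<Omega> (\<lambda>y. \<kappa> (x - y))" using bumps_test_function[OF \<kappa>] K by blast
    have "(LINT y|lebesgue_on \<Omega>. u y $ i * grad (\<lambda>y. \<kappa> (x - y)) y $ j) =
        - (LINT y|lebesgue_on \<Omega>. G y $ i $ j * \<kappa> (x - y))"
      using wg tf by (simp add: has_weak_gradient_def)
    moreover have "grad (\<lambda>y. \<kappa> (x - y)) y $ j = - ddir (axis j 1) \<kappa> (x - y)" for y
      by (simp add: grad_def ddir_reflect[OF \<kappa>(1)])
    ultimately have "(LINT y|lebesgue_on \<Omega>. u y $ i * ddir (axis j 1) \<kappa> (x - y)) =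
        (LINT y|lebesgue_on \<Omega>. G y $ i $ j * \<kappa> (x - y))" by simp
    then have "conv (ddir (axis j 1) \<kappa>) (rs K (\<lambda>y. u y $ i)) x = conv \<kappa> (rs K (\<lambda>y. G y $ i $ j)) x"
      unfolding integral_on_eq_conv[OF \<kappa> K(1,2,4)] integral_on_eq_conv[OF b \<kappa>(2) K(1,2,4)] .
    moreover have "conv (ddir (axis j 1) \<kappa>) (rs K u) x $ i = conv (ddir (axis j 1) \<kappa>) (rs K (\<lambda>y. u y $ i)) x"
      using conv_component[OF bumps_continuous[OF b] B' iu] by simp
    moreover have "conv \<kappa> (rs K (\<lambda>y. column j (G y))) x $ i = conv \<kappa> (rs K (\<lambda>y. G y $ i $ j)) x"
      using conv_component[OF bumps_continuous[OF \<kappa>(1)] B iGj] by (simp add: column_def)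
    ultimately show ?thesis by simp
  qed
  then show ?thesis by (simp add: vec_eq_iff)
qed

text \<open>Testing with the reflected kernel yields the equation for the mollified map pointwise,
  but with the mollified \<open>\<nabla>V(u)\<close> on the right instead of
  \<open>\<nabla>V\<close> of the mollified map. The difference is the defect of the energy
  estimate.\<close>

lemma allen_cahn_conv:
  fixes u :: "real^2 \<Rightarrow> real^'k"
  assumes ac: "allen_cahn_solution \<Omega> V \<epsilon> u" and \<kappa>: "bumps 0 (\<delta>\<^sup>2) \<kappa>" "0 \<le> \<delta>"
    and K: "cball x \<delta> \<subseteq> K" "K \<subseteq> \<Omega>" "compact K" "open \<Omega>"
  shows "conv (ddir (ax 1) (ddir (ax 1) \<kappa>)) (rs K u) x + conv (ddir (ax 2) (ddir (ax 2) \<kappa>)) (rs K u) x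
    = (1 / \<epsilon>\<^sup>2) *\<^sub>R conv \<kappa> (rs K (\<lambda>y. grad V (u y))) x"
proof -
  define G where "G = weak_grad \<Omega> u"
  have wg: "has_weak_gradient \<Omega> u G"
    using ac unfolding G_def weak_grad_def allen_cahn_solution_def H1_on_def by (metis someI)
  have iG: "integrable lebesgue (rs K G)" using wg K by (auto simp: has_weak_gradient_def intro!: integrable_rs)
  have iF: "integrable lebesgue (rs K (\<lambda>y. grad V (u y)))" using ac K by (auto simp: allen_cahn_solution_def intro!: integrable_rs)
  have b: "bumps 0 (\<delta>\<^sup>2) (ddir (ax j) \<kappa>)" for j by (rule bumps_ddir[OF \<kappa>(1)])
  obtain B where B: "\<And>z. \<bar>\<kappa> z\<bar> \<le> B" using bumps_bounded[OF \<kappa>] by metis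
  have "\<exists>B. \<forall>z. \<bar>ddir (ax j) \<kappa> z\<bar> \<le> B" for j using bumps_bounded[OF b \<kappa>(2)] by metis
  then obtain B' where B': "\<And>j z. \<bar>ddir (ax j) \<kappa> z\<bar> \<le> B' j" by metis
  have iGj: "integrable lebesgue (rs K (\<lambda>y. column j (G y)))" for j
  proof -
    have "integrable lebesgue (\<lambda>y. column j (indicat_real K y *\<^sub>R G y))"
      by (rule integrable_bounded_linear[OF bounded_linear_column iG])
    moreover have "column j (c *\<^sub>R A) = c *\<^sub>R column j A" for c and A :: "real^2^'k"
      by (simp add: column_def vec_eq_iff)
    ultimately show ?thesis by simp
  qed
  have "(conv (ddir (ax 1) \<kappa>) (rs K (\<lambda>y. column 1 (G y))) x + conv (ddir (ax 2) \<kappa>) (rs K (\<lambda>y. column 2 (G y))) x) $ i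
      = ((1 / \<epsilon>\<^sup>2) *\<^sub>R conv \<kappa> (rs K (\<lambda>y. grad V (u y))) x) $ i" for i
  proof -
    have tf: "test_function \<Omega> (\<lambda>y. \<kappa> (x - y))" using bumps_test_function[OF \<kappa>] K by blast
    have "(LINT y|lebesgue_on \<Omega>. (G y $ i) \<bullet> grad (\<lambda>y. \<kappa> (x - y)) y) =
        - (1 / \<epsilon>\<^sup>2) * (LINT y|lebesgue_on \<Omega>. grad V (u y) $ i * \<kappa> (x - y))"
      using ac tf unfolding allen_cahn_solution_def G_def by blast
    moreover have "(G y $ i) \<bullet> grad (\<lambda>y. \<kappa> (x - y)) y = - (G y $ i $ 1 * ddir (ax 1) \<kappa> (x - y) + G y $ i $ 2 * ddir (ax 2) \<kappa> (x - y))" for y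
      by (simp add: inner_vec_def sum_2 grad_def ddir_reflect[OF \<kappa>(1)])
    ultimately have 1: "(LINT y|lebesgue_on \<Omega>. G y $ i $ 1 * ddir (ax 1) \<kappa> (x - y) + G y $ i $ 2 * ddir (ax 2) \<kappa> (x - y)) =
        (1 / \<epsilon>\<^sup>2) * (LINT y|lebesgue_on \<Omega>. grad V (u y) $ i * \<kappa> (x - y))"
      by (simp only: Bochner_Integration.integral_minus)
    \<comment> \<open>Splitting the integral of the inner product requires integrability of each
      summand, as a nonintegrable one would have integral 0 by default.\<close>
    have int: "integrable (lebesgue_on \<Omega>) (\<lambda>y. G y $ i $ j * ddir (ax j) \<kappa> (x - y))" for j
    proof -
      have "integrable lebesgue (\<lambda>y. (ddir (ax j) \<kappa> (x - y) *\<^sub>R rs K (\<lambda>y. column j (G y)) y) $ i)"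
        by (rule integrable_vec_nth[OF conv_integrable[OF bumps_continuous[OF b] B' iGj]])
      moreover have eq: "(ddir (ax j) \<kappa> (x - y) *\<^sub>R rs K (\<lambda>y. column j (G y)) y) $ i = indicator \<Omega> y *\<^sub>R (G y $ i $ j * ddir (ax j) \<kappa> (x - y))" for y
        using bumps_outside[OF bumps_reflect[OF b] \<kappa>(2), of y x] K(1,2)
        by (cases "y \<in> cball x \<delta>") (auto simp: indicator_def column_def)
      ultimately have "integrable lebesgue (\<lambda>y. indicator \<Omega> y *\<^sub>R (G y $ i $ j * ddir (ax j) \<kappa> (x - y)))" by (simp only: eq)
      then show ?thesis using K(4) by (subst integrable_restrict_space) (auto intro: lmeasurable_open)
    qed
    have "(LINT y|lebesgue_on \<Omega>. G y $ i $ 1 * ddir (ax 1) \<kappa> (x - y)) + (LINT y|lebesgue_on \<Omega>. G y $ i $ 2 * ddir (ax 2) \<kappa> (x - y)) =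
        (1 / \<epsilon>\<^sup>2) * (LINT y|lebesgue_on \<Omega>. grad V (u y) $ i * \<kappa> (x - y))"
      using 1 int by simp
    then have "conv (ddir (ax 1) \<kappa>) (rs K (\<lambda>y. G y $ i $ 1)) x + conv (ddir (ax 2) \<kappa>) (rs K (\<lambda>y. G y $ i $ 2)) x
       = (1 / \<epsilon>\<^sup>2) * conv \<kappa> (rs K (\<lambda>y. grad V (u y) $ i)) x"
      unfolding integral_on_eq_conv[OF \<kappa> K(1,2,4)] integral_on_eq_conv[OF b \<kappa>(2) K(1,2,4)] .
    moreover have "conv (ddir (ax j) \<kappa>) (rs K (\<lambda>y. column j (G y))) x $ i = conv (ddir (ax j) \<kappa>) (rs K (\<lambda>y. G y $ i $ j)) x" for j
      using conv_component[OF bumps_continuous[OF b] B' iGj] by (simp add: column_def)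
    moreover have "conv \<kappa> (rs K (\<lambda>y. grad V (u y))) x $ i = conv \<kappa> (rs K (\<lambda>y. grad V (u y) $ i)) x"
      using conv_component[OF bumps_continuous[OF \<kappa>(1)] B iF] by simp
    ultimately show ?thesis by simp
  qed
  then have "conv (ddir (ax 1) \<kappa>) (rs K (\<lambda>y. column 1 (G y))) x + conv (ddir (ax 2) \<kappa>) (rs K (\<lambda>y. column 2 (G y))) x
      = (1 / \<epsilon>\<^sup>2) *\<^sub>R conv \<kappa> (rs K (\<lambda>y. grad V (u y))) x" by (simp add: vec_eq_iff)
  then show ?thesis
    using weak_gradient_conv[OF wg b \<kappa>(2) K, of 1 1] weak_gradient_conv[OF wg b \<kappa>(2) K, of 2 2] by simp
qed

text \<open>The variance of \<open>F\<close> about its weighted mean is nonnegative.\<close>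

lemma conv_jensen:
  fixes F :: "'a::euclidean_space \<Rightarrow> 'b::euclidean_space"
  assumes d: "0 < \<delta>" and F: "integrable lebesgue F" "integrable lebesgue (\<lambda>y. (norm (F y))\<^sup>2)"
  shows "(norm (conv (moll \<delta>) F x))\<^sup>2 \<le> conv (moll \<delta>) (\<lambda>y. (norm (F y))\<^sup>2) x"
proof -
  obtain M where M: "\<And>x::'a. \<bar>moll \<delta> x\<bar> \<le> M" using bumps_bounded[OF moll_bumps] d by (metis less_imp_le)
  note ck = bumps_continuous[OF moll_bumps]
  define c where "c = conv (moll \<delta>) F x"
  have i1: "integrable lebesgue (\<lambda>y. moll \<delta> (x - y) *\<^sub>R F y)" by (rule conv_integrable[OF ck M F(1)])
  have i2: "integrable lebesgue (\<lambda>y. moll \<delta> (x - y) *\<^sub>R (norm (F y))\<^sup>2)" by (rule conv_integrable[OF ck M F(2)])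
  have i3: "integrable lebesgue (\<lambda>y. moll \<delta> (x - y))" by (rule moll_total_integrable[OF d])
  have "0 \<le> (LINT y|lebesgue. moll \<delta> (x - y) * (norm (F y - c))\<^sup>2)"
    by (intro Bochner_Integration.integral_nonneg) (simp add: moll_nonneg[OF d])
  also have "(\<lambda>y. moll \<delta> (x - y) * (norm (F y - c))\<^sup>2) = (\<lambda>y. moll \<delta> (x - y) *\<^sub>R (norm (F y))\<^sup>2 - 2 * ((moll \<delta> (x - y) *\<^sub>R F y) \<bullet> c) + (c \<bullet> c) * moll \<delta> (x - y))"
    by (auto simp: power2_norm_eq_inner inner_diff algebra_simps inner_commute)
  also have "(LINT y|lebesgue. moll \<delta> (x - y) *\<^sub>R (norm (F y))\<^sup>2 - 2 * ((moll \<delta> (x - y) *\<^sub>R F y) \<bullet> c) + (c \<bullet> c) * moll \<delta> (x - y))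
     = conv (moll \<delta>) (\<lambda>y. (norm (F y))\<^sup>2) x - 2 * (conv (moll \<delta>) F x \<bullet> c) + c \<bullet> c"
    unfolding conv_def using i1 i2 i3 moll_total[OF d, of x] by (simp del: inner_scaleR_left)
  finally show ?thesis by (simp add: c_def power2_norm_eq_inner)
qed

section \<open>Uniform boundedness of solutions\<close>

lemma second_difference:
  fixes f :: "'a::euclidean_space \<Rightarrow> real"
  assumes pd: "pder e f f1" "pder e f1 f2" and h: "0 < h"
  shows "\<exists>s. \<bar>s\<bar> \<le> h \<and> f (x + h *\<^sub>R e) + f (x - h *\<^sub>R e) - 2 * f x = h\<^sup>2 * f2 (x + s *\<^sub>R e)"
proof -
  have d: "((\<lambda>t. f (x + t *\<^sub>R e)) has_real_derivative f1 (x + t *\<^sub>R e)) (at t)" for t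
    using pderD[OF pd(1)] by (simp add: has_real_derivative_iff_has_vector_derivative)
  have d1: "((\<lambda>t. f1 (x + t *\<^sub>R e)) has_real_derivative f2 (x + t *\<^sub>R e)) (at t)" for t
    using pderD[OF pd(2)] by (simp add: has_real_derivative_iff_has_vector_derivative)
  have dm: "((\<lambda>t. f (x - t *\<^sub>R e)) has_real_derivative - f1 (x - t *\<^sub>R e)) (at t)" for t
    using DERIV_mirror[of "\<lambda>t. f (x + t *\<^sub>R e)" "f1 (x - t *\<^sub>R e)" t] d[of "- t"] by simp
  \<comment> \<open>With this \<open>c\<close> the auxiliary \<open>\<psi>\<close> vanishes at 0 and
    at \<open>h\<close>; the mean value theorem is then applied once to \<open>\<psi>\<close> and
    once to \<open>f1\<close>.\<close>
  define c where "c = (f (x + h *\<^sub>R e) + f (x - h *\<^sub>R e) - 2 * f x) / h\<^sup>2"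
  define \<psi> where "\<psi> t = f (x + t *\<^sub>R e) + f (x - t *\<^sub>R e) - 2 * f x - c * t\<^sup>2" for t
  have d\<psi>: "(\<psi> has_real_derivative f1 (x + t *\<^sub>R e) - f1 (x - t *\<^sub>R e) - 2 * c * t) (at t)" for t
    unfolding \<psi>_def by (auto intro!: derivative_eq_intros d dm)
  obtain \<xi> where \<xi>: "0 < \<xi>" "\<xi> < h" "\<psi> h - \<psi> 0 = (h - 0) * (f1 (x + \<xi> *\<^sub>R e) - f1 (x - \<xi> *\<^sub>R e) - 2 * c * \<xi>)"
    using MVT2[OF h, of \<psi> "\<lambda>t. f1 (x + t *\<^sub>R e) - f1 (x - t *\<^sub>R e) - 2 * c * t"] d\<psi> by auto
  have "\<psi> h = 0" "\<psi> 0 = 0" using h by (simp_all add: \<psi>_def c_def)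
  then have 1: "f1 (x + \<xi> *\<^sub>R e) - f1 (x - \<xi> *\<^sub>R e) = 2 * c * \<xi>" using \<xi> h by simp
  obtain s where s: "- \<xi> < s" "s < \<xi>" "f1 (x + \<xi> *\<^sub>R e) - f1 (x + (- \<xi>) *\<^sub>R e) = (\<xi> - (- \<xi>)) * f2 (x + s *\<^sub>R e)"
    using MVT2[of "- \<xi>" \<xi> "\<lambda>t. f1 (x + t *\<^sub>R e)" "\<lambda>t. f2 (x + t *\<^sub>R e)"] d1 \<xi> by auto
  then have "c = f2 (x + s *\<^sub>R e)" using 1 \<xi> by simp
  then show ?thesis using s \<xi> h by (intro exI[of _ s]) (auto simp: c_def field_simps)
qed

lemma tendsto_second_difference:
  fixes f :: "'a::euclidean_space \<Rightarrow> real"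
  assumes pd: "pder e f f1" "pder e f1 f2" and c: "continuous_on UNIV f2" and h: "\<And>n. 0 < h n" "h \<longlonglongrightarrow> 0"
  shows "(\<lambda>n. (f (x + h n *\<^sub>R e) + f (x - h n *\<^sub>R e) - 2 * f x) / (h n)\<^sup>2) \<longlonglongrightarrow> f2 x"
proof -
  obtain s where s: "\<And>n. \<bar>s n\<bar> \<le> h n" "\<And>n. f (x + h n *\<^sub>R e) + f (x - h n *\<^sub>R e) - 2 * f x = (h n)\<^sup>2 * f2 (x + s n *\<^sub>R e)"
    using choice[of "\<lambda>n s. \<bar>s\<bar> \<le> h n \<and> f (x + h n *\<^sub>R e) + f (x - h n *\<^sub>R e) - 2 * f x = (h n)\<^sup>2 * f2 (x + s *\<^sub>R e)"]
      second_difference[OF pd h(1)] by blast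
  have "s \<longlonglongrightarrow> 0" by (rule Lim_null_comparison[OF _ h(2)]) (use s in auto)
  then have "(\<lambda>n. x + s n *\<^sub>R e) \<longlonglongrightarrow> x + 0 *\<^sub>R e" by (intro tendsto_intros)
  moreover have "isCont f2 (x + 0 *\<^sub>R e)" using c by (simp add: continuous_on_eq_continuous_at)
  ultimately have "(\<lambda>n. f2 (x + s n *\<^sub>R e)) \<longlonglongrightarrow> f2 (x + 0 *\<^sub>R e)" by (rule isCont_tendsto_compose[rotated])
  moreover have "(f (x + h n *\<^sub>R e) + f (x - h n *\<^sub>R e) - 2 * f x) / (h n)\<^sup>2 = f2 (x + s n *\<^sub>R e)" for n
    using s(2)[of n] h(1)[of n] by simp
  ultimately show ?thesis by simp
qed

text \<open>A smoothed version of the distance to the ball of radius \<open>R\<close>: it is convex and its gradient is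
  radial, so it is subharmonic along a solution as soon as \<open>y \<bullet> \<nabla>V(y) \<ge> 0\<close> outside that ball.\<close>

definition excess :: "real \<Rightarrow> 'b::real_inner \<Rightarrow> real" where
  "excess R y = sqrt (1 + (max (norm y - R) 0)\<^sup>2)"

text \<open>The gradient of \<open>excess R\<close>. Inside the ball of radius \<open>R\<close> the
  numerator vanishes, and having \<open>R\<close> instead of the norm in the denominator there keeps
  the formula continuous at the origin.\<close>

definition excess_grad :: "real \<Rightarrow> 'b::real_inner \<Rightarrow> 'b" where
  "excess_grad R y = (max (norm y - R) 0 / (excess R y * max (norm y) R)) *\<^sub>R y"

lemma excess_ge_1: "1 \<le> excess R y"
  by (simp add: excess_def)

lemma continuous_excess: "continuous_on UNIV (excess R)"
  unfolding excess_def by (intro continuous_intros)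

lemma continuous_excess_grad: "0 < R \<Longrightarrow> continuous_on UNIV (excess_grad R)"
proof -
  assume R: "0 < R"
  have "excess R y * max (norm y) R \<noteq> 0" for y :: 'a
    using excess_ge_1[of R y] R by (auto simp: max_def)
  then show ?thesis unfolding excess_grad_def by (intro continuous_intros continuous_excess) auto
qed

lemma norm_le_excess: "norm y \<le> R + excess R y"
proof -
  have "norm y - R \<le> sqrt ((max (norm y - R) 0)\<^sup>2)" by simp
  also have "\<dots> \<le> excess R y" unfolding excess_def by (intro real_sqrt_le_mono) simp
  finally show ?thesis by simp
qed

lemma excess_le: "0 < R \<Longrightarrow> excess R y \<le> 1 + norm y"
proof -
  assume R: "0 < R"
  have "1 + (max (norm y - R) 0)\<^sup>2 \<le> (1 + max (norm y - R) 0)\<^sup>2" by (simp add: power2_eq_square algebra_simps)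
  then have "excess R y \<le> 1 + max (norm y - R) 0" unfolding excess_def by (intro real_le_lsqrt) auto
  also have "\<dots> \<le> 1 + norm y" using R by auto
  finally show ?thesis .
qed

lemma norm_excess_grad: "0 < R \<Longrightarrow> norm (excess_grad R y) \<le> 1"
proof (cases "norm y \<le> R")
  case False
  assume R: "0 < R"
  have "norm (excess_grad R y) = (norm y - R) / excess R y"
    using False R excess_ge_1[of R y] by (cases "y = 0") (simp_all add: excess_grad_def max_def)
  also have "\<dots> \<le> 1" using norm_le_excess[of y R] excess_ge_1[of R y] by (simp add: divide_le_eq)
  finally show ?thesis .
qed (simp add: excess_grad_def)

text \<open>Cauchy-Schwarz twice: for the vectors it reduces the claim to the distances
  \<open>d\<close> and \<open>d'\<close> from the ball, and for the pairs (1, d) and (1, d') it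
  gives convexity of sqrt (1 + d^2). The subgradient form avoids second derivatives of
  \<open>excess\<close>, which do not exist on the sphere of radius \<open>R\<close>.\<close>

lemma excess_convex: "0 < R \<Longrightarrow> excess R y + excess_grad R y \<bullet> (z - y) \<le> excess R z"
proof -
  assume R: "0 < R"
  define d where "d = max (norm y - R) 0"
  define d' where "d' = max (norm z - R) 0"
  define b where "b = excess R y"
  have b: "1 \<le> b" "b\<^sup>2 = 1 + d\<^sup>2" using excess_ge_1[of R y] by (simp_all add: b_def excess_def d_def)
  have dd: "0 \<le> d" "0 \<le> d'" by (simp_all add: d_def d'_def)
  have "excess_grad R y \<bullet> (z - y) \<le> d * (d' - d) / b"
  proof (cases "norm y \<le> R")
    case True
    then show ?thesis by (simp add: excess_grad_def d_def)
  next
    case False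
    then have ny: "0 < norm y" "d = norm y - R" using R by (auto simp: d_def)
    have "excess_grad R y = (d / (b * norm y)) *\<^sub>R y" using False by (simp add: excess_grad_def b_def d_def max_def)
    then have "excess_grad R y \<bullet> (z - y) = (d / (b * norm y)) * (y \<bullet> z - (norm y)\<^sup>2)"
      by (simp add: inner_diff_right power2_norm_eq_inner right_diff_distrib)
    also have "\<dots> \<le> (d / (b * norm y)) * (norm y * norm z - (norm y)\<^sup>2)"
      using dd b ny norm_cauchy_schwarz[of y z] by (intro mult_left_mono) auto
    also have "\<dots> = d / b * (norm z - norm y)" using ny(1) b by (simp add: divide_simps power2_eq_square) (simp add: algebra_simps)
    also have "\<dots> \<le> d / b * (d' - d)"
      using dd b ny by (intro mult_left_mono) (auto simp: d'_def)
    finally show ?thesis by simp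
  qed
  moreover have "b + d * (d' - d) / b \<le> excess R z"
  proof -
    have "b + d * (d' - d) / b = (1 + d * d') / b"
      using b by (simp add: field_simps power2_eq_square)
    also have "\<dots> \<le> excess R z"
    proof -
      have "(1 + d * d')\<^sup>2 \<le> (1 + d\<^sup>2) * (1 + d'\<^sup>2)"
        using zero_le_power2[of "d - d'"] by (simp add: power2_eq_square algebra_simps)
      then have "1 + d * d' \<le> sqrt ((1 + d\<^sup>2) * (1 + d'\<^sup>2))" by (rule real_le_rsqrt)
      also have "\<dots> = b * excess R z" by (simp add: real_sqrt_mult b_def excess_def d_def d'_def)
      finally show ?thesis using b by (simp add: divide_le_eq mult.commute)
    qed
    finally show ?thesis .
  qed
  ultimately show ?thesis by (simp add: b_def)
qed

lemma excess_lipschitz: assumes "0 < R" shows "\<bar>excess R y - excess R z\<bar> \<le> norm (y - z)"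
proof -
  have 1: "excess R a - excess R b \<le> norm (a - b)" for a b :: 'a
  proof -
    have "- (excess_grad R a \<bullet> (b - a)) \<le> norm (excess_grad R a) * norm (b - a)"
      using Cauchy_Schwarz_ineq2[of "excess_grad R a" "b - a"] by linarith
    also have "\<dots> \<le> 1 * norm (b - a)" using norm_excess_grad[OF assms] by (intro mult_right_mono) auto
    finally show ?thesis using excess_convex[OF assms, of a b] by (simp add: norm_minus_commute)
  qed
  show ?thesis using 1[of y z] 1[of z y] by (simp add: norm_minus_commute abs_le_iff)
qed

lemma excess_grad_inner: "0 < R \<Longrightarrow> (norm y > R \<Longrightarrow> 0 \<le> y \<bullet> g) \<Longrightarrow> 0 \<le> excess_grad R y \<bullet> g"
  using excess_ge_1[of R y] by (cases "norm y > R") (auto simp: excess_grad_def)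

text \<open>Formally, convexity bounds the second derivative of \<open>excess R (v x)\<close> below
  by \<open>excess_grad R (v x) \<bullet> a x\<close>. Second differences replace derivatives here:
  translation invariance moves them to \<phi>, and the subgradient inequality compares them
  pointwise before the limit.\<close>

lemma excess_laplace_dir:
  fixes v :: "'a::euclidean_space \<Rightarrow> 'b::euclidean_space"
  assumes R: "0 < R" and pd: "pder e v p" "pder e p a" and cv: "continuous_on UNIV v" "continuous_on UNIV a"
    and \<phi>: "pder e \<phi> \<phi>1" "pder e \<phi>1 \<phi>2" "continuous_on UNIV \<phi>" "continuous_on UNIV \<phi>2" "\<And>x. 0 \<le> \<phi> x"
    and S: "\<And>x. x \<notin> cball 0 r \<Longrightarrow> \<phi> x = 0 \<and> \<phi>2 x = 0" "0 \<le> r"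
  shows "(LINT x|lborel. \<phi> x * (excess_grad R (v x) \<bullet> a x)) \<le> (LINT x|lborel. excess R (v x) * \<phi>2 x)"
proof -
  define h where "h n = inverse (real (Suc n))" for n
  have h: "0 < h n" "h n \<le> 1" for n by (auto simp: h_def field_simps)
  have hl: "h \<longlonglongrightarrow> 0" unfolding h_def by (rule LIMSEQ_inverse_real_of_nat)
  define \<rho> where "\<rho> = r + norm e"
  define B where "B = cball (0::'a) (\<rho> + norm e)"
  have cB: "compact B" by (simp add: B_def)
  define w where "w x = excess R (v x)" for x
  define s where "s x = excess_grad R (v x)" for x
  have cw: "continuous_on UNIV w" unfolding w_def by (rule continuous_on_compose2[OF continuous_excess cv(1)]) auto
  have cs: "continuous_on UNIV s" unfolding s_def by (rule continuous_on_compose2[OF continuous_excess_grad[OF R] cv(1)]) auto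
  define DD where "DD n f x = (f (x + h n *\<^sub>R e) + f (x - h n *\<^sub>R e) - 2 * f x) / (h n)\<^sup>2" for n and f :: "'a \<Rightarrow> real" and x
  have cDD: "continuous_on UNIV (DD n f)" if "continuous_on UNIV f" for n f
    unfolding DD_def using h(1)[of n] by (intro continuous_intros continuous_on_compose2[OF that]) auto
  have he: "norm (t *\<^sub>R e) \<le> norm e" if "\<bar>t\<bar> \<le> h n" for t n
  proof -
    have "\<bar>t\<bar> \<le> 1" using that h(2)[of n] by linarith
    then show ?thesis using mult_right_mono[of "\<bar>t\<bar>" 1 "norm e"] by simp
  qed
  have out: "x + t *\<^sub>R e \<notin> cball 0 r" if "x \<notin> cball 0 \<rho>" "\<bar>t\<bar> \<le> h n" for x t n
  proof -
    have "norm x \<le> norm (x + t *\<^sub>R e) + norm (t *\<^sub>R e)" using norm_triangle_ineq4[of "x + t *\<^sub>R e" "t *\<^sub>R e"] by simp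
    then show ?thesis using that he[OF that(2)] by (simp add: \<rho>_def)
  qed
  have DD\<phi>_out: "DD n \<phi> x = 0" if "x \<notin> cball 0 \<rho>" for n x
    using S(1) out[OF that, of "h n" n] out[OF that, of "- h n" n] out[OF that, of 0 n] h(1)[of n] by (simp add: DD_def)
  obtain M2 where M2: "0 < M2" "\<And>x. x \<in> B \<Longrightarrow> \<bar>\<phi>2 x\<bar> \<le> M2"
  proof -
    have "bounded (\<phi>2 ` B)" using \<phi>(4) cB by (intro compact_imp_bounded compact_continuous_image) (auto intro: continuous_on_subset)
    then show ?thesis using that unfolding bounded_pos by auto
  qed
  obtain Ma where Ma: "0 < Ma" "\<And>x. x \<in> B \<Longrightarrow> norm (a x) \<le> Ma"
  proof -
    have "bounded (a ` B)" using cv(2) cB by (intro compact_imp_bounded compact_continuous_image) (auto intro: continuous_on_subset)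
    then show ?thesis using that unfolding bounded_pos by auto
  qed
  have inB: "x + t *\<^sub>R e \<in> B" if "x \<in> cball 0 \<rho>" "\<bar>t\<bar> \<le> h n" for x t n
    using that he[OF that(2)] norm_triangle_ineq[of x "t *\<^sub>R e"] by (simp add: B_def)
  have r\<rho>: "cball (0::'a) r \<subseteq> cball 0 \<rho>" "cball (0::'a) \<rho> \<subseteq> B" unfolding \<rho>_def B_def by (intro subset_cball; simp)+
  have DD\<phi>_le: "\<bar>w x * DD n \<phi> x\<bar> \<le> indicator B x *\<^sub>R (\<bar>w x\<bar> * M2)" for n x
  proof (cases "x \<in> cball 0 \<rho>")
    case True
    obtain t where t: "\<bar>t\<bar> \<le> h n" "\<phi> (x + h n *\<^sub>R e) + \<phi> (x - h n *\<^sub>R e) - 2 * \<phi> x = (h n)\<^sup>2 * \<phi>2 (x + t *\<^sub>R e)"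
      using second_difference[OF \<phi>(1,2) h(1)] by blast
    have "DD n \<phi> x = \<phi>2 (x + t *\<^sub>R e)" unfolding DD_def t(2) using h(1)[of n] by simp
    then have "\<bar>DD n \<phi> x\<bar> \<le> M2" using M2(2)[OF inB[OF True t(1)]] by simp
    moreover have "x \<in> B" using True r\<rho>(2) by blast
    ultimately show ?thesis by (simp add: abs_mult mult_left_mono)
  next
    case False
    then show ?thesis using DD\<phi>_out M2 by (auto simp: indicator_def)
  qed
  have int_w: "integrable lborel (\<lambda>x. w x * f x)" if "continuous_on UNIV f" "\<And>x. x \<notin> cball 0 \<rho> \<Longrightarrow> f x = 0" for f
    by (rule integrable_continuous_compact_support[of _ "cball 0 \<rho>"]) (use that cw in \<open>auto intro!: continuous_intros\<close>)
  have lim1: "(\<lambda>n. LINT x|lborel. w x * DD n \<phi> x) \<longlonglongrightarrow> (LINT x|lborel. w x * \<phi>2 x)"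
  proof (rule integral_dominated_convergence[where w = "\<lambda>x. indicator B x *\<^sub>R (\<bar>w x\<bar> * M2)"])
    show "(\<lambda>x. w x * \<phi>2 x) \<in> borel_measurable lborel" "(\<lambda>x. w x * DD n \<phi> x) \<in> borel_measurable lborel" for n
      using borel_measurable_continuous_onI[OF continuous_on_mult[OF cw \<phi>(4)]]
        borel_measurable_continuous_onI[OF continuous_on_mult[OF cw cDD[OF \<phi>(3)]]] by auto
    show "integrable lborel (\<lambda>x. indicator B x *\<^sub>R (\<bar>w x\<bar> * M2))"
      using cw cB by (intro borel_integrable_compact continuous_intros) (auto intro: continuous_on_subset)
    show "AE x in lborel. (\<lambda>n. w x * DD n \<phi> x) \<longlonglongrightarrow> w x * \<phi>2 x"
      unfolding DD_def by (intro AE_I2 tendsto_mult tendsto_const tendsto_second_difference[OF \<phi>(1,2,4) h(1) hl])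
    show "AE x in lborel. norm (w x * DD n \<phi> x) \<le> indicator B x *\<^sub>R (\<bar>w x\<bar> * M2)" for n
      using DD\<phi>_le by (intro AE_I2) simp
  qed
  have pds: "pder e (\<lambda>x. s y \<bullet> v x) (\<lambda>x. s y \<bullet> p x)" "pder e (\<lambda>x. s y \<bullet> p x) (\<lambda>x. s y \<bullet> a x)" for y
    using pder_inner[OF pder_const pd(1), of "s y"] pder_inner[OF pder_const pd(2), of "s y"] by simp_all
  \<comment> \<open>The second difference of \<open>v\<close> is paired with the slope frozen at the
    centre point, as the subgradient inequality demands.\<close>
  define Ds where "Ds n y = DD n (\<lambda>x. s y \<bullet> v x) y" for n y
  have cDs: "continuous_on UNIV (Ds n)" for n
    unfolding Ds_def DD_def using h(1)[of n] by (intro continuous_intros cs continuous_on_compose2[OF cv(1)] cv(1)) auto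
  have Ds_le: "\<bar>\<phi> x * Ds n x\<bar> \<le> indicator B x *\<^sub>R (\<bar>\<phi> x\<bar> * Ma)" for n x
  proof (cases "x \<in> cball 0 \<rho>")
    case True
    obtain t where t: "\<bar>t\<bar> \<le> h n" "s x \<bullet> v (x + h n *\<^sub>R e) + s x \<bullet> v (x - h n *\<^sub>R e) - 2 * (s x \<bullet> v x) = (h n)\<^sup>2 * (s x \<bullet> a (x + t *\<^sub>R e))"
      using second_difference[OF pds h(1)] by blast
    have "Ds n x = s x \<bullet> a (x + t *\<^sub>R e)" unfolding Ds_def DD_def t(2) using h(1)[of n] by simp
    also have "\<bar>\<dots>\<bar> \<le> norm (s x) * norm (a (x + t *\<^sub>R e))" by (rule Cauchy_Schwarz_ineq2)
    also have "\<dots> \<le> 1 * Ma" using norm_excess_grad[OF R] Ma(2)[OF inB[OF True t(1)]] by (intro mult_mono) (auto simp: s_def)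
    finally have "\<bar>Ds n x\<bar> \<le> Ma" by simp
    moreover have "x \<in> B" using True r\<rho>(2) by blast
    ultimately show ?thesis by (simp add: abs_mult mult_left_mono)
  next
    case False
    then have "\<phi> x = 0" using S(1) r\<rho>(1) by blast
    then show ?thesis by simp
  qed
  have lim2: "(\<lambda>n. LINT x|lborel. \<phi> x * Ds n x) \<longlonglongrightarrow> (LINT x|lborel. \<phi> x * (s x \<bullet> a x))"
  proof (rule integral_dominated_convergence[where w = "\<lambda>x. indicator B x *\<^sub>R (\<bar>\<phi> x\<bar> * Ma)"])
    show "(\<lambda>x. \<phi> x * (s x \<bullet> a x)) \<in> borel_measurable lborel" "(\<lambda>x. \<phi> x * Ds n x) \<in> borel_measurable lborel" for n
      using borel_measurable_continuous_onI[OF continuous_on_mult[OF \<phi>(3) continuous_on_inner[OF cs cv(2)]]]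
        borel_measurable_continuous_onI[OF continuous_on_mult[OF \<phi>(3) cDs]] by auto
    show "integrable lborel (\<lambda>x. indicator B x *\<^sub>R (\<bar>\<phi> x\<bar> * Ma))"
      using \<phi>(3) cB by (intro borel_integrable_compact continuous_intros) (auto intro: continuous_on_subset)
    show "AE x in lborel. (\<lambda>n. \<phi> x * Ds n x) \<longlonglongrightarrow> \<phi> x * (s x \<bullet> a x)"
      unfolding Ds_def DD_def
      by (intro AE_I2 tendsto_mult tendsto_const tendsto_second_difference[OF pds _ h(1) hl] continuous_intros cv(2))
    show "AE x in lborel. norm (\<phi> x * Ds n x) \<le> indicator B x *\<^sub>R (\<bar>\<phi> x\<bar> * Ma)" for n
      using Ds_le by (intro AE_I2) simp
  qed
  have main: "(LINT x|lborel. \<phi> x * Ds n x) \<le> (LINT x|lborel. w x * DD n \<phi> x)" for n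
  proof -
    define k where "k = h n"
    have k: "0 < k" using h(1) by (simp add: k_def)
    have c\<phi>p: "continuous_on UNIV (\<lambda>x. \<phi> (x + k *\<^sub>R e))" and c\<phi>m: "continuous_on UNIV (\<lambda>x. \<phi> (x - k *\<^sub>R e))"
      by (intro continuous_on_compose2[OF \<phi>(3)] continuous_intros; simp)+
    have cwp: "continuous_on UNIV (\<lambda>x. w (x + k *\<^sub>R e))" and cwm: "continuous_on UNIV (\<lambda>x. w (x - k *\<^sub>R e))"
      by (intro continuous_on_compose2[OF cw] continuous_intros; simp)+
    have i\<phi>: "integrable lborel (\<lambda>x. f x * \<phi> x)" if "continuous_on UNIV f" for f :: "'a \<Rightarrow> real"
      by (rule integrable_continuous_compact_support[of _ "cball 0 r"]) (use that \<phi>(3) S(1) in \<open>auto intro!: continuous_intros\<close>)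
    have iw: "integrable lborel (\<lambda>x. w x * \<phi> (x + k *\<^sub>R e))" "integrable lborel (\<lambda>x. w x * \<phi> (x - k *\<^sub>R e))" "integrable lborel (\<lambda>x. w x * \<phi> x)"
    proof -
      show "integrable lborel (\<lambda>x. w x * \<phi> (x + k *\<^sub>R e))"
        by (rule int_w[OF c\<phi>p]) (use out[of _ "h n" n] h(1)[of n] S(1) in \<open>auto simp: k_def\<close>)
      show "integrable lborel (\<lambda>x. w x * \<phi> (x - k *\<^sub>R e))"
        by (rule int_w[OF c\<phi>m]) (use out[of _ "- h n" n] h(1)[of n] S(1) in \<open>auto simp: k_def\<close>)
      show "integrable lborel (\<lambda>x. w x * \<phi> x)" by (rule i\<phi>[OF cw])
    qed
    have tr1: "(LINT x|lborel. w x * \<phi> (x + k *\<^sub>R e)) = (LINT x|lborel. w (x - k *\<^sub>R e) * \<phi> x)"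
      using integral_lborel_translation[of "\<lambda>x. w (x - k *\<^sub>R e) * \<phi> x" "k *\<^sub>R e"]
        borel_measurable_continuous_onI[OF continuous_on_mult[OF cwm \<phi>(3)]] by simp
    have tr2: "(LINT x|lborel. w x * \<phi> (x - k *\<^sub>R e)) = (LINT x|lborel. w (x + k *\<^sub>R e) * \<phi> x)"
      using integral_lborel_translation[of "\<lambda>x. w (x + k *\<^sub>R e) * \<phi> x" "- (k *\<^sub>R e)"]
        borel_measurable_continuous_onI[OF continuous_on_mult[OF cwp \<phi>(3)]] by simp
    have "(LINT x|lborel. w x * DD n \<phi> x) = (LINT x|lborel. (w x * \<phi> (x + k *\<^sub>R e) + w x * \<phi> (x - k *\<^sub>R e) - 2 * (w x * \<phi> x)) / k\<^sup>2)"
      by (simp add: DD_def k_def algebra_simps)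
    also have "\<dots> = ((LINT x|lborel. w x * \<phi> (x + k *\<^sub>R e)) + (LINT x|lborel. w x * \<phi> (x - k *\<^sub>R e)) - 2 * (LINT x|lborel. w x * \<phi> x)) / k\<^sup>2"
      using iw by simp
    also have "\<dots> = (LINT x|lborel. (w (x - k *\<^sub>R e) * \<phi> x + w (x + k *\<^sub>R e) * \<phi> x - 2 * (w x * \<phi> x)) / k\<^sup>2)"
      unfolding tr1 tr2 using i\<phi>[OF cwm] i\<phi>[OF cwp] i\<phi>[OF cw] by simp
    also have "\<dots> \<ge> (LINT x|lborel. \<phi> x * Ds n x)"
    proof (rule integral_mono)
      show "integrable lborel (\<lambda>x. \<phi> x * Ds n x)" using i\<phi>[OF cDs] by (simp add: mult.commute)
      show "integrable lborel (\<lambda>x. (w (x - k *\<^sub>R e) * \<phi> x + w (x + k *\<^sub>R e) * \<phi> x - 2 * (w x * \<phi> x)) / k\<^sup>2)"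
        using i\<phi>[OF cwm] i\<phi>[OF cwp] i\<phi>[OF cw] by simp
      fix x
      have "s x \<bullet> v (x + k *\<^sub>R e) + s x \<bullet> v (x - k *\<^sub>R e) - 2 * (s x \<bullet> v x) \<le> w (x - k *\<^sub>R e) + w (x + k *\<^sub>R e) - 2 * w x"
        using excess_convex[OF R, of "v x" "v (x + k *\<^sub>R e)"] excess_convex[OF R, of "v x" "v (x - k *\<^sub>R e)"]
        by (simp add: w_def s_def inner_diff_right)
      then have "\<phi> x * (s x \<bullet> v (x + k *\<^sub>R e) + s x \<bullet> v (x - k *\<^sub>R e) - 2 * (s x \<bullet> v x)) / k\<^sup>2 \<le> \<phi> x * (w (x - k *\<^sub>R e) + w (x + k *\<^sub>R e) - 2 * w x) / k\<^sup>2"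
        using \<phi>(5) by (intro divide_right_mono mult_left_mono) auto
      then show "\<phi> x * Ds n x \<le> (w (x - k *\<^sub>R e) * \<phi> x + w (x + k *\<^sub>R e) * \<phi> x - 2 * (w x * \<phi> x)) / k\<^sup>2"
        by (simp add: Ds_def DD_def k_def algebra_simps)
    qed
    finally show ?thesis .
  qed
  show ?thesis using LIMSEQ_le[OF lim2 lim1] main by (auto simp: w_def s_def)
qed

lemma ddir_ddir_reflect:
  assumes "bumps 0 r \<kappa>"
  shows "ddir v (ddir v (\<lambda>y. \<kappa> (x - y))) y = ddir v (ddir v \<kappa>) (x - y)"
proof -
  have "ddir v (\<lambda>y. \<kappa> (x - y)) = (\<lambda>y. (- 1) * ddir v \<kappa> (x - y))"
    using ddir_reflect[OF assms] by auto
  moreover have b: "bumps 0 r (\<lambda>z. (- 1) * ddir v \<kappa> z)" by (intro bumps.scale bumps_ddir assms)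
  have "ddir v (\<lambda>y. (- 1) * ddir v \<kappa> (x - y)) y = - ddir v (\<lambda>z. (- 1) * ddir v \<kappa> z) (x - y)"
    using ddir_reflect[OF b] by simp
  moreover have "frechet_derivative (\<lambda>z. (- 1) * ddir v \<kappa> z) (at w) = (\<lambda>h. (- 1) * frechet_derivative (ddir v \<kappa>) (at w) h)" for w
    by (rule frechet_derivative_at[symmetric]) (intro has_derivative_mult_right bumps_has_derivative[OF bumps_ddir[OF assms]])
  ultimately show ?thesis by simp
qed

lemma conv_measurable:
  fixes F :: "'a::euclidean_space \<Rightarrow> 'b::euclidean_space"
  assumes "0 < \<delta>" "integrable lebesgue F"
  shows "conv (moll \<delta>) F \<in> borel_measurable lebesgue" "continuous_on UNIV (conv (moll \<delta>) F)"
proof -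
  obtain M where M: "\<And>x::'a. \<bar>moll \<delta> x\<bar> \<le> M" using bumps_bounded[OF moll_bumps] assms(1) by (metis less_imp_le)
  show "continuous_on UNIV (conv (moll \<delta>) F)" by (rule conv_continuous[OF bumps_continuous[OF moll_bumps] M assms(2)])
  show "conv (moll \<delta>) F \<in> borel_measurable lebesgue" using conv_moll_L1(1)[OF assms] by auto
qed

text \<open>For a mollified solution the inequality follows from \<open>excess_laplace_dir\<close>
  and the equation. Letting its mollification scale tend to 0 leaves a term with the sign of
  \<open>y \<bullet> \<nabla>V(y)\<close> outside the ball of radius \<open>R\<close>, whereas the
  scale \<tau> of the test kernel stays fixed.\<close>

lemma excess_subharmonic:
  fixes u :: "real^2 \<Rightarrow> real^'k"
  assumes ac: "allen_cahn_solution \<Omega> V \<epsilon> u" and \<epsilon>: "0 < \<epsilon>" and R: "0 < R" "\<And>y. norm y > R \<Longrightarrow> 0 \<le> y \<bullet> grad V y"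
    and K: "K \<subseteq> \<Omega>" "compact K" "open \<Omega>" and \<tau>: "0 < \<tau>" "0 < \<delta>0" "cball x (\<tau> + \<delta>0) \<subseteq> K"
  shows "0 \<le> conv (ddir (ax 1) (ddir (ax 1) (moll \<tau>))) (rs K (\<lambda>y. excess R (u y))) x
    + conv (ddir (ax 2) (ddir (ax 2) (moll \<tau>))) (rs K (\<lambda>y. excess R (u y))) x"
proof -
  define U where "U = rs K u"
  define F where "F = rs K (\<lambda>y. grad V (u y))"
  obtain G where wg: "has_weak_gradient \<Omega> u G" using ac by (auto simp: allen_cahn_solution_def H1_on_def)
  have iU: "integrable lebesgue U" using wg K unfolding U_def by (auto simp: has_weak_gradient_def intro!: integrable_rs)
  have iF: "integrable lebesgue F" using ac K unfolding F_def by (auto simp: allen_cahn_solution_def intro!: integrable_rs)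
  define \<phi> where "\<phi> y = moll \<tau> (x - y)" for y
  have b: "bumps x (\<tau>\<^sup>2) \<phi>" unfolding \<phi>_def by (rule moll_translate_bumps)
  have bd: "bumps 0 (\<tau>\<^sup>2) (ddir (ax j) (ddir (ax j) (moll \<tau>)))" for j by (intro bumps_ddir moll_bumps)
  have bd\<phi>: "bumps x (\<tau>\<^sup>2) (ddir (ax j) (ddir (ax j) \<phi>))" for j by (intro bumps_ddir b)
  have \<phi>dd: "ddir (ax j) (ddir (ax j) \<phi>) y = ddir (ax j) (ddir (ax j) (moll \<tau>)) (x - y)" for j y
    unfolding \<phi>_def by (rule ddir_ddir_reflect[OF moll_bumps])
  define \<Delta> where "\<Delta> y = ddir (ax 1) (ddir (ax 1) \<phi>) y + ddir (ax 2) (ddir (ax 2) \<phi>) y" for y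
  have b\<Delta>: "bumps x (\<tau>\<^sup>2) \<Delta>" unfolding \<Delta>_def by (intro bumps.add bd\<phi>)
  obtain M where M: "0 < M" "\<And>y. \<bar>\<Delta> y\<bar> \<le> M" using bumps_bounded[OF b\<Delta>] \<tau>(1) by (metis less_imp_le)
  obtain M\<phi> where M\<phi>: "0 < M\<phi>" "\<And>y. \<bar>\<phi> y\<bar> \<le> M\<phi>" using bumps_bounded[OF b] \<tau>(1) by (metis less_imp_le)
  have out: "f y = 0" if "bumps x (\<tau>\<^sup>2) f" "y \<notin> cball x \<tau>" for f y
    using bumps_outside[OF that(1) _ that(2)] \<tau>(1) by simp
  have cxK: "cball x \<tau> \<subseteq> K" using \<tau> by (intro subset_trans[OF _ \<tau>(3)] subset_cball) simp
  define \<delta> where "\<delta> n = \<delta>0 / real (Suc n)" for n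
  have \<delta>: "0 < \<delta> n" "\<delta> n \<le> \<delta>0" for n using \<tau>(2) by (auto simp: \<delta>_def field_simps)
  have \<delta>l: "\<delta> \<longlonglongrightarrow> 0" unfolding \<delta>_def by (rule LIMSEQ_Suc[OF lim_const_over_n])
  obtain \<sigma> where \<sigma>: "strict_mono \<sigma>" "AE y in lebesgue. (\<lambda>n. conv (moll (\<delta> (\<sigma> n))) U y) \<longlonglongrightarrow> U y"
    by (rule conv_moll_AE_subseq[OF iU \<delta>(1) \<delta>l])
  define d where "d n = \<delta> (\<sigma> n)" for n
  have d: "0 < d n" "d n \<le> \<delta>0" for n using \<delta> by (auto simp: d_def)
  have dl: "d \<longlonglongrightarrow> 0" using LIMSEQ_subseq_LIMSEQ[OF \<delta>l \<sigma>(1)] unfolding d_def[abs_def] o_def .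
  define v where "v n = conv (moll (d n)) U" for n
  define f where "f n = conv (moll (d n)) F" for n
  have vl: "AE y in lebesgue. (\<lambda>n. v n y) \<longlonglongrightarrow> U y" using \<sigma>(2) by (simp add: v_def d_def)
  note cm_v = conv_measurable[OF d(1) iU, folded v_def] and cm_f = conv_measurable[OF d(1) iF, folded f_def]
  have Um: "U \<in> borel_measurable lebesgue" and Fm: "F \<in> borel_measurable lebesgue" using iU iF by auto
  have em: "excess R \<in> borel_measurable borel" "excess_grad R \<in> borel_measurable (borel :: (real^'k) measure)"
    by (rule borel_measurable_continuous_onI[OF continuous_excess])
      (rule borel_measurable_continuous_onI[OF continuous_excess_grad[OF R(1)]])
  have contm: "f \<in> borel_measurable lebesgue" if "continuous_on UNIV f" for f :: "real^2 \<Rightarrow> real"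
    using borel_measurable_continuous_onI[OF that] by (intro measurable_completion) simp
  have \<Delta>m: "\<Delta> \<in> borel_measurable lebesgue" "\<phi> \<in> borel_measurable lebesgue"
    using contm bumps_continuous[OF b\<Delta>] bumps_continuous[OF b] by auto
  have i\<Delta>: "integrable lebesgue \<Delta>"
    using integrable_bumps[OF b\<Delta>] \<tau>(1) lebesgue_integral_borel(2)[OF borel_measurable_continuous_onI[OF bumps_continuous[OF b\<Delta>]]] by simp
  have bnd: "integrable lebesgue (\<lambda>y. excess R (w y) * \<Delta> y)" if w: "integrable lebesgue w" for w :: "real^2 \<Rightarrow> real^'k"
  proof (rule Bochner_Integration.integrable_bound)
    show "integrable lebesgue (\<lambda>y. \<bar>\<Delta> y\<bar> + norm (w y) * M)" using i\<Delta> w by simp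
    show "(\<lambda>y. excess R (w y) * \<Delta> y) \<in> borel_measurable lebesgue"
      using measurable_compose[OF borel_measurable_integrable[OF w] em(1)] \<Delta>m(1) by (intro borel_measurable_times)
    show "AE y in lebesgue. norm (excess R (w y) * \<Delta> y) \<le> norm (\<bar>\<Delta> y\<bar> + norm (w y) * M)"
    proof (rule AE_I2)
      fix y
      have "\<bar>excess R (w y) * \<Delta> y\<bar> = excess R (w y) * \<bar>\<Delta> y\<bar>" using excess_ge_1[of R "w y"] by (simp add: abs_mult)
      also have "\<dots> \<le> (1 + norm (w y)) * \<bar>\<Delta> y\<bar>" using excess_le[OF R(1)] by (intro mult_right_mono) auto
      also have "\<dots> \<le> \<bar>\<Delta> y\<bar> + norm (w y) * M" using M(2)[of y] by (simp add: distrib_right mult_left_mono)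
      finally show "norm (excess R (w y) * \<Delta> y) \<le> norm (\<bar>\<Delta> y\<bar> + norm (w y) * M)" using M(1) by simp
    qed
  qed
  have step: "(LINT y|lebesgue. \<phi> y * (excess_grad R (v n y) \<bullet> ((1 / \<epsilon>\<^sup>2) *\<^sub>R f n y))) \<le> (LINT y|lebesgue. excess R (v n y) * \<Delta> y)" for n
  proof -
    let ?a = "\<lambda>j. conv (ddir (ax j) (ddir (ax j) (moll (d n)))) U"
    have bk: "bumps 0 ((d n)\<^sup>2) (moll (d n) :: real^2 \<Rightarrow> real)" by (rule moll_bumps)
    have d0: "0 \<le> d n" using d(1)[of n] by simp
    have ca: "continuous_on UNIV (?a j)" for j
    proof -
      have "bumps 0 ((d n)\<^sup>2) (ddir (ax j) (ddir (ax j) (moll (d n))))" by (intro bumps_ddir bk)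
      then obtain B where "\<And>z. \<bar>ddir (ax j) (ddir (ax j) (moll (d n))) z\<bar> \<le> B" using bumps_bounded[OF _ d0] by metis
      then show ?thesis by (intro conv_continuous[OF bumps_continuous[OF bumps_ddir[OF bumps_ddir[OF bk]]] _ iU])
    qed
    have 1: "(LINT y|lborel. \<phi> y * (excess_grad R (v n y) \<bullet> ?a j y)) \<le> (LINT y|lborel. excess R (v n y) * ddir (ax j) (ddir (ax j) \<phi>) y)" for j
    proof (rule excess_laplace_dir[OF R(1)])
      show "pder (ax j) (v n) (conv (ddir (ax j) (moll (d n))) U)" unfolding v_def by (rule conv_pder[OF bk d0 iU])
      show "pder (ax j) (conv (ddir (ax j) (moll (d n))) U) (?a j)" by (rule conv_pder[OF bumps_ddir[OF bk] d0 iU])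
      show "continuous_on UNIV (v n)" by (rule cm_v(2))
      show "continuous_on UNIV (?a j)" by (rule ca)
      show "pder (ax j) \<phi> (ddir (ax j) \<phi>)" "pder (ax j) (ddir (ax j) \<phi>) (ddir (ax j) (ddir (ax j) \<phi>))"
        by (intro bumps_pder[OF b] bumps_pder[OF bumps_ddir[OF b]])+
      show "continuous_on UNIV \<phi>" "continuous_on UNIV (ddir (ax j) (ddir (ax j) \<phi>))"
        by (intro bumps_continuous[OF b] bumps_continuous[OF bd\<phi>])+
      show "0 \<le> \<phi> y" for y unfolding \<phi>_def by (rule moll_nonneg[OF \<tau>(1)])
      show "\<phi> y = 0 \<and> ddir (ax j) (ddir (ax j) \<phi>) y = 0" if "y \<notin> cball 0 (norm x + \<tau>)" for y
      proof -
        have "y \<notin> cball x \<tau>" using that norm_triangle_ineq2[of y x] by (auto simp: dist_norm norm_minus_commute)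
        then show ?thesis using out[OF b] out[OF bd\<phi>] by blast
      qed
      show "0 \<le> norm x + \<tau>" using \<tau>(1) by simp
    qed
    have cs: "continuous_on UNIV (\<lambda>y. excess_grad R (v n y))" "continuous_on UNIV (\<lambda>y. excess R (v n y))"
      by (intro continuous_on_compose2[OF continuous_excess_grad[OF R(1)] cm_v(2)] continuous_on_compose2[OF continuous_excess cm_v(2)] subset_UNIV)+
    have i1: "integrable lborel (\<lambda>y. \<phi> y * (excess_grad R (v n y) \<bullet> ?a j y))" for j
      by (rule integrable_continuous_compact_support[OF _ compact_cball[of x \<tau>]])
        (use out[OF b] in \<open>auto intro!: continuous_intros cs ca bumps_continuous[OF b]\<close>)
    have i2: "integrable lborel (\<lambda>y. excess R (v n y) * ddir (ax j) (ddir (ax j) \<phi>) y)" for j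
      by (rule integrable_continuous_compact_support[OF _ compact_cball[of x \<tau>]])
        (use out[OF bd\<phi>] in \<open>auto intro!: continuous_intros cs bumps_continuous[OF bd\<phi>]\<close>)
    have eqf: "\<phi> y * (excess_grad R (v n y) \<bullet> ((1 / \<epsilon>\<^sup>2) *\<^sub>R f n y)) = \<phi> y * (excess_grad R (v n y) \<bullet> ?a 1 y) + \<phi> y * (excess_grad R (v n y) \<bullet> ?a 2 y)" for y
    proof (cases "y \<in> cball x \<tau>")
      case True
      have "cball y (d n) \<subseteq> K"
      proof
        fix z assume "z \<in> cball y (d n)"
        then have "dist x z \<le> \<tau> + \<delta>0" using True d(2)[of n] dist_triangle[of x z y] by simp
        then show "z \<in> K" using \<tau>(3) by auto
      qed
      from allen_cahn_conv[OF ac bk d0 this K(1,2,3)]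
      have "(1 / \<epsilon>\<^sup>2) *\<^sub>R f n y = ?a 1 y + ?a 2 y" by (simp add: f_def F_def U_def)
      then show ?thesis by (simp only: inner_add_right distrib_left)
    next
      case False
      then show ?thesis using out[OF b] by simp
    qed
    have "(LINT y|lebesgue. \<phi> y * (excess_grad R (v n y) \<bullet> ((1 / \<epsilon>\<^sup>2) *\<^sub>R f n y))) = (LINT y|lborel. \<phi> y * (excess_grad R (v n y) \<bullet> ((1 / \<epsilon>\<^sup>2) *\<^sub>R f n y)))"
      by (intro lebesgue_integral_borel borel_measurable_continuous_onI continuous_intros cs bumps_continuous[OF b] cm_f(2))
    also have "\<dots> = (LINT y|lborel. \<phi> y * (excess_grad R (v n y) \<bullet> ?a 1 y)) + (LINT y|lborel. \<phi> y * (excess_grad R (v n y) \<bullet> ?a 2 y))"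
      unfolding eqf using i1 by simp
    also have "\<dots> \<le> (LINT y|lborel. excess R (v n y) * ddir (ax 1) (ddir (ax 1) \<phi>) y) + (LINT y|lborel. excess R (v n y) * ddir (ax 2) (ddir (ax 2) \<phi>) y)"
      by (intro add_mono 1)
    also have "\<dots> = (LINT y|lborel. excess R (v n y) * \<Delta> y)"
      unfolding \<Delta>_def distrib_left using i2 by simp
    also have "\<dots> = (LINT y|lebesgue. excess R (v n y) * \<Delta> y)"
      by (intro lebesgue_integral_borel[symmetric] borel_measurable_continuous_onI continuous_intros cs bumps_continuous[OF b\<Delta>])
    finally show ?thesis .
  qed
  have iv: "integrable lebesgue (v n)" "integrable lebesgue (f n)" for n
    unfolding v_def f_def using conv_moll_L1(1)[OF d(1)] iU iF by auto
  have limR: "(\<lambda>n. LINT y|lebesgue. excess R (v n y) * \<Delta> y) \<longlonglongrightarrow> (LINT y|lebesgue. excess R (U y) * \<Delta> y)"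
  proof (rule LIM_zero_cancel, rule Lim_null_comparison)
    show "(\<lambda>n. M * (LINT y|lebesgue. norm (v n y - U y))) \<longlonglongrightarrow> 0"
      using tendsto_mult_right_zero[OF conv_moll_tendsto_L1[OF iU d(1) dl], of M] by (simp add: v_def)
    show "\<forall>\<^sub>F n in sequentially. norm ((LINT y|lebesgue. excess R (v n y) * \<Delta> y) - (LINT y|lebesgue. excess R (U y) * \<Delta> y)) \<le> M * (LINT y|lebesgue. norm (v n y - U y))"
    proof (intro always_eventually allI)
      fix n
      have "(LINT y|lebesgue. excess R (v n y) * \<Delta> y) - (LINT y|lebesgue. excess R (U y) * \<Delta> y) = (LINT y|lebesgue. excess R (v n y) * \<Delta> y - excess R (U y) * \<Delta> y)"
        using bnd iv iU by simp
      also have "norm \<dots> \<le> (LINT y|lebesgue. M * norm (v n y - U y))"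
      proof (rule Bochner_Integration.integral_norm_bound_integral)
        fix y
        have "norm (excess R (v n y) * \<Delta> y - excess R (U y) * \<Delta> y) = \<bar>excess R (v n y) - excess R (U y)\<bar> * \<bar>\<Delta> y\<bar>"
          by (simp add: abs_mult[symmetric] left_diff_distrib)
        also have "\<dots> \<le> norm (v n y - U y) * M" by (intro mult_mono excess_lipschitz[OF R(1)] M) auto
        finally show "norm (excess R (v n y) * \<Delta> y - excess R (U y) * \<Delta> y) \<le> M * norm (v n y - U y)" by (simp add: mult.commute)
      qed (use bnd iv iU in auto)
      finally show "norm ((LINT y|lebesgue. excess R (v n y) * \<Delta> y) - (LINT y|lebesgue. excess R (U y) * \<Delta> y)) \<le> M * (LINT y|lebesgue. norm (v n y - U y))"
        by simp
    qed
  qed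
  have sgm: "(\<lambda>y. excess_grad R (w y)) \<in> borel_measurable lebesgue" if "w \<in> borel_measurable lebesgue" for w :: "real^2 \<Rightarrow> real^'k"
    using measurable_compose[OF that em(2)] .
  have ibL: "integrable lebesgue (\<lambda>y. \<phi> y * (excess_grad R (w y) \<bullet> g y))"
    and bL: "norm (\<phi> y * (excess_grad R (w y) \<bullet> g y)) \<le> M\<phi> * norm (g y)"
    if g: "integrable lebesgue g" and w: "w \<in> borel_measurable lebesgue" for g w :: "real^2 \<Rightarrow> real^'k" and y
  proof -
    have le: "norm (\<phi> y * (excess_grad R (w y) \<bullet> g y)) \<le> M\<phi> * norm (g y)" for y
    proof -
      have "\<bar>excess_grad R (w y) \<bullet> g y\<bar> \<le> norm (excess_grad R (w y)) * norm (g y)" by (rule Cauchy_Schwarz_ineq2)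
      also have "\<dots> \<le> 1 * norm (g y)" by (intro mult_right_mono norm_excess_grad R) simp
      finally show ?thesis unfolding real_norm_def abs_mult using M\<phi> by (intro mult_mono) auto
    qed
    then show "norm (\<phi> y * (excess_grad R (w y) \<bullet> g y)) \<le> M\<phi> * norm (g y)" .
    show "integrable lebesgue (\<lambda>y. \<phi> y * (excess_grad R (w y) \<bullet> g y))"
    proof (rule Bochner_Integration.integrable_bound)
      show "integrable lebesgue (\<lambda>y. M\<phi> * norm (g y))" using g by simp
      show "(\<lambda>y. \<phi> y * (excess_grad R (w y) \<bullet> g y)) \<in> borel_measurable lebesgue"
        by (intro borel_measurable_times borel_measurable_inner sgm w \<Delta>m borel_measurable_integrable g)
      show "AE y in lebesgue. norm (\<phi> y * (excess_grad R (w y) \<bullet> g y)) \<le> norm (M\<phi> * norm (g y))"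
        by (intro AE_I2 order_trans[OF le abs_ge_self[THEN order_trans]]) simp
    qed
  qed
  \<comment> \<open>Both factors vary with \<open>n\<close>. The slope is bounded and converges
    almost everywhere, so dominated convergence applies against the fixed \<open>F\<close>;
    replacing \<open>f n\<close> by \<open>F\<close> costs an L1 error.\<close>
  have limL: "(\<lambda>n. LINT y|lebesgue. \<phi> y * (excess_grad R (v n y) \<bullet> f n y)) \<longlonglongrightarrow> (LINT y|lebesgue. \<phi> y * (excess_grad R (U y) \<bullet> F y))"
  proof -
    have A: "(\<lambda>n. LINT y|lebesgue. \<phi> y * (excess_grad R (v n y) \<bullet> F y)) \<longlonglongrightarrow> (LINT y|lebesgue. \<phi> y * (excess_grad R (U y) \<bullet> F y))"
    proof (rule integral_dominated_convergence[where w = "\<lambda>y. M\<phi> * norm (F y)"])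
      show "AE y in lebesgue. (\<lambda>n. \<phi> y * (excess_grad R (v n y) \<bullet> F y)) \<longlonglongrightarrow> \<phi> y * (excess_grad R (U y) \<bullet> F y)"
        using vl
      proof eventually_elim
        case (elim y)
        have "continuous_on UNIV (excess_grad R :: real^'k \<Rightarrow> real^'k)" by (rule continuous_excess_grad[OF R(1)])
        then have "isCont (excess_grad R) (U y)" by (simp add: continuous_on_eq_continuous_at)
        from isCont_tendsto_compose[OF this elim] show ?case by (intro tendsto_intros)
      qed
    qed (use bL[OF iF cm_v(1)] ibL[OF iF cm_v(1)] ibL[OF iF Um] iF in auto)
    have B: "(\<lambda>n. LINT y|lebesgue. \<phi> y * (excess_grad R (v n y) \<bullet> (f n y - F y))) \<longlonglongrightarrow> 0"
    proof (rule Lim_null_comparison)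
      show "(\<lambda>n. M\<phi> * (LINT y|lebesgue. norm (f n y - F y))) \<longlonglongrightarrow> 0"
        using tendsto_mult_right_zero[OF conv_moll_tendsto_L1[OF iF d(1) dl], of M\<phi>] by (simp add: f_def)
      show "\<forall>\<^sub>F n in sequentially. norm (LINT y|lebesgue. \<phi> y * (excess_grad R (v n y) \<bullet> (f n y - F y))) \<le> M\<phi> * (LINT y|lebesgue. norm (f n y - F y))"
      proof (intro always_eventually allI)
        fix n
        have g: "integrable lebesgue (\<lambda>y. f n y - F y)" using iv iF by simp
        have "norm (LINT y|lebesgue. \<phi> y * (excess_grad R (v n y) \<bullet> (f n y - F y))) \<le> (LINT y|lebesgue. M\<phi> * norm (f n y - F y))"
          using bL[OF g cm_v(1)] ibL[OF g cm_v(1)] g by (intro Bochner_Integration.integral_norm_bound_integral) auto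
        then show "norm (LINT y|lebesgue. \<phi> y * (excess_grad R (v n y) \<bullet> (f n y - F y))) \<le> M\<phi> * (LINT y|lebesgue. norm (f n y - F y))" by simp
      qed
    qed
    have "(LINT y|lebesgue. \<phi> y * (excess_grad R (v n y) \<bullet> f n y)) = (LINT y|lebesgue. \<phi> y * (excess_grad R (v n y) \<bullet> F y)) + (LINT y|lebesgue. \<phi> y * (excess_grad R (v n y) \<bullet> (f n y - F y)))" for n
    proof -
      have g: "integrable lebesgue (\<lambda>y. f n y - F y)" using iv iF by simp
      have "(\<lambda>y. \<phi> y * (excess_grad R (v n y) \<bullet> f n y)) = (\<lambda>y. \<phi> y * (excess_grad R (v n y) \<bullet> F y) + \<phi> y * (excess_grad R (v n y) \<bullet> (f n y - F y)))"
        by (auto simp: inner_diff_right algebra_simps)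
      then show ?thesis using ibL[OF iF cm_v(1)[of n]] ibL[OF g cm_v(1)[of n]] by simp
    qed
    then show ?thesis using tendsto_add[OF A B] by simp
  qed
  have "0 \<le> (LINT y|lebesgue. \<phi> y * (excess_grad R (U y) \<bullet> F y))"
  proof (rule Bochner_Integration.integral_nonneg)
    fix y
    show "0 \<le> \<phi> y * (excess_grad R (U y) \<bullet> F y)"
    proof (cases "y \<in> K")
      case True
      then have "0 \<le> excess_grad R (U y) \<bullet> F y" unfolding U_def F_def using R(2) by (simp add: excess_grad_inner[OF R(1)])
      then show ?thesis using moll_nonneg[OF \<tau>(1), of "x - y"] by (simp add: \<phi>_def)
    qed (simp add: F_def)
  qed
  moreover have "(1 / \<epsilon>\<^sup>2) * (LINT y|lebesgue. \<phi> y * (excess_grad R (U y) \<bullet> F y)) \<le> (LINT y|lebesgue. excess R (U y) * \<Delta> y)"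
  proof (rule LIMSEQ_le[OF tendsto_mult[OF tendsto_const limL] limR])
    have "(1 / \<epsilon>\<^sup>2) * (LINT y|lebesgue. \<phi> y * (excess_grad R (v n y) \<bullet> f n y)) \<le> (LINT y|lebesgue. excess R (v n y) * \<Delta> y)" for n
    proof -
      have "(LINT y|lebesgue. \<phi> y * (excess_grad R (v n y) \<bullet> ((1 / \<epsilon>\<^sup>2) *\<^sub>R f n y))) = (LINT y|lebesgue. (1 / \<epsilon>\<^sup>2) * (\<phi> y * (excess_grad R (v n y) \<bullet> f n y)))"
        by (intro Bochner_Integration.integral_cong) auto
      also have "\<dots> = (1 / \<epsilon>\<^sup>2) * (LINT y|lebesgue. \<phi> y * (excess_grad R (v n y) \<bullet> f n y))" by (rule integral_mult_right_zero)
      finally show ?thesis using step[of n] by simp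
    qed
    then show "\<exists>N. \<forall>n\<ge>N. (1 / \<epsilon>\<^sup>2) * (LINT y|lebesgue. \<phi> y * (excess_grad R (v n y) \<bullet> f n y)) \<le> (LINT y|lebesgue. excess R (v n y) * \<Delta> y)" by blast
  qed
  moreover have "0 \<le> 1 / \<epsilon>\<^sup>2" by simp
  ultimately have "0 \<le> (LINT y|lebesgue. excess R (U y) * \<Delta> y)" by (meson mult_nonneg_nonneg order_trans)
  also have "\<dots> = (LINT y|lebesgue. ddir (ax 1) (ddir (ax 1) (moll \<tau>)) (x - y) *\<^sub>R rs K (\<lambda>y. excess R (u y)) y + ddir (ax 2) (ddir (ax 2) (moll \<tau>)) (x - y) *\<^sub>R rs K (\<lambda>y. excess R (u y)) y)"
  proof (rule Bochner_Integration.integral_cong)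
    fix y
    show "excess R (U y) * \<Delta> y = ddir (ax 1) (ddir (ax 1) (moll \<tau>)) (x - y) *\<^sub>R rs K (\<lambda>y. excess R (u y)) y + ddir (ax 2) (ddir (ax 2) (moll \<tau>)) (x - y) *\<^sub>R rs K (\<lambda>y. excess R (u y)) y"
    proof (cases "y \<in> cball x \<tau>")
      case True
      then have "y \<in> K" using cxK by blast
      then show ?thesis by (simp add: U_def \<Delta>_def \<phi>dd algebra_simps)
    next
      case False
      then show ?thesis using out[OF bd\<phi>] by (simp add: \<Delta>_def \<phi>dd[symmetric])
    qed
  qed simp
  also have "\<dots> = conv (ddir (ax 1) (ddir (ax 1) (moll \<tau>))) (rs K (\<lambda>y. excess R (u y))) x
    + conv (ddir (ax 2) (ddir (ax 2) (moll \<tau>))) (rs K (\<lambda>y. excess R (u y))) x"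
  proof -
    have Km: "K \<in> sets lebesgue" using K(2) by (intro lmeasurable_compact fmeasurableD)
    have "integrable lebesgue (rs K (\<lambda>y. excess R (u y)))"
    proof (rule Bochner_Integration.integrable_bound)
      show "integrable lebesgue (\<lambda>y. indicat_real K y + norm (U y))"
        using iU K(2) lmeasurable_compact[OF K(2)] by (auto simp: integrable_indicator_iff fmeasurable_def)
      have "rs K (\<lambda>y. excess R (u y)) = (\<lambda>y. indicat_real K y *\<^sub>R excess R (U y))" by (auto simp: U_def indicator_def)
      then show "rs K (\<lambda>y. excess R (u y)) \<in> borel_measurable lebesgue"
        using measurable_compose[OF Um em(1)] Km by simp
      show "AE y in lebesgue. norm (rs K (\<lambda>y. excess R (u y)) y) \<le> norm (indicat_real K y + norm (U y))"
      proof (rule AE_I2)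
        fix y show "norm (rs K (\<lambda>y. excess R (u y)) y) \<le> norm (indicat_real K y + norm (U y))"
          using excess_le[OF R(1), of "u y"] excess_ge_1[of R "u y"] by (simp add: U_def indicator_def)
      qed
    qed
    then have "integrable lebesgue (\<lambda>y. ddir (ax j) (ddir (ax j) (moll \<tau>)) (x - y) *\<^sub>R rs K (\<lambda>y. excess R (u y)) y)" for j
    proof -
      obtain B where "\<And>z. \<bar>ddir (ax j) (ddir (ax j) (moll \<tau>)) z\<bar> \<le> B"
        using bumps_bounded[OF bd[of j] less_imp_le[OF \<tau>(1)]] by metis
      then show ?thesis by (rule conv_integrable[OF bumps_continuous[OF bd]]) fact
    qed
    then show ?thesis unfolding conv_def by (intro Bochner_Integration.integral_add)
  qed
  finally show ?thesis .
qed

section \<open>The mean value inequality for subharmonic functions\<close>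

lemma pder_affine: "pder e f f' \<Longrightarrow> pder e (\<lambda>y. f (x + t *\<^sub>R y)) (\<lambda>y. t *\<^sub>R f' (x + t *\<^sub>R y))"
  unfolding pder_def
proof
  fix y assume pd: "\<forall>x. ((\<lambda>t. f (x + t *\<^sub>R e)) has_vector_derivative f' x) (at 0)"
  have "((\<lambda>s. f ((x + t *\<^sub>R y) + s *\<^sub>R e)) \<circ> (\<lambda>s. s * t) has_vector_derivative t *\<^sub>R f' (x + t *\<^sub>R y)) (at 0)"
    by (rule vector_diff_chain_at) (use pd in \<open>auto intro!: derivative_eq_intros\<close>)
  then show "((\<lambda>s. f (x + t *\<^sub>R (y + s *\<^sub>R e))) has_vector_derivative t *\<^sub>R f' (x + t *\<^sub>R y)) (at 0)"
    by (simp add: o_def algebra_simps)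
qed

lemma integral_lborel_scale:
  fixes f :: "'a::euclidean_space \<Rightarrow> real"
  assumes f: "integrable lborel f" "f \<in> borel_measurable borel" and s: "0 < s"
  shows "integrable lborel (\<lambda>y. f (x + s *\<^sub>R y))" "(LINT y|lborel. f (x + s *\<^sub>R y)) = (LINT y|lborel. f y) / s ^ DIM('a)"
proof -
  let ?c = "s ^ DIM('a)"
  let ?g = "\<lambda>y::'a. x + s *\<^sub>R y"
  have m [measurable]: "?g \<in> measurable lborel borel" by simp
  have eq: "lborel = density (distr lborel borel ?g) (\<lambda>_. ennreal ?c)"
    using lborel_affine[of s x] s by (simp add: ennreal_power)
  have "integrable (density (distr lborel borel ?g) (\<lambda>_. ennreal ?c)) f" using f(1) eq by metis
  then have "integrable (distr lborel borel ?g) (\<lambda>y. ?c *\<^sub>R f y)"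
    using f(2) s by (subst (asm) integrable_density) auto
  then have "integrable lborel (\<lambda>y. ?c *\<^sub>R f (?g y))"
    using f(2) by (subst (asm) integrable_distr_eq) auto
  then show "integrable lborel (\<lambda>y. f (?g y))" using s by simp
  have "(LINT y|lborel. f y) = (LINT y|density (distr lborel borel ?g) (\<lambda>_. ennreal ?c). f y)" using eq by metis
  also have "\<dots> = (LINT y|distr lborel borel ?g. ?c *\<^sub>R f y)" using f(2) s by (intro integral_density) auto
  also have "\<dots> = (LINT y|lborel. ?c *\<^sub>R f (?g y))" using f(2) by (intro integral_distr) auto
  finally show "(LINT y|lborel. f (?g y)) = (LINT y|lborel. f y) / ?c" using s by simp
qed

text \<open>An upper bound of the averaging profile divided by its integral, hence independent of
  the function, the centre and the radius. Any bound serves, so one is merely chosen.\<close>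

definition mean_value_const :: real where
  "mean_value_const = (SOME M. 0 < M \<and> (\<forall>y::real^2. flat_exp 2 (1 - y \<bullet> y) \<le> M)) / (LINT y|lborel. flat_exp 2 (1 - y \<bullet> (y::real^2)))"

text \<open>The weighted means \<open>A t\<close> over disks of radius \<open>t\<close> are
  nondecreasing: as y \<rho>(y) = - \<nabla>P(y) / 2, integration by parts turns \<open>A' t\<close>
  into t / 2 times the integral of \<open>P\<close> against the Laplacian. \<open>A 0\<close> is a
  multiple of the point value, and \<open>A s\<close> is bounded by the full integral.\<close>

lemma mean_value_inequality:
  fixes W :: "real^2 \<Rightarrow> real"
  assumes pdW: "\<And>y. pder y W (\<lambda>x. y $ 1 * W1 x + y $ 2 * W2 x)"
    and pd: "pder (ax 1) W1 W11" "pder (ax 2) W2 W22"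
    and c: "continuous_on UNIV W" "continuous_on UNIV W1" "continuous_on UNIV W2" "continuous_on UNIV W11" "continuous_on UNIV W22"
    and sub: "\<And>z. z \<in> cball x s \<Longrightarrow> 0 \<le> W11 z + W22 z" and s: "0 < s"
    and W0: "\<And>z. 0 \<le> W z" and iW: "integrable lborel W"
  shows "W x \<le> mean_value_const / s\<^sup>2 * (LINT z|lborel. W z)"
proof -
  define \<rho> where "\<rho> y = flat_exp 2 (1 - y \<bullet> y)" for y :: "real^2"
  define P where "P y = flat_exp 0 (1 - y \<bullet> y)" for y :: "real^2"
  have b\<rho>: "bumps 0 (1\<^sup>2) \<rho>" using bumps.base[of "0::real^2" "1" 2] by (simp add: \<rho>_def[abs_def])
  have bP: "bumps 0 (1\<^sup>2) P" using bumps.base[of "0::real^2" "1" 0] by (simp add: P_def[abs_def])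
  have c\<rho>: "continuous_on UNIV \<rho>" and cP: "continuous_on UNIV P" using bumps_continuous b\<rho> bP by auto
  have out: "\<rho> y = 0" "P y = 0" if "y \<notin> cball 0 1" for y using bumps_outside[OF b\<rho> _ that] bumps_outside[OF bP _ that] by auto
  have \<rho>0: "0 \<le> \<rho> y" "0 \<le> P y" for y by (simp_all add: \<rho>_def P_def flat_exp_nonneg)
  \<comment> \<open>\<open>flat_exp 2\<close> is the derivative of \<open>flat_exp 0\<close>; this
    dictates the choice of the profile \<rho>.\<close>
  have pdP: "pder (ax j) P (\<lambda>y. - 2 * (\<rho> y * y $ j))" for j
  proof -
    have d1: "((\<lambda>y::real^2. 1 - y \<bullet> y) has_derivative (\<lambda>h. - 2 * (y \<bullet> h))) (at y)" for y
      by (auto intro!: derivative_eq_intros simp: inner_commute)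
    have "(P has_derivative (\<lambda>h. \<rho> y * (- 2 * (y \<bullet> h)))) (at y)" for y
    proof -
      have "(flat_exp 0 has_derivative (\<lambda>h. \<rho> y * h)) (at (1 - y \<bullet> y))"
        using flat_exp_has_derivative[of 0 "1 - y \<bullet> y"] by (simp add: has_field_derivative_def \<rho>_def numeral_2_eq_2)
      from has_derivative_compose[OF d1 this] show ?thesis by (simp add: P_def[abs_def])
    qed
    from has_derivative_pder[of P "\<lambda>y h. \<rho> y * (- 2 * (y \<bullet> h))", OF this, of "ax j"]
    show ?thesis by (rule pder_eq) (simp add: inner_axis)
  qed
  define M where "M = (SOME M. 0 < M \<and> (\<forall>y::real^2. flat_exp 2 (1 - y \<bullet> y) \<le> M))"
  have "\<exists>M. 0 < M \<and> (\<forall>y::real^2. flat_exp 2 (1 - y \<bullet> y) \<le> M)"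
    using bumps_bounded[OF b\<rho>] unfolding \<rho>_def by (metis abs_le_D1 zero_le_one)
  from someI_ex[OF this] have M: "0 < M" "\<And>y. \<rho> y \<le> M" unfolding M_def \<rho>_def by auto
  define m where "m = (LINT y|lborel. \<rho> y)"
  have i\<rho>: "integrable lborel \<rho>" using integrable_bumps[OF b\<rho>] by simp
  have m0: "0 < m"
  proof -
    have "0 < (LINT y|lborel. flat_exp 0 (1\<^sup>2 - y \<bullet> (y::real^2)))"
      using moll_integral_pos[of 1, where 'a="real^2"] lebesgue_integral_borel(1)[OF borel_measurable_continuous_onI[OF cP]] by (simp add: P_def[abs_def])
    also have "\<dots> \<le> m" unfolding m_def
    proof (rule integral_mono)
      show "integrable lborel (\<lambda>y::real^2. flat_exp 0 (1\<^sup>2 - y \<bullet> y))" using integrable_bumps[OF bP] by (simp add: P_def[abs_def])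
      fix y :: "real^2"
      have "exp (- 1 / t) \<le> exp (- 1 / t) / t\<^sup>2" if "0 < t" "t \<le> 1" for t :: real
        using that by (simp add: le_divide_eq mult_left_le power_le_one)
      moreover have "1 - y \<bullet> y \<le> 1" by simp
      ultimately show "flat_exp 0 (1\<^sup>2 - y \<bullet> y) \<le> \<rho> y" by (simp add: \<rho>_def flat_exp_def)
    qed (rule i\<rho>)
    finally show ?thesis .
  qed
  have mvc: "mean_value_const = M / m" by (simp add: mean_value_const_def M_def m_def \<rho>_def)
  \<comment> \<open>A box containing the unit disk, on which the Leibniz rule for continuous
    integrands differentiates \<open>A\<close>.\<close>
  define Q where "Q = cbox (- One) (One :: real^2)"
  have ballQ: "cball 0 1 \<subseteq> Q"
  proof
    fix y :: "real^2" assume "y \<in> cball 0 1"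
    then have "\<bar>y \<bullet> b\<bar> \<le> 1" if "b \<in> Basis" for b using Basis_le_norm[OF that, of y] by simp
    then show "y \<in> Q" unfolding Q_def mem_box by (auto simp: abs_le_iff)
  qed
  have HK: "integral Q f = (LINT y|lborel. f y)" "f integrable_on Q"
    if "continuous_on UNIV f" "\<And>y. y \<notin> cball 0 1 \<Longrightarrow> f y = 0" for f :: "real^2 \<Rightarrow> real"
  proof -
    have "set_integrable lborel Q f" unfolding set_integrable_def Q_def
      by (rule borel_integrable_compact) (use that in \<open>auto intro: continuous_on_subset\<close>)
    then have "(LINT y:Q|lborel. f y) = integral Q f" by (rule set_borel_integral_eq_integral)
    moreover have "(\<lambda>y. indicat_real Q y *\<^sub>R f y) = f"
    proof
      fix y show "indicat_real Q y *\<^sub>R f y = f y"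
      proof (cases "y \<in> cball 0 1")
        case True then show ?thesis using subsetD[OF ballQ True] by simp
      next
        case False then show ?thesis using that(2) by simp
      qed
    qed
    ultimately show "integral Q f = (LINT y|lborel. f y)" by (simp add: set_lebesgue_integral_def)
    show "f integrable_on Q" unfolding Q_def by (rule integrable_continuous) (use that in \<open>auto intro: continuous_on_subset\<close>)
  qed
  have cc: "continuous_on UNIV (\<lambda>y. f (x + t *\<^sub>R y))" if "continuous_on UNIV f" for f :: "real^2 \<Rightarrow> real" and t
    by (rule continuous_on_compose2[OF that]) (auto intro!: continuous_intros)
  define A where "A t = integral Q (\<lambda>y. \<rho> y * W (x + t *\<^sub>R y))" for t
  define A' where "A' t = integral Q (\<lambda>y. \<rho> y * (y $ 1 * W1 (x + t *\<^sub>R y) + y $ 2 * W2 (x + t *\<^sub>R y)))" for t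
  have dA: "(A has_real_derivative A' t) (at t)" for t
    unfolding A_def A'_def Q_def
  proof (rule leibniz_rule_field_derivative[where U = UNIV, simplified])
    fix t and y :: "real^2"
    have "((\<lambda>t. W (x + t *\<^sub>R y)) has_real_derivative (y $ 1 * W1 (x + t *\<^sub>R y) + y $ 2 * W2 (x + t *\<^sub>R y))) (at t)"
      using pderD[OF pdW, of x y t] by (simp add: has_real_derivative_iff_has_vector_derivative)
    from DERIV_cmult[OF this, of "\<rho> y"]
    show "((\<lambda>t. \<rho> y * W (x + t *\<^sub>R y)) has_real_derivative \<rho> y * (y $ 1 * W1 (x + t *\<^sub>R y) + y $ 2 * W2 (x + t *\<^sub>R y))) (at t)" .
  next
    fix t show "(\<lambda>y. \<rho> y * W (x + t *\<^sub>R y)) integrable_on cbox (- One) One"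
      using HK(2)[of "\<lambda>y. \<rho> y * W (x + t *\<^sub>R y)"] out c\<rho> cc[OF c(1)] by (simp add: Q_def continuous_on_mult)
  next
    have 1: "continuous_on (UNIV \<times> cbox (- One) One) (\<lambda>z. f (x + fst z *\<^sub>R snd z))" if "continuous_on UNIV f" for f :: "real^2 \<Rightarrow> real"
      by (rule continuous_on_compose2[OF that]) (auto intro!: continuous_intros)
    have 2: "continuous_on (UNIV \<times> cbox (- One) One) (\<lambda>z::real \<times> (real^2). \<rho> (snd z))"
      by (rule continuous_on_compose2[OF c\<rho>]) (auto intro!: continuous_intros)
    show "continuous_on (UNIV \<times> cbox (- One) One) (\<lambda>(t, y). \<rho> y * (y $ 1 * W1 (x + t *\<^sub>R y) + y $ 2 * W2 (x + t *\<^sub>R y)))"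
      unfolding case_prod_beta by (intro continuous_on_mult continuous_on_add 1 2 c continuous_on_component continuous_on_snd continuous_on_id)
  qed
  have A'0: "0 \<le> A' t" if t: "0 \<le> t" "t \<le> s" for t
  proof -
    define f where "f j y = (if j = (1::2) then W1 (x + t *\<^sub>R y) else W2 (x + t *\<^sub>R y))" for j y
    define fd where "fd j y = (if j = (1::2) then W11 (x + t *\<^sub>R y) else W22 (x + t *\<^sub>R y))" for j y
    have cf: "continuous_on UNIV (f j)" "continuous_on UNIV (fd j)" for j
      unfolding f_def fd_def using cc c by (cases "j = 1"; simp)+
    have pf: "pder (ax j) (\<lambda>y. P y * f j y) (\<lambda>y. (- 2 * (\<rho> y * y $ j)) * f j y + P y * (t * fd j y))" if "j = 1 \<or> j = 2" for j
    proof (rule pder_mult[OF pdP])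
      show "pder (ax j) (f j) (\<lambda>y. t * fd j y)"
        using that pder_affine[OF pd(1), of x t] pder_affine[OF pd(2), of x t] unfolding f_def fd_def by auto
    qed
    have z: "(LINT y|lborel. (- 2 * (\<rho> y * y $ j)) * f j y + P y * (t * fd j y)) = 0" if "j = 1 \<or> j = 2" for j
    proof (rule integral_pder_eq_0[OF pf[OF that] _ _ compact_cball[of 0 1]])
      show "continuous_on UNIV (\<lambda>y. P y * f j y)" by (intro continuous_on_mult cP cf)
      show "continuous_on UNIV (\<lambda>y. - 2 * (\<rho> y * y $ j) * f j y + P y * (t * fd j y))"
        by (intro continuous_on_add continuous_on_mult continuous_on_const c\<rho> cP cf continuous_on_component continuous_on_id)
    qed (use out in simp)
    have i1: "integrable lborel (\<lambda>y. \<rho> y * y $ j * f j y)" for j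
      by (rule integrable_continuous_compact_support[OF _ compact_cball[of 0 1]])
        (use out in \<open>auto intro!: continuous_on_mult c\<rho> cf continuous_on_component continuous_on_id\<close>)
    have i2: "integrable lborel (\<lambda>y. P y * (t * fd j y))" for j
      by (rule integrable_continuous_compact_support[OF _ compact_cball[of 0 1]])
        (use out in \<open>auto intro!: continuous_on_mult cP cf continuous_on_const\<close>)
    have zz: "2 * (LINT y|lborel. \<rho> y * y $ j * f j y) = (LINT y|lborel. P y * (t * fd j y))" if "j = 1 \<or> j = 2" for j
    proof -
      have "(LINT y|lborel. (- 2 * (\<rho> y * y $ j)) * f j y + P y * (t * fd j y)) = (LINT y|lborel. (- 2) * (\<rho> y * y $ j * f j y) + P y * (t * fd j y))"
        by (intro Bochner_Integration.integral_cong) auto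
      also have "\<dots> = (- 2) * (LINT y|lborel. \<rho> y * y $ j * f j y) + (LINT y|lborel. P y * (t * fd j y))"
        using i1[of j] i2[of j] by (subst Bochner_Integration.integral_add) auto
      finally show ?thesis using z[OF that] by simp
    qed
    have "A' t = (LINT y|lborel. \<rho> y * (y $ 1 * W1 (x + t *\<^sub>R y) + y $ 2 * W2 (x + t *\<^sub>R y)))"
      unfolding A'_def by (rule HK(1)) (use out c in \<open>auto intro!: continuous_on_mult continuous_on_add c\<rho> cc continuous_on_component continuous_on_id\<close>)
    also have "\<dots> = (LINT y|lborel. \<rho> y * y $ 1 * f 1 y + \<rho> y * y $ 2 * f 2 y)"
      by (intro Bochner_Integration.integral_cong) (auto simp: f_def algebra_simps)
    also have "\<dots> = (LINT y|lborel. \<rho> y * y $ 1 * f 1 y) + (LINT y|lborel. \<rho> y * y $ 2 * f 2 y)"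
      by (intro Bochner_Integration.integral_add i1)
    finally have "2 * A' t = (LINT y|lborel. P y * (t * fd 1 y)) + (LINT y|lborel. P y * (t * fd 2 y))"
      using zz[of 1] zz[of 2] by simp
    also have "\<dots> = (LINT y|lborel. P y * (t * fd 1 y) + P y * (t * fd 2 y))" using i2 by simp
    also have "\<dots> \<ge> 0"
    proof (rule Bochner_Integration.integral_nonneg)
      fix y
      show "0 \<le> P y * (t * fd 1 y) + P y * (t * fd 2 y)"
      proof (cases "y \<in> cball 0 1")
        case True
        have "norm (t *\<^sub>R y) \<le> s * 1" unfolding norm_scaleR using True t by (intro mult_mono) auto
        then have "x + t *\<^sub>R y \<in> cball x s" by (simp add: dist_norm)
        then have "0 \<le> fd 1 y + fd 2 y" using sub by (simp add: fd_def)
        then have "0 \<le> P y * (t * (fd 1 y + fd 2 y))" using \<rho>0 t by simp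
        then show ?thesis by (simp add: algebra_simps)
      next
        case False then show ?thesis using out by simp
      qed
    qed
    finally show ?thesis by simp
  qed
  have "A 0 \<le> A s"
    by (rule DERIV_nonneg_imp_nondecreasing[of 0 s A]) (use dA A'0 s in \<open>auto intro: exI[of _ "A' _"]\<close>)
  moreover have "A 0 = W x * m"
  proof -
    have "A 0 = (LINT y|lborel. \<rho> y * W (x + 0 *\<^sub>R y))"
      unfolding A_def by (rule HK(1)) (use out c in \<open>auto intro!: continuous_on_mult c\<rho>\<close>)
    then show ?thesis using i\<rho> by (simp add: m_def)
  qed
  moreover have "A s \<le> M * ((LINT y|lborel. W y) / s\<^sup>2)"
  proof -
    note sc = integral_lborel_scale[OF iW borel_measurable_continuous_onI[OF c(1)] s, of x]
    have i: "integrable lborel (\<lambda>y. \<rho> y * W (x + s *\<^sub>R y))"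
      by (rule integrable_continuous_compact_support[OF _ compact_cball[of 0 1]]) (use out c in \<open>auto intro!: continuous_on_mult c\<rho> cc\<close>)
    have "A s = (LINT y|lborel. \<rho> y * W (x + s *\<^sub>R y))"
      unfolding A_def by (rule HK(1)) (use out c in \<open>auto intro!: continuous_on_mult c\<rho> cc\<close>)
    also have "\<dots> \<le> (LINT y|lborel. M * W (x + s *\<^sub>R y))"
      by (rule integral_mono) (use i sc M W0 in \<open>auto intro: mult_right_mono\<close>)
    also have "\<dots> = M * ((LINT y|lborel. W y) / s\<^sup>2)" using sc by simp
    finally show ?thesis .
  qed
  ultimately have "W x * m \<le> M * ((LINT y|lborel. W y) / s\<^sup>2)" by linarith
  then have "W x \<le> M * ((LINT y|lborel. W y) / s\<^sup>2) / m" by (subst pos_le_divide_eq[OF m0])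
  then show ?thesis by (simp add: mvc mult_ac)
qed

section \<open>Local energy bounds and the sup bound for solutions\<close>

lemma ddir_decompose:
  fixes k :: "real^2 \<Rightarrow> real"
  assumes "bumps a r k"
  shows "ddir y k z = y $ 1 * ddir (ax 1) k z + y $ 2 * ddir (ax 2) k z"
proof -
  have "k differentiable (at z)" using bumps_has_derivative[OF assms] differentiable_def by blast
  from frechet_derivative_eq_grad[OF this, of y] show ?thesis
    by (simp add: inner_vec_def sum_2 grad_def mult.commute)
qed

lemma conv_pder_all:
  fixes F :: "real^2 \<Rightarrow> real"
  assumes k: "bumps 0 (\<delta>\<^sup>2) k" "0 \<le> \<delta>" and F: "integrable lebesgue F"
  shows "pder y (conv k F) (\<lambda>x. y $ 1 * conv (ddir (ax 1) k) F x + y $ 2 * conv (ddir (ax 2) k) F x)"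
proof (rule pder_eq[OF conv_pder[OF k F]])
  fix x
  have i: "integrable lebesgue (\<lambda>w. ddir (ax j) k (x - w) *\<^sub>R F w)" for j
  proof -
    obtain B where "\<And>z. \<bar>ddir (ax j) k z\<bar> \<le> B" using bumps_bounded[OF bumps_ddir[OF k(1)] k(2)] by metis
    then show ?thesis by (rule conv_integrable[OF bumps_continuous[OF bumps_ddir[OF k(1)]] _ F])
  qed
  have "conv (ddir y k) F x = (LINT w|lebesgue. y $ 1 * (ddir (ax 1) k (x - w) *\<^sub>R F w) + y $ 2 * (ddir (ax 2) k (x - w) *\<^sub>R F w))"
    unfolding conv_def by (intro Bochner_Integration.integral_cong) (simp_all add: ddir_decompose[OF k(1), where y = y] algebra_simps)
  also have "\<dots> = y $ 1 * conv (ddir (ax 1) k) F x + y $ 2 * conv (ddir (ax 2) k) F x"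
    unfolding conv_def using i[of 1] i[of 2] by simp
  finally show "conv (ddir y k) F x = y $ 1 * conv (ddir (ax 1) k) F x + y $ 2 * conv (ddir (ax 2) k) F x" .
qed

lemma compact_neighbourhood:
  fixes K :: "'a::heine_borel set"
  assumes "compact K" "open \<Omega>" "K \<subseteq> \<Omega>"
  obtains s K' where "0 < s" "compact K'" "K' \<subseteq> \<Omega>" "\<And>x. x \<in> K \<Longrightarrow> cball x s \<subseteq> K'"
proof (cases "K = {}")
  case True
  then show ?thesis using that[of 1 "{}"] by simp
next
  case False
  obtain s where s: "0 < s" "{x. infdist x K \<le> s} \<subseteq> \<Omega>"
    using compact_in_open_separated[OF False assms] by metis
  show ?thesis
  proof (rule that[OF s(1) compact_infdist_le[OF False assms(1) s(1)] s(2)])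
    fix x assume "x \<in> K"
    then show "cball x s \<subseteq> {x. infdist x K \<le> s}"
      by (auto simp: dist_commute intro!: order_trans[OF infdist_le[OF \<open>x \<in> K\<close>]])
  qed
qed

lemma energy_density_integrable:
  fixes u :: "real^2 \<Rightarrow> real^'k"
  assumes ac: "allen_cahn_solution \<Omega> V \<epsilon> u" and \<epsilon>: "0 < \<epsilon>" and V: "continuous_on UNIV V" "\<And>y. 0 \<le> V y"
    and E: "energy \<Omega> V \<epsilon> u \<le> ennreal M0" and K: "compact K" "K \<subseteq> \<Omega>" and \<Omega>: "open \<Omega>" and M0: "0 \<le> M0"
  shows "rs K u \<in> borel_measurable lebesgue" "rs K (weak_grad \<Omega> u) \<in> borel_measurable lebesgue"
    "integrable lebesgue (rs K (energy_density \<Omega> V \<epsilon> u))"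
    "(LINT x|lebesgue. rs K (energy_density \<Omega> V \<epsilon> u) x) \<le> M0"
    "integrable lebesgue (rs K (\<lambda>x. V (u x)))" "(LINT x|lebesgue. rs K (\<lambda>x. V (u x)) x) \<le> \<epsilon> * M0"
    "integrable lebesgue (rs K (\<lambda>x. (norm (weak_grad \<Omega> u x))\<^sup>2))"
proof -
  define G where "G = weak_grad \<Omega> u"
  have wg: "has_weak_gradient \<Omega> u G"
    using ac unfolding G_def weak_grad_def allen_cahn_solution_def H1_on_def by (metis someI)
  have Km: "K \<in> sets lebesgue" using K by (intro lmeasurable_compact fmeasurableD)
  have iu: "integrable lebesgue (rs K u)" and iG: "integrable lebesgue (rs K G)"
    using wg K by (auto simp: has_weak_gradient_def intro!: integrable_rs)
  show um: "rs K u \<in> borel_measurable lebesgue" and Gm: "rs K (weak_grad \<Omega> u) \<in> borel_measurable lebesgue"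
    using iu iG by (auto simp: G_def)
  let ?e = "energy_density \<Omega> V \<epsilon> u"
  have Vm: "rs K (\<lambda>x. V (u x)) \<in> borel_measurable lebesgue"
  proof -
    have "rs K (\<lambda>x. V (u x)) = (\<lambda>x. indicat_real K x * V (rs K u x))" by (auto simp: indicator_def)
    moreover have "(\<lambda>x. V (rs K u x)) \<in> borel_measurable lebesgue"
      by (rule measurable_compose[OF um borel_measurable_continuous_onI[OF V(1)]])
    ultimately show ?thesis using Km by simp
  qed
  have G2m: "rs K (\<lambda>x. (norm (weak_grad \<Omega> u x))\<^sup>2) \<in> borel_measurable lebesgue"
  proof -
    have "rs K (\<lambda>x. (norm (weak_grad \<Omega> u x))\<^sup>2) = (\<lambda>x. (norm (rs K (weak_grad \<Omega> u) x))\<^sup>2)" by (auto simp: indicator_def)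
    moreover have "(\<lambda>x. (norm (rs K (weak_grad \<Omega> u) x))\<^sup>2) \<in> borel_measurable lebesgue"
      by (rule measurable_compose[OF Gm borel_measurable_continuous_onI[of "\<lambda>A. (norm A)\<^sup>2"]]) (intro continuous_intros)
    ultimately show ?thesis by (simp only:)
  qed
  have e: "rs K ?e = (\<lambda>x. \<epsilon> / 2 * rs K (\<lambda>x. (norm (weak_grad \<Omega> u x))\<^sup>2) x + (1 / \<epsilon>) * rs K (\<lambda>x. V (u x)) x)"
    by (auto simp: energy_density_def indicator_def)
  have em: "rs K ?e \<in> borel_measurable lebesgue" unfolding e using Vm G2m by (intro borel_measurable_add borel_measurable_times borel_measurable_const)
  have e0: "0 \<le> ?e x" for x using \<epsilon> V by (simp add: energy_density_def)
  have nn: "(\<integral>\<^sup>+x. ennreal (norm (rs K ?e x)) \<partial>lebesgue) \<le> ennreal M0"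
  proof -
    have "(\<integral>\<^sup>+x. ennreal (norm (rs K ?e x)) \<partial>lebesgue) \<le> (\<integral>\<^sup>+x. ennreal (?e x) * indicator \<Omega> x \<partial>lebesgue)"
      using e0 K(2) by (intro nn_integral_mono) (auto simp: indicator_def)
    also have "\<dots> = (\<integral>\<^sup>+x. ennreal (?e x) \<partial>lebesgue_on \<Omega>)"
      using \<Omega> by (intro nn_integral_restrict_space[symmetric]) auto
    also have "\<dots> \<le> ennreal M0" using E by (simp add: energy_def)
    finally show ?thesis .
  qed
  show ie: "integrable lebesgue (rs K ?e)"
    by (rule integrableI_bounded[OF em]) (use nn ennreal_less_top le_less_trans in \<open>simp add: infinity_ennreal_def, blast\<close>)
  have "ennreal (LINT x|lebesgue. rs K ?e x) = (\<integral>\<^sup>+x. ennreal (rs K ?e x) \<partial>lebesgue)"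
    using ie e0 by (intro nn_integral_eq_integral[symmetric]) auto
  also have "\<dots> \<le> ennreal M0" using nn e0 by simp
  finally show eM: "(LINT x|lebesgue. rs K ?e x) \<le> M0" using M0 by (simp add: ennreal_le_iff)
  have le: "norm (rs K (\<lambda>x. V (u x)) x) \<le> norm (\<epsilon> * rs K ?e x)" "norm (rs K (\<lambda>x. (norm (weak_grad \<Omega> u x))\<^sup>2) x) \<le> norm (2 / \<epsilon> * rs K ?e x)" for x
    using \<epsilon> V(2)[of "u x"] by (auto simp: energy_density_def indicator_def abs_mult field_simps)
  show iV: "integrable lebesgue (rs K (\<lambda>x. V (u x)))"
    by (rule Bochner_Integration.integrable_bound[of _ "\<lambda>x. \<epsilon> * rs K ?e x", OF integrable_mult_right[OF ie] Vm]) (intro AE_I2 le)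
  show "integrable lebesgue (rs K (\<lambda>x. (norm (weak_grad \<Omega> u x))\<^sup>2))"
    by (rule Bochner_Integration.integrable_bound[of _ "\<lambda>x. 2 / \<epsilon> * rs K ?e x", OF integrable_mult_right[OF ie] G2m]) (intro AE_I2 le)
  have "(LINT x|lebesgue. rs K (\<lambda>x. V (u x)) x) \<le> (LINT x|lebesgue. \<epsilon> * rs K ?e x)"
  proof (rule integral_mono[OF iV])
    fix x show "rs K (\<lambda>x. V (u x)) x \<le> \<epsilon> * rs K ?e x"
      using \<epsilon> by (auto simp: energy_density_def indicator_def field_simps)
  qed (use ie in auto)
  also have "\<dots> \<le> \<epsilon> * M0" using eM \<epsilon> by (simp add: mult_left_mono)
  finally show "(LINT x|lebesgue. rs K (\<lambda>x. V (u x)) x) \<le> \<epsilon> * M0" .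
qed

text \<open>By coercivity the energy bounds the integral of the excess, whose mollifications are
  subharmonic. The mean value inequality bounds these independently of the mollification scale, and
  an almost everywhere limit passes the bound to \<open>u\<close>. The factor 1 / \<epsilon>^2 of
  the equation only multiplies a term of good sign, hence uniformity in \<epsilon>.\<close>

lemma solution_bounded:
  fixes V :: "real^'k \<Rightarrow> real"
  assumes V: "multiwell_potential V" and K: "compact K" "K \<subseteq> \<Omega>" "open \<Omega>" and M0: "0 \<le> M0"
  obtains L where "0 \<le> L" "\<And>\<epsilon> u. 0 < \<epsilon> \<Longrightarrow> \<epsilon> \<le> 1 \<Longrightarrow> allen_cahn_solution \<Omega> V \<epsilon> u \<Longrightarrow> energy \<Omega> V \<epsilon> u \<le> ennreal M0 \<Longrightarrow>
     AE x in lebesgue. x \<in> K \<longrightarrow> norm (u x) \<le> L"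
proof -
  obtain R C where R: "0 < R" "0 < C" "\<And>y. norm y > R \<Longrightarrow> 0 \<le> y \<bullet> grad V y" "\<And>y. norm y \<le> R + C * V y"
    using multiwell_coercive[OF V] by metis
  have sm: "smooth_on UNIV V" using V by (simp add: multiwell_potential_def)
  note V0 = multiwell_nonneg[OF V] and cV = smooth_on_continuous[OF sm]
  obtain s0 K' where s0: "0 < s0" "compact K'" "K' \<subseteq> \<Omega>" "\<And>x. x \<in> K \<Longrightarrow> cball x s0 \<subseteq> K'"
    using compact_neighbourhood[OF K(1,3,2)] by metis
  \<comment> \<open>Each third of the available room has a purpose: the averaging disk, the
    mollification radius \<open>\<tau> n\<close>, and the margin required by
    \<open>excess_subharmonic\<close>.\<close>
  define s where "s = s0 / 3"
  have s: "0 < s" using s0 by (simp add: s_def)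
  define B where "B = (1 + R) * measure lebesgue K' + C * M0"
  define L where "L = \<bar>R + \<bar>mean_value_const\<bar> / s\<^sup>2 * B\<bar>"
  show ?thesis
  proof (rule that[of L])
    show "0 \<le> L" by (simp add: L_def)
    fix \<epsilon> :: real and u :: "real^2 \<Rightarrow> real^'k"
    assume \<epsilon>: "0 < \<epsilon>" "\<epsilon> \<le> 1" and ac: "allen_cahn_solution \<Omega> V \<epsilon> u" and E: "energy \<Omega> V \<epsilon> u \<le> ennreal M0"
    note ed = energy_density_integrable[OF ac \<epsilon>(1) cV V0 E s0(2,3) K(3) M0]
    define w where "w = rs K' (\<lambda>y. excess R (u y))"
    have iK: "integrable lebesgue (indicat_real K')" 
      using lmeasurable_compact[OF s0(2)] by (auto simp: integrable_indicator_iff fmeasurable_def)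
    have wle: "norm (w y) \<le> (1 + R) * indicat_real K' y + C * rs K' (\<lambda>x. V (u x)) y" for y
      using excess_le[OF R(1), of "u y"] excess_ge_1[of R "u y"] R(4)[of "u y"] by (simp add: w_def indicator_def)
    have wm: "w \<in> borel_measurable lebesgue"
    proof -
      have "w = (\<lambda>y. indicat_real K' y * excess R (rs K' u y))" by (auto simp: w_def indicator_def)
      moreover have "(\<lambda>y. excess R (rs K' u y)) \<in> borel_measurable lebesgue"
        by (rule measurable_compose[OF ed(1) borel_measurable_continuous_onI[OF continuous_excess]])
      ultimately show ?thesis using iK by simp
    qed
    have ib: "integrable lebesgue (\<lambda>y. (1 + R) * indicat_real K' y + C * rs K' (\<lambda>x. V (u x)) y)"
      using iK ed(5) by simp
    have iw: "integrable lebesgue w"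
      by (rule Bochner_Integration.integrable_bound[OF ib wm]) (intro AE_I2 order_trans[OF wle], simp)
    have wB: "(LINT y|lebesgue. norm (w y)) \<le> B"
    proof -
      have "(LINT y|lebesgue. norm (w y)) \<le> (LINT y|lebesgue. (1 + R) * indicat_real K' y + C * rs K' (\<lambda>x. V (u x)) y)"
        using iw ib wle by (intro integral_mono) auto
      also have "\<dots> = (1 + R) * measure lebesgue K' + C * (LINT y|lebesgue. rs K' (\<lambda>x. V (u x)) y)"
        using iK ed(5) by simp
      also have "\<dots> \<le> (1 + R) * measure lebesgue K' + C * (\<epsilon> * M0)" using ed(6) R by (intro add_left_mono mult_left_mono) auto
      also have "\<dots> \<le> B" using \<epsilon> R M0 unfolding B_def by (intro add_left_mono mult_left_mono) (auto simp: mult_left_le_one_le)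
      finally show ?thesis .
    qed
    define \<tau> where "\<tau> n = s / real (Suc n)" for n
    have \<tau>: "0 < \<tau> n" "\<tau> n \<le> s" for n using s by (auto simp: \<tau>_def field_simps)
    have \<tau>l: "\<tau> \<longlonglongrightarrow> 0" unfolding \<tau>_def by (rule LIMSEQ_Suc[OF lim_const_over_n])
    obtain \<sigma> where \<sigma>: "strict_mono \<sigma>" "AE y in lebesgue. (\<lambda>n. conv (moll (\<tau> (\<sigma> n))) w y) \<longlonglongrightarrow> w y"
      by (rule conv_moll_AE_subseq[OF iw \<tau>(1) \<tau>l])
    have bound: "conv (moll (\<tau> n)) w x \<le> \<bar>mean_value_const\<bar> / s\<^sup>2 * B" if x: "x \<in> K" for n x
    proof -
      let ?k = "moll (\<tau> n) :: real^2 \<Rightarrow> real" and ?W = "conv (moll (\<tau> n)) w"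
      have bk: "bumps 0 ((\<tau> n)\<^sup>2) ?k" by (rule moll_bumps)
      have t0: "0 \<le> \<tau> n" using \<tau>(1)[of n] by simp
      have cc: "continuous_on UNIV (conv k w)" if bb: "bumps 0 ((\<tau> n)\<^sup>2) k" for k
      proof -
        obtain M where "\<And>z. \<bar>k z\<bar> \<le> M" using bumps_bounded[OF bb t0] by metis
        then show ?thesis by (rule conv_continuous[OF bumps_continuous[OF bb] _ iw])
      qed
      have W0: "0 \<le> ?W z" for z
      proof -
        have "0 \<le> w y" for y using excess_ge_1[of R "u y"] by (simp add: w_def indicator_def)
        then show ?thesis unfolding conv_def using moll_nonneg[OF \<tau>(1), of n "z - _"]
          by (intro Bochner_Integration.integral_nonneg) simp
      qed
      have iW: "integrable lborel ?W"
        using conv_moll_L1(1)[OF \<tau>(1) iw] lebesgue_integral_borel(2)[OF borel_measurable_continuous_onI[OF cc[OF bk]]] by simp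
      have "?W x \<le> mean_value_const / s\<^sup>2 * (LINT z|lborel. ?W z)"
      proof (rule mean_value_inequality[OF conv_pder_all[OF bk t0 iw]])
        show "pder (ax 1) (conv (ddir (ax 1) ?k) w) (conv (ddir (ax 1) (ddir (ax 1) ?k)) w)"
          "pder (ax 2) (conv (ddir (ax 2) ?k) w) (conv (ddir (ax 2) (ddir (ax 2) ?k)) w)"
          by (intro conv_pder[OF bumps_ddir[OF bk] t0 iw])+
        show "continuous_on UNIV ?W" "continuous_on UNIV (conv (ddir (ax 1) ?k) w)" "continuous_on UNIV (conv (ddir (ax 2) ?k) w)"
          "continuous_on UNIV (conv (ddir (ax 1) (ddir (ax 1) ?k)) w)" "continuous_on UNIV (conv (ddir (ax 2) (ddir (ax 2) ?k)) w)"
          by (intro cc bk bumps_ddir[OF bk] bumps_ddir[OF bumps_ddir[OF bk]])+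
        fix z assume z: "z \<in> cball x s"
        have "cball z (\<tau> n + s) \<subseteq> K'"
        proof
          fix y assume "y \<in> cball z (\<tau> n + s)"
          then have "dist x y \<le> s0" using z \<tau>(2)[of n] dist_triangle[of x y z] by (simp add: s_def)
          then show "y \<in> K'" using s0(4)[OF x] by auto
        qed
        from excess_subharmonic[OF ac \<epsilon>(1) R(1,3) s0(3,2) K(3) \<tau>(1) s this]
        show "0 \<le> conv (ddir (ax 1) (ddir (ax 1) ?k)) w z + conv (ddir (ax 2) (ddir (ax 2) ?k)) w z"
          unfolding w_def by simp
      qed (use s W0 iW in auto)
      also have "(LINT z|lborel. ?W z) = (LINT z|lebesgue. norm (?W z))"
        using W0 lebesgue_integral_borel(1)[OF borel_measurable_continuous_onI[OF cc[OF bk]]] by simp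
      also have "mean_value_const / s\<^sup>2 * (LINT z|lebesgue. norm (?W z)) \<le> \<bar>mean_value_const\<bar> / s\<^sup>2 * B"
        using conv_moll_L1(2)[OF \<tau>(1) iw, of n] wB by (intro mult_mono divide_right_mono) auto
      finally show ?thesis .
    qed
    show "AE x in lebesgue. x \<in> K \<longrightarrow> norm (u x) \<le> L"
      using \<sigma>(2)
    proof eventually_elim
      case (elim x)
      show ?case
      proof
        assume x: "x \<in> K"
        have "w x \<le> \<bar>mean_value_const\<bar> / s\<^sup>2 * B"
          by (rule LIMSEQ_le_const2[OF elim]) (use bound[OF x] in blast)
        moreover have "x \<in> K'" using s0(4)[OF x] s0(1) by auto
        ultimately show "norm (u x) \<le> L" using norm_le_excess[of "u x" R] by (simp add: w_def L_def)
      qed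
    qed
  qed
qed

section \<open>The energy estimate for weak solutions\<close>

text \<open>Subsequences are refined one map at a time, so that all maps converge along a common
  one.\<close>

lemma conv_moll_AE_subseq_family:
  fixes F :: "'i \<Rightarrow> 'a::euclidean_space \<Rightarrow> 'b::euclidean_space"
  assumes "finite I" "\<And>i. i \<in> I \<Longrightarrow> integrable lebesgue (F i)" and \<delta>: "\<And>n. 0 < \<delta> n" "\<delta> \<longlonglongrightarrow> 0"
  shows "\<exists>s :: nat \<Rightarrow> nat. strict_mono s \<and> (\<forall>i\<in>I. AE x in lebesgue. (\<lambda>n. conv (moll (\<delta> (s n))) (F i) x) \<longlonglongrightarrow> F i x)"
  using assms(1,2)
proof (induction I)
  case empty
  show ?case by (intro exI[of _ id]) (simp add: strict_mono_def)
next
  case (insert i I)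
  then obtain s where s: "strict_mono (s :: nat \<Rightarrow> nat)" "\<And>i. i \<in> I \<Longrightarrow> AE x in lebesgue. (\<lambda>n. conv (moll (\<delta> (s n))) (F i) x) \<longlonglongrightarrow> F i x"
    by auto
  have ds: "(\<lambda>n. \<delta> (s n)) \<longlonglongrightarrow> 0" using LIMSEQ_subseq_LIMSEQ[OF \<delta>(2) s(1)] by (simp add: o_def)
  obtain t where t: "strict_mono (t :: nat \<Rightarrow> nat)" "AE x in lebesgue. (\<lambda>n. conv (moll (\<delta> (s (t n)))) (F i) x) \<longlonglongrightarrow> F i x"
    by (rule conv_moll_AE_subseq[OF insert.prems[OF insertI1] \<delta>(1) ds])
  have "AE x in lebesgue. (\<lambda>n. conv (moll (\<delta> (s (t n)))) (F j) x) \<longlonglongrightarrow> F j x" if "j \<in> I" for j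
    using s(2)[OF that]
  proof eventually_elim
    case (elim x)
    from LIMSEQ_subseq_LIMSEQ[OF this t(1)] show ?case by (simp add: o_def)
  qed
  then show ?case using t strict_mono_o[OF s(1) t(1)] by (intro exI[of _ "\<lambda>n. s (t n)"]) (auto simp: o_def)
qed

lemma norm_matrix_columns:
  fixes A :: "real^2^'k"
  shows "(norm A)\<^sup>2 = (norm (column 1 A))\<^sup>2 + (norm (column 2 A))\<^sup>2"
  by (simp add: power2_norm_eq_inner inner_vec_def sum_2 column_def sum.distrib)

lemma energy_const_nonneg: "0 < \<kappa> \<Longrightarrow> 0 \<le> C \<Longrightarrow> 0 \<le> R \<Longrightarrow> 0 \<le> B \<Longrightarrow> 0 \<le> energy_const \<kappa> C L R B"
  unfolding energy_const_def by (intro divide_nonneg_nonneg add_nonneg_nonneg mult_nonneg_nonneg) auto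

text \<open>All derivatives fall on the kernel, where they commute; this identifies the two mixed
  second derivatives and the two third derivatives.\<close>

lemma conv_jet:
  fixes U :: "real^2 \<Rightarrow> 'b::euclidean_space"
  assumes k: "bumps 0 (\<delta>\<^sup>2) k" "0 \<le> \<delta>" and U: "integrable lebesgue U"
  shows "pder (ax 1) (conv k U) (conv (ddir (ax 1) k) U)" "pder (ax 2) (conv k U) (conv (ddir (ax 2) k) U)"
    "pder (ax 1) (conv (ddir (ax 1) k) U) (conv (ddir (ax 1) (ddir (ax 1) k)) U)"
    "pder (ax 2) (conv (ddir (ax 1) k) U) (conv (ddir (ax 2) (ddir (ax 1) k)) U)"
    "pder (ax 1) (conv (ddir (ax 2) k) U) (conv (ddir (ax 2) (ddir (ax 1) k)) U)"
    "pder (ax 2) (conv (ddir (ax 2) k) U) (conv (ddir (ax 2) (ddir (ax 2) k)) U)"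
    "pder (ax 2) (conv (ddir (ax 2) (ddir (ax 1) k)) U) (conv (ddir (ax 2) (ddir (ax 2) (ddir (ax 1) k))) U)"
    "pder (ax 1) (conv (ddir (ax 2) (ddir (ax 2) k)) U) (conv (ddir (ax 2) (ddir (ax 2) (ddir (ax 1) k))) U)"
proof -
  have b: "bumps 0 (\<delta>\<^sup>2) (ddir e k)" for e by (rule bumps_ddir[OF k(1)])
  have bb: "bumps 0 (\<delta>\<^sup>2) (ddir e (ddir f k))" for e f by (rule bumps_ddir[OF b])
  note c = conv_pder[OF k U] conv_pder[OF b k(2) U] conv_pder[OF bb k(2) U]
  have s1: "ddir (ax 1) (ddir (ax 2) k) = ddir (ax 2) (ddir (ax 1) k)" by (rule bumps_symmetric[OF k(1)])
  have s2: "ddir (ax 1) (ddir (ax 2) (ddir (ax 2) k)) = ddir (ax 2) (ddir (ax 2) (ddir (ax 1) k))"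
    using bumps_symmetric[OF b[of "ax 2"], of "ax 1" "ax 2"] by (simp only: s1)
  show "pder (ax 1) (conv k U) (conv (ddir (ax 1) k) U)" "pder (ax 2) (conv k U) (conv (ddir (ax 2) k) U)"
    "pder (ax 1) (conv (ddir (ax 1) k) U) (conv (ddir (ax 1) (ddir (ax 1) k)) U)"
    "pder (ax 2) (conv (ddir (ax 1) k) U) (conv (ddir (ax 2) (ddir (ax 1) k)) U)"
    "pder (ax 2) (conv (ddir (ax 2) k) U) (conv (ddir (ax 2) (ddir (ax 2) k)) U)"
    "pder (ax 2) (conv (ddir (ax 2) (ddir (ax 1) k)) U) (conv (ddir (ax 2) (ddir (ax 2) (ddir (ax 1) k))) U)"
    by (rule c)+
  show "pder (ax 1) (conv (ddir (ax 2) k) U) (conv (ddir (ax 2) (ddir (ax 1) k)) U)"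
    unfolding s1[symmetric] by (rule c)
  show "pder (ax 1) (conv (ddir (ax 2) (ddir (ax 2) k)) U) (conv (ddir (ax 2) (ddir (ax 2) (ddir (ax 1) k))) U)"
    unfolding s2[symmetric] by (rule c)
qed

lemma conv_bumps_continuous:
  fixes U :: "'a::euclidean_space \<Rightarrow> 'b::euclidean_space"
  assumes "bumps 0 (\<delta>\<^sup>2) k" "0 \<le> \<delta>" "integrable lebesgue U"
  shows "continuous_on UNIV (conv k U)"
proof -
  obtain M where "\<And>z. \<bar>k z\<bar> \<le> M" using bumps_bounded[OF assms(1,2)] by metis
  then show ?thesis by (rule conv_continuous[OF bumps_continuous[OF assms(1)] _ assms(3)])
qed

text \<open>The estimate for smooth maps is applied to the mollified solution. On the right,
  Jensen's inequality replaces its squared gradient by the mollified squared gradient, which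
  converges in L1; on the left, Fatou's lemma needs only almost everywhere convergence. The defect
  disappears with the mollification scale for fixed \<open>Kp\<close>, after which \<open>Kp\<close>
  tends to infinity.\<close>

lemma solution_energy_estimate:
  fixes u :: "real^2 \<Rightarrow> real^'k" and V :: "real^'k \<Rightarrow> real"
  assumes ac: "allen_cahn_solution \<Omega> V \<epsilon> u" and \<epsilon>: "0 < \<epsilon>" "\<epsilon> \<le> 1"
    and V: "smooth_on UNIV V" "\<And>y. 0 \<le> V y" and E: "energy \<Omega> V \<epsilon> u \<le> ennreal M0" "0 \<le> M0"
    and \<Omega>: "open \<Omega>" and K: "compact K" "K \<subseteq> \<Omega>" and T: "compact T" "0 < \<delta>0" "\<And>x. x \<in> T \<Longrightarrow> cball x \<delta>0 \<subseteq> K"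
    and uL: "AE x in lebesgue. x \<in> K \<longrightarrow> norm (u x) \<le> L" and L0: "0 \<le> L"
    and pd\<theta>: "pder (ax 1) \<theta> \<theta>1" "pder (ax 2) \<theta> \<theta>2"
    and cont\<theta>: "continuous_on UNIV \<theta>" "continuous_on UNIV \<theta>1" "continuous_on UNIV \<theta>2"
    and \<theta>T: "\<And>x. x \<notin> T \<Longrightarrow> \<theta> x = 0 \<and> \<theta>1 x = 0 \<and> \<theta>2 x = 0" and \<theta>: "\<And>x. 0 \<le> \<theta> x" "\<And>x. \<theta> x \<le> 1"
    and R: "\<And>x. x \<in> T \<Longrightarrow> norm x \<le> R" "0 \<le> R" and c0: "0 < \<kappa>" "0 \<le> C"
    and B: "\<And>y. norm y \<le> L \<Longrightarrow> V y \<le> B" "0 \<le> B"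
    and GV: "\<And>y. norm y \<le> L \<Longrightarrow> grad V y \<bullet> grad V y \<le> C * V y"
    and HH: "\<And>y w. norm y \<le> L \<Longrightarrow> (hessian V y *v w) \<bullet> w \<ge> \<kappa> * (w \<bullet> w) - C * V y * (w \<bullet> w)"
  defines "z \<equiv> \<lambda>x. \<bar>\<theta>1 x\<bar> + \<bar>\<theta>2 x\<bar> + (\<theta>1 x)\<^sup>2 + (\<theta>2 x)\<^sup>2"
  shows "(\<integral>\<^sup>+x. ennreal ((\<theta> x)\<^sup>2 * energy_density \<Omega> V \<epsilon> u x) \<partial>lebesgue)
    \<le> ennreal (energy_const \<kappa> C L R B * (LINT x|lebesgue. z x * energy_density \<Omega> V \<epsilon> u x))"
proof -
  define G where "G = weak_grad \<Omega> u"
  define EC where "EC = energy_const \<kappa> C L R B"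
  have EC0: "0 \<le> EC" unfolding EC_def by (rule energy_const_nonneg[OF c0 R(2) B(2)])
  have wg: "has_weak_gradient \<Omega> u G"
    using ac unfolding G_def weak_grad_def allen_cahn_solution_def H1_on_def by (metis someI)
  note cV = smooth_on_continuous[OF V(1)]
  have cgV: "continuous_on UNIV (grad V)"
    using has_derivative_hessian[OF V(1)] by (auto intro!: continuous_at_imp_continuous_on has_derivative_continuous)
  note ed = energy_density_integrable[OF ac \<epsilon>(1) cV V(2) E(1) K \<Omega> E(2), folded G_def]
  define U where "U = rs K u"
  define F where "F = rs K (\<lambda>y. grad V (u y))"
  define Gc where "Gc j = rs K (\<lambda>y. column j (G y))" for j
  define H where "H = rs K (\<lambda>x. (norm (G x))\<^sup>2)"
  have iU: "integrable lebesgue U" and iG: "integrable lebesgue (rs K G)"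
    using wg K unfolding U_def by (auto simp: has_weak_gradient_def intro!: integrable_rs)
  have iF: "integrable lebesgue F" using ac K unfolding F_def by (auto simp: allen_cahn_solution_def intro!: integrable_rs)
  have iH: "integrable lebesgue H" using ed(7) by (simp add: H_def)
  have iGc: "integrable lebesgue (Gc j)" for j
  proof -
    have "integrable lebesgue (\<lambda>y. column j (rs K G y))" by (rule integrable_bounded_linear[OF bounded_linear_column iG])
    moreover have "column j (c *\<^sub>R A) = c *\<^sub>R column j A" for c and A :: "real^2^'k" by (simp add: column_def vec_eq_iff)
    ultimately show ?thesis by (simp add: Gc_def)
  qed
  have HGc: "H y = (norm (Gc 1 y))\<^sup>2 + (norm (Gc 2 y))\<^sup>2" for y
    by (simp add: H_def Gc_def norm_matrix_columns indicator_def)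
  have H0: "0 \<le> H y" for y by (simp add: HGc)
  have iGc2: "integrable lebesgue (\<lambda>y. (norm (Gc j y))\<^sup>2)" if "j = 1 \<or> j = 2" for j
  proof (rule Bochner_Integration.integrable_bound[OF iH])
    show "(\<lambda>y. (norm (Gc j y))\<^sup>2) \<in> borel_measurable lebesgue"
      by (rule measurable_compose[OF borel_measurable_integrable[OF iGc] borel_measurable_continuous_onI[of "\<lambda>A. (norm A)\<^sup>2"]]) (intro continuous_intros)
    show "AE y in lebesgue. norm ((norm (Gc j y))\<^sup>2) \<le> norm (H y)"
      using that by (intro AE_I2) (auto simp: HGc)
  qed
  define \<delta> where "\<delta> n = \<delta>0 / real (Suc n)" for n
  have \<delta>: "0 < \<delta> n" "\<delta> n \<le> \<delta>0" for n using T(2) by (auto simp: \<delta>_def field_simps)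
  have \<delta>l: "\<delta> \<longlonglongrightarrow> 0" unfolding \<delta>_def by (rule LIMSEQ_Suc[OF lim_const_over_n])
  obtain \<sigma> where \<sigma>: "strict_mono (\<sigma> :: nat \<Rightarrow> nat)" "\<And>X. X \<in> {U, F, Gc 1, Gc 2} \<Longrightarrow> AE x in lebesgue. (\<lambda>n. conv (moll (\<delta> (\<sigma> n))) X x) \<longlonglongrightarrow> X x"
    using conv_moll_AE_subseq_family[of "{U, F, Gc 1, Gc 2}" "\<lambda>X. X" \<delta>, OF _ _ \<delta>(1) \<delta>l] iU iF iGc by fastforce
  define d where "d n = \<delta> (\<sigma> n)" for n
  have d: "0 < d n" "d n \<le> \<delta>0" for n using \<delta> by (auto simp: d_def)
  have dl: "d \<longlonglongrightarrow> 0" using LIMSEQ_subseq_LIMSEQ[OF \<delta>l \<sigma>(1)] unfolding d_def[abs_def] o_def .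
  define k where "k n = (moll (d n) :: real^2 \<Rightarrow> real)" for n
  have bk: "bumps 0 ((d n)\<^sup>2) (k n)" and d0: "0 \<le> d n" for n unfolding k_def using d(1)[of n] by (auto intro: moll_bumps)
  have TK: "T \<subseteq> K" using T(2,3) by force
  have dK: "cball x (d n) \<subseteq> K" if "x \<in> T" for x n using T(3)[OF that] subset_cball[OF d(2), of x n] by blast
  define v where "v n = conv (k n) U" for n
  define p where "p n = conv (ddir (ax 1) (k n)) U" for n
  define q where "q n = conv (ddir (ax 2) (k n)) U" for n
  define a where "a n = conv (ddir (ax 1) (ddir (ax 1) (k n))) U" for n
  define b where "b n = conv (ddir (ax 2) (ddir (ax 1) (k n))) U" for n
  define c where "c n = conv (ddir (ax 2) (ddir (ax 2) (k n))) U" for n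
  define dd where "dd n = conv (ddir (ax 2) (ddir (ax 2) (ddir (ax 1) (k n)))) U" for n
  note defs = v_def p_def q_def a_def b_def c_def dd_def
  have cc: "continuous_on UNIV (conv k' X)" if "bumps 0 ((d n)\<^sup>2) k'" "integrable lebesgue X" for n k' and X :: "real^2 \<Rightarrow> real^'k"
    by (rule conv_bumps_continuous[OF that(1) d0 that(2)])
  have jet: "cutoff_jet (v n) (p n) (q n) (a n) (b n) (c n) (dd n) \<theta> \<theta>1 \<theta>2 T V (grad V) (\<lambda>y h. hessian V y *v h)" for n
    by (unfold_locales; (unfold defs)?; (rule conv_jet[OF bk d0 iU] cc bk bumps_ddir[OF bk] bumps_ddir[OF bumps_ddir[OF bk]]
        bumps_ddir[OF bumps_ddir[OF bumps_ddir[OF bk]]] iU pd\<theta> cont\<theta> T(1) \<theta>T has_derivative_grad[OF V(1)] has_derivative_hessian[OF V(1)] continuous_hessian[OF V(1)])+; assumption?)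
  have pG: "p n x = conv (k n) (Gc 1) x" "q n x = conv (k n) (Gc 2) x" if "x \<in> T" for n x
    using weak_gradient_conv[OF wg bk d0 dK[OF that] K(2,1) \<Omega>] by (simp_all add: p_def q_def U_def Gc_def)
  have acF: "a n x + c n x = (1 / \<epsilon>\<^sup>2) *\<^sub>R conv (k n) F x" if "x \<in> T" for n x
    using allen_cahn_conv[OF ac bk d0 dK[OF that] K(2,1) \<Omega>] by (simp add: a_def c_def U_def F_def)
  have vL: "norm (v n x) \<le> L" if "x \<in> T" for n x
  proof -
    have "norm (conv (moll (d n)) U x - 0) \<le> L"
    proof (rule conv_moll_dist_le[OF d(1) iU])
      show "AE y in lebesgue. y \<in> ball x (d n) \<longrightarrow> norm (U y - 0) \<le> L"
        using uL by eventually_elim (use L0 in \<open>auto simp: U_def indicator_def\<close>)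
    qed
    then show ?thesis by (simp add: v_def k_def)
  qed
  \<comment> \<open>A bound for \<open>\<nabla>V\<close> on the ball of radius \<open>L\<close>.
    Both parts of the defect obey it, which provides the dominating function for the squared
    defect.\<close>
  define MF where "MF = sqrt (C * B)"
  have MF: "norm (grad V y) \<le> MF" if "norm y \<le> L" for y
  proof -
    have "grad V y \<bullet> grad V y \<le> C * B" using GV[OF that] B(1)[OF that] c0 by (meson mult_left_mono order_trans)
    then show ?thesis unfolding MF_def norm_eq_sqrt_inner by (rule real_sqrt_le_mono)
  qed
  have MF0: "0 \<le> MF" using c0 B by (simp add: MF_def)
  have FL: "norm (conv (k n) F x) \<le> MF" if "x \<in> T" for n x
  proof -
    have "norm (conv (moll (d n)) F x - 0) \<le> MF"
    proof (rule conv_moll_dist_le[OF d(1) iF])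
      show "AE y in lebesgue. y \<in> ball x (d n) \<longrightarrow> norm (F y - 0) \<le> MF"
        using uL by eventually_elim (use MF MF0 in \<open>auto simp: F_def indicator_def\<close>)
    qed
    then show ?thesis by (simp add: k_def)
  qed
  define N where "N n x = p n x \<bullet> p n x + q n x \<bullet> q n x" for n x
  define e where "e n x = \<epsilon> * (p n x \<bullet> p n x + q n x \<bullet> q n x) / 2 + V (v n x) / \<epsilon>" for n x
  define g where "g n x = a n x + c n x - (1 / \<epsilon>\<^sup>2) *\<^sub>R grad V (v n x)" for n x
  have N0: "0 \<le> N n x" for n x by (simp add: N_def)
  have cH: "continuous_on UNIV (conv (k n) H)" for n by (rule conv_bumps_continuous[OF bk d0 iH])
  have NH: "N n x \<le> conv (k n) H x" if "x \<in> T" for n x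
  proof -
    have "N n x = (norm (conv (k n) (Gc 1) x))\<^sup>2 + (norm (conv (k n) (Gc 2) x))\<^sup>2"
      by (simp add: N_def pG[OF that] power2_norm_eq_inner)
    also have "\<dots> \<le> conv (k n) (\<lambda>y. (norm (Gc 1 y))\<^sup>2) x + conv (k n) (\<lambda>y. (norm (Gc 2 y))\<^sup>2) x"
      unfolding k_def by (intro add_mono conv_jensen[OF d(1) iGc iGc2]) auto
    also have "\<dots> = conv (k n) H x"
    proof -
      obtain M where M: "\<And>z. \<bar>k n z\<bar> \<le> M" using bumps_bounded[OF bk d0] by metis
      have i: "integrable lebesgue (\<lambda>y. k n (x - y) *\<^sub>R (norm (Gc j y))\<^sup>2)" if "j = 1 \<or> j = 2" for j
        by (rule conv_integrable[OF bumps_continuous[OF bk] M iGc2[OF that]])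
      show ?thesis unfolding conv_def HGc scaleR_add_right using i[of 1] i[of 2] by simp
    qed
    finally show ?thesis .
  qed
  have leb: "(LINT x|lborel. f x) = (LINT x|lebesgue. f x)" if "continuous_on UNIV f" for f :: "real^2 \<Rightarrow> real"
    using lebesgue_integral_borel(1)[OF borel_measurable_continuous_onI[OF that]] by simp
  have lebi: "integrable lebesgue f" if "continuous_on UNIV f" "\<And>x. x \<notin> T \<Longrightarrow> f x = 0" for f :: "real^2 \<Rightarrow> real"
    using lebesgue_integral_borel(2)[OF borel_measurable_continuous_onI[OF that(1)]] integrable_continuous_compact_support[OF that(1) T(1) that(2)] by simp
  have cont: "continuous_on UNIV (v n)" "continuous_on UNIV (p n)" "continuous_on UNIV (q n)" "continuous_on UNIV (a n)" "continuous_on UNIV (c n)" for n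
    unfolding defs by (intro cc[OF bk iU] cc[OF bumps_ddir[OF bk] iU] cc[OF bumps_ddir[OF bumps_ddir[OF bk]] iU])+
  have cVv: "continuous_on UNIV (\<lambda>x. V (v n x))" "continuous_on UNIV (\<lambda>x. grad V (v n x))" for n
    by (intro continuous_on_compose2[OF cV cont(1)] continuous_on_compose2[OF cgV cont(1)] subset_UNIV)+
  have cN: "continuous_on UNIV (N n)" and ce: "continuous_on UNIV (e n)" and cg: "continuous_on UNIV (g n)" for n
    unfolding N_def e_def g_def using \<epsilon> by (intro continuous_intros cont cVv; simp)+
  have cz: "continuous_on UNIV z" unfolding z_def by (intro continuous_intros cont\<theta>)
  have zT: "z x = 0" if "x \<notin> T" for x using \<theta>T[OF that] by (simp add: z_def)
  have z0: "0 \<le> z x" for x by (simp add: z_def)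
  obtain Mz where Mz: "0 < Mz" "\<And>x. z x \<le> Mz"
  proof -
    have "bounded (z ` T)" using cz T(1) by (intro compact_imp_bounded compact_continuous_image) (auto intro: continuous_on_subset)
    then obtain M where M: "0 < M" "\<And>x. x \<in> T \<Longrightarrow> norm (z x) \<le> M" unfolding bounded_pos by auto
    have "z x \<le> M" for x
    proof (cases "x \<in> T")
      case True then show ?thesis using M(2)[OF True] by simp
    next
      case False then show ?thesis using zT M(1) by simp
    qed
    then show ?thesis using that M(1) by blast
  qed
  have Tm: "T \<in> lmeasurable" using T(1) by (rule lmeasurable_compact)
  then have iT: "integrable lebesgue (indicat_real T)" by (auto simp: integrable_indicator_iff fmeasurable_def)
  define \<alpha> where "\<alpha> = (LINT x|lebesgue. z x * energy_density \<Omega> V \<epsilon> u x)"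
  define \<gamma> where "\<gamma> = (LINT x|lebesgue. norm (H x))"
  define A1 where "A1 n = (LINT x|lebesgue. z x * conv (k n) H x)" for n
  define A2 where "A2 n = (LINT x|lebesgue. z x * V (v n x))" for n
  define \<beta> where "\<beta> n = (LINT x|lebesgue. \<theta> x * (g n x \<bullet> g n x))" for n
  have icH: "integrable lebesgue (conv (k n) H)" for n unfolding k_def by (rule conv_moll_L1(1)[OF d(1) iH])
  have zH: "integrable lebesgue (\<lambda>x. z x * X x)" if "integrable lebesgue X" for X :: "real^2 \<Rightarrow> real"
  proof (rule Bochner_Integration.integrable_bound)
    show "integrable lebesgue (\<lambda>x. Mz * X x)" using that by simp
    have "z \<in> borel_measurable lebesgue" using borel_measurable_continuous_onI[OF cz] by (intro measurable_completion) simp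
    then show "(\<lambda>x. z x * X x) \<in> borel_measurable lebesgue" using that by (intro borel_measurable_times) auto
    show "AE x in lebesgue. norm (z x * X x) \<le> norm (Mz * X x)"
      using z0 Mz by (intro AE_I2) (auto simp: abs_mult intro!: mult_right_mono)
  qed
  have A1l: "A1 \<longlonglongrightarrow> (LINT x|lebesgue. z x * H x)"
  proof (rule LIM_zero_cancel, rule Lim_null_comparison)
    show "(\<lambda>n. Mz * (LINT y|lebesgue. norm (conv (k n) H y - H y))) \<longlonglongrightarrow> 0"
      using tendsto_mult_right_zero[OF conv_moll_tendsto_L1[OF iH d(1) dl], of Mz] by (simp add: k_def)
    show "\<forall>\<^sub>F n in sequentially. norm (A1 n - (LINT x|lebesgue. z x * H x)) \<le> Mz * (LINT y|lebesgue. norm (conv (k n) H y - H y))"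
    proof (intro always_eventually allI)
      fix n
      have "A1 n - (LINT x|lebesgue. z x * H x) = (LINT x|lebesgue. z x * (conv (k n) H x - H x))"
        unfolding A1_def right_diff_distrib using zH[OF icH] zH[OF iH] by simp
      also have "norm \<dots> \<le> (LINT x|lebesgue. Mz * norm (conv (k n) H x - H x))"
        using z0 Mz icH iH by (intro Bochner_Integration.integral_norm_bound_integral zH) (auto simp: abs_mult intro!: mult_right_mono)
      finally show "norm (A1 n - (LINT x|lebesgue. z x * H x)) \<le> Mz * (LINT y|lebesgue. norm (conv (k n) H y - H y))" by simp
    qed
  qed
  have AEv: "AE x in lebesgue. x \<in> T \<longrightarrow> (\<lambda>n. v n x) \<longlonglongrightarrow> u x"
    using \<sigma>(2)[of U, simplified]
    by eventually_elim (use TK in \<open>auto simp: v_def k_def d_def U_def indicator_def\<close>)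
  have AEF: "AE x in lebesgue. x \<in> T \<longrightarrow> (\<lambda>n. conv (k n) F x) \<longlonglongrightarrow> grad V (u x)"
    using \<sigma>(2)[of F, simplified]
    by eventually_elim (use TK in \<open>auto simp: k_def d_def F_def indicator_def\<close>)
  have AEG: "AE x in lebesgue. x \<in> T \<longrightarrow> (\<lambda>n. conv (k n) (Gc j) x) \<longlonglongrightarrow> column j (G x)" if j: "j = 1 \<or> j = 2" for j
  proof -
    have "Gc j \<in> {U, F, Gc 1, Gc 2}" using j by auto
    from \<sigma>(2)[OF this] show ?thesis
      by eventually_elim (use TK in \<open>auto simp: k_def d_def Gc_def indicator_def\<close>)
  qed
  have Vc: "(\<lambda>n. V (w n)) \<longlonglongrightarrow> V l" "(\<lambda>n. grad V (w n)) \<longlonglongrightarrow> grad V l" if "w \<longlonglongrightarrow> l" for w l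
  proof -
    have "isCont V l" "isCont (grad V) l" using cV cgV by (simp_all add: continuous_on_eq_continuous_at)
    then show "(\<lambda>n. V (w n)) \<longlonglongrightarrow> V l" "(\<lambda>n. grad V (w n)) \<longlonglongrightarrow> grad V l" using that by (auto intro: isCont_tendsto_compose)
  qed
  have izV: "integrable lebesgue (\<lambda>x. z x * rs K (\<lambda>x. V (u x)) x)" by (rule zH[OF ed(5)])
  have A2l: "A2 \<longlonglongrightarrow> (LINT x|lebesgue. z x * rs K (\<lambda>x. V (u x)) x)"
    unfolding A2_def
  proof (rule integral_dominated_convergence[where w = "\<lambda>x. (Mz * B) * indicat_real T x"])
    show "(\<lambda>x. z x * rs K (\<lambda>x. V (u x)) x) \<in> borel_measurable lebesgue" using izV by auto
    show "(\<lambda>x. z x * V (v n x)) \<in> borel_measurable lebesgue" for n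
      using lebi[OF continuous_on_mult[OF cz cVv(1)]] zT by (intro borel_measurable_integrable) auto
    show "integrable lebesgue (\<lambda>x. (Mz * B) * indicat_real T x)" using iT by simp
    show "AE x in lebesgue. (\<lambda>n. z x * V (v n x)) \<longlonglongrightarrow> z x * rs K (\<lambda>x. V (u x)) x"
      using AEv
    proof eventually_elim
      case (elim x)
      show ?case
      proof (cases "x \<in> T")
        case True
        then have "rs K (\<lambda>x. V (u x)) x = V (u x)" using TK by auto
        then show ?thesis using tendsto_mult[OF tendsto_const Vc(1)[of "\<lambda>n. v n x" "u x"], of "z x"] elim True by metis
      qed (simp add: zT)
    qed
    show "AE x in lebesgue. norm (z x * V (v n x)) \<le> (Mz * B) * indicat_real T x" for n
    proof (rule AE_I2)
      fix x show "norm (z x * V (v n x)) \<le> (Mz * B) * indicat_real T x"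
      proof (cases "x \<in> T")
        case True
        then show ?thesis using z0 Mz B(1)[OF vL[OF True]] V(2) by (simp add: abs_mult mult_mono)
      qed (simp add: zT)
    qed
  qed
  \<comment> \<open>Both parts of the defect tend to a multiple of \<open>grad V (u x)\<close>
    almost everywhere: the mollified \<open>\<nabla>V(u)\<close> along the chosen subsequence, and
    \<open>\<nabla>V\<close> of the mollified map by continuity.\<close>
  have \<beta>l: "\<beta> \<longlonglongrightarrow> (LINT x|(lebesgue :: (real^2) measure). 0)"
    unfolding \<beta>_def
  proof (rule integral_dominated_convergence[where w = "\<lambda>x. (2 * MF / \<epsilon>\<^sup>2)\<^sup>2 * indicat_real T x"])
    have gF: "g n x = (1 / \<epsilon>\<^sup>2) *\<^sub>R (conv (k n) F x - grad V (v n x))" if "x \<in> T" for n x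
      by (simp add: g_def acF[OF that] scaleR_diff_right)
    show "(\<lambda>x. \<theta> x * (g n x \<bullet> g n x)) \<in> borel_measurable lebesgue" for n
      using lebi[OF continuous_on_mult[OF cont\<theta>(1) continuous_on_inner[OF cg cg]]] \<theta>T by (intro borel_measurable_integrable) auto
    show "integrable lebesgue (\<lambda>x. (2 * MF / \<epsilon>\<^sup>2)\<^sup>2 * indicat_real T x)" using iT by simp
    show "AE x in lebesgue. (\<lambda>n. \<theta> x * (g n x \<bullet> g n x)) \<longlonglongrightarrow> 0"
      using AEv AEF
    proof eventually_elim
      case (elim x)
      show ?case
      proof (cases "x \<in> T")
        case True
        have "(\<lambda>n. conv (k n) F x - grad V (v n x)) \<longlonglongrightarrow> grad V (u x) - grad V (u x)"
          by (intro tendsto_diff Vc(2)) (use elim True in auto)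
        then have "(\<lambda>n. g n x) \<longlonglongrightarrow> (1 / \<epsilon>\<^sup>2) *\<^sub>R (grad V (u x) - grad V (u x))" unfolding gF[OF True] by (intro tendsto_scaleR tendsto_const)
        then have "(\<lambda>n. g n x) \<longlonglongrightarrow> 0" by simp
        then have "(\<lambda>n. \<theta> x * (g n x \<bullet> g n x)) \<longlonglongrightarrow> \<theta> x * (0 \<bullet> (0 :: real^'k))" by (intro tendsto_mult tendsto_inner tendsto_const)
        then show ?thesis by simp
      qed (simp add: \<theta>T)
    qed
    show "AE x in lebesgue. norm (\<theta> x * (g n x \<bullet> g n x)) \<le> (2 * MF / \<epsilon>\<^sup>2)\<^sup>2 * indicat_real T x" for n
    proof (rule AE_I2)
      fix x show "norm (\<theta> x * (g n x \<bullet> g n x)) \<le> (2 * MF / \<epsilon>\<^sup>2)\<^sup>2 * indicat_real T x"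
      proof (cases "x \<in> T")
        case True
        have "norm (conv (k n) F x - grad V (v n x)) \<le> MF + MF"
          by (rule norm_triangle_le_diff) (intro add_mono FL[OF True] MF[OF vL[OF True]])
        then have "norm (g n x) \<le> 2 * MF / \<epsilon>\<^sup>2" unfolding gF[OF True] using \<epsilon>(1) by (simp add: divide_right_mono)
        then have "(norm (g n x))\<^sup>2 \<le> (2 * MF / \<epsilon>\<^sup>2)\<^sup>2" by (intro power_mono) auto
        moreover have "\<theta> x * (g n x \<bullet> g n x) \<le> 1 * (g n x \<bullet> g n x)" using \<theta> by (intro mult_right_mono) auto
        ultimately show ?thesis using True \<theta>(1)[of x] by (simp add: power2_norm_eq_inner)
      qed (simp add: \<theta>T)
    qed
  qed simp
  have main: "(LINT x|lebesgue. (\<theta> x)\<^sup>2 * e n x) \<le> EC * (\<epsilon> / 2 * A1 n + A2 n / \<epsilon> + Kp * \<beta> n + \<gamma> / Kp)" if Kp: "1 \<le> Kp" for n Kp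
  proof -
    interpret J: cutoff_jet "v n" "p n" "q n" "a n" "b n" "c n" "dd n" \<theta> \<theta>1 \<theta>2 T V "grad V" "\<lambda>y h. hessian V y *v h"
      by (rule jet)
    have "(LINT x|lborel. (\<theta> x)\<^sup>2 * e n x) \<le> EC * ((LINT x|lborel. z x * e n x) + Kp * (LINT x|lborel. \<theta> x * (g n x \<bullet> g n x)) + (LINT x|lborel. \<theta> x * N n x) / Kp)"
      unfolding EC_def z_def e_def g_def N_def
      by (rule J.energy_estimate[OF \<epsilon> Kp c0 \<theta> vL R V(2) B GV HH])
    then have 1: "(LINT x|lebesgue. (\<theta> x)\<^sup>2 * e n x) \<le> EC * ((LINT x|lebesgue. z x * e n x) + Kp * \<beta> n + (LINT x|lebesgue. \<theta> x * N n x) / Kp)"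
      unfolding \<beta>_def using leb[of "\<lambda>x. (\<theta> x)\<^sup>2 * e n x"] leb[of "\<lambda>x. z x * e n x"] leb[of "\<lambda>x. \<theta> x * (g n x \<bullet> g n x)"] leb[of "\<lambda>x. \<theta> x * N n x"]
      by (simp add: continuous_on_mult continuous_on_inner continuous_on_power cont\<theta> ce cz cg cN)
    have iVz: "integrable lebesgue (\<lambda>x. z x * V (v n x))"
      using lebi[OF continuous_on_mult[OF cz cVv(1)]] zT by auto
    have ize: "integrable lebesgue (\<lambda>x. z x * e n x)" using lebi[OF continuous_on_mult[OF cz ce]] zT by auto
    have "(LINT x|lebesgue. z x * e n x) \<le> (LINT x|lebesgue. \<epsilon> / 2 * (z x * conv (k n) H x) + (z x * V (v n x)) / \<epsilon>)"
    proof (rule integral_mono[OF ize])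
      show "integrable lebesgue (\<lambda>x. \<epsilon> / 2 * (z x * conv (k n) H x) + (z x * V (v n x)) / \<epsilon>)" using zH[OF icH] iVz by simp
      fix x
      show "z x * e n x \<le> \<epsilon> / 2 * (z x * conv (k n) H x) + (z x * V (v n x)) / \<epsilon>"
      proof (cases "x \<in> T")
        case True
        have "z x * (\<epsilon> / 2 * N n x) \<le> z x * (\<epsilon> / 2 * conv (k n) H x)"
          using NH[OF True] z0 \<epsilon> by (intro mult_left_mono) auto
        moreover have "z x * e n x = z x * (\<epsilon> / 2 * N n x) + (z x * V (v n x)) / \<epsilon>"
          by (simp add: e_def N_def distrib_left)
        ultimately show ?thesis by (simp add: mult_ac)
      qed (simp add: zT)
    qed
    also have "\<dots> = \<epsilon> / 2 * A1 n + A2 n / \<epsilon>" unfolding A1_def A2_def using zH[OF icH, of n] iVz by simp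
    finally have 2: "(LINT x|lebesgue. z x * e n x) \<le> \<epsilon> / 2 * A1 n + A2 n / \<epsilon>" .
    have 3: "(LINT x|lebesgue. \<theta> x * N n x) \<le> \<gamma>"
    proof -
      have i\<theta>N: "integrable lebesgue (\<lambda>x. \<theta> x * N n x)" using lebi[OF continuous_on_mult[OF cont\<theta>(1) cN]] \<theta>T by auto
      have "(LINT x|lebesgue. \<theta> x * N n x) \<le> (LINT x|lebesgue. norm (conv (k n) H x))"
      proof (rule integral_mono[OF i\<theta>N])
        show "integrable lebesgue (\<lambda>x. norm (conv (k n) H x))" using icH by simp
        fix x show "\<theta> x * N n x \<le> norm (conv (k n) H x)"
        proof (cases "x \<in> T")
          case True
          have "\<theta> x * N n x \<le> 1 * N n x" using \<theta> N0 by (intro mult_right_mono)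
          also have "\<dots> \<le> norm (conv (k n) H x)" using NH[OF True, of n] by simp
          finally show ?thesis .
        qed (simp add: \<theta>T)
      qed
      also have "\<dots> \<le> \<gamma>" unfolding \<gamma>_def k_def by (rule conv_moll_L1(2)[OF d(1) iH])
      finally show ?thesis .
    qed
    have "(LINT x|lebesgue. z x * e n x) + Kp * \<beta> n + (LINT x|lebesgue. \<theta> x * N n x) / Kp \<le> \<epsilon> / 2 * A1 n + A2 n / \<epsilon> + Kp * \<beta> n + \<gamma> / Kp"
      using 2 3 Kp by (intro add_mono divide_right_mono) auto
    from mult_left_mono[OF this EC0] 1 show ?thesis by linarith
  qed
  have \<alpha>: "\<alpha> = \<epsilon> / 2 * (LINT x|lebesgue. z x * H x) + (LINT x|lebesgue. z x * rs K (\<lambda>x. V (u x)) x) / \<epsilon>"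
  proof -
    have "\<alpha> = (LINT x|lebesgue. \<epsilon> / 2 * (z x * H x) + (z x * rs K (\<lambda>x. V (u x)) x) / \<epsilon>)"
      unfolding \<alpha>_def
    proof (rule Bochner_Integration.integral_cong)
      fix x show "z x * energy_density \<Omega> V \<epsilon> u x = \<epsilon> / 2 * (z x * H x) + (z x * rs K (\<lambda>x. V (u x)) x) / \<epsilon>"
        using TK zT[of x] by (cases "x \<in> T") (auto simp: energy_density_def H_def G_def algebra_simps)
    qed simp
    then show ?thesis using zH[OF iH] izV by simp
  qed
  have bnd: "(\<integral>\<^sup>+x. ennreal ((\<theta> x)\<^sup>2 * energy_density \<Omega> V \<epsilon> u x) \<partial>lebesgue) \<le> ennreal (EC * (\<alpha> + \<gamma> / Kp))" if Kp: "1 \<le> Kp" for Kp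
  proof -
    have e0: "0 \<le> e n x" for n x using N0[of n x] \<epsilon> V(2) by (simp add: e_def N_def)
    have i\<theta>e: "integrable lebesgue (\<lambda>x. (\<theta> x)\<^sup>2 * e n x)" for n
      using lebi[OF continuous_on_mult[OF continuous_on_power[OF cont\<theta>(1)] ce]] \<theta>T by auto
    have lim: "(\<lambda>n. ennreal (EC * (\<epsilon> / 2 * A1 n + A2 n / \<epsilon> + Kp * \<beta> n + \<gamma> / Kp))) \<longlonglongrightarrow> ennreal (EC * (\<alpha> + \<gamma> / Kp))"
    proof -
      have "(\<lambda>n. EC * (\<epsilon> / 2 * A1 n + A2 n / \<epsilon> + Kp * \<beta> n + \<gamma> / Kp)) \<longlonglongrightarrow> EC * (\<alpha> + Kp * (LINT x|(lebesgue :: (real^2) measure). 0) + \<gamma> / Kp)"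
        unfolding \<alpha> by (intro tendsto_intros A1l A2l \<beta>l) (use \<epsilon> in auto)
      then show ?thesis by (intro tendsto_ennrealI) simp
    qed
    have "(\<integral>\<^sup>+x. ennreal ((\<theta> x)\<^sup>2 * energy_density \<Omega> V \<epsilon> u x) \<partial>lebesgue) = (\<integral>\<^sup>+x. liminf (\<lambda>n. ennreal ((\<theta> x)\<^sup>2 * e n x)) \<partial>lebesgue)"
    proof (rule nn_integral_cong_AE)
      show "AE x in lebesgue. ennreal ((\<theta> x)\<^sup>2 * energy_density \<Omega> V \<epsilon> u x) = liminf (\<lambda>n. ennreal ((\<theta> x)\<^sup>2 * e n x))"
        using AEv AEG[OF disjI1[OF refl]] AEG[OF disjI2[OF refl]]
      proof eventually_elim
        case (elim x)
        have "(\<lambda>n. (\<theta> x)\<^sup>2 * e n x) \<longlonglongrightarrow> (\<theta> x)\<^sup>2 * energy_density \<Omega> V \<epsilon> u x"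
        proof (cases "x \<in> T")
          case True
          have "(\<lambda>n. e n x) \<longlonglongrightarrow> \<epsilon> * (column 1 (G x) \<bullet> column 1 (G x) + column 2 (G x) \<bullet> column 2 (G x)) / 2 + V (u x) / \<epsilon>"
            unfolding e_def pG[OF True] using elim True Vc(1) \<epsilon> by (intro tendsto_intros) auto
          moreover have "\<epsilon> * (column 1 (G x) \<bullet> column 1 (G x) + column 2 (G x) \<bullet> column 2 (G x)) / 2 + V (u x) / \<epsilon> = energy_density \<Omega> V \<epsilon> u x"
            using norm_matrix_columns[of "G x"] by (simp add: energy_density_def G_def power2_norm_eq_inner)
          ultimately show ?thesis by (intro tendsto_intros) simp
        qed (simp add: \<theta>T)
        from lim_imp_Liminf[OF _ tendsto_ennrealI[OF this]] show ?case by simp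
      qed
    qed
    also have "\<dots> \<le> liminf (\<lambda>n. \<integral>\<^sup>+x. ennreal ((\<theta> x)\<^sup>2 * e n x) \<partial>lebesgue)"
      using i\<theta>e by (intro nn_integral_liminf) auto
    also have "\<dots> \<le> liminf (\<lambda>n. ennreal (EC * (\<epsilon> / 2 * A1 n + A2 n / \<epsilon> + Kp * \<beta> n + \<gamma> / Kp)))"
    proof (intro Liminf_mono always_eventually allI)
      fix n
      have "(\<integral>\<^sup>+x. ennreal ((\<theta> x)\<^sup>2 * e n x) \<partial>lebesgue) = ennreal (LINT x|lebesgue. (\<theta> x)\<^sup>2 * e n x)"
        using i\<theta>e e0 by (intro nn_integral_eq_integral) auto
      also have "\<dots> \<le> ennreal (EC * (\<epsilon> / 2 * A1 n + A2 n / \<epsilon> + Kp * \<beta> n + \<gamma> / Kp))" by (intro ennreal_leI main Kp)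
      finally show "(\<integral>\<^sup>+x. ennreal ((\<theta> x)\<^sup>2 * e n x) \<partial>lebesgue) \<le> \<dots>" .
    qed
    also have "\<dots> = ennreal (EC * (\<alpha> + \<gamma> / Kp))" using lim_imp_Liminf[OF _ lim] by simp
    finally show ?thesis .
  qed
  \<comment> \<open>\<open>\<gamma>\<close> does not depend on \<open>Kp\<close>, so its share
    disappears along \<open>Kp = n + 1\<close>.\<close>
  have "(\<lambda>n. ennreal (EC * (\<alpha> + \<gamma> / real (Suc n)))) \<longlonglongrightarrow> ennreal (EC * (\<alpha> + 0))"
    by (intro tendsto_ennrealI tendsto_intros LIMSEQ_Suc[OF lim_const_over_n])
  then have "(\<integral>\<^sup>+x. ennreal ((\<theta> x)\<^sup>2 * energy_density \<Omega> V \<epsilon> u x) \<partial>lebesgue) \<le> ennreal (EC * (\<alpha> + 0))"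
    by (rule LIMSEQ_le_const) (use bnd in \<open>auto intro!: exI[of _ 0]\<close>)
  then show ?thesis by (simp add: EC_def \<alpha>_def)
qed

section \<open>The concentration set\<close>

lemma pder_locally_constant:
  assumes "pder e f f'" "open U" "x \<in> U" "\<And>y. y \<in> U \<Longrightarrow> f y = c"
  shows "f' x = 0"
proof -
  have d: "((\<lambda>t. f (x + t *\<^sub>R e)) has_vector_derivative f' x) (at 0)" using assms(1) by (simp add: pder_def)
  have op: "open ((\<lambda>t. x + t *\<^sub>R e) -` U)" by (intro open_vimage assms(2) continuous_intros)
  have "((\<lambda>t. f (x + t *\<^sub>R e)) has_vector_derivative 0) (at 0)"
    by (rule has_vector_derivative_transform_within_open[OF has_vector_derivative_const[of c] op]) (use assms in auto)
  then show ?thesis using d vector_derivative_unique_at by blast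
qed

text \<open>The indicator of the closed neighbourhood of radius 2 \<delta>, mollified at scale
  \<delta>: it is constant on the ball of radius \<delta> about any point at distance below \<delta>
  or above 3 \<delta> from \<open>Z\<close>. The derivatives vanish at these points because they
  form open sets.\<close>

lemma smooth_cutoff:
  fixes Z :: "(real^2) set"
  assumes Z: "compact Z" "Z \<noteq> {}" and \<delta>: "0 < \<delta>"
  obtains \<theta> \<theta>1 \<theta>2 :: "real^2 \<Rightarrow> real"
  where "pder (ax 1) \<theta> \<theta>1" "pder (ax 2) \<theta> \<theta>2"
    "continuous_on UNIV \<theta>" "continuous_on UNIV \<theta>1" "continuous_on UNIV \<theta>2" "\<And>x. 0 \<le> \<theta> x" "\<And>x. \<theta> x \<le> 1"
    "\<And>x. infdist x Z < \<delta> \<Longrightarrow> \<theta> x = 1 \<and> \<theta>1 x = 0 \<and> \<theta>2 x = 0"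
    "\<And>x. 3 * \<delta> < infdist x Z \<Longrightarrow> \<theta> x = 0 \<and> \<theta>1 x = 0 \<and> \<theta>2 x = 0"
proof -
  define N where "N = {x. infdist x Z \<le> 2 * \<delta>}"
  define F where "F = (indicat_real N :: real^2 \<Rightarrow> real)"
  define k where "k = (moll \<delta> :: real^2 \<Rightarrow> real)"
  define \<theta> where "\<theta> = conv k F"
  have "compact N" unfolding N_def using Z \<delta> by (intro compact_infdist_le) auto
  then have "N \<in> lmeasurable" by (rule lmeasurable_compact)
  then have iF: "integrable lebesgue F" by (auto simp: F_def integrable_indicator_iff fmeasurable_def)
  have bk: "bumps 0 (\<delta>\<^sup>2) k" and d0: "0 \<le> \<delta>" using \<delta> moll_bumps by (auto simp: k_def)
  have near: "\<theta> x = c" if "\<And>y. y \<in> ball x \<delta> \<Longrightarrow> F y = c" for x c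
  proof -
    have "norm (conv (moll \<delta>) F x - c) \<le> 0"
      by (rule conv_moll_dist_le[OF \<delta> iF]) (use that in auto)
    then show ?thesis by (simp add: \<theta>_def k_def)
  qed
  have dist: "\<bar>infdist x Z - infdist y Z\<bar> \<le> dist x y" for x y
    using infdist_triangle[of x Z y] infdist_triangle[of y Z x] by (simp add: dist_commute abs_le_iff)
  have one: "\<theta> x = 1" if "infdist x Z < \<delta>" for x
  proof (rule near)
    fix y assume "y \<in> ball x \<delta>"
    then show "F y = 1" using dist[of x y] that by (simp add: F_def N_def)
  qed
  have zero: "\<theta> x = 0" if "3 * \<delta> < infdist x Z" for x
  proof (rule near)
    fix y assume "y \<in> ball x \<delta>"
    then show "F y = 0" using dist[of x y] that by (simp add: F_def N_def)
  qed
  have pd: "pder (ax i) \<theta> (conv (ddir (ax i) k) F)" for i unfolding \<theta>_def by (rule conv_pder[OF bk d0 iF])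
  have ci: "continuous_on UNIV (\<lambda>x. infdist x Z)" by (intro continuous_intros)
  have d1: "conv (ddir (ax i) k) F x = 0" if "infdist x Z < \<delta>" for i x
  proof (rule pder_locally_constant[OF pd])
    show "open {x. infdist x Z < \<delta>}" by (intro open_Collect_less ci continuous_intros)
  qed (use that one in auto)
  have d2: "conv (ddir (ax i) k) F x = 0" if "3 * \<delta> < infdist x Z" for i x
  proof (rule pder_locally_constant[OF pd])
    show "open {x. 3 * \<delta> < infdist x Z}" by (intro open_Collect_less ci continuous_intros)
  qed (use that zero in auto)
  have "\<bar>\<theta> x - 1 / 2\<bar> \<le> 1 / 2" for x
  proof -
    have "norm (conv (moll \<delta>) F x - 1 / 2) \<le> 1 / 2"
      by (rule conv_moll_dist_le[OF \<delta> iF]) (auto simp: F_def indicator_def)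
    then show ?thesis by (simp add: \<theta>_def k_def)
  qed
  then have "0 \<le> \<theta> x" "\<theta> x \<le> 1" for x unfolding abs_le_iff by (smt (verit) field_sum_of_halves)+
  moreover have "continuous_on UNIV \<theta>" "continuous_on UNIV (conv (ddir (ax i) k) F)" for i
    unfolding \<theta>_def by (intro conv_bumps_continuous[OF _ d0 iF] bk bumps_ddir)+
  ultimately show ?thesis using that[OF pd pd] one zero d1 d2 by blast
qed

section \<open>From energy densities to the limit measure\<close>

lemma energy_density_measurable:
  fixes u :: "real^2 \<Rightarrow> real^'k"
  assumes ac: "allen_cahn_solution \<Omega> V \<epsilon> u" and \<epsilon>: "0 < \<epsilon>" and V: "continuous_on UNIV V" "\<And>y. 0 \<le> V y"
    and E: "energy \<Omega> V \<epsilon> u \<le> ennreal M0" and \<Omega>: "open \<Omega>" and M0: "0 \<le> M0"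
  shows "energy_density \<Omega> V \<epsilon> u \<in> borel_measurable (lebesgue_on \<Omega>)"
proof -
  \<comment> \<open>Measurability is known after cutting off at compact sets; an exhaustion gives it
    on the whole domain.\<close>
  obtain K where K: "\<And>n. compact (K n)" "\<And>n. K n \<subseteq> \<Omega>" "\<And>n. K n \<subseteq> interior (K (Suc n))" "\<Union>(range K) = \<Omega>"
    using open_Union_compact_subsets[OF \<Omega>] by metis
  have inc: "K n \<subseteq> K m" if "n \<le> m" for n m
    using that by (rule lift_Suc_mono_le[rotated]) (use K(3) interior_subset in blast)
  have "rs \<Omega> (energy_density \<Omega> V \<epsilon> u) \<in> borel_measurable lebesgue"
  proof (rule borel_measurable_LIMSEQ_real)
    show "rs (K n) (energy_density \<Omega> V \<epsilon> u) \<in> borel_measurable lebesgue" for n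
      using energy_density_integrable(3)[OF ac \<epsilon> V E K(1,2) \<Omega> M0] by auto
    fix x
    have "\<exists>N. \<forall>n\<ge>N. rs (K n) (energy_density \<Omega> V \<epsilon> u) x = rs \<Omega> (energy_density \<Omega> V \<epsilon> u) x"
    proof (cases "x \<in> \<Omega>")
      case True
      then obtain N where "x \<in> K N" using K(4) by auto
      then have "x \<in> K n" if "N \<le> n" for n using inc[OF that] by blast
      then show ?thesis using True by (intro exI[of _ N]) (simp add: indicator_def)
    next
      case False
      then have "x \<notin> K n" for n using K(2) by blast
      then show ?thesis using False by (simp add: indicator_def)
    qed
    then show "(\<lambda>n. rs (K n) (energy_density \<Omega> V \<epsilon> u) x) \<longlonglongrightarrow> rs \<Omega> (energy_density \<Omega> V \<epsilon> u) x"
      by (intro tendsto_eventually) (simp only: eventually_sequentially)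
  qed
  then show ?thesis
    using \<Omega> by (subst borel_measurable_restrict_space_iff) (auto simp: mult.commute)
qed

lemma integral_energy_measure:
  fixes u :: "real^2 \<Rightarrow> real^'k"
  assumes ac: "allen_cahn_solution \<Omega> V \<epsilon> u" and \<epsilon>: "0 < \<epsilon>" and V: "continuous_on UNIV V" "\<And>y. 0 \<le> V y"
    and E: "energy \<Omega> V \<epsilon> u \<le> ennreal M0" and \<Omega>: "open \<Omega>" and M0: "0 \<le> M0"
    and \<phi>: "continuous_on UNIV \<phi>" "\<And>x. x \<notin> \<Omega> \<Longrightarrow> \<phi> x = 0"
  shows "(LINT x|energy_measure \<Omega> V \<epsilon> u. \<phi> x) = (LINT x|lebesgue. \<phi> x * energy_density \<Omega> V \<epsilon> u x)"
proof -
  have m\<phi>: "\<phi> \<in> borel_measurable lebesgue" using borel_measurable_continuous_onI[OF \<phi>(1)] by (intro measurable_completion) simp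
  have "(LINT x|energy_measure \<Omega> V \<epsilon> u. \<phi> x) = (LINT x|lebesgue_on \<Omega>. energy_density \<Omega> V \<epsilon> u x *\<^sub>R \<phi> x)"
    unfolding energy_measure_def
  proof (rule integral_density)
    show "\<phi> \<in> borel_measurable (lebesgue_on \<Omega>)" using m\<phi> by (rule measurable_restrict_space1)
    show "AE x in lebesgue_on \<Omega>. 0 \<le> energy_density \<Omega> V \<epsilon> u x" using \<epsilon> V(2) by (intro AE_I2) (simp add: energy_density_def)
  qed (rule energy_density_measurable[OF ac \<epsilon> V E \<Omega> M0])
  also have "\<dots> = (LINT x|lebesgue. indicator \<Omega> x *\<^sub>R (energy_density \<Omega> V \<epsilon> u x *\<^sub>R \<phi> x))"
    using \<Omega> by (intro integral_restrict_space) auto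
  also have "\<dots> = (LINT x|lebesgue. \<phi> x * energy_density \<Omega> V \<epsilon> u x)"
    using \<phi>(2) by (intro Bochner_Integration.integral_cong) (auto simp: indicator_def)
  finally show ?thesis .
qed

text \<open>Clearing-out upgrades small mass at one scale to a null disk of half the radius. At a
  point of the set this cannot happen, since the liminf would be 0; off the set, a liminf below
  \<eta> provides an arbitrarily small scale at which it does.\<close>

lemma concentration_set_density:
  assumes cl: "\<And>x r. 0 < r \<Longrightarrow> ball x r \<subseteq> \<Omega> \<Longrightarrow> emeasure \<nu> (cball x r \<inter> \<Omega>) < ennreal (\<eta> * r) \<Longrightarrow> emeasure \<nu> (cball x (r / 2) \<inter> \<Omega>) = 0"
    and \<eta>: "0 < \<eta>" and \<nu>: "radon_measure_on \<Omega> \<nu>" and \<Omega>: "open \<Omega>"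
  shows "x \<in> concentration_set \<Omega> \<nu> \<eta> \<Longrightarrow> 0 < s \<Longrightarrow> ball x s \<subseteq> \<Omega> \<Longrightarrow> ennreal (\<eta> * s) \<le> emeasure \<nu> (cball x s \<inter> \<Omega>)"
    and "x \<in> \<Omega> \<Longrightarrow> x \<notin> concentration_set \<Omega> \<nu> \<eta> \<Longrightarrow> \<exists>\<rho>>0. emeasure \<nu> (cball x \<rho> \<inter> \<Omega>) = 0"
proof -
  have sm: "cball y t \<inter> \<Omega> \<in> sets \<nu>" for y t
    using \<nu> \<Omega> by (auto simp: radon_measure_on_def sets_restrict_space image_iff intro!: bexI[of _ "cball y t"])
  show "ennreal (\<eta> * s) \<le> emeasure \<nu> (cball x s \<inter> \<Omega>)" if x: "x \<in> concentration_set \<Omega> \<nu> \<eta>" "0 < s" "ball x s \<subseteq> \<Omega>"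
  proof (rule ccontr)
    assume "\<not> ?thesis"
    then have z: "emeasure \<nu> (cball x (s / 2) \<inter> \<Omega>) = 0" using cl[OF x(2,3)] by auto
    have "\<forall>\<^sub>F r in at_right 0. emeasure \<nu> (cball x r \<inter> \<Omega>) / ennreal r = 0"
      using eventually_at_right_real[OF half_gt_zero[OF x(2)]]
    proof eventually_elim
      case (elim r)
      have "emeasure \<nu> (cball x r \<inter> \<Omega>) \<le> emeasure \<nu> (cball x (s / 2) \<inter> \<Omega>)"
        using elim sm by (intro emeasure_mono) auto
      then show ?case using z by simp
    qed
    then have "Liminf (at_right 0) (\<lambda>r. emeasure \<nu> (cball x r \<inter> \<Omega>) / ennreal r) = Liminf (at_right (0::real)) (\<lambda>r. 0 :: ennreal)"
      by (rule Liminf_eq)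
    also have "\<dots> = 0" by (intro Liminf_const) simp
    finally show False using x(1) \<eta> by (simp add: concentration_set_def)
  qed
  show "\<exists>\<rho>>0. emeasure \<nu> (cball x \<rho> \<inter> \<Omega>) = 0" if x: "x \<in> \<Omega>" "x \<notin> concentration_set \<Omega> \<nu> \<eta>"
  proof -
    obtain t where t: "0 < t" "ball x t \<subseteq> \<Omega>" using \<Omega> x(1) open_contains_ball by blast
    have nl: "\<not> ennreal \<eta> \<le> Liminf (at_right 0) (\<lambda>r. emeasure \<nu> (cball x r \<inter> \<Omega>) / ennreal r)"
      using x by (simp add: concentration_set_def)
    have "\<not> (\<forall>r. 0 < r \<and> r < t \<longrightarrow> ennreal \<eta> \<le> emeasure \<nu> (cball x r \<inter> \<Omega>) / ennreal r)"
    proof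
      assume a: "\<forall>r. 0 < r \<and> r < t \<longrightarrow> ennreal \<eta> \<le> emeasure \<nu> (cball x r \<inter> \<Omega>) / ennreal r"
      have "\<forall>\<^sub>F r in at_right 0. ennreal \<eta> \<le> emeasure \<nu> (cball x r \<inter> \<Omega>) / ennreal r"
        using eventually_at_right_real[OF t(1)] by eventually_elim (use a in auto)
      from Liminf_bounded[OF this] nl show False by simp
    qed
    then obtain r where r: "0 < r" "r < t" "emeasure \<nu> (cball x r \<inter> \<Omega>) / ennreal r < ennreal \<eta>" by (auto simp: not_le)
    have "emeasure \<nu> (cball x r \<inter> \<Omega>) < ennreal \<eta> * ennreal r"
      using r by (simp add: divide_less_ennreal)
    then have "emeasure \<nu> (cball x r \<inter> \<Omega>) < ennreal (\<eta> * r)" using \<eta> r by (simp add: ennreal_mult)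
    then have "emeasure \<nu> (cball x (r / 2) \<inter> \<Omega>) = 0"
      using cl[OF r(1)] t(2) r(2) subset_ball[of r t x] by auto
    then show ?thesis using r(1) by (intro exI[of _ "r / 2"]) simp
  qed
qed

lemma emeasure_compact_locally_null:
  fixes \<nu> :: "'a::metric_space measure"
  assumes "compact A" "A \<in> sets \<nu>" "\<And>x. x \<in> A \<Longrightarrow> \<exists>\<rho>>0. cball x \<rho> \<inter> \<Omega> \<in> sets \<nu> \<and> emeasure \<nu> (cball x \<rho> \<inter> \<Omega>) = 0" "A \<subseteq> \<Omega>"
  shows "emeasure \<nu> A = 0"
proof -
  obtain \<rho> where \<rho>: "\<And>x. x \<in> A \<Longrightarrow> 0 < \<rho> x \<and> cball x (\<rho> x) \<inter> \<Omega> \<in> sets \<nu> \<and> emeasure \<nu> (cball x (\<rho> x) \<inter> \<Omega>) = 0"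
    using assms(3) by metis
  obtain F where F: "F \<subseteq> A" "finite F" "A \<subseteq> (\<Union>x\<in>F. ball x (\<rho> x))"
  proof (rule compactE_image[OF assms(1), of A "\<lambda>x. ball x (\<rho> x)"])
    show "A \<subseteq> (\<Union>x\<in>A. ball x (\<rho> x))" using \<rho> by force
  qed auto
  have n: "(\<Union>x\<in>F. cball x (\<rho> x) \<inter> \<Omega>) \<in> null_sets \<nu>"
    using F(1,2) \<rho> by (intro null_sets.finite_UN) auto
  have "A \<subseteq> (\<Union>x\<in>F. cball x (\<rho> x) \<inter> \<Omega>)" using F(3) assms(4) by (force simp: less_imp_le)
  then show ?thesis using null_sets_subset[OF n assms(2)] by auto
qed

lemma concentration_set_no_isolated_part:
  fixes u :: "nat \<Rightarrow> real^2 \<Rightarrow> real^'k"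
  assumes \<Omega>: "open \<Omega>" and V: "multiwell_potential V" and M0: "0 \<le> M0" and \<epsilon>: "\<And>n. 0 < \<epsilon> n \<and> \<epsilon> n \<le> 1"
    and ac: "\<And>n. allen_cahn_solution \<Omega> V (\<epsilon> n) (u n)" and E: "\<And>n. energy \<Omega> V (\<epsilon> n) (u n) \<le> ennreal M0"
    and \<nu>: "radon_measure_on \<Omega> \<nu>" and wc: "weakly_converges_on \<Omega> (\<lambda>n. energy_measure \<Omega> V (\<epsilon> n) (u n)) \<nu>"
    and pos: "\<And>x s. x \<in> S \<Longrightarrow> 0 < s \<Longrightarrow> ball x s \<subseteq> \<Omega> \<Longrightarrow> 0 < emeasure \<nu> (cball x s \<inter> \<Omega>)"
    and null: "\<And>x. x \<in> \<Omega> \<Longrightarrow> x \<notin> S \<Longrightarrow> \<exists>\<rho>>0. emeasure \<nu> (cball x \<rho> \<inter> \<Omega>) = 0"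
    and Z: "compact Z" "Z = S \<inter> W" "open W" "W \<subseteq> \<Omega>"
  shows "Z = {}"
proof (rule ccontr)
  assume ne: "Z \<noteq> {}"
  have ZW: "Z \<subseteq> W" using Z by auto
  obtain d where d: "0 < d" "{x. infdist x Z \<le> d} \<subseteq> W"
    using compact_in_open_separated[OF ne Z(1,3) ZW] by metis
  \<comment> \<open>Quarters of the room inside \<open>W\<close>: \<theta> is 1 up to distance
    \<delta> and vanishes beyond 3 \<delta>, which defines \<open>T\<close>; \<open>K\<close> adds
    one more \<delta> for mollification.\<close>
  define \<delta> where "\<delta> = d / 4"
  have \<delta>: "0 < \<delta>" using d by (simp add: \<delta>_def)
  define T where "T = {x. infdist x Z \<le> 3 * \<delta>}"
  define K where "K = {x. infdist x Z \<le> 4 * \<delta>}"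
  have cT: "compact T" and cK: "compact K" unfolding T_def K_def using ne Z(1) \<delta> by (auto intro!: compact_infdist_le)
  have TK: "T \<subseteq> K" using \<delta> by (auto simp: T_def K_def)
  have KW: "K \<subseteq> W" using d by (auto simp: K_def \<delta>_def)
  have K\<Omega>: "K \<subseteq> \<Omega>" using KW Z(4) by auto
  have ballK: "cball x \<delta> \<subseteq> K" if "x \<in> T" for x
  proof
    fix y assume "y \<in> cball x \<delta>"
    then show "y \<in> K" using that infdist_triangle[of y Z x] by (simp add: T_def K_def dist_commute)
  qed
  obtain \<theta> \<theta>1 \<theta>2 :: "real^2 \<Rightarrow> real" where \<theta>: "pder (ax 1) \<theta> \<theta>1" "pder (ax 2) \<theta> \<theta>2"
    "continuous_on UNIV \<theta>" "continuous_on UNIV \<theta>1" "continuous_on UNIV \<theta>2" "\<And>x. 0 \<le> \<theta> x" "\<And>x. \<theta> x \<le> 1"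
    "\<And>x. infdist x Z < \<delta> \<Longrightarrow> \<theta> x = 1 \<and> \<theta>1 x = 0 \<and> \<theta>2 x = 0"
    "\<And>x. 3 * \<delta> < infdist x Z \<Longrightarrow> \<theta> x = 0 \<and> \<theta>1 x = 0 \<and> \<theta>2 x = 0"
    using smooth_cutoff[OF Z(1) ne \<delta>] by blast
  define z where "z x = \<bar>\<theta>1 x\<bar> + \<bar>\<theta>2 x\<bar> + (\<theta>1 x)\<^sup>2 + (\<theta>2 x)\<^sup>2" for x
  have cz: "continuous_on UNIV z" unfolding z_def[abs_def] by (intro continuous_intros \<theta>)
  have \<theta>T: "\<theta> x = 0 \<and> \<theta>1 x = 0 \<and> \<theta>2 x = 0" if "x \<notin> T" for x using \<theta>(9) that by (simp add: T_def)
  have zT: "z x = 0" if "x \<notin> T" for x using \<theta>T[OF that] by (simp add: z_def)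
  have sm: "smooth_on UNIV V" and V0: "\<And>y. 0 \<le> V y" and pd: "\<And>\<sigma>. V \<sigma> = 0 \<Longrightarrow> positive_definite (hessian V \<sigma>)"
    using V multiwell_nonneg[OF V] by (auto simp: multiwell_potential_def)
  have cV: "continuous_on UNIV V" by (rule smooth_on_continuous[OF sm])
  obtain L where L: "0 \<le> L" "\<And>\<epsilon> u. 0 < \<epsilon> \<Longrightarrow> \<epsilon> \<le> 1 \<Longrightarrow> allen_cahn_solution \<Omega> V \<epsilon> u \<Longrightarrow> energy \<Omega> V \<epsilon> u \<le> ennreal M0 \<Longrightarrow>
     AE x in lebesgue. x \<in> K \<longrightarrow> norm (u x) \<le> L"
    using solution_bounded[OF V cK K\<Omega> \<Omega> M0] by blast
  obtain C1 where C1: "0 \<le> C1" "\<And>y. norm y \<le> L \<Longrightarrow> grad V y \<bullet> grad V y \<le> C1 * V y"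
    using multiwell_gradient_bound[OF sm V0, of L] by blast
  obtain \<kappa> C2 where C2: "0 < \<kappa>" "0 \<le> C2"
    "\<And>y w. norm y \<le> L \<Longrightarrow> (hessian V y *v w) \<bullet> w \<ge> \<kappa> * (w \<bullet> w) - C2 * V y * (w \<bullet> w)"
    using multiwell_hessian_bound[OF sm V0 pd, of L] by blast
  define C where "C = C1 + C2"
  have C: "0 \<le> C" "\<And>y. norm y \<le> L \<Longrightarrow> grad V y \<bullet> grad V y \<le> C * V y"
    "\<And>y w. norm y \<le> L \<Longrightarrow> (hessian V y *v w) \<bullet> w \<ge> \<kappa> * (w \<bullet> w) - C * V y * (w \<bullet> w)"
  proof -
    show "0 \<le> C" using C1 C2 by (simp add: C_def)
    fix y :: "real^'k" assume y: "norm y \<le> L"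
    show "grad V y \<bullet> grad V y \<le> C * V y" using C1(2)[OF y] mult_nonneg_nonneg[OF C2(2) V0[of y]] by (simp add: C_def distrib_right)
    fix w :: "real^'k"
    have "C2 * V y * (w \<bullet> w) \<le> C * V y * (w \<bullet> w)" using C1(1) V0 by (intro mult_right_mono) (auto simp: C_def)
    then show "(hessian V y *v w) \<bullet> w \<ge> \<kappa> * (w \<bullet> w) - C * V y * (w \<bullet> w)" using C2(3)[OF y, of w] by simp
  qed
  obtain B where B: "0 \<le> B" "\<And>y. norm y \<le> L \<Longrightarrow> V y \<le> B"
  proof -
    have "bounded (V ` cball 0 L)" using cV by (intro compact_imp_bounded compact_continuous_image) (auto intro: continuous_on_subset)
    then obtain B where "0 < B" "\<And>y. y \<in> cball 0 L \<Longrightarrow> norm (V y) \<le> B" unfolding bounded_pos by auto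
    then show ?thesis using that[of B] by fastforce
  qed
  obtain R where R: "0 \<le> R" "\<And>x. x \<in> T \<Longrightarrow> norm x \<le> R"
    using compact_imp_bounded[OF cT] unfolding bounded_pos by (metis less_imp_le)
  define EC where "EC = energy_const \<kappa> C L R B"
  have en: "0 < \<epsilon> n" "\<epsilon> n \<le> 1" for n using \<epsilon> by auto
  have uL: "AE x in lebesgue. x \<in> K \<longrightarrow> norm (u n x) \<le> L" for n by (rule L(2)[OF en ac E])
  define I where "I n = (LINT x|lebesgue. z x * energy_density \<Omega> V (\<epsilon> n) (u n) x)" for n
  \<comment> \<open>The absolute value supplies the nonnegative bound required to pass from the
    nonnegative integral to the Bochner integral.\<close>
  have est: "(LINT x|lebesgue. (\<theta> x)\<^sup>2 * energy_density \<Omega> V (\<epsilon> n) (u n) x) \<le> \<bar>EC * I n\<bar>" for n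
  proof (rule integral_real_bounded)
    have "(\<integral>\<^sup>+x. ennreal ((\<theta> x)\<^sup>2 * energy_density \<Omega> V (\<epsilon> n) (u n) x) \<partial>lebesgue) \<le> ennreal (EC * I n)"
      unfolding EC_def I_def z_def
      by (rule solution_energy_estimate[where K = K and T = T])
        (fact ac en sm V0 E M0 \<Omega> cK K\<Omega> cT \<delta> ballK uL L(1) \<theta> \<theta>T R C2(1) C B)+
    then show "(\<integral>\<^sup>+x. ennreal ((\<theta> x)\<^sup>2 * energy_density \<Omega> V (\<epsilon> n) (u n) x) \<partial>lebesgue) \<le> ennreal \<bar>EC * I n\<bar>"
      by (rule order_trans) (rule ennreal_leI[OF abs_ge_self])
  qed (rule abs_ge_zero)
  have conv: "(\<lambda>n. LINT x|lebesgue. \<phi> x * energy_density \<Omega> V (\<epsilon> n) (u n) x) \<longlonglongrightarrow> (LINT x|\<nu>. \<phi> x)"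
    if \<phi>: "continuous_on UNIV \<phi>" "\<And>x. x \<notin> T \<Longrightarrow> \<phi> x = 0" for \<phi>
  proof -
    have "closure {x. \<phi> x \<noteq> 0} \<subseteq> T" using \<phi>(2) compact_imp_closed[OF cT] by (intro closure_minimal) auto
    then have "compact (closure {x. \<phi> x \<noteq> 0})" "closure {x. \<phi> x \<noteq> 0} \<subseteq> \<Omega>"
      using compact_Int_closed[OF cT closed_closure[of "{x. \<phi> x \<noteq> 0}"]] TK K\<Omega> by (auto simp: Int_absorb1)
    then have "(\<lambda>n. LINT x|energy_measure \<Omega> V (\<epsilon> n) (u n). \<phi> x) \<longlonglongrightarrow> (LINT x|\<nu>. \<phi> x)"
      using wc \<phi>(1) unfolding weakly_converges_on_def by blast
    moreover have "(LINT x|energy_measure \<Omega> V (\<epsilon> n) (u n). \<phi> x) = (LINT x|lebesgue. \<phi> x * energy_density \<Omega> V (\<epsilon> n) (u n) x)" for n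
    proof (rule integral_energy_measure[OF ac _ cV V0 E \<Omega> M0 \<phi>(1)])
      show "\<phi> x = 0" if "x \<notin> \<Omega>" for x using \<phi>(2) that TK K\<Omega> by blast
    qed (use \<epsilon> in auto)
    ultimately show ?thesis by simp
  qed
  have msr: "A \<in> sets \<nu>" if "A \<in> sets borel" "A \<subseteq> \<Omega>" for A
    using \<nu> that by (auto simp: radon_measure_on_def sets_restrict_space image_iff intro!: bexI[of _ A])
  have mf: "\<phi> \<in> borel_measurable \<nu>" if "continuous_on UNIV \<phi>" for \<phi> :: "real^2 \<Rightarrow> real"
    using measurable_restrict_space1[OF borel_measurable_continuous_onI[OF that], of \<Omega>] \<nu>
    by (simp add: radon_measure_on_def cong: measurable_cong_sets)
  \<comment> \<open>The shell that carries the derivatives of \<theta> lies in \<open>W\<close> and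
    misses \<open>Z\<close>, hence misses \<open>S\<close>; it is covered by finitely many null
    disks.\<close>
  have A0: "emeasure \<nu> {x. \<delta> \<le> infdist x Z \<and> infdist x Z \<le> 3 * \<delta>} = 0" (is "emeasure \<nu> ?A = 0")
  proof (rule emeasure_compact_locally_null)
    have "closed {x. \<delta> \<le> infdist x Z}" by (intro closed_Collect_le continuous_intros)
    moreover have "?A = T \<inter> {x. \<delta> \<le> infdist x Z}" by (auto simp: T_def)
    ultimately show cA: "compact ?A" using cT by auto
    show A: "?A \<subseteq> \<Omega>" using TK K\<Omega> by (auto simp: T_def)
    then show "?A \<in> sets \<nu>" using cA by (intro msr) (auto intro: borel_compact)
    fix x assume x: "x \<in> ?A"
    have "x \<notin> Z" using x \<delta> by auto
    moreover have "x \<in> W" using x TK KW by (auto simp: T_def)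
    ultimately have "x \<notin> S" using Z by auto
    then obtain \<rho> where "0 < \<rho>" "emeasure \<nu> (cball x \<rho> \<inter> \<Omega>) = 0" using null x A by blast
    then show "\<exists>\<rho>>0. cball x \<rho> \<inter> \<Omega> \<in> sets \<nu> \<and> emeasure \<nu> (cball x \<rho> \<inter> \<Omega>) = 0" using \<Omega> by (intro exI[of _ \<rho>] conjI msr) auto
  qed
  have "(LINT x|\<nu>. z x) = 0"
  proof (rule integral_eq_zero_AE)
    show "AE x in \<nu>. z x = 0"
    proof (rule AE_I[where N = ?A])
      show "{x \<in> space \<nu>. z x \<noteq> 0} \<subseteq> ?A" using \<theta>(8,9) by (force simp: z_def not_less[symmetric])
      have "closed ?A" by (intro closed_Collect_conj closed_Collect_le continuous_intros)
      then show "?A \<in> sets \<nu>" using TK K\<Omega> by (intro msr) (auto simp: T_def)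
    qed (rule A0)
  qed
  then have "I \<longlonglongrightarrow> 0" using conv[OF cz zT] by (simp add: I_def[abs_def])
  then have "(\<lambda>n. \<bar>EC * I n\<bar>) \<longlonglongrightarrow> 0" by (intro tendsto_rabs_zero tendsto_mult_right_zero)
  moreover have c2: "continuous_on UNIV (\<lambda>x. (\<theta> x)\<^sup>2)" by (intro continuous_intros \<theta>)
  have "(\<lambda>n. LINT x|lebesgue. (\<theta> x)\<^sup>2 * energy_density \<Omega> V (\<epsilon> n) (u n) x) \<longlonglongrightarrow> (LINT x|\<nu>. (\<theta> x)\<^sup>2)"
    by (rule conv[OF c2]) (simp add: \<theta>T)
  ultimately have le0: "(LINT x|\<nu>. (\<theta> x)\<^sup>2) \<le> 0"
    using est by (intro LIMSEQ_le[where X = "\<lambda>n. LINT x|lebesgue. (\<theta> x)\<^sup>2 * energy_density \<Omega> V (\<epsilon> n) (u n) x"]) auto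
  obtain p where p: "p \<in> Z" using ne by auto
  \<comment> \<open>On this disk \<theta> is 1, so its mass is at most the limit of the weighted
    energies, which is 0; yet \<open>pos\<close> makes the mass positive at
    \<open>p\<close>.\<close>
  define Q where "Q = cball p (\<delta> / 2)"
  have Qd: "infdist x Z < \<delta>" if "x \<in> Q" for x
    using infdist_le[OF p, of x] that \<delta> by (simp add: Q_def dist_commute)
  have Q\<Omega>: "Q \<subseteq> \<Omega>" using Qd TK K\<Omega> \<delta> by (force simp: T_def)
  have Qm: "Q \<in> sets \<nu>" using Q\<Omega> by (intro msr) (auto simp: Q_def)
  have Tm: "T \<in> sets \<nu>" using TK K\<Omega> cT by (intro msr) (auto intro: borel_compact)
  have fin: "emeasure \<nu> T < \<infinity>" "emeasure \<nu> Q < \<infinity>" using \<nu> cT TK K\<Omega> Q\<Omega> by (auto simp: radon_measure_on_def Q_def)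
  have "measure \<nu> Q = (LINT x|\<nu>. indicat_real Q x)" using Qm by (simp add: sets.Int_space_eq1 sets.sets_into_space Int_absorb1 Int_absorb2)
  also have "\<dots> \<le> (LINT x|\<nu>. (\<theta> x)\<^sup>2)"
  proof (rule integral_mono)
    show "integrable \<nu> (indicat_real Q)" using Qm fin by (intro integrable_real_indicator) auto
    show "integrable \<nu> (\<lambda>x. (\<theta> x)\<^sup>2)"
    proof (rule Bochner_Integration.integrable_bound)
      show "integrable \<nu> (indicat_real T)" using Tm fin by (intro integrable_real_indicator) auto
      show "AE x in \<nu>. norm ((\<theta> x)\<^sup>2) \<le> norm (indicat_real T x)"
        using \<theta>(6,7) \<theta>T by (intro AE_I2) (auto simp: indicator_def power_le_one)
    qed (rule mf[OF c2])
    show "indicat_real Q x \<le> (\<theta> x)\<^sup>2" for x using \<theta>(8)[OF Qd] by (auto simp: indicator_def)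
  qed
  finally have "measure \<nu> Q = 0" using le0 measure_nonneg[of \<nu> Q] by linarith
  then have "emeasure \<nu> Q = 0" using fin by (simp add: emeasure_eq_ennreal_measure)
  moreover have "0 < emeasure \<nu> (cball p (\<delta> / 2) \<inter> \<Omega>)"
  proof (rule pos)
    show "p \<in> S" using p Z by auto
    show "ball p (\<delta> / 2) \<subseteq> \<Omega>" using Q\<Omega> ball_subset_cball[of p "\<delta> / 2"] by (auto simp: Q_def)
  qed (use \<delta> in simp)
  ultimately show False using Q\<Omega> by (simp add: Q_def Int_absorb2)
qed

theorem proposition3:
  fixes \<Omega> :: "(real^2) set"
    and V :: "real^'k \<Rightarrow> real"
    and M0 \<eta>1 r :: real
    and \<epsilon> :: "nat \<Rightarrow> real"
    and u :: "nat \<Rightarrow> real^2 \<Rightarrow> real^'k"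
    and \<nu> :: "(real^2) measure"
    and x0 :: "real^2"
  assumes "smooth_bounded_domain \<Omega>"
    and "multiwell_potential V"
    and "M0 > 0"
    and "\<And>n. 0 < \<epsilon> n \<and> \<epsilon> n \<le> 1"
    and "\<epsilon> \<longlonglongrightarrow> 0"
    and "\<And>n. allen_cahn_solution \<Omega> V (\<epsilon> n) (u n)"
    and "\<And>n. energy \<Omega> V (\<epsilon> n) (u n) \<le> ennreal M0"
    and "radon_measure_on \<Omega> \<nu>"
    and "weakly_converges_on \<Omega> (\<lambda>n. energy_measure \<Omega> V (\<epsilon> n) (u n)) \<nu>"
    and "\<eta>1 > 0"
    and "clearing_out \<Omega> V \<eta>1"
    and "x0 \<in> \<Omega>"
    and "r > 0"
    and "ball x0 (2 * r) \<subseteq> \<Omega>"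
  shows "\<exists>\<rho>0. r < \<rho>0 \<and> \<rho>0 < 2 * r \<and>
    finite (path_components_of (top_of_set (concentration_set \<Omega> \<nu> \<eta>1 \<inter> ball x0 \<rho>0)))"
proof -
  define A where "A = concentration_set \<Omega> \<nu> \<eta>1"
  have \<Omega>: "open \<Omega>" using assms(1) by (simp add: smooth_bounded_domain_def)
  have "(SUP n. energy \<Omega> V (\<epsilon> n) (u n)) \<le> ennreal M0" by (intro SUP_least assms(7))
  then have "(SUP n. energy \<Omega> V (\<epsilon> n) (u n)) < \<infinity>" by (rule le_less_trans) simp
  then have cl: "emeasure \<nu> (cball x (s / 2) \<inter> \<Omega>) = 0"
    if "0 < s" "ball x s \<subseteq> \<Omega>" "emeasure \<nu> (cball x s \<inter> \<Omega>) < ennreal (\<eta>1 * s)" for x s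
    using assms(11)[unfolded clearing_out_def, rule_format, of \<epsilon> u \<nu> s x] assms that by blast
  have dens: "ennreal (\<eta>1 * s) \<le> emeasure \<nu> (cball x s \<inter> \<Omega>)" if "x \<in> A" "0 < s" "ball x s \<subseteq> \<Omega>" for x s
    by (rule concentration_set_density(1)[of \<Omega> \<nu> \<eta>1]) (use cl assms(8,10) \<Omega> that in \<open>auto simp: A_def\<close>)
  have null: "\<exists>\<rho>>0. emeasure \<nu> (cball x \<rho> \<inter> \<Omega>) = 0" if "x \<in> \<Omega>" "x \<notin> A" for x
    by (rule concentration_set_density(2)[of \<Omega> \<nu> \<eta>1]) (use cl assms(8,10) \<Omega> that in \<open>auto simp: A_def\<close>)
  have A\<Omega>: "A \<subseteq> \<Omega>" by (auto simp: A_def concentration_set_def)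
  have msr: "X \<in> sets \<nu>" if "X \<in> sets borel" "X \<subseteq> \<Omega>" for X
    using assms(8) that by (auto simp: radon_measure_on_def sets_restrict_space image_iff intro!: bexI[of _ X])
  have sp: "space \<nu> = \<Omega>"
    using sets_eq_imp_space_eq[of \<nu> "restrict_space borel \<Omega>"] assms(8) by (simp add: radon_measure_on_def space_restrict_space)
  have pos: "0 < emeasure \<nu> (cball x s \<inter> \<Omega>)" if "x \<in> A" "0 < s" "ball x s \<subseteq> \<Omega>" for x s
    using dens[OF that] assms(10) that by (simp add: order.strict_trans2[of 0 "ennreal (\<eta>1 * s)"])
  \<comment> \<open>The radius 7/4 r is below 2 r, so that the closed disk \<open>Y\<close> is
    compact in the domain and has finite mass, and above 3/2 r, so that radii up to 3/2 r give
    closed disks inside \<open>D\<close>.\<close>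
  define D where "D = ball x0 (7 / 4 * r)"
  define Y where "Y = cball x0 (7 / 4 * r)"
  have Y\<Omega>: "Y \<subseteq> \<Omega>" using assms(13,14) by (force simp: Y_def)
  have DY: "D \<subseteq> Y" by (auto simp: D_def Y_def)
  have Ym: "Y \<in> sets \<nu>" using Y\<Omega> by (intro msr) (auto simp: Y_def)
  have Yfin: "emeasure \<nu> Y < \<infinity>" using assms(8) Y\<Omega> by (auto simp: radon_measure_on_def Y_def)
  \<comment> \<open>Restriction to \<open>Y\<close> makes the measure finite; transport along the
    identity makes it a Borel measure on the whole plane, as \<open>ahlfors_set\<close>
    demands.\<close>
  define M where "M = distr (restrict_space \<nu> Y) borel (\<lambda>x. x)"
  have idm: "(\<lambda>x. x) \<in> restrict_space \<nu> Y \<rightarrow>\<^sub>M borel"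
  proof (rule measurable_restrict_space1)
    have "(\<lambda>x. x) \<in> restrict_space borel \<Omega> \<rightarrow>\<^sub>M borel" by (rule measurable_restrict_space1) simp
    then show "(\<lambda>x. x) \<in> \<nu> \<rightarrow>\<^sub>M borel" using assms(8) by (simp add: radon_measure_on_def cong: measurable_cong_sets)
  qed
  have spY: "space (restrict_space \<nu> Y) = Y" using Y\<Omega> by (auto simp: space_restrict_space sp)
  have Mem: "emeasure M X = emeasure \<nu> (X \<inter> Y)" if "X \<in> sets borel" for X
    unfolding M_def using that Ym sp Y\<Omega> spY by (subst emeasure_distr[OF idm that]) (auto simp: emeasure_restrict_space)
  have "space M = UNIV" by (simp add: M_def)
  then have finM: "finite_measure M" using Yfin by (intro finite_measureI) (simp add: Mem)
  \<comment> \<open>Half of \<open>\<eta>1\<close> appears because the density bound concerns closed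
    disks: the open disk of radius \<open>s\<close> contains the closed one of radius
    \<open>s / 2\<close>.\<close>
  interpret ahlfors_set M "A \<inter> D" D "\<eta>1 / 2"
  proof (rule ahlfors_set.intro)
    show "sets M = sets borel" by (simp add: M_def)
    show "0 < \<eta>1 / 2" using assms(10) by simp
    show "open D" by (simp add: D_def)
    show "closedin (top_of_set D) (A \<inter> D)"
    proof -
      \<comment> \<open>A null disk about a point off \<open>A\<close> contains no point of
        \<open>A\<close> in \<open>D\<close>, since such a point would have a small disk of positive
        mass inside it.\<close>
      have "openin (top_of_set D) (D - A)"
        unfolding openin_contains_ball
      proof (intro conjI ballI)
        fix x assume x: "x \<in> D - A"
        then obtain \<rho> where \<rho>: "0 < \<rho>" "emeasure \<nu> (cball x \<rho> \<inter> \<Omega>) = 0" using null DY Y\<Omega> by blast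
        have "y \<notin> A" if y: "y \<in> ball x \<rho> \<inter> D" for y
        proof
          assume yA: "y \<in> A"
          have "open (ball x \<rho> \<inter> D)" by (simp add: D_def open_Int)
          then obtain s where s: "0 < s" "cball y s \<subseteq> ball x \<rho> \<inter> D" using y open_contains_cball by blast
          have "ball y s \<subseteq> \<Omega>" using s(2) DY Y\<Omega> ball_subset_cball[of y s] by blast
          from pos[OF yA s(1) this] have "0 < emeasure \<nu> (cball y s \<inter> \<Omega>)" .
          also have "\<dots> \<le> emeasure \<nu> (cball x \<rho> \<inter> \<Omega>)"
            using s(2) \<Omega> by (intro emeasure_mono msr) auto
          finally show False using \<rho> by simp
        qed
        then show "\<exists>e>0. ball x e \<inter> D \<subseteq> D - A" using \<rho>(1) by blast
      qed auto
      then show ?thesis by (simp add: closedin_def Diff_Int Diff_Int_distrib2)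
    qed
    show "\<eta>1 / 2 * s \<le> measure M (ball x s)" if x: "x \<in> A \<inter> D" "0 < s" "ball x s \<subseteq> D" for x s
    proof -
      have sub: "cball x (s / 2) \<subseteq> ball x s" using x(2) by (auto simp: subset_eq)
      have b: "ball x (s / 2) \<subseteq> \<Omega>" using sub x(3) DY Y\<Omega> ball_subset_cball[of x "s / 2"] by blast
      have "ennreal (\<eta>1 * (s / 2)) \<le> emeasure \<nu> (cball x (s / 2) \<inter> \<Omega>)" using x by (intro dens b) auto
      also have "\<dots> \<le> emeasure \<nu> (ball x s \<inter> Y)"
        using sub x(3) DY Y\<Omega> by (intro emeasure_mono msr) (auto simp: Y_def)
      also have "\<dots> = emeasure M (ball x s)" by (simp add: Mem)
      also have "\<dots> = ennreal (measure M (ball x s))" by (rule finite_measure.emeasure_eq_measure[OF finM])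
      finally show ?thesis by simp
    qed
    fix Z assume cZ: "compact Z" and oZ: "openin (top_of_set (A \<inter> D)) Z"
    then obtain W where W: "open W" "Z = (A \<inter> D) \<inter> W" by (auto simp: openin_open)
    show "Z = {}"
    proof (rule concentration_set_no_isolated_part[OF \<Omega> assms(2) _ assms(4,6,7,8,9) pos null cZ])
      show "Z = A \<inter> (D \<inter> W)" "D \<inter> W \<subseteq> \<Omega>" using W DY Y\<Omega> by auto
      show "open (D \<inter> W)" using W by (simp add: D_def open_Int)
    qed (use assms(3) in auto)
  qed (rule finM)
  obtain \<rho> where \<rho>: "r < \<rho>" "\<rho> \<le> 3 / 2 * r" "finite (path_components_of (top_of_set ((A \<inter> D) \<inter> ball x0 \<rho>)))"
    by (rule finite_path_components_ball[of r "3 / 2 * r" x0]) (use assms(13) in \<open>auto simp: D_def\<close>)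
  have "(A \<inter> D) \<inter> ball x0 \<rho> = A \<inter> ball x0 \<rho>" using \<rho>(2) assms(13) by (auto simp: D_def)
  then show ?thesis using \<rho> assms(13) unfolding A_def by (intro exI[of _ \<rho>]) auto
qed

end
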